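(* Let $0<\alpha<\beta$ with $\alpha,\beta\notin\mathbb{Z}$, and let $f$ be analytic inside a closed contour strictly containing $[\alpha,\beta]$. Let $\chi$ be a non-principal even primitive Dirichlet character modulo $q$, and let $\nu\in\mathbb{C}$ with $0<\Re(\nu)<\frac12$. Then \begin{align*} &\frac{ q^{1-\frac{\nu}{2}} } {\tau(\chi )} \sum_{\alpha<j <\beta} \bar{\sigma}_{-\nu, \chi }(j) f(j) = \frac{ q^{1-\frac{\nu}{2}}}{\tau(\chi)} L(1-\nu,\chi) \int_\alpha^\beta \frac{f(t) }{t^{\nu}} \,dt+2\pi \sum_{n=1}^{\infty}\sigma_{-\nu, \bar{\chi }}(n)\, n^{\nu/2} \int_{\alpha} ^{ \beta }f(t) t^{-\frac{\nu}{2}} \\ & \times \left\{ \left( \frac{2}{\pi} K_{\nu}\left(4\pi \sqrt{\tfrac{nt}{q}} \right) - Y_{\nu}\left(4\pi \sqrt{\tfrac{nt}{q}} \right) \right) \cos \left(\frac{\pi \nu}{2}\right) - J_{\nu}\left(4\pi \sqrt{\tfrac{nt}{q}} \right) \sin \left(\frac{\pi \nu}{2}\right) \right\} dt, \end{align*} where the sum on the left is over integers $j$.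
   Context: For a Dirichlet character $\chi$ and $z\in\mathbb{C}$: $\sigma_{z,\chi}(n)=\sum_{d\mid n}d^z\chi(d)$ and $\bar{\sigma}_{z,\chi}(n)=\sum_{d\mid n}d^z\chi(n/d)$. $\tau(\chi)=\sum_{h=1}^q\chi(h)e^{2\pi i h/q}$ is the Gauss sum, $L(s,\chi)$ the Dirichlet $L$-function. $J_\nu$, $Y_\nu$ are the Bessel functions of the first and second kind and $K_\nu$ the modified Bessel function of the second kind. *)

theory Defs
  imports "HOL-Analysis.Analysis"
begin

text \<open>A Dirichlet character modulo q, viewed as a function on the naturals
  (chi(-1) is chi(q-1) by periodicity).\<close>
definition dirichlet_char :: "nat \<Rightarrow> (nat \<Rightarrow> complex) \<Rightarrow> bool" where
  "dirichlet_char q chi \<longleftrightarrow> q > 0 \<and> (\<forall>n. chi (n + q) = chi n) \<and>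
     (\<forall>m n. chi (m * n) = chi m * chi n) \<and> chi 1 = 1 \<and>
     (\<forall>n. chi n = 0 \<longleftrightarrow> \<not> coprime n q)"

definition principal_char :: "nat \<Rightarrow> (nat \<Rightarrow> complex) \<Rightarrow> bool" where
  "principal_char q chi \<longleftrightarrow> (\<forall>n. coprime n q \<longrightarrow> chi n = 1)"

definition induced_modulus :: "nat \<Rightarrow> (nat \<Rightarrow> complex) \<Rightarrow> nat \<Rightarrow> bool" where
  "induced_modulus q chi d \<longleftrightarrow> d dvd q \<and>
     (\<forall>m n. coprime m q \<longrightarrow> coprime n q \<longrightarrow> m mod d = n mod d \<longrightarrow> chi m = chi n)"

definition primitive_char :: "nat \<Rightarrow> (nat \<Rightarrow> complex) \<Rightarrow> bool" where
  "primitive_char q chi \<longleftrightarrow> dirichlet_char q chi \<and> (\<forall>d < q. \<not> induced_modulus q chi d)"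

definition even_char :: "nat \<Rightarrow> (nat \<Rightarrow> complex) \<Rightarrow> bool" where
  "even_char q chi \<longleftrightarrow> chi (q - 1) = 1"

definition gauss_sum :: "nat \<Rightarrow> (nat \<Rightarrow> complex) \<Rightarrow> complex" where
  "gauss_sum q chi = (\<Sum>h=1..q. chi h * exp (2 * pi * \<i> * of_nat h / of_nat q))"

text \<open>Dirichlet L-function of a non-principal character, for Re s > 0, as the
  (conditionally convergent) Dirichlet series; this agrees with the analytic continuation.\<close>
definition dirichlet_L :: "(nat \<Rightarrow> complex) \<Rightarrow> complex \<Rightarrow> complex" where
  "dirichlet_L chi s = lim (\<lambda>N. \<Sum>n=1..N. chi n / of_nat n powr s)"

definition sigma_char :: "complex \<Rightarrow> (nat \<Rightarrow> complex) \<Rightarrow> nat \<Rightarrow> complex" where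
  "sigma_char z chi n = (\<Sum>d | d dvd n. of_nat d powr z * chi d)"

definition sigma_bar_char :: "complex \<Rightarrow> (nat \<Rightarrow> complex) \<Rightarrow> nat \<Rightarrow> complex" where
  "sigma_bar_char z chi n = (\<Sum>d | d dvd n. of_nat d powr z * chi (n div d))"

definition bessel_J :: "complex \<Rightarrow> real \<Rightarrow> complex" where
  "bessel_J \<nu> x = of_real (x / 2) powr \<nu> *
     (\<Sum>m. (-1) ^ m * rGamma (of_nat m + \<nu> + 1) / fact m * of_real ((x / 2) ^ (2 * m)))"

definition bessel_I :: "complex \<Rightarrow> real \<Rightarrow> complex" where
  "bessel_I \<nu> x = of_real (x / 2) powr \<nu> *
     (\<Sum>m. rGamma (of_nat m + \<nu> + 1) / fact m * of_real ((x / 2) ^ (2 * m)))"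

text \<open>Standard definitions for non-integer order (the only case used here).\<close>
definition bessel_Y :: "complex \<Rightarrow> real \<Rightarrow> complex" where
  "bessel_Y \<nu> x = (bessel_J \<nu> x * cos (\<nu> * of_real pi) - bessel_J (-\<nu>) x) / sin (\<nu> * of_real pi)"

definition bessel_K :: "complex \<Rightarrow> real \<Rightarrow> complex" where
  "bessel_K \<nu> x = pi / 2 * (bessel_I (-\<nu>) x - bessel_I \<nu> x) / sin (\<nu> * of_real pi)"

end

theory Submission
  imports Defs "HOL-Complex_Analysis.Complex_Analysis" "HOL-Number_Theory.Number_Theory"
    "HOL-Real_Asymp.Real_Asymp" "HOL-Library.Discrete_Functions"
begin

text \<open>
  Let \<open>\<Theta>(y) = \<Sum>h. cnj (\<chi> h) exp (- 2 \<pi> h y / q)\<close>. Because \<open>\<chi>\<close> is even and primitive, finite Fourier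
  inversion and the partial fractions of the cotangent give \<open>\<Theta>(y)\<close> as a constant times
  \<open>\<Sum>j. \<chi> j 2 y / (y\<^sup>2 + j\<^sup>2)\<close>. Evaluating
  \<open>\<integral> y\<^sup>\<nu>\<^sup>-\<^sup>1 \<Theta>(\<zeta> y) / (exp (2 \<pi> / y) - 1) dy\<close> once by expanding both factors in exponentials and once by expanding
  both in partial fractions yields a Koshliakov-type identity: for \<open>Re w > 0\<close> the series
  \<open>\<Sum>n. \<sigma>(n) n\<^sup>\<nu>\<^sup>/\<^sup>2 w\<^sup>-\<^sup>\<nu> K\<^sub>\<nu>(4 \<pi> w \<surd>(n / q))\<close> equals two powers of \<open>w\<close> plus a series of simple fractions with poles
  at \<open>w\<^sup>4 = N\<^sup>2\<close>, whose residues are multiples of the values of the dual divisor function at \<open>N\<close>.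

  The kernel of the theorem is a combination of \<open>K\<^sub>\<nu>\<close> rotated by \<open>\<plusminus> \<i>\<close>, with \<open>w = \<surd>t\<close>. For \<open>e = \<plusminus> \<i>\<close> the
  corresponding half of the series converges only for \<open>Re (e w) > 0\<close>, that is, on one side of the
  real axis. After integration in \<open>w\<close> along a segment pushed off the axis, its sum continues
  holomorphically to the axis, the poles turning into logarithms. A Tauberian theorem in the manner of
  Fatou, Riesz and Newman then gives convergence on the axis itself; its hypothesis is a bound on the
  integrated terms over the blocks between consecutive squares, where \<open>Re \<nu> < 1/2\<close> enters. Adding the
  two halves, the logarithms cancel up to the jumps \<open>2 \<pi> \<i>\<close>, which produce the finite sum.
\<close>

subsection \<open>A Tauberian theorem\<close>

text \<open>The bound for the n-th term is d(n) n^(Re \<nu>/2 - 1/4), with d the number of divisors,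
  and integration gains only n^(-1/2). This does not give absolute convergence on the axis, which is
  why a Tauberian theorem is called for. The frequencies grow like sqrt n, so a block between
  consecutive squares has frequency length of order one; its bound is of order T^(Re \<nu> - 1/2)
  log T, which tends to 0 precisely for Re \<nu> < 1/2. Each half of the kernel carries a rotated
  and an unrotated copy of K. The unrotated copy has to be there: rotation changes the sign of w^2
  but not of w^4, so the pole series without the factor w^(-2 \<nu>) cancels already inside each
  half. What is left is odd in e, except for the L-value term, so the second pole series and an
  unevaluated Mellin constant meet their negatives when the halves are added. K is needed in two
  forms: the power series matches the definitions of J, Y and K and is defined beyond the imaginary
  axis, but shows no decay; the decay is read off a Laplace integral. Much of the preparation
  identifies the two.\<close>

text \<open>From 1 + y \<le> exp y. The bound is uniform in N, and its growth like 1/y as y tends to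
  0 is what the contour kernel later compensates.\<close>

lemma geometric_sum_le:
  fixes y :: real
  assumes "y > 0"
  shows "(\<Sum>i<N. exp (- y * real i)) \<le> (1 + y) / y"
proof -
  have q: "exp (- y * real i) = exp (- y) ^ i" for i
    by (simp add: exp_of_nat_mult [symmetric] mult.commute)
  have lt: "exp (-y) < 1" using assms by simp
  have "(1 + y) * exp (-y) \<le> 1"
    using exp_ge_add_one_self [of y] by (simp add: exp_minus field_simps)
  hence le: "y / (1 + y) \<le> 1 - exp (-y)"
    using assms by (simp add: field_simps)
  have "(\<Sum>i<N. exp (- y * real i)) = (1 - exp (-y) ^ N) / (1 - exp (-y))"
    unfolding q using lt by (simp add: sum_gp_strict)
  also have "\<dots> \<le> 1 / (1 - exp (-y))"
    using lt by (intro divide_right_mono) auto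
  also have "\<dots> \<le> 1 / (y / (1 + y))"
    using le assms lt by (intro divide_left_mono mult_pos_pos) auto
  finally show ?thesis by simp
qed

text \<open>On the left half of the contour the weighted partial sums are bounded by such a
  convolution of the block bounds with a decaying exponential. Tannery's theorem applies, since E is
  bounded and the exponentials are summable.\<close>

lemma convolution_geometric_tendsto_0:
  fixes E :: "nat \<Rightarrow> real"
  assumes "E \<longlonglongrightarrow> 0" "y > 0"
  shows "(\<lambda>T. \<Sum>i<T. E (T - Suc i) * exp (- y * real i)) \<longlonglongrightarrow> 0"
proof -
  have q: "exp (- y * real i) = exp (- y) ^ i" for i
    by (simp add: exp_of_nat_mult [symmetric] mult.commute)
  from assms(1) have "Bseq E" by (auto intro: convergent_imp_Bseq convergentI)
  then obtain M where M: "M > 0" "\<And>n. norm (E n) \<le> M" by (auto simp: Bseq_def)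
  have sm: "summable (\<lambda>i. M * exp (- y) ^ i)"
    using assms(2) by (intro summable_mult summable_geometric) auto
  have "((\<lambda>T. \<Sum>i. if i < T then E (T - Suc i) * exp (-y) ^ i else 0) \<longlongrightarrow> (\<Sum>i. 0::real)) sequentially"
  proof (rule tannerys_theorem [THEN conjunct2, THEN conjunct2])
    show "summable (\<lambda>i. M * exp (- y) ^ i)" by (fact sm)
    show "((\<lambda>T. if i < T then E (T - Suc i) * exp (-y) ^ i else 0) \<longlongrightarrow> 0) sequentially" for i
    proof (rule Lim_transform_eventually)
      have "filterlim (\<lambda>T. T - Suc i) at_top sequentially"
        by (rule filterlim_minus_const_nat_at_top)
      hence "(\<lambda>T. E (T - Suc i)) \<longlonglongrightarrow> 0"
        using assms(1) by (rule filterlim_compose [rotated])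
      thus "(\<lambda>T. E (T - Suc i) * exp (-y) ^ i) \<longlonglongrightarrow> 0"
        by (rule tendsto_mult_left_zero)
      show "\<forall>\<^sub>F T in sequentially. E (T - Suc i) * exp (-y) ^ i =
              (if i < T then E (T - Suc i) * exp (-y) ^ i else 0)"
        using eventually_gt_at_top [of i] by eventually_elim auto
    qed
    have "norm (if i < T then E (T - Suc i) * exp (-y) ^ i else 0) \<le> M * exp (-y) ^ i" for i T
      using M by (auto simp: abs_mult intro!: mult_right_mono)
    thus "\<forall>\<^sub>F (i, T) in at_top \<times>\<^sub>F sequentially.
            norm (if i < T then E (T - Suc i) * exp (-y) ^ i else 0) \<le> M * exp (-y) ^ i"
      by (intro always_eventually) auto
  qed auto
  also have "(\<lambda>T. \<Sum>i. if i < T then E (T - Suc i) * exp (-y) ^ i else 0)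
               = (\<lambda>T. \<Sum>i<T. E (T - Suc i) * exp (- y * real i))"
    by (intro ext, subst suminf_finite [of "{..<T}" for T]) (auto simp: q [simplified])
  finally show ?thesis by simp
qed

lemma sum_square_blocks:
  fixes f :: "nat \<Rightarrow> 'a :: comm_monoid_add"
  shows "(\<Sum>n<T\<^sup>2. f n) = (\<Sum>m<T. \<Sum>n=m\<^sup>2..<(Suc m)\<^sup>2. f n)"
proof (induction T)
  case (Suc T)
  have "T\<^sup>2 \<le> (Suc T)\<^sup>2" by (rule power_mono) auto
  hence "x < T\<^sup>2 \<Longrightarrow> x < (Suc T)\<^sup>2" for x by linarith
  hence "{..<(Suc T)\<^sup>2} = {..<T\<^sup>2} \<union> {T\<^sup>2..<(Suc T)\<^sup>2}" by auto
  hence "(\<Sum>n<(Suc T)\<^sup>2. f n) = (\<Sum>n<T\<^sup>2. f n) + (\<Sum>n=T\<^sup>2..<(Suc T)\<^sup>2. f n)"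
    by (simp add: sum.union_disjoint ivl_disj_int)
  thus ?case using Suc by simp
qed auto

text \<open>Newman's contour argument. On the circle the factor \<open>1 + z\<^sup>2 / R\<^sup>2\<close> equals \<open>2 Re z z / R\<^sup>2\<close>,
  which absorbs the blow-up \<open>1 / \<bar>Re z\<bar>\<close> of the tails (right half) and of the partial sums
  (left half), so dominated convergence applies on the whole circle.\<close>
theorem fatou_riesz_sqrt:
  fixes u :: "nat \<Rightarrow> complex \<Rightarrow> complex" and e :: "nat \<Rightarrow> real" and F :: "complex \<Rightarrow> complex"
  assumes R: "R > 0" and c: "c > 0"
    and U: "open U" "cball 0 R \<subseteq> U"
    and hu: "\<And>n. u n holomorphic_on U" and hF: "F holomorphic_on U"
    and bd: "\<And>n z. z \<in> cball 0 R \<Longrightarrow> norm (u n z) \<le> e n * exp (- c * sqrt (real n) * Re z)"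
    and blk: "(\<lambda>T. \<Sum>n=T\<^sup>2..<(Suc T)\<^sup>2. e n) \<longlonglongrightarrow> 0"
    and sm: "\<And>z. z \<in> cball 0 R \<Longrightarrow> Re z > 0 \<Longrightarrow> (\<lambda>n. u n z) sums F z"
  shows "(\<lambda>n. u n 0) sums F 0"
proof -
  define E where "E = (\<lambda>T. \<Sum>n=T\<^sup>2..<(Suc T)\<^sup>2. e n)"
  define S where "S = (\<lambda>T z. \<Sum>n<T\<^sup>2. u n z)"
  \<comment> \<open>The weight exp(c T z) balances both halves of the circle: the tail beyond block
    T decays like exp(-c T Re z) on the right, and the partial sum grows at the inverse rate on the
    left. Weight and kernel are 1 at the origin, so \<open>h T 0\<close> is the remainder
    \<open>F 0 - S T 0\<close>.\<close>
  define h where "h = (\<lambda>T z. (F z - S T z) * exp (of_real (c * real T) * z) * (1 + z\<^sup>2 / of_real (R\<^sup>2)))"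
  have e0: "e n \<ge> 0" for n
    using bd [of 0 n] R order_trans [OF norm_ge_zero] by simp
  have E0: "E T \<ge> 0" for T
    unfolding E_def by (intro sum_nonneg e0)
  have Elim: "E \<longlonglongrightarrow> 0" using blk by (simp add: E_def)
  then have "Bseq E" by (auto intro: convergent_imp_Bseq convergentI)
  then obtain M where M: "M > 0" "\<And>n. E n \<le> M"
    by (auto simp: Bseq_def abs_le_iff)
  \<comment> \<open>The value at x = R, hence the maximum over 0 < x \<le> R, of the geometric bound
    (1 + c x)/(c x) times the kernel modulus 2 x/R.\<close>
  define B where "B = 2 * (1 + c * R) / (c * R)"
  have B: "B > 0" using R c by (auto simp: B_def intro!: divide_pos_pos add_pos_pos)
  have sqrt_block: "real m \<le> sqrt (real n)" "sqrt (real n) \<le> real (Suc m)"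
    if "n \<in> {m\<^sup>2..<(Suc m)\<^sup>2}" for m n
  proof -
    have "real (m\<^sup>2) \<le> real n" "real n \<le> real ((Suc m)\<^sup>2)"
      using that unfolding of_nat_le_iff by auto
    thus "real m \<le> sqrt (real n)" "sqrt (real n) \<le> real (Suc m)"
      by (auto intro!: real_le_rsqrt real_le_lsqrt)
  qed
  have kernel: "norm (1 + z\<^sup>2 / of_real (R\<^sup>2)) = 2 * \<bar>Re z\<bar> / R" if "norm z = R" for z
  proof -
    have "z * cnj z = of_real (R\<^sup>2)" using that by (simp add: complex_norm_square [symmetric])
    hence "of_real (R\<^sup>2) + z\<^sup>2 = z * (z + cnj z)" by (simp add: algebra_simps power2_eq_square)
    also have "z + cnj z = of_real (2 * Re z)" by (simp add: complex_add_cnj)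
    finally have "1 + z\<^sup>2 / of_real (R\<^sup>2) = z * of_real (2 * Re z) / of_real (R\<^sup>2)"
      using R by (simp add: field_simps)
    also have "norm \<dots> = R * (2 * \<bar>Re z\<bar>) / R\<^sup>2"
      using that R by (simp add: norm_mult norm_divide norm_power)
    finally show ?thesis using R by (simp add: power2_eq_square)
  qed
  have fin: "a * ((1 + c * x) / (c * x)) * (2 * x / R) \<le> a * B" if "0 < x" "x \<le> R" "a \<ge> 0" for a x
  proof -
    have "(1 + c * x) / (c * x) * (2 * x / R) = 2 * (1 + c * x) / (c * R)"
      using that c R by (simp add: field_simps)
    also have "\<dots> \<le> B"
      unfolding B_def using that c R by (intro divide_right_mono) auto
    finally have "a * ((1 + c * x) / (c * x) * (2 * x / R)) \<le> a * B"
      using that by (intro mult_left_mono)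
    thus ?thesis by (simp only: mult.assoc)
  qed
  have right: "norm (h T z) \<le> \<delta> * B"
    if z: "norm z = R" "Re z > 0" and \<delta>: "\<And>m. m \<ge> T \<Longrightarrow> E m \<le> \<delta>" for T z \<delta>
  proof -
    define x where "x = Re z"
    have x: "0 < x" "x \<le> R" using z complex_Re_le_cmod [of z] by (auto simp: x_def)
    have d0: "\<delta> \<ge> 0" using \<delta> [of T] E0 [of T] by simp
    have part: "norm (S N z - S T z) \<le> \<delta> * exp (- c * real T * x) * ((1 + c * x) / (c * x))"
      if "N \<ge> T" for N
    proof -
      have "S N z - S T z = (\<Sum>m=T..<N. \<Sum>n=m\<^sup>2..<(Suc m)\<^sup>2. u n z)"
        unfolding S_def sum_square_blocks using that
        by (simp add: lessThan_atLeast0 sum_diff_nat_ivl)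
      also have "norm \<dots> \<le> (\<Sum>m=T..<N. E m * exp (- c * real m * x))"
      proof (rule sum_norm_le)
        fix m
        have "norm (\<Sum>n=m\<^sup>2..<(Suc m)\<^sup>2. u n z) \<le> (\<Sum>n=m\<^sup>2..<(Suc m)\<^sup>2. e n * exp (- c * real m * x))"
        proof (rule sum_norm_le)
          fix n assume "n \<in> {m\<^sup>2..<(Suc m)\<^sup>2}"
          from sqrt_block(1) [OF this] have "c * real m * x \<le> c * sqrt (real n) * x"
            using c x by (intro mult_right_mono mult_left_mono) auto
          hence "e n * exp (- c * sqrt (real n) * x) \<le> e n * exp (- c * real m * x)"
            using e0 by (intro mult_left_mono) auto
          moreover have "norm (u n z) \<le> e n * exp (- c * sqrt (real n) * x)"
            using bd [of z n] z by (simp add: x_def)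
          ultimately show "norm (u n z) \<le> e n * exp (- c * real m * x)" by linarith
        qed
        thus "norm (\<Sum>n=m\<^sup>2..<(Suc m)\<^sup>2. u n z) \<le> E m * exp (- c * real m * x)"
          by (simp add: E_def sum_distrib_right)
      qed
      also have "\<dots> \<le> (\<Sum>m=T..<N. \<delta> * exp (- c * real m * x))"
        using \<delta> by (intro sum_mono mult_right_mono) auto
      also have "\<dots> = (\<Sum>i<N - T. \<delta> * exp (- c * real T * x) * exp (- (c * x) * real i))"
      proof (rule sum.reindex_bij_witness [of _ "\<lambda>i. i + T" "\<lambda>m. m - T"])
        fix m assume m: "m \<in> {T..<N}"
        have "exp (- c * real m * x) = exp (- c * real T * x + - (c * x) * real (m - T))"
          using m by (intro arg_cong [of _ _ exp]) (simp add: of_nat_diff algebra_simps)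
        thus "\<delta> * exp (- c * real T * x) * exp (- (c * x) * real (m - T)) = \<delta> * exp (- c * real m * x)"
          by (simp only: exp_add mult.assoc)
      qed auto
      also have "\<dots> = \<delta> * exp (- c * real T * x) * (\<Sum>i<N - T. exp (- (c * x) * real i))"
        by (simp add: sum_distrib_left)
      also have "\<dots> \<le> \<delta> * exp (- c * real T * x) * ((1 + c * x) / (c * x))"
        using geometric_sum_le [of "c * x" "N - T"] c x d0 by (intro mult_left_mono) auto
      finally show ?thesis .
    qed
    have "(\<lambda>N. S N z) \<longlonglongrightarrow> F z"
    proof -
      have "filterlim (\<lambda>N::nat. N\<^sup>2) at_top sequentially"
        by (rule filterlim_subseq) (auto simp: strict_mono_def power_strict_mono)
      moreover have "(\<lambda>N. \<Sum>n<N. u n z) \<longlonglongrightarrow> F z"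
        using sm [of z] z by (simp add: sums_def)
      ultimately show ?thesis unfolding S_def by (rule filterlim_compose [rotated])
    qed
    hence "(\<lambda>N. norm (S N z - S T z)) \<longlonglongrightarrow> norm (F z - S T z)"
      by (intro tendsto_intros)
    hence "norm (F z - S T z) \<le> \<delta> * exp (- c * real T * x) * ((1 + c * x) / (c * x))"
      by (rule tendsto_upperbound) (use part in \<open>auto simp: eventually_sequentially\<close>)
    hence "norm (h T z) \<le> \<delta> * exp (- c * real T * x) * ((1 + c * x) / (c * x)) *
             exp (c * real T * x) * (2 * x / R)"
      unfolding h_def norm_mult using kernel [OF z(1)] x R c d0
      by (intro mult_mono mult_nonneg_nonneg divide_nonneg_nonneg) (auto simp: x_def)
    also have "\<dots> = \<delta> * ((1 + c * x) / (c * x)) * (2 * x / R) * (exp (- c * real T * x) * exp (c * real T * x))"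
      by (simp only: mult_ac)
    also have "exp (- c * real T * x) * exp (c * real T * x) = 1"
      by (simp add: exp_add [symmetric])
    also have "\<delta> * ((1 + c * x) / (c * x)) * (2 * x / R) * 1 \<le> \<delta> * B"
      using fin [OF x d0] by simp
    finally show ?thesis .
  qed
  have left: "norm (S T z * exp (of_real (c * real T) * z)) \<le> (\<Sum>i<T. E (T - Suc i) * exp (- (c * y) * real i))"
    if z: "norm z = R" "Re z < 0" and y: "y = - Re z" for T z y
  proof -
    have "norm (S T z) \<le> (\<Sum>m<T. E m * exp (c * real (Suc m) * y))"
      unfolding S_def sum_square_blocks
    proof (rule sum_norm_le)
      fix m
      have "norm (\<Sum>n=m\<^sup>2..<(Suc m)\<^sup>2. u n z) \<le> (\<Sum>n=m\<^sup>2..<(Suc m)\<^sup>2. e n * exp (c * real (Suc m) * y))"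
      proof (rule sum_norm_le)
        fix n assume "n \<in> {m\<^sup>2..<(Suc m)\<^sup>2}"
        from sqrt_block(2) [OF this] have "c * sqrt (real n) * y \<le> c * real (Suc m) * y"
          using c z y by (intro mult_right_mono mult_left_mono) auto
        hence "e n * exp (c * sqrt (real n) * y) \<le> e n * exp (c * real (Suc m) * y)"
          using e0 by (intro mult_left_mono) auto
        moreover have "norm (u n z) \<le> e n * exp (c * sqrt (real n) * y)"
          using bd [of z n] z y by simp
        ultimately show "norm (u n z) \<le> e n * exp (c * real (Suc m) * y)" by linarith
      qed
      thus "norm (\<Sum>n=m\<^sup>2..<(Suc m)\<^sup>2. u n z) \<le> E m * exp (c * real (Suc m) * y)"
        by (simp add: E_def sum_distrib_right)
    qed
    hence "norm (S T z * exp (of_real (c * real T) * z)) \<le>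
             (\<Sum>m<T. E m * exp (c * real (Suc m) * y)) * exp (- (c * real T * y))"
      unfolding norm_mult using y by (intro mult_mono sum_nonneg mult_nonneg_nonneg E0) auto
    also have "\<dots> = (\<Sum>m<T. E m * exp (- (c * y) * real (T - Suc m)))"
      unfolding sum_distrib_right
    proof (intro sum.cong refl)
      fix m assume m: "m \<in> {..<T}"
      have "exp (- (c * y) * real (T - Suc m)) = exp (c * real (Suc m) * y + - (c * real T * y))"
        using m by (intro arg_cong [of _ _ exp]) (simp add: of_nat_diff algebra_simps)
      thus "E m * exp (c * real (Suc m) * y) * exp (- (c * real T * y)) = E m * exp (- (c * y) * real (T - Suc m))"
        by (simp only: exp_add mult.assoc)
    qed
    also have "\<dots> = (\<Sum>i<T. E (T - Suc i) * exp (- (c * y) * real i))"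
      by (rule sum.reindex_bij_witness [of _ "\<lambda>i. T - Suc i" "\<lambda>i. T - Suc i"]) auto
    finally show ?thesis .
  qed
  have contF: "continuous_on (cball 0 R) F"
    using hF U holomorphic_on_imp_continuous_on holomorphic_on_subset by blast
  have "bounded (F ` cball 0 R)"
    by (intro compact_imp_bounded compact_continuous_image contF) auto
  then obtain MF where MF: "MF > 0" "\<And>z. z \<in> cball 0 R \<Longrightarrow> norm (F z) \<le> MF"
    by (auto simp: bounded_pos)
  have hzero: "h T z = 0" if "norm z = R" "Re z = 0" for T z
    using kernel [OF that(1)] that by (simp add: h_def)
  have left_bd: "norm (h T z) \<le> MF * exp (- (c * y) * real T) * 2
        + (\<Sum>i<T. E (T - Suc i) * exp (- (c * y) * real i)) * (2 * y / R)"
    if z: "norm z = R" "Re z < 0" and y: "y = - Re z" for T z y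
  proof -
    have yR: "2 * y / R \<le> 2" "y > 0"
      using z y R abs_Re_le_cmod [of z] by (auto simp: field_simps)
    have "h T z = F z * exp (of_real (c * real T) * z) * (1 + z\<^sup>2 / of_real (R\<^sup>2))
            - S T z * exp (of_real (c * real T) * z) * (1 + z\<^sup>2 / of_real (R\<^sup>2))"
      by (simp add: h_def algebra_simps)
    also have "norm \<dots> \<le> norm (F z) * exp (- (c * y) * real T) * (2 * y / R)
        + norm (S T z * exp (of_real (c * real T) * z)) * (2 * y / R)"
    proof (rule order_trans [OF norm_triangle_ineq4], rule add_mono)
      have k: "norm (1 + z\<^sup>2 / of_real (R\<^sup>2)) = 2 * y / R"
        using kernel [OF z(1)] y z by simp
      show "norm (F z * exp (of_real (c * real T) * z) * (1 + z\<^sup>2 / of_real (R\<^sup>2)))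
              \<le> norm (F z) * exp (- (c * y) * real T) * (2 * y / R)"
        unfolding norm_mult k using y by (simp add: mult_ac)
      show "norm (S T z * exp (of_real (c * real T) * z) * (1 + z\<^sup>2 / of_real (R\<^sup>2)))
              \<le> norm (S T z * exp (of_real (c * real T) * z)) * (2 * y / R)"
        unfolding norm_mult k by simp
    qed
    also have "\<dots> \<le> MF * exp (- (c * y) * real T) * 2
        + (\<Sum>i<T. E (T - Suc i) * exp (- (c * y) * real i)) * (2 * y / R)"
      using left [OF z y] MF z yR R
      by (intro add_mono mult_mono mult_right_mono) auto
    finally show ?thesis .
  qed
  have bound: "norm (h T z) \<le> M * B + 2 * MF" if z: "norm z = R" for T z
  proof -
    consider "Re z > 0" | "Re z = 0" | "Re z < 0" by linarith
    thus ?thesis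
    proof cases
      case 1
      have "norm (h T z) \<le> M * B" by (rule right [OF z 1]) (use M in auto)
      thus ?thesis using MF by simp
    next
      case 2
      thus ?thesis using hzero [OF z 2] M B MF by simp
    next
      case 3
      define y where "y = - Re z"
      have y: "0 < y" "y \<le> R" using 3 z abs_Re_le_cmod [of z] by (auto simp: y_def)
      have "(\<Sum>i<T. E (T - Suc i) * exp (- (c * y) * real i)) \<le> (\<Sum>i<T. M * exp (- (c * y) * real i))"
        using M by (intro sum_mono mult_right_mono) auto
      also have "\<dots> \<le> M * ((1 + c * y) / (c * y))"
        unfolding sum_distrib_left [symmetric]
        using geometric_sum_le [of "c * y" T] c y M by (intro mult_left_mono) auto
      finally have "(\<Sum>i<T. E (T - Suc i) * exp (- (c * y) * real i)) * (2 * y / R)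
                      \<le> M * ((1 + c * y) / (c * y)) * (2 * y / R)"
        using y R by (intro mult_right_mono) auto
      also have "\<dots> \<le> M * B" using y M by (intro fin) auto
      finally have 1: "(\<Sum>i<T. E (T - Suc i) * exp (- (c * y) * real i)) * (2 * y / R) \<le> M * B" .
      have "MF * exp (- (c * y) * real T) * 2 \<le> MF * 1 * 2"
        using MF c y by (intro mult_mono) auto
      with 1 left_bd [OF z 3 y_def, of T] show ?thesis by linarith
    qed
  qed
  have lim: "(\<lambda>T. h T z) \<longlonglongrightarrow> 0" if z: "norm z = R" for z
  proof -
    consider "Re z > 0" | "Re z = 0" | "Re z < 0" by linarith
    thus ?thesis
    proof cases
      case 1
      show ?thesis
      proof (rule LIMSEQ_I)
        fix r :: real assume r: "r > 0"
        hence "r / (2 * B) > 0" using B by simp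
        with Elim obtain T0 where T0: "\<And>T. T \<ge> T0 \<Longrightarrow> E T < r / (2 * B)"
          using LIMSEQ_D [of E 0 "r / (2 * B)"] by (auto simp: abs_less_iff)
        have "norm (h T z - 0) < r" if "T \<ge> T0" for T
        proof -
          have "norm (h T z) \<le> r / (2 * B) * B"
            by (rule right [OF z 1]) (use T0 that in \<open>auto intro: less_imp_le\<close>)
          thus ?thesis using r B by simp
        qed
        thus "\<exists>no. \<forall>n\<ge>no. norm (h n z - 0) < r" by blast
      qed
    next
      case 2
      thus ?thesis using hzero [OF z 2] by simp
    next
      case 3
      define y where "y = - Re z"
      have y: "0 < c * y" using 3 c by (intro mult_pos_pos) (auto simp: y_def)
      have "(\<lambda>T. exp (- (c * y)) ^ T) \<longlonglongrightarrow> 0"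
        using y by (intro LIMSEQ_power_zero) auto
      moreover have "exp (- (c * y)) ^ T = exp (- (c * y) * real T)" for T
        by (metis exp_of_nat_mult mult.commute)
      ultimately have e: "(\<lambda>T. exp (- (c * y) * real T)) \<longlonglongrightarrow> 0" by (simp only:)
      have "(\<lambda>T. MF * exp (- (c * y) * real T) * 2
        + (\<Sum>i<T. E (T - Suc i) * exp (- (c * y) * real i)) * (2 * y / R)) \<longlonglongrightarrow> MF * 0 * 2 + 0 * (2 * y / R)"
        by (intro tendsto_intros e convolution_geometric_tendsto_0 Elim y)
      hence "(\<lambda>T. MF * exp (- (c * y) * real T) * 2
        + (\<Sum>i<T. E (T - Suc i) * exp (- (c * y) * real i)) * (2 * y / R)) \<longlonglongrightarrow> 0"
        by (simp only: mult_zero_right mult_zero_left add_0)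
      thus ?thesis
        by (rule Lim_null_comparison [OF always_eventually, rotated])
           (intro allI left_bd [OF z 3 y_def])
    qed
  qed
  have hol_h: "h T holomorphic_on U" for T
    unfolding h_def S_def using R by (intro holomorphic_intros hF hu) auto
  have int: "((\<lambda>x. h T (circlepath 0 R x)) has_integral (F 0 - S T 0)) {0..1}" for T
  proof -
    have "((\<lambda>z. h T z / (z - 0)) has_contour_integral 2 * of_real pi * \<i> * h T 0) (circlepath 0 R)"
    proof (rule Cauchy_integral_circlepath)
      show "continuous_on (cball 0 R) (h T)"
        using hol_h U holomorphic_on_imp_continuous_on holomorphic_on_subset by blast
      show "h T holomorphic_on ball 0 R"
        using hol_h U by (meson ball_subset_cball holomorphic_on_subset order_trans)
    qed (use R in auto)
    hence "((\<lambda>x. h T (circlepath 0 R x) / circlepath 0 R x * vector_derivative (circlepath 0 R) (at x within {0..1}))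
             has_integral (2 * of_real pi * \<i> * h T 0)) {0..1}"
      by (simp add: has_contour_integral_def)
    hence "((\<lambda>x. (2 * of_real pi * \<i>) * h T (circlepath 0 R x)) has_integral (2 * of_real pi * \<i> * h T 0)) {0..1}"
    proof (rule has_integral_eq [rotated])
      fix x :: real assume "x \<in> {0..1}"
      hence "vector_derivative (circlepath 0 R) (at x within {0..1}) = 2 * of_real pi * \<i> * circlepath 0 R x"
        by (simp add: vector_derivative_circlepath01) (simp add: circlepath)
      moreover have "circlepath 0 R x \<noteq> 0" using R by (simp add: circlepath)
      ultimately show "h T (circlepath 0 R x) / circlepath 0 R x * vector_derivative (circlepath 0 R) (at x within {0..1})
          = (2 * of_real pi * \<i>) * h T (circlepath 0 R x)" by simp
    qed
    from has_integral_mult_right [OF this, of "1 / (2 * of_real pi * \<i>)"]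
    show ?thesis by (simp add: h_def)
  qed
  have circ: "norm (circlepath 0 R x) = R" for x
    using R by (simp add: circlepath norm_mult)
  have "(\<lambda>T. integral {0..1} (\<lambda>x. h T (circlepath 0 R x))) \<longlonglongrightarrow> integral {0..1} (\<lambda>x::real. 0::complex)"
  proof (rule dominated_convergence(2) [where h = "\<lambda>_. M * B + 2 * MF"])
    show "(\<lambda>x. h T (circlepath 0 R x)) integrable_on {0..1}" for T
      using int by (rule has_integral_integrable)
    show "norm (h T (circlepath 0 R x)) \<le> M * B + 2 * MF" for T x
      by (rule bound [OF circ])
    show "(\<lambda>T. h T (circlepath 0 R x)) \<longlonglongrightarrow> 0" for x
      by (rule lim [OF circ])
  qed auto
  hence "(\<lambda>T. F 0 - S T 0) \<longlonglongrightarrow> 0"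
    by (simp add: integral_unique [OF int])
  hence "(\<lambda>T. F 0 - (F 0 - S T 0)) \<longlonglongrightarrow> F 0 - 0"
    by (intro tendsto_intros)
  hence Slim: "(\<lambda>T. S T 0) \<longlonglongrightarrow> F 0" by simp
  have fs: "filterlim floor_sqrt at_top sequentially"
    unfolding filterlim_at_top eventually_sequentially
    by (auto simp: le_floor_sqrt_iff)
  \<comment> \<open>So far only partial sums up to squares are handled. Between squares they move by
    at most the bound E of the current block, because the e n are nonnegative.\<close>
  have "(\<lambda>N. S (floor_sqrt N) 0 + ((\<Sum>n<N. u n 0) - S (floor_sqrt N) 0)) \<longlonglongrightarrow> F 0 + 0"
  proof (rule tendsto_add)
    show "(\<lambda>N. S (floor_sqrt N) 0) \<longlonglongrightarrow> F 0"
      by (rule filterlim_compose [OF Slim fs])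
    have "(\<lambda>N. E (floor_sqrt N)) \<longlonglongrightarrow> 0"
      by (rule filterlim_compose [OF Elim fs])
    thus "(\<lambda>N. (\<Sum>n<N. u n 0) - S (floor_sqrt N) 0) \<longlonglongrightarrow> 0"
    proof (rule Lim_null_comparison [OF always_eventually, rotated], intro allI)
      fix N
      define T where "T = floor_sqrt N"
      have T: "T\<^sup>2 \<le> N" "N < (Suc T)\<^sup>2"
        by (simp_all add: T_def Suc_floor_sqrt_power2_gt)
      have "(\<Sum>n<N. u n 0) - S T 0 = (\<Sum>n=T\<^sup>2..<N. u n 0)"
        unfolding S_def using T by (simp add: sum_diff_nat_ivl lessThan_atLeast0)
      also have "norm \<dots> \<le> (\<Sum>n=T\<^sup>2..<N. e n)"
        using bd [of 0] R by (intro sum_norm_le) auto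
      also have "\<dots> \<le> E T"
        unfolding E_def using T e0 by (intro sum_mono2) auto
      finally show "norm ((\<Sum>n<N. u n 0) - S (floor_sqrt N) 0) \<le> E (floor_sqrt N)"
        by (simp add: T_def)
    qed
  qed
  thus ?thesis by (simp add: sums_def)
qed

subsection \<open>Integrals over the positive half-line\<close>

text \<open>A measure of its own, so that Fubini and dominated convergence apply to it directly and
  pointwise claims need only positive arguments.\<close>

definition half_line :: "real measure" where
  "half_line = restrict_space lborel {0<..}"

lemma space_half_line [simp]: "space half_line = {0<..}"
  by (simp add: half_line_def space_restrict_space)

lemma sigma_finite_half_line: "sigma_finite_measure half_line"
  unfolding half_line_def
  by (rule sigma_finite_measure_restrict_space) (auto simp: sigma_finite_lborel)

interpretation half_line: sigma_finite_measure half_line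
  by (rule sigma_finite_half_line)

interpretation half_line_pair: pair_sigma_finite half_line half_line ..

lemma measurable_half_line:
  fixes f :: "real \<Rightarrow> 'a :: real_normed_vector"
  assumes "continuous_on {0<..} f"
  shows "f \<in> borel_measurable half_line"
proof -
  have "f \<in> borel_measurable (restrict_space borel {0<..})"
    by (rule borel_measurable_continuous_on_restrict [OF assms])
  moreover have "sets half_line = sets (restrict_space borel {0<..})"
    unfolding half_line_def by (intro sets_restrict_space_cong) auto
  ultimately show ?thesis by (simp cong: measurable_cong_sets)
qed

text \<open>The bridge to \<open>absolutely_integrable_on\<close>, in which change of variables and
  Euler's integral are stated. Measurability is assumed because that notion refers to the completed
  measure.\<close>

lemma half_line_lebesgue:
  fixes f :: "real \<Rightarrow> 'a :: euclidean_space"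
  assumes "f \<in> borel_measurable half_line"
  shows "integrable half_line f \<longleftrightarrow> f absolutely_integrable_on {0<..}"
    and "integrable half_line f \<Longrightarrow> integral\<^sup>L half_line f = integral {0<..} f"
proof -
  have m: "(\<lambda>x. indicator {0<..} x *\<^sub>R f x) \<in> borel_measurable lborel"
    using assms unfolding half_line_def by (subst (asm) borel_measurable_restrict_space_iff) auto
  show iff: "integrable half_line f \<longleftrightarrow> f absolutely_integrable_on {0<..}"
    unfolding half_line_def set_integrable_def
    by (subst integrable_restrict_space) (simp_all add: integrable_completion [OF m])
  assume "integrable half_line f"
  hence "f absolutely_integrable_on {0<..}" using iff by simp
  from set_lebesgue_integral_eq_integral(2) [OF this]
  show "integral\<^sup>L half_line f = integral {0<..} f"
    unfolding half_line_def set_lebesgue_integral_def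
    by (subst integral_restrict_space) (simp_all add: integral_completion [OF m])
qed

text \<open>Only bijectivity is asked of g, and the absolute value takes care of orientation: the
  decreasing map y -> z/y is one of the uses.\<close>

lemma half_line_substitution:
  fixes f :: "real \<Rightarrow> complex"
  assumes der: "\<forall>x>0. (g has_field_derivative h x) (at x)"
    and bij: "bij_betw g {0<..} {0<..}"
    and cont: "continuous_on {0<..} f" "continuous_on {0<..} h"
  shows "integrable half_line f \<longleftrightarrow> integrable half_line (\<lambda>x. \<bar>h x\<bar> *\<^sub>R f (g x))"
    and "integral\<^sup>L half_line f = integral\<^sup>L half_line (\<lambda>x. \<bar>h x\<bar> *\<^sub>R f (g x))"
proof -
  have img: "g ` {0<..} = {0<..}" and inj: "inj_on g {0<..}"
    using bij by (auto simp: bij_betw_def)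
  have contg: "continuous_on {0<..} g"
    using der by (auto intro!: continuous_at_imp_continuous_on DERIV_isCont)
  have m1: "f \<in> borel_measurable half_line"
    by (rule measurable_half_line [OF cont(1)])
  have m2: "(\<lambda>x. \<bar>h x\<bar> *\<^sub>R f (g x)) \<in> borel_measurable half_line"
    by (intro measurable_half_line continuous_intros cont
          continuous_on_compose2 [OF cont(1) contg]) (use img in auto)
  have der': "x \<in> {0<..} \<Longrightarrow> (g has_field_derivative h x) (at x within {0<..})" for x
    using der by (auto intro: DERIV_subset)
  note cov = has_absolute_integral_change_of_variables_real [OF _ der' inj, of f, unfolded img]
  show iff: "integrable half_line f \<longleftrightarrow> integrable half_line (\<lambda>x. \<bar>h x\<bar> *\<^sub>R f (g x))"
    unfolding half_line_lebesgue(1) [OF m1] half_line_lebesgue(1) [OF m2]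
    using cov [of "integral {0<..} f"] cov [of "integral {0<..} (\<lambda>x. \<bar>h x\<bar> *\<^sub>R f (g x))"] by auto
  show "integral\<^sup>L half_line f = integral\<^sup>L half_line (\<lambda>x. \<bar>h x\<bar> *\<^sub>R f (g x))"
  proof (cases "integrable half_line f")
    case True
    thus ?thesis
      using iff half_line_lebesgue [OF m1] half_line_lebesgue [OF m2] cov [of "integral {0<..} f"]
      by auto
  next
    case False
    thus ?thesis using iff by (simp add: not_integrable_integral_eq)
  qed
qed

lemma of_real_powr_eq_exp: "x > 0 \<Longrightarrow> complex_of_real x powr s = exp (s * of_real (ln x))"
  by (simp add: powr_def Ln_of_real)

lemma norm_of_real_powr: "x > 0 \<Longrightarrow> norm (complex_of_real x powr s) = x powr Re s"
  by (simp add: of_real_powr_eq_exp powr_def)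

lemma continuous_on_of_real_powr [continuous_intros]:
  "continuous_on S f \<Longrightarrow> (\<And>x. x \<in> S \<Longrightarrow> f x > 0) \<Longrightarrow> continuous_on S (\<lambda>x. complex_of_real (f x) powr s)"
  by (subst continuous_on_cong [OF refl of_real_powr_eq_exp]) (auto intro!: continuous_intros simp: less_imp_neq [symmetric])

lemma integrable_mult_cancel:
  fixes f :: "'a \<Rightarrow> complex"
  assumes "integrable M (\<lambda>x. c * f x)" "c \<noteq> 0"
  shows "integrable M f"
  using integrable_mult_right [OF assms(1), of "1 / c"] assms(2) by simp

lemma half_line_Gamma:
  assumes s: "Re s > 0" and v: "v > 0"
  shows "integrable half_line (\<lambda>x. of_real x powr (s - 1) * of_real (exp (- (v * x))))"
    and "(\<integral>x. of_real x powr (s - 1) * of_real (exp (- (v * x))) \<partial>half_line) = of_real v powr (- s) * Gamma s"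
proof -
  let ?f = "\<lambda>x. complex_of_real x powr (s - 1) * of_real (exp (- x))"
  have cont: "continuous_on {0<..} ?f" by (auto intro!: continuous_intros)
  have f: "?f = (\<lambda>t. complex_of_real t powr (s - 1) / of_real (exp t))"
    by (auto simp: exp_minus field_simps)
  have int: "integrable half_line ?f"
    using half_line_lebesgue(1) [OF measurable_half_line [OF cont]]
      absolutely_integrable_Gamma_integral' [OF s] by (simp add: f)
  have val: "integral\<^sup>L half_line ?f = Gamma s"
    using half_line_lebesgue(2) [OF measurable_half_line [OF cont] int]
      integral_unique [OF Gamma_integral_complex' [OF s]] by (simp add: f)
  have bij: "bij_betw (\<lambda>x. v * x) {0<..} {0<..}"
    using v by (intro bij_betwI [where g = "\<lambda>x. x / v"]) auto
  have der: "\<forall>x>0. ((\<lambda>x. v * x) has_field_derivative v) (at x)"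
    by (auto intro!: derivative_eq_intros)
  have eq: "\<bar>v\<bar> *\<^sub>R ?f (v * x) = of_real v powr s * (of_real x powr (s - 1) * of_real (exp (- (v * x))))"
    if "x \<in> space half_line" for x
  proof -
    have "of_real v powr s * of_real x powr (s - 1) = complex_of_real v * (of_real v powr (s - 1) * of_real x powr (s - 1))"
      using v by (simp add: powr_diff)
    also have "of_real v powr (s - 1) * of_real x powr (s - 1) = complex_of_real (v * x) powr (s - 1)"
      using v that by (simp add: powr_times_real)
    finally show ?thesis using v by (simp add: scaleR_conv_of_real)
  qed
  note sub = half_line_substitution [OF der bij cont continuous_on_const]
  have "integrable half_line (\<lambda>x. of_real v powr s * (of_real x powr (s - 1) * of_real (exp (- (v * x)))))"
    using sub(1) int by (simp only: Bochner_Integration.integrable_cong [OF refl eq])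
  thus i: "integrable half_line (\<lambda>x. of_real x powr (s - 1) * of_real (exp (- (v * x))))"
    by (rule integrable_mult_cancel) (use v in simp)
  have "Gamma s = (\<integral>x. of_real v powr s * (of_real x powr (s - 1) * of_real (exp (- (v * x)))) \<partial>half_line)"
    using sub(2) val by (simp only: Bochner_Integration.integral_cong [OF refl eq])
  thus "(\<integral>x. of_real x powr (s - 1) * of_real (exp (- (v * x))) \<partial>half_line) = of_real v powr (- s) * Gamma s"
    using v by (simp add: powr_minus field_simps)
qed

lemma half_line_Gamma_real:
  assumes s: "(s::real) > 0" and v: "v > 0"
  shows "integrable half_line (\<lambda>x. x powr (s - 1) * exp (- (v * x)))"
    and "(\<integral>x. x powr (s - 1) * exp (- (v * x)) \<partial>half_line) = v powr (- s) * Gamma s"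
proof -
  have eq: "complex_of_real x powr (of_real s - 1) * of_real (exp (- (v * x))) = of_real (x powr (s - 1) * exp (- (v * x)))"
    if "x \<in> space half_line" for x
    using that powr_of_real [of x "s - 1"] by simp
  have "integrable half_line (\<lambda>x. complex_of_real (x powr (s - 1) * exp (- (v * x))))"
    using half_line_Gamma(1) [of "of_real s" v] s v
    by (simp only: Bochner_Integration.integrable_cong [OF refl eq] Re_complex_of_real)
  thus "integrable half_line (\<lambda>x. x powr (s - 1) * exp (- (v * x)))"
    by (simp only: complex_of_real_integrable_eq)
  have "complex_of_real (\<integral>x. x powr (s - 1) * exp (- (v * x)) \<partial>half_line) = of_real v powr (- of_real s) * Gamma (of_real s)"
    using half_line_Gamma(2) [of "of_real s" v] s v
    by (simp only: Bochner_Integration.integral_cong [OF refl eq] Re_complex_of_real integral_complex_of_real)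
  also have "\<dots> = of_real (v powr (- s) * Gamma s)"
    using v powr_of_real [of v "- s"] by (simp add: Gamma_complex_of_real)
  finally show "(\<integral>x. x powr (s - 1) * exp (- (v * x)) \<partial>half_line) = v powr (- s) * Gamma s"
    by (simp only: of_real_eq_iff)
qed

text \<open>Write 1/(1 + x) as the integral of exp(-v (1 + x)) over v and exchange: the inner
  integrals are Gamma functions, and the reflection formula evaluates Gamma(s) Gamma(1 - s).\<close>

lemma half_line_mellin:
  assumes s: "0 < Re s" "Re s < 1"
  shows "integrable half_line (\<lambda>x. of_real x powr (s - 1) / of_real (1 + x))"
    and "(\<integral>x. of_real x powr (s - 1) / of_real (1 + x) \<partial>half_line) = of_real pi / sin (of_real pi * s)"
proof -
  let ?f = "\<lambda>v x. complex_of_real x powr (s - 1) * of_real (exp (- (v * x))) * of_real (exp (- v))"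
  have id: "(\<lambda>x. x) \<in> borel_measurable half_line"
    by (intro measurable_half_line continuous_intros)
  have [measurable]: "(\<lambda>x. complex_of_real x powr (s - 1)) \<in> borel_measurable half_line"
    by (auto intro!: measurable_half_line continuous_intros)
  have [measurable]: "fst \<in> borel_measurable (half_line \<Otimes>\<^sub>M half_line)"
    by (rule measurable_compose [OF measurable_fst id])
  have [measurable]: "snd \<in> borel_measurable (half_line \<Otimes>\<^sub>M half_line)"
    by (rule measurable_compose [OF measurable_snd id])
  have meas: "case_prod ?f \<in> borel_measurable (half_line \<Otimes>\<^sub>M half_line)"
    by measurable
  have inner: "(\<integral>x. ?f v x \<partial>half_line) = Gamma s * (of_real v powr ((1 - s) - 1) * of_real (exp (- (1 * v))))"
    if "v \<in> space half_line" for v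
    using half_line_Gamma [OF s(1), of v] that by (simp add: algebra_simps)
  have norm_inner: "(\<integral>x. norm (?f v x) \<partial>half_line) = Gamma (Re s) * (v powr ((1 - Re s) - 1) * exp (- (1 * v)))"
    if "v \<in> space half_line" for v
  proof -
    have "(\<integral>x. norm (?f v x) \<partial>half_line) = (\<integral>x. x powr (Re s - 1) * exp (- (v * x)) * exp (- v) \<partial>half_line)"
      by (intro Bochner_Integration.integral_cong refl) (simp add: norm_mult norm_of_real_powr)
    thus ?thesis using half_line_Gamma_real [OF s(1), of v] that by (simp add: algebra_simps)
  qed
  have int: "integrable (half_line \<Otimes>\<^sub>M half_line) (case_prod ?f)"
  proof (rule half_line_pair.Fubini_integrable [OF meas])
    have "integrable half_line (\<lambda>v. Gamma (Re s) * (v powr ((1 - Re s) - 1) * exp (- (1 * v))))"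
      using s by (intro integrable_mult_right half_line_Gamma_real(1)) auto
    thus "integrable half_line (\<lambda>v. \<integral>x. norm (case_prod ?f (v, x)) \<partial>half_line)"
      by (simp only: Bochner_Integration.integrable_cong [OF refl norm_inner] split_conv)
    show "AE v in half_line. integrable half_line (\<lambda>x. case_prod ?f (v, x))"
      using half_line_Gamma(1) [OF s(1)] by (intro AE_I2) simp
  qed
  have outer: "(\<integral>v. ?f v x \<partial>half_line) = of_real x powr (s - 1) / of_real (1 + x)"
    if "x \<in> space half_line" for x
  proof -
    have "?f v x = of_real x powr (s - 1) * (of_real v powr (1 - 1) * of_real (exp (- ((1 + x) * v))))"
      if "v \<in> space half_line" for v
      using that by (simp add: algebra_simps exp_add exp_minus exp_diff divide_inverse)
    hence "(\<integral>v. ?f v x \<partial>half_line) =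
            (\<integral>v. of_real x powr (s - 1) * (of_real v powr (1 - 1) * of_real (exp (- ((1 + x) * v)))) \<partial>half_line)"
      by (intro Bochner_Integration.integral_cong refl)
    also have "\<dots> = of_real x powr (s - 1) * (of_real (1 + x) powr (- 1) * Gamma 1)"
      using half_line_Gamma(2) [of 1 "1 + x"] that by simp
    finally show ?thesis using that by (simp add: powr_minus field_simps)
  qed
  have "integrable half_line (\<lambda>x. \<integral>v. ?f v x \<partial>half_line)"
    using half_line_pair.integrable_snd [OF int] by simp
  thus "integrable half_line (\<lambda>x. of_real x powr (s - 1) / of_real (1 + x))"
    by (simp only: Bochner_Integration.integrable_cong [OF refl outer])
  have "(\<integral>x. of_real x powr (s - 1) / of_real (1 + x) \<partial>half_line) = (\<integral>x. (\<integral>v. ?f v x \<partial>half_line) \<partial>half_line)"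
    by (simp only: Bochner_Integration.integral_cong [OF refl outer])
  also have "\<dots> = (\<integral>v. (\<integral>x. ?f v x \<partial>half_line) \<partial>half_line)"
    by (rule half_line_pair.Fubini_integral [OF int])
  also have "\<dots> = (\<integral>v. Gamma s * (of_real v powr ((1 - s) - 1) * of_real (exp (- (1 * v)))) \<partial>half_line)"
    by (simp only: Bochner_Integration.integral_cong [OF refl inner])
  also have "\<dots> = Gamma s * Gamma (1 - s)"
    using half_line_Gamma(2) [of "1 - s" 1] s by simp
  finally show "(\<integral>x. of_real x powr (s - 1) / of_real (1 + x) \<partial>half_line) = of_real pi / sin (of_real pi * s)"
    by (simp add: Gamma_reflection_complex)
qed

text \<open>The substitution x = (c y)^2 in the preceding integral, taken at s/2; this doubles the
  admissible range of Re s.\<close>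

lemma half_line_mellin_square:
  assumes s: "0 < Re s" "Re s < 2" and c: "c > 0"
  shows "integrable half_line (\<lambda>y. of_real y powr (s - 1) / of_real (1 + (c * y)\<^sup>2))"
    and "(\<integral>y. of_real y powr (s - 1) / of_real (1 + (c * y)\<^sup>2) \<partial>half_line)
           = of_real c powr (- s) * (of_real pi / (2 * sin (of_real pi * s / 2)))"
proof -
  let ?f = "\<lambda>x. complex_of_real x powr (s / 2 - 1) / of_real (1 + x)"
  have cont: "continuous_on {0<..} ?f" by (auto intro!: continuous_intros simp del: of_real_add)
  have bij: "bij_betw (\<lambda>y. (c * y)\<^sup>2) {0<..} {0<..}"
    using c by (intro bij_betwI [where g = "\<lambda>x. sqrt x / c"]) (auto simp: power_mult_distrib real_sqrt_mult)
  have der: "\<forall>y>0. ((\<lambda>y. (c * y)\<^sup>2) has_field_derivative (2 * c\<^sup>2 * y)) (at y)"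
    by (auto intro!: derivative_eq_intros simp: power2_eq_square)
  have eq: "\<bar>2 * c\<^sup>2 * y\<bar> *\<^sub>R ?f ((c * y)\<^sup>2) = (2 * of_real c powr s) * (of_real y powr (s - 1) / of_real (1 + (c * y)\<^sup>2))"
    if "y \<in> space half_line" for y
  proof -
    have y: "y > 0" using that by simp
    have "complex_of_real ((c * y)\<^sup>2) powr (s / 2 - 1) = exp ((s / 2 - 1) * of_real (2 * (ln c + ln y)))"
      using c y by (subst of_real_powr_eq_exp) (auto simp: ln_realpow ln_mult)
    also have "\<dots> = exp (s * of_real (ln c)) * exp ((s - 1) * of_real (ln y)) / of_real (exp (2 * ln c) * exp (ln y))"
      by (simp add: algebra_simps exp_of_real [symmetric] flip: exp_add exp_diff)
    also have "exp (2 * ln c) * exp (ln y) = c\<^sup>2 * y"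
      using c y by (simp add: exp_double)
    finally show ?thesis
      using c y by (simp add: of_real_powr_eq_exp scaleR_conv_of_real)
  qed
  have cd: "continuous_on {0<..} (\<lambda>y. 2 * c\<^sup>2 * y)" by (intro continuous_intros)
  note sub = half_line_substitution [OF der bij cont cd]
  have s2: "0 < Re (s / 2)" "Re (s / 2) < 1" using s by auto
  have "integrable half_line (\<lambda>y. (2 * of_real c powr s) * (of_real y powr (s - 1) / of_real (1 + (c * y)\<^sup>2)))"
    using sub(1) half_line_mellin(1) [OF s2]
    by (simp only: Bochner_Integration.integrable_cong [OF refl eq])
  thus "integrable half_line (\<lambda>y. of_real y powr (s - 1) / of_real (1 + (c * y)\<^sup>2))"
    by (rule integrable_mult_cancel) (use c in simp)
  have "of_real pi / sin (of_real pi * (s / 2)) = (\<integral>y. (2 * of_real c powr s) * (of_real y powr (s - 1) / of_real (1 + (c * y)\<^sup>2)) \<partial>half_line)"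
    using sub(2) half_line_mellin(2) [OF s2]
    by (simp only: Bochner_Integration.integral_cong [OF refl eq])
  also have "\<dots> = (2 * of_real c powr s) * (\<integral>y. of_real y powr (s - 1) / of_real (1 + (c * y)\<^sup>2) \<partial>half_line)"
    by (rule integral_mult_right_zero)
  finally have "(2 * of_real c powr s) * (\<integral>y. of_real y powr (s - 1) / of_real (1 + (c * y)\<^sup>2) \<partial>half_line)
      = of_real pi / sin (of_real pi * (s / 2))" ..
  hence *: "(\<integral>y. of_real y powr (s - 1) / of_real (1 + (c * y)\<^sup>2) \<partial>half_line)
      = of_real pi / sin (of_real pi * (s / 2)) / (2 * of_real c powr s)"
    using c by (subst eq_divide_eq) (simp add: mult.commute)
  show "(\<integral>y. of_real y powr (s - 1) / of_real (1 + (c * y)\<^sup>2) \<partial>half_line)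
           = of_real c powr (- s) * (of_real pi / (2 * sin (of_real pi * s / 2)))"
    unfolding * using c by (simp add: powr_minus field_simps)
qed

text \<open>A dominating function for f itself is enough: Cauchy's inequality on discs of radius
  \<rho>/4 bounds the derivatives, hence the difference quotients, by 4/\<rho> times the same
  function.\<close>

lemma integral_has_field_derivative:
  fixes f :: "complex \<Rightarrow> 'a \<Rightarrow> complex"
  assumes \<rho>: "\<rho> > 0"
    and hol: "\<And>t. t \<in> space M \<Longrightarrow> (\<lambda>z. f z t) holomorphic_on ball z0 \<rho>"
    and bd: "\<And>z t. z \<in> ball z0 \<rho> \<Longrightarrow> t \<in> space M \<Longrightarrow> norm (f z t) \<le> g t"
    and g: "integrable M g"
    and meas: "\<And>z. z \<in> ball z0 \<rho> \<Longrightarrow> f z \<in> borel_measurable M"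
  shows "((\<lambda>z. \<integral>t. f z t \<partial>M) has_field_derivative (\<integral>t. deriv (\<lambda>z. f z t) z0 \<partial>M)) (at z0)"
proof -
  have int: "integrable M (f z)" if "z \<in> ball z0 \<rho>" for z
    by (rule Bochner_Integration.integrable_bound [OF g meas [OF that]])
       (intro AE_I2, use bd [OF that] in force)
  have lip: "norm (f z t - f z0 t) \<le> 4 / \<rho> * g t * norm (z - z0)"
    if z: "z \<in> ball z0 (\<rho> / 2)" and t: "t \<in> space M" for z t
  proof (rule field_differentiable_bound [of "ball z0 (\<rho> / 2)" _ "deriv (\<lambda>z. f z t)"])
    fix w assume w: "w \<in> ball z0 (\<rho> / 2)"
    have sub: "ball w (\<rho> / 2) \<subseteq> ball z0 \<rho>" "cball w (\<rho> / 4) \<subseteq> ball z0 \<rho>"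
    proof -
      show "ball w (\<rho> / 2) \<subseteq> ball z0 \<rho>"
      proof
        fix x assume "x \<in> ball w (\<rho> / 2)"
        thus "x \<in> ball z0 \<rho>" using w dist_triangle [of z0 x w] by simp
      qed
      moreover have "cball w (\<rho> / 4) \<subseteq> ball w (\<rho> / 2)" using \<rho> by auto
      ultimately show "cball w (\<rho> / 4) \<subseteq> ball z0 \<rho>" by blast
    qed
    show "((\<lambda>z. f z t) has_field_derivative deriv (\<lambda>z. f z t) w) (at w within ball z0 (\<rho> / 2))"
      using holomorphic_derivI [OF hol [OF t] open_ball, of w] sub(1) \<rho>
      by (meson centre_in_ball field_differentiable_at_within has_field_derivative_at_within half_gt_zero subsetD)
    have "norm ((deriv ^^ 1) (\<lambda>z. f z t) w) \<le> fact 1 * g t / (\<rho> / 4) ^ 1"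
    proof (rule Cauchy_inequality)
      show "(\<lambda>z. f z t) holomorphic_on ball w (\<rho> / 4)"
        using hol [OF t] sub(2) by (meson ball_subset_cball holomorphic_on_subset order_trans)
      show "continuous_on (cball w (\<rho> / 4)) (\<lambda>z. f z t)"
        using hol [OF t] sub(2) holomorphic_on_imp_continuous_on holomorphic_on_subset by blast
      show "norm (f x t) \<le> g t" if "norm (w - x) = \<rho> / 4" for x
        using that sub(2) by (intro bd t) (auto simp: dist_norm subset_iff)
    qed (use \<rho> in auto)
    thus "norm (deriv (\<lambda>z. f z t) w) \<le> 4 / \<rho> * g t" by (simp add: field_simps)
  qed (use z \<rho> in auto)
  have der: "((\<lambda>z. f z t) has_field_derivative deriv (\<lambda>z. f z t) z0) (at z0)" if "t \<in> space M" for t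
    using holomorphic_derivI [OF hol [OF that] open_ball, of z0] \<rho> by auto
  show ?thesis
    unfolding has_field_derivative_iff
  proof (rule LIMSEQ_SEQ_conv [THEN iffD1], intro allI impI)
    fix X :: "nat \<Rightarrow> complex" assume X: "(\<forall>n. X n \<noteq> z0) \<and> X \<longlonglongrightarrow> z0"
    have Xf: "filterlim X (at z0) sequentially"
      using X by (auto simp: filterlim_at)
    have ev: "\<forall>\<^sub>F n in sequentially. X n \<in> ball z0 (\<rho> / 2)"
      using X \<rho> by (auto dest: topological_tendstoD [of X z0 _ "ball z0 (\<rho> / 2)"])
    then obtain N where N: "\<And>n. n \<ge> N \<Longrightarrow> X n \<in> ball z0 (\<rho> / 2)"
      by (auto simp: eventually_sequentially)
    have N': "X (n + N) \<in> ball z0 (\<rho> / 2)" "X (n + N) \<in> ball z0 \<rho>" for n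
      using N [of "n + N"] \<rho> by auto
    have lim: "(\<lambda>n. (f (X (n + N)) t - f z0 t) / (X (n + N) - z0)) \<longlonglongrightarrow> deriv (\<lambda>z. f z t) z0"
      if "t \<in> space M" for t
      by (rule LIMSEQ_ignore_initial_segment, rule filterlim_compose [OF _ Xf])
         (use der [OF that] in \<open>simp add: has_field_derivative_iff\<close>)
    have m: "(\<lambda>t. (f (X (n + N)) t - f z0 t) / (X (n + N) - z0)) \<in> borel_measurable M" for n
      using meas [OF N'(2)] meas [of z0] \<rho> by auto
    have "(\<lambda>n. \<integral>t. (f (X (n + N)) t - f z0 t) / (X (n + N) - z0) \<partial>M) \<longlonglongrightarrow> (\<integral>t. deriv (\<lambda>z. f z t) z0 \<partial>M)"
    proof (rule integral_dominated_convergence [where w = "\<lambda>t. 4 / \<rho> * g t"])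
      show "(\<lambda>t. deriv (\<lambda>z. f z t) z0) \<in> borel_measurable M"
        by (rule borel_measurable_LIMSEQ_metric [OF m lim])
      show "integrable M (\<lambda>t. 4 / \<rho> * g t)" using g by simp
      show "AE t in M. norm ((f (X (n + N)) t - f z0 t) / (X (n + N) - z0)) \<le> 4 / \<rho> * g t" for n
      proof (rule AE_I2)
        fix t assume "t \<in> space M"
        from lip [OF N'(1) this, of n] X
        show "norm ((f (X (n + N)) t - f z0 t) / (X (n + N) - z0)) \<le> 4 / \<rho> * g t"
          by (simp add: norm_divide divide_le_eq)
      qed
    qed (use m lim in auto)
    also have "(\<lambda>n. \<integral>t. (f (X (n + N)) t - f z0 t) / (X (n + N) - z0) \<partial>M) =
        (\<lambda>n. ((\<integral>t. f (X (n + N)) t \<partial>M) - (\<integral>t. f z0 t \<partial>M)) / (X (n + N) - z0))"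
      using int [OF N'(2)] int [of z0] \<rho> by (auto simp: fun_eq_iff)
    finally show "(\<lambda>n. ((\<integral>t. f (X n) t \<partial>M) - (\<integral>t. f z0 t \<partial>M)) / (X n - z0)) \<longlonglongrightarrow> (\<integral>t. deriv (\<lambda>z. f z t) z0 \<partial>M)"
      by (rule LIMSEQ_offset)
  qed
qed

subsection \<open>The integral of Macdonald's function\<close>

text \<open>For \<open>z > 0\<close> this is \<open>2 z\<^sup>\<mu>\<^sup>/\<^sup>2 K\<^sub>\<mu>(2 \<surd>z)\<close>.\<close>
definition macdonald :: "complex \<Rightarrow> complex \<Rightarrow> complex" where
  "macdonald \<mu> z = (\<integral>y. of_real y powr (\<mu> - 1) * exp (- of_real y - z / of_real y) \<partial>half_line)"

lemma exp_neg_le_power: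
  assumes "(x::real) > 0"
  shows "exp (- x) \<le> fact N / x ^ N"
proof -
  have "x ^ N / fact N \<le> exp x"
    using sum_le_suminf [OF summable_exp_generic [of x], of "{N}"] assms
    by (simp add: exp_def divide_inverse mult.commute)
  thus ?thesis using assms by (simp add: exp_minus field_simps)
qed

lemma macdonald_continuous:
  "continuous_on {0<..} (\<lambda>y. complex_of_real y powr (\<mu> - 1) * exp (- of_real y - z / of_real y))"
  by (auto intro!: continuous_intros)

lemma macdonald_dominant_integrable:
  fixes m x :: real
  assumes "x > 0 \<or> x = 0 \<and> m > 0"
  shows "integrable half_line (\<lambda>y. y powr (m - 1) * exp (- y - x / y))"
proof -
  \<comment> \<open>For m \<le> 0 the singularity at y = 0 is removed by trading exp(-x/y) for a
    multiple of y^N, which requires x > 0. For m > 0 nothing is traded, and this admits x =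
    0.\<close>
  define N where "N = (if m > 0 then 0 else nat \<lceil>1 - m\<rceil>)"
  have N: "m + real N > 0" unfolding N_def by (auto simp: not_less) linarith
  define C where "C = (if N = 0 then 1 else fact N / x ^ N)"
  have "integrable half_line (\<lambda>y. C * (y powr ((m + real N) - 1) * exp (- (1 * y))))"
    by (intro integrable_mult_right half_line_Gamma_real N) auto
  thus ?thesis
  proof (rule Bochner_Integration.integrable_bound)
    show "(\<lambda>y. y powr (m - 1) * exp (- y - x / y)) \<in> borel_measurable half_line"
      by (auto intro!: measurable_half_line continuous_intros)
    show "AE y in half_line. norm (y powr (m - 1) * exp (- y - x / y)) \<le>
            norm (C * (y powr ((m + real N) - 1) * exp (- (1 * y))))"
    proof (rule AE_I2)
      fix y :: real assume "y \<in> space half_line"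
      hence y: "y > 0" by simp
      have "exp (- (x / y)) \<le> C * y ^ N"
      proof (cases "N = 0")
        case True
        thus ?thesis using assms y by (auto simp: C_def)
      next
        case False
        hence x: "x > 0" using assms by (auto simp: N_def split: if_splits)
        show ?thesis
          using exp_neg_le_power [of "x / y" N] x y False by (simp add: C_def power_divide)
      qed
      hence "y powr (m - 1) * (exp (- y) * exp (- (x / y))) \<le> y powr (m - 1) * (exp (- y) * (C * y ^ N))"
        by (intro mult_left_mono) auto
      also have "\<dots> = C * (y powr (m - 1) * y powr real N * exp (- y))"
        using y by (simp add: powr_realpow mult_ac)
      also have "y powr (m - 1) * y powr real N = y powr ((m + real N) - 1)"
        by (simp add: powr_add [symmetric] algebra_simps)
      finally have "y powr (m - 1) * exp (- y - x / y) \<le> C * (y powr ((m + real N) - 1) * exp (- (1 * y)))"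
        by (simp add: exp_diff exp_minus divide_inverse)
      thus "norm (y powr (m - 1) * exp (- y - x / y)) \<le> norm (C * (y powr ((m + real N) - 1) * exp (- (1 * y))))"
        unfolding real_norm_def using mult_nonneg_nonneg [OF powr_ge_zero exp_ge_zero, of y "m - 1" "- y - x / y"]
        by linarith
    qed
  qed
qed

lemma norm_macdonald_integrand:
  "y > 0 \<Longrightarrow> norm (of_real y powr (\<mu> - 1) * exp (- of_real y - z / of_real y))
     = y powr (Re \<mu> - 1) * exp (- y - Re z / y)"
  by (simp add: norm_mult norm_of_real_powr Re_divide_of_real)

lemma macdonald_integrable:
  assumes "Re z > 0 \<or> Re z = 0 \<and> Re \<mu> > 0"
  shows "integrable half_line (\<lambda>y. of_real y powr (\<mu> - 1) * exp (- of_real y - z / of_real y))"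
  by (rule Bochner_Integration.integrable_bound [OF macdonald_dominant_integrable [OF assms]
        measurable_half_line [OF macdonald_continuous]])
     (auto intro!: AE_I2 simp: norm_macdonald_integrand)

lemma macdonald_has_field_derivative:
  assumes "Re z > 0"
  shows "(macdonald \<mu> has_field_derivative - macdonald (\<mu> - 1) z) (at z)"
proof -
  let ?f = "\<lambda>z y. complex_of_real y powr (\<mu> - 1) * exp (- of_real y - z / of_real y)"
  have "((\<lambda>z. \<integral>y. ?f z y \<partial>half_line) has_field_derivative (\<integral>y. deriv (\<lambda>z. ?f z y) z \<partial>half_line)) (at z)"
  proof (rule integral_has_field_derivative [where \<rho> = "Re z / 2" and g = "\<lambda>y. y powr (Re \<mu> - 1) * exp (- y - (Re z / 2) / y)"])
    show "integrable half_line (\<lambda>y. y powr (Re \<mu> - 1) * exp (- y - (Re z / 2) / y))"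
      using assms by (intro macdonald_dominant_integrable) auto
    fix w y assume w: "w \<in> ball z (Re z / 2)" and y: "y \<in> space half_line"
    have "Re w \<ge> Re z / 2" using w abs_Re_le_cmod [of "z - w"] by (auto simp: dist_norm)
    hence "(Re z / 2) / y \<le> Re w / y" using y by (intro divide_right_mono) auto
    thus "norm (?f w y) \<le> y powr (Re \<mu> - 1) * exp (- y - (Re z / 2) / y)"
      using y by (subst norm_macdonald_integrand) (auto intro!: mult_left_mono)
  qed (use assms in \<open>auto intro!: holomorphic_intros measurable_half_line macdonald_continuous\<close>)
  also have "(\<integral>y. deriv (\<lambda>z. ?f z y) z \<partial>half_line) = (\<integral>y. - (complex_of_real y powr ((\<mu> - 1) - 1) * exp (- of_real y - z / of_real y)) \<partial>half_line)"
  proof (intro Bochner_Integration.integral_cong refl DERIV_imp_deriv)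
    fix y assume "y \<in> space half_line"
    hence y: "y > 0" by simp
    have "complex_of_real y powr ((\<mu> - 1) - 1) = of_real y powr (\<mu> - 1) / of_real y"
      using y by (simp add: powr_diff power2_eq_square)
    thus "((\<lambda>z. ?f z y) has_field_derivative - (of_real y powr ((\<mu> - 1) - 1) * exp (- of_real y - z / of_real y))) (at z)"
      using y by (auto intro!: derivative_eq_intros)
  qed
  finally show ?thesis by (simp add: macdonald_def [abs_def])
qed

text \<open>The substitution y -> z/y. In the classical normalisation this is the symmetry of K in
  its order. With the derivative formula above it expresses the derivative at order \<mu> through
  order 1 - \<mu>.\<close>

lemma macdonald_reflect:
  assumes z: "z > 0"
  shows "macdonald (- \<mu>) (of_real z) = of_real z powr (- \<mu>) * macdonald \<mu> (of_real z)"
proof -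
  let ?f = "\<lambda>y. complex_of_real y powr (- \<mu> - 1) * exp (- of_real y - of_real z / of_real y)"
  have bij: "bij_betw (\<lambda>y. z / y) {0<..} {0<..}"
    using z by (intro bij_betwI [where g = "\<lambda>y. z / y"]) auto
  have der: "\<forall>y>0. ((\<lambda>y. z / y) has_field_derivative (- z / y\<^sup>2)) (at y)"
    by (auto intro!: derivative_eq_intros simp: power2_eq_square)
  have cd: "continuous_on {0<..} (\<lambda>y. - z / y\<^sup>2)" by (auto intro!: continuous_intros)
  have "macdonald (- \<mu>) (of_real z) = (\<integral>y. \<bar>- z / y\<^sup>2\<bar> *\<^sub>R ?f (z / y) \<partial>half_line)"
    unfolding macdonald_def
    by (rule half_line_substitution(2) [OF der bij macdonald_continuous cd])
  also have "\<dots> = (\<integral>y. of_real z powr (- \<mu>) * (of_real y powr (\<mu> - 1) * exp (- of_real y - of_real z / of_real y)) \<partial>half_line)"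
  proof (intro Bochner_Integration.integral_cong refl)
    fix y assume "y \<in> space half_line"
    hence y: "y > 0" by simp
    have "complex_of_real (z / y) powr (- \<mu> - 1) = exp ((- \<mu> - 1) * of_real (ln z - ln y))"
      using z y by (subst of_real_powr_eq_exp) (auto simp: ln_div)
    also have "\<dots> = exp (- \<mu> * of_real (ln z)) * exp ((\<mu> - 1) * of_real (ln y)) * (exp (- of_real (ln z)) * exp (2 * of_real (ln y)))"
      by (simp add: algebra_simps flip: exp_add)
    also have "exp (- complex_of_real (ln z)) * exp (2 * of_real (ln y)) = of_real (y\<^sup>2 / z)"
      using z y by (simp add: exp_minus exp_double exp_of_real field_simps)
    finally have "complex_of_real (z / y) powr (- \<mu> - 1) = of_real z powr (- \<mu>) * of_real y powr (\<mu> - 1) * of_real (y\<^sup>2 / z)"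
      using z y by (simp add: of_real_powr_eq_exp)
    moreover have "- of_real (z / y) - of_real z / of_real (z / y) = - complex_of_real y - of_real z / of_real y"
      using z y by simp
    ultimately show "\<bar>- z / y\<^sup>2\<bar> *\<^sub>R ?f (z / y) = of_real z powr (- \<mu>) * (of_real y powr (\<mu> - 1) * exp (- of_real y - of_real z / of_real y))"
      using z y by (simp only: mult.assoc [symmetric]) (simp add: scaleR_conv_of_real)
  qed
  finally show ?thesis unfolding macdonald_def by simp
qed

text \<open>The initial value that singles out this solution of the differential relations; a limit
  along one sequence tending to 0 suffices for that.\<close>

lemma macdonald_tendsto_Gamma:
  assumes \<mu>: "Re \<mu> > 0"
  shows "(\<lambda>n. macdonald \<mu> (of_real (1 / real (Suc n)))) \<longlonglongrightarrow> Gamma \<mu>"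
proof -
  let ?f = "\<lambda>z y. complex_of_real y powr (\<mu> - 1) * exp (- of_real y - of_real z / of_real y)"
  have "(\<lambda>n. \<integral>y. ?f (1 / real (Suc n)) y \<partial>half_line) \<longlonglongrightarrow> (\<integral>y. ?f 0 y \<partial>half_line)"
  proof (rule integral_dominated_convergence [where w = "\<lambda>y. y powr (Re \<mu> - 1) * exp (- y - 0 / y)"])
    show "integrable half_line (\<lambda>y. y powr (Re \<mu> - 1) * exp (- y - 0 / y))"
      using \<mu> by (intro macdonald_dominant_integrable) auto
    show "AE y in half_line. (\<lambda>n. ?f (1 / real (Suc n)) y) \<longlonglongrightarrow> ?f 0 y"
    proof (rule AE_I2)
      fix y assume "y \<in> space half_line"
      hence y: "complex_of_real y \<noteq> 0" by simp
      have "(\<lambda>n. 1 / real (Suc n)) \<longlonglongrightarrow> 0"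
        by (rule LIMSEQ_Suc [OF lim_1_over_n])
      thus "(\<lambda>n. ?f (1 / real (Suc n)) y) \<longlonglongrightarrow> ?f 0 y"
        using y by (intro tendsto_intros)
    qed
    show "AE y in half_line. norm (?f (1 / real (Suc n)) y) \<le> y powr (Re \<mu> - 1) * exp (- y - 0 / y)" for n
      by (rule AE_I2, subst norm_macdonald_integrand) (auto intro!: mult_left_mono)
  qed (rule measurable_half_line [OF macdonald_continuous])+
  also have "(\<integral>y. ?f 0 y \<partial>half_line) = (\<integral>y. of_real y powr (\<mu> - 1) * of_real (exp (- (1 * y))) \<partial>half_line)"
    by (intro Bochner_Integration.integral_cong refl) (simp add: exp_of_real [symmetric])
  also have "\<dots> = Gamma \<mu>" using half_line_Gamma(2) [OF \<mu>, of 1] by simp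
  finally show ?thesis by (simp add: macdonald_def)
qed

lemma macdonald_bound:
  assumes "Re \<mu> > 0" "z > 0"
  shows "norm (macdonald \<mu> (of_real z)) \<le> Gamma (Re \<mu>)"
proof -
  have "norm (macdonald \<mu> (of_real z)) \<le> (\<integral>y. norm (of_real y powr (\<mu> - 1) * exp (- of_real y - of_real z / of_real y)) \<partial>half_line)"
    unfolding macdonald_def by (rule integral_norm_bound)
  also have "\<dots> \<le> (\<integral>y. y powr (Re \<mu> - 1) * exp (- (1 * y)) \<partial>half_line)"
    using assms
    by (intro integral_mono integrable_norm macdonald_integrable half_line_Gamma_real)
       (auto simp: norm_macdonald_integrand intro!: mult_left_mono)
  also have "\<dots> = Gamma (Re \<mu>)" using half_line_Gamma_real(2) [of "Re \<mu>" 1] assms by simp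
  finally show ?thesis .
qed

text \<open>At order 1/2 derivative and reflection give the closed equation K' = -K/sqrt x, so K
  exp(2 sqrt x) is constant, and its limit at 0 is Gamma(1/2) = sqrt pi.\<close>

lemma macdonald_half:
  assumes z: "z > 0"
  shows "macdonald (1/2) (of_real z) = of_real (sqrt pi * exp (- 2 * sqrt z))"
    and "macdonald (- (1/2)) (of_real z) = of_real (sqrt pi * exp (- 2 * sqrt z) / sqrt z)"
proof -
  let ?K = "\<lambda>x::real. macdonald (1/2) (of_real x)"
  have refl: "macdonald (- (1/2)) (of_real x) = ?K x / of_real (sqrt x)" if "x > 0" for x
  proof -
    have "of_real x powr (- (1/2)) = complex_of_real (x powr (- (1/2)))"
      using powr_of_real [of x "- (1/2)"] that by simp
    also have "x powr (- (1/2)) = 1 / sqrt x"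
      using that powr_minus_divide [of x "1/2"] powr_half_sqrt [of x] by simp
    finally show ?thesis using macdonald_reflect [OF that, of "1/2"] by (simp add: field_simps)
  qed
  have der: "((\<lambda>x. ?K x * of_real (exp (2 * sqrt x))) has_vector_derivative 0) (at x)" if "x > 0" for x
  proof -
    have "((\<lambda>x. ?K x) has_vector_derivative 1 * (- macdonald (1/2 - 1) (of_real x))) (at x)"
      using that
      by (intro field_vector_diff_chain_at [unfolded o_def] macdonald_has_field_derivative has_vector_derivative_of_real)
         (auto intro!: derivative_eq_intros)
    hence K: "((\<lambda>x. ?K x) has_vector_derivative - (?K x / of_real (sqrt x))) (at x)"
      using refl [OF that] by simp
    have e: "((\<lambda>x. complex_of_real (exp (2 * sqrt x))) has_vector_derivative of_real (exp (2 * sqrt x) / sqrt x)) (at x)"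
      using that by (intro has_vector_derivative_of_real) (auto intro!: derivative_eq_intros simp: field_simps has_real_derivative_iff_has_vector_derivative [symmetric])
    show ?thesis
      using has_vector_derivative_mult [OF K e] by (simp add: field_simps)
  qed
  have const: "?K x * of_real (exp (2 * sqrt x)) = ?K y * of_real (exp (2 * sqrt y))" if "x > 0" "y > 0" for x y
  proof -
    obtain c where "\<And>x. x \<in> {0<..} \<Longrightarrow> ?K x * of_real (exp (2 * sqrt x)) = c"
      using has_vector_derivative_zero_constant [of "{0<..}" "\<lambda>x. ?K x * of_real (exp (2 * sqrt x))"] der
      by (auto intro: has_vector_derivative_at_within)
    thus ?thesis using that by auto
  qed
  have e1: "(\<lambda>n. exp (2 * sqrt (1 / real (Suc n)))) \<longlonglongrightarrow> exp (2 * sqrt 0)"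
    by (intro tendsto_intros LIMSEQ_Suc lim_1_over_n)
  have "(\<lambda>n. ?K (1 / real (Suc n)) * of_real (exp (2 * sqrt (1 / real (Suc n))))) \<longlonglongrightarrow> Gamma (1/2) * of_real (exp (2 * sqrt 0))"
    by (intro tendsto_intros macdonald_tendsto_Gamma tendsto_of_real e1) auto
  also have "(\<lambda>n. ?K (1 / real (Suc n)) * of_real (exp (2 * sqrt (1 / real (Suc n))))) = (\<lambda>n. ?K z * of_real (exp (2 * sqrt z)))"
    using z by (intro ext const) auto
  finally have "?K z * of_real (exp (2 * sqrt z)) = Gamma (1/2)"
    by (simp add: LIMSEQ_const_iff)
  moreover have "Gamma (1/2 :: complex) = of_real (sqrt pi)"
    by (simp add: Gamma_one_half_complex)
  ultimately show K: "?K z = of_real (sqrt pi * exp (- 2 * sqrt z))"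
    by (simp add: exp_minus field_simps)
  show "macdonald (- (1/2)) (of_real z) = of_real (sqrt pi * exp (- 2 * sqrt z) / sqrt z)"
    using refl [OF z] K by simp
qed

lemma norm_complex_powr_le:
  assumes "w \<noteq> 0"
  shows "norm (w powr a) \<le> norm w powr Re a * exp (pi * \<bar>Im a\<bar>)"
proof -
  have "\<bar>Im (Ln w)\<bar> \<le> pi"
    using assms mpi_less_Im_Ln [of w] Im_Ln_le_pi [of w] by linarith
  hence "\<bar>Im a\<bar> * \<bar>Im (Ln w)\<bar> \<le> \<bar>Im a\<bar> * pi" by (intro mult_left_mono) auto
  hence "- (Im a * Im (Ln w)) \<le> pi * \<bar>Im a\<bar>"
    using abs_ge_minus_self [of "Im a * Im (Ln w)"] by (simp add: abs_mult mult.commute)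
  thus ?thesis
    using assms by (simp add: powr_def flip: exp_add)
qed

subsection \<open>The power series of the Bessel functions\<close>

text \<open>The entire function common to both families: up to the power (x/2)^\<nu>, I takes it at
  (x/2)^2 and J at -(x/2)^2. A quarter turn of the argument of K thus exchanges I and J.\<close>

definition bessel_series :: "complex \<Rightarrow> complex \<Rightarrow> complex" where
  "bessel_series \<nu> z = (\<Sum>m. rGamma (of_nat m + \<nu> + 1) / fact m * z ^ m)"

lemma summable_bessel_series:
  "summable (\<lambda>m. rGamma (of_nat m + \<nu> + 1) / fact m * (z :: complex) ^ m)"
proof -
  define a where "a = (\<lambda>m. rGamma (of_nat m + \<nu> + 1) / fact m * z ^ m)"
  \<comment> \<open>Beyond N one has |m + 1 + \<nu>| \<ge> 2 |z| + 1, which makes the ratio of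
    consecutive terms at most 1/2 and excludes a zero denominator.\<close>
  define N where "N = nat \<lceil>norm \<nu> + 2 * norm z + 1\<rceil>"
  have "norm (a (Suc m)) \<le> 1/2 * norm (a m)" if "m \<ge> N" for m
  proof -
    have m: "real m \<ge> norm \<nu> + 2 * norm z + 1"
      using that by (simp add: N_def) linarith
    have "norm (of_nat (Suc m) + \<nu>) \<ge> real (Suc m) - norm \<nu>"
      using norm_diff_ineq [of "of_nat (Suc m)" \<nu>] by (simp del: of_nat_Suc)
    hence w: "norm (of_nat (Suc m) + \<nu>) \<ge> 2 * norm z + 1" using m by simp
    have nz: "of_nat (Suc m) + \<nu> \<noteq> 0"
    proof
      assume "of_nat (Suc m) + \<nu> = 0"
      thus False using w norm_ge_zero [of z] by (simp only: norm_zero)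
    qed
    have "(of_nat (Suc m) + \<nu>) * rGamma (of_nat (Suc m) + \<nu> + 1) = rGamma (of_nat m + \<nu> + 1)"
      using rGamma_plus1 [of "of_nat (Suc m) + \<nu>"] by (simp add: add_ac)
    hence "rGamma (of_nat (Suc m) + \<nu> + 1) = rGamma (of_nat m + \<nu> + 1) / (of_nat (Suc m) + \<nu>)"
      using nz by (simp add: field_simps del: of_nat_Suc)
    hence "a (Suc m) = a m * (z / ((of_nat (Suc m) + \<nu>) * of_nat (Suc m)))"
      by (simp add: a_def fact_Suc field_simps del: of_nat_Suc)
    moreover have n: "norm (z / ((of_nat (Suc m) + \<nu>) * of_nat (Suc m))) \<le> 1/2"
    proof -
      have "norm (of_nat (Suc m) + \<nu>) * 1 \<le> norm (of_nat (Suc m) + \<nu>) * real (Suc m)"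
        by (intro mult_left_mono) auto
      hence "2 * norm z \<le> norm (of_nat (Suc m) + \<nu>) * real (Suc m)" using w by linarith
      moreover have "norm (of_nat (Suc m) + \<nu>) * real (Suc m) > 0" using nz by simp
      ultimately show ?thesis
        by (simp add: norm_divide norm_mult divide_le_eq del: of_nat_Suc)
    qed
    moreover from n have "norm (a m) * norm (z / ((of_nat (Suc m) + \<nu>) * of_nat (Suc m))) \<le> norm (a m) * (1/2)"
      by (intro mult_left_mono) auto
    ultimately show ?thesis by (simp only: norm_mult mult.commute)
  qed
  hence "summable a" by (intro summable_ratio_test [of "1/2" N]) auto
  thus ?thesis by (simp add: a_def)
qed

lemma bessel_series_has_field_derivative:
  "(bessel_series \<nu> has_field_derivative bessel_series (\<nu> + 1) z) (at z)"
proof -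
  have "diffs (\<lambda>m. rGamma (of_nat m + \<nu> + 1) / fact m) = (\<lambda>m. rGamma (of_nat m + (\<nu> + 1) + 1) / fact m :: complex)"
    by (auto simp: diffs_def fact_Suc field_simps fun_eq_iff simp del: of_nat_Suc)
       (auto simp: add_ac)
  thus ?thesis
    using termdiffs_strong_converges_everywhere [OF summable_bessel_series, of \<nu> z]
    by (simp add: bessel_series_def [abs_def])
qed

lemma bessel_series_holomorphic [holomorphic_intros]:
  "f holomorphic_on S \<Longrightarrow> (\<lambda>z. bessel_series \<nu> (f z)) holomorphic_on S"
proof -
  have "bessel_series \<nu> holomorphic_on UNIV"
    using bessel_series_has_field_derivative by (auto simp: holomorphic_on_open)
  thus "f holomorphic_on S \<Longrightarrow> (\<lambda>z. bessel_series \<nu> (f z)) holomorphic_on S"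
    using holomorphic_on_compose_gen [of f S "bessel_series \<nu>" UNIV] by (simp add: o_def)
qed

text \<open>Coefficientwise this is the functional equation of \<open>rGamma\<close>. Together with
  the derivative, which raises the order, it produces the lowered order needed for the derivative of
  \<open>macdonald_series\<close>.\<close>

lemma bessel_series_recurrence:
  "\<nu> * bessel_series \<nu> z + z * bessel_series (\<nu> + 1) z = bessel_series (\<nu> - 1) z"
proof -
  let ?c = "\<lambda>\<nu> m. rGamma (of_nat m + \<nu> + 1) / fact m :: complex"
  have s: "(\<lambda>m. ?c \<nu> m * z ^ m) sums bessel_series \<nu> z" for \<nu>
    unfolding bessel_series_def by (rule summable_sums [OF summable_bessel_series])
  have "(\<lambda>m. of_nat m * (?c \<nu> m * z ^ m)) sums (z * bessel_series (\<nu> + 1) z)"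
  proof -
    have "(\<lambda>m. z * (?c (\<nu> + 1) m * z ^ m)) sums (z * bessel_series (\<nu> + 1) z)"
      by (intro sums_mult s)
    also have "(\<lambda>m. z * (?c (\<nu> + 1) m * z ^ m)) = (\<lambda>m. of_nat (Suc m) * (?c \<nu> (Suc m) * z ^ Suc m))"
      by (auto simp: fact_Suc field_simps fun_eq_iff simp del: of_nat_Suc) (auto simp: add_ac)
    finally show ?thesis by (subst (asm) sums_Suc_iff) simp
  qed
  with sums_mult [OF s, of \<nu> \<nu>]
  have "(\<lambda>m. \<nu> * (?c \<nu> m * z ^ m) + of_nat m * (?c \<nu> m * z ^ m)) sums (\<nu> * bessel_series \<nu> z + z * bessel_series (\<nu> + 1) z)"
    by (rule sums_add)
  also have "(\<lambda>m. \<nu> * (?c \<nu> m * z ^ m) + of_nat m * (?c \<nu> m * z ^ m)) = (\<lambda>m. ?c (\<nu> - 1) m * z ^ m)"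
  proof
    fix m
    have "(of_nat m + \<nu>) * rGamma (of_nat m + \<nu> + 1) = rGamma (of_nat m + (\<nu> - 1) + 1)"
      using rGamma_plus1 [of "of_nat m + \<nu>"] by (simp add: add_ac)
    thus "\<nu> * (?c \<nu> m * z ^ m) + of_nat m * (?c \<nu> m * z ^ m) = ?c (\<nu> - 1) m * z ^ m"
      by (simp add: field_simps) (simp add: mult.left_commute [of _ "z ^ m"] flip: distrib_left)
  qed
  finally show ?thesis using s [of "\<nu> - 1"] by (rule sums_unique2)
qed

text \<open>The classical formula for K through I of orders \<nu> and -\<nu>, in the normalisation 2
  z^(\<nu>/2) K(2 sqrt z) of \<open>macdonald\<close>.\<close>

definition macdonald_series :: "complex \<Rightarrow> complex \<Rightarrow> complex" where
  "macdonald_series \<nu> z = of_real pi / sin (of_real pi * \<nu>) * (bessel_series (- \<nu>) z - z powr \<nu> * bessel_series \<nu> z)"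

text \<open>The relation that \<open>macdonald\<close> satisfies after
  \<open>macdonald_reflect\<close>, so the difference of the two functions obeys a homogeneous
  system coupling the orders \<nu> and 1 - \<nu>.\<close>

lemma macdonald_series_has_field_derivative:
  assumes x: "x > 0"
  shows "(macdonald_series \<nu> has_field_derivative
           - (of_real x powr (\<nu> - 1) * macdonald_series (1 - \<nu>) (of_real x))) (at (of_real x))"
proof -
  let ?x = "complex_of_real x"
  have sin: "sin (of_real pi * (1 - \<nu>)) = sin (of_real pi * \<nu>)"
    by (simp add: algebra_simps sin_diff)
  have x0: "?x \<notin> \<real>\<^sub>\<le>\<^sub>0" using x by simp
  have "(macdonald_series \<nu> has_field_derivative
      of_real pi / sin (of_real pi * \<nu>) * (bessel_series (- \<nu> + 1) ?x -
        (\<nu> * ?x powr (\<nu> - 1) * bessel_series \<nu> ?x + ?x powr \<nu> * bessel_series (\<nu> + 1) ?x))) (at ?x)"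
    unfolding macdonald_series_def [abs_def]
    by (rule derivative_eq_intros bessel_series_has_field_derivative has_field_derivative_powr [OF x0] refl | simp add: mult_ac)+
  also have "?x powr \<nu> = ?x powr (\<nu> - 1) * ?x" using x by (simp add: powr_diff)
  also have "\<nu> * ?x powr (\<nu> - 1) * bessel_series \<nu> ?x + ?x powr (\<nu> - 1) * ?x * bessel_series (\<nu> + 1) ?x
      = ?x powr (\<nu> - 1) * bessel_series (\<nu> - 1) ?x"
    unfolding bessel_series_recurrence [of \<nu> ?x, symmetric] by (simp only: distrib_left mult_ac)
  also have "of_real pi / sin (of_real pi * \<nu>) * (bessel_series (- \<nu> + 1) ?x - ?x powr (\<nu> - 1) * bessel_series (\<nu> - 1) ?x)
      = - (of_real x powr (\<nu> - 1) * macdonald_series (1 - \<nu>) ?x)"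
  proof -
    have "?x powr (\<nu> - 1) * ?x powr (1 - \<nu>) = 1" using x by (simp add: powr_add [symmetric])
    hence "?x powr (\<nu> - 1) * (bessel_series (- (1 - \<nu>)) ?x - ?x powr (1 - \<nu>) * bessel_series (1 - \<nu>) ?x)
       = ?x powr (\<nu> - 1) * bessel_series (\<nu> - 1) ?x - bessel_series (- \<nu> + 1) ?x"
      by (simp add: right_diff_distrib mult.assoc [symmetric])
    thus ?thesis unfolding macdonald_series_def sin by (simp add: algebra_simps)
  qed
  finally show ?thesis .
qed

lemma of_real_powr_tendsto_0:
  assumes "Re \<nu> > 0"
  shows "(\<lambda>n. complex_of_real (1 / real (Suc n)) powr \<nu>) \<longlonglongrightarrow> 0"
proof (rule tendsto_norm_zero_cancel)
  have "(\<lambda>n. (1 / real (Suc n)) powr Re \<nu>) \<longlonglongrightarrow> 0 powr Re \<nu>"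
    using assms by (intro tendsto_powr2 [OF LIMSEQ_Suc [OF lim_1_over_n] tendsto_const] always_eventually) auto
  moreover have "norm (complex_of_real (1 / real (Suc n)) powr \<nu>) = (1 / real (Suc n)) powr Re \<nu>" for n
    by (rule norm_of_real_powr) simp
  ultimately show "(\<lambda>n. norm (complex_of_real (1 / real (Suc n)) powr \<nu>)) \<longlonglongrightarrow> 0"
    by (simp only: powr_0)
qed

lemma sin_pi_nonzero:
  assumes "0 < Re \<nu>" "Re \<nu> < 1"
  shows "sin (of_real pi * \<nu>) \<noteq> 0"
proof
  assume "sin (of_real pi * \<nu>) = 0"
  then obtain n :: int where "of_real pi * \<nu> = of_real (of_int n * pi)" by (auto simp: sin_eq_0)
  hence "\<nu> = of_int n" by simp
  thus False using assms by auto
qed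

lemma macdonald_series_tendsto_Gamma:
  assumes \<nu>: "0 < Re \<nu>" "Re \<nu> < 1"
  shows "(\<lambda>n. macdonald_series \<nu> (of_real (1 / real (Suc n)))) \<longlonglongrightarrow> Gamma \<nu>"
proof -
  have z: "(\<lambda>n. complex_of_real (1 / real (Suc n))) \<longlonglongrightarrow> of_real 0"
    by (rule tendsto_of_real [OF LIMSEQ_Suc [OF lim_1_over_n]])
  have E: "(\<lambda>n. bessel_series \<mu> (of_real (1 / real (Suc n)))) \<longlonglongrightarrow> bessel_series \<mu> (of_real 0)" for \<mu>
    using isCont_tendsto_compose [OF DERIV_isCont [OF bessel_series_has_field_derivative] z] .
  have "(\<lambda>n. macdonald_series \<nu> (of_real (1 / real (Suc n)))) \<longlonglongrightarrow>
     of_real pi / sin (of_real pi * \<nu>) * (bessel_series (- \<nu>) (of_real 0) - 0 * bessel_series \<nu> (of_real 0))"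
    unfolding macdonald_series_def by (intro tendsto_intros E of_real_powr_tendsto_0 \<nu>)
  also have "bessel_series (- \<nu>) (of_real 0) = rGamma (1 - \<nu>)"
    using powser_zero [of "\<lambda>m. rGamma (of_nat m + - \<nu> + 1) / fact m :: complex"] by (simp add: bessel_series_def)
  also have "of_real pi / sin (of_real pi * \<nu>) * (rGamma (1 - \<nu>) - 0 * bessel_series \<nu> (of_real 0)) = Gamma \<nu>"
  proof -
    have "1 - \<nu> \<notin> \<int>\<^sub>\<le>\<^sub>0" using \<nu> by (auto elim!: nonpos_Ints_cases simp: complex_eq_iff)
    hence "Gamma (1 - \<nu>) \<noteq> 0" by (simp add: Gamma_eq_zero_iff)
    hence "Gamma \<nu> * Gamma (1 - \<nu>) * inverse (Gamma (1 - \<nu>)) = Gamma \<nu>" by simp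
    thus ?thesis unfolding Gamma_reflection_complex by (simp add: rGamma_inverse_Gamma)
  qed
  finally show ?thesis .
qed

text \<open>The hypotheses are symmetric in \<open>\<nu> \<leftrightarrow> 1 - \<nu>\<close>. Integrating twice gains the factor \<open>z0 / (1 - Re \<nu>)\<close>,
  hence the two functions vanish.\<close>
lemma coupled_system_zero:
  fixes p q :: "real \<Rightarrow> complex"
  assumes \<nu>: "0 < Re \<nu>" "Re \<nu> < 1"
    and p: "\<And>x. 0 < x \<Longrightarrow> (p has_vector_derivative - (of_real x powr (\<nu> - 1) * q x)) (at x)"
    and q: "\<And>x. 0 < x \<Longrightarrow> (q has_vector_derivative - (of_real x powr (- \<nu>) * p x)) (at x)"
    and p0: "(\<lambda>n. p (1 / real (Suc n))) \<longlonglongrightarrow> 0" and q0: "(\<lambda>n. q (1 / real (Suc n))) \<longlonglongrightarrow> 0"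
    and z0: "z0 \<le> (1 - Re \<nu>) / 2"
    and bd: "\<And>x. 0 < x \<Longrightarrow> x \<le> z0 \<Longrightarrow> norm (p x) \<le> B"
    and x: "0 < x" "x \<le> z0"
  shows "p x = 0"
proof -
  define r where "r = Re \<nu>"
  have r: "0 < r" "r < 1" using \<nu> by (auto simp: r_def)
  \<comment> \<open>The mean value inequality on {w..z}, with w sent to 0 along 1/(n + 1); nothing
    is assumed about f at 0 itself.\<close>
  have limit: "norm (f z) \<le> \<phi> z"
    if z: "0 < z" and f: "\<And>x. 0 < x \<Longrightarrow> (f has_vector_derivative f' x) (at x)"
      and \<phi>: "\<And>x. 0 < x \<Longrightarrow> (\<phi> has_vector_derivative \<phi>' x) (at x)"
      and le: "\<And>x. 0 < x \<Longrightarrow> x \<le> z \<Longrightarrow> norm (f' x) \<le> \<phi>' x"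
      and pos: "\<And>x. 0 < x \<Longrightarrow> \<phi> x \<ge> 0"
      and lim: "(\<lambda>n. f (1 / real (Suc n))) \<longlonglongrightarrow> 0"
    for f f' :: "real \<Rightarrow> complex" and \<phi> \<phi>' :: "real \<Rightarrow> real" and z
  proof -
    have "norm (f z - f w) \<le> \<phi> z" if w: "0 < w" "w < z" for w
    proof -
      have "norm (f z - f w) \<le> \<phi> z - \<phi> w"
      proof (rule differentiable_bound_general [OF w(2)])
        show "continuous_on {w..z} f"
          by (intro continuous_at_imp_continuous_on ballI, rule has_vector_derivative_continuous, rule f) (use w in auto)
        show "continuous_on {w..z} \<phi>"
          by (intro continuous_at_imp_continuous_on ballI, rule has_vector_derivative_continuous, rule \<phi>) (use w in auto)
        show "norm (f' x) \<le> \<phi>' x" if "w < x" "x < z" for x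
          using le that w by simp
      qed (use f \<phi> w in auto)
      thus ?thesis using pos [OF w(1)] by linarith
    qed
    moreover have "\<forall>\<^sub>F n in sequentially. 1 / real (Suc n) < z"
      using order_tendstoD(2) [OF LIMSEQ_Suc [OF lim_1_over_n] z] by simp
    ultimately have "\<forall>\<^sub>F n in sequentially. norm (f z - f (1 / real (Suc n))) \<le> \<phi> z"
      by (auto elim!: eventually_mono)
    moreover have "(\<lambda>n. norm (f z - f (1 / real (Suc n)))) \<longlonglongrightarrow> norm (f z - 0)"
      by (intro tendsto_intros lim)
    ultimately show ?thesis using tendsto_upperbound by fastforce
  qed
  have B0: "norm (p x) \<le> B / 2 ^ n" if "0 < x" "x \<le> z0" for n x
    using that
  proof (induction n arbitrary: x)
    case 0
    thus ?case using bd by simp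
  next
    case (Suc n)
    define C where "C = B / 2 ^ n"
    have IH: "norm (p x) \<le> C" if "0 < x" "x \<le> z0" for x
      using Suc.IH that by (simp add: C_def)
    have C0: "C \<ge> 0" using order_trans [OF norm_ge_zero IH [OF Suc.prems]] .
    have qb: "norm (q z) \<le> C * z powr (1 - r) / (1 - r)" if z: "0 < z" "z \<le> z0" for z
    proof (rule limit [OF z(1) q])
      show "((\<lambda>x. C * x powr (1 - r) / (1 - r)) has_vector_derivative C * x powr (- r)) (at x)" if "0 < x" for x
        unfolding has_real_derivative_iff_has_vector_derivative [symmetric]
        using that r by (auto intro!: derivative_eq_intros)
      show "norm (- (of_real x powr (- \<nu>) * p x)) \<le> C * x powr (- r)" if "0 < x" "x \<le> z" for x
        using IH [of x] that z by (simp add: norm_mult norm_of_real_powr r_def mult.commute mult_right_mono)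
    qed (use r C0 q0 in auto)
    have "norm (p x) \<le> C * x / (1 - r)"
    proof (rule limit [OF Suc.prems(1) p])
      show "((\<lambda>x. C * x / (1 - r)) has_vector_derivative C / (1 - r)) (at x)" for x
        unfolding has_real_derivative_iff_has_vector_derivative [symmetric]
        using r by (auto intro!: derivative_eq_intros)
      show "norm (- (of_real y powr (\<nu> - 1) * q y)) \<le> C / (1 - r)" if y: "0 < y" "y \<le> x" for y
      proof -
        have "norm (- (of_real y powr (\<nu> - 1) * q y)) = y powr (r - 1) * norm (q y)"
          using y by (simp add: norm_mult norm_of_real_powr r_def)
        also have "\<dots> \<le> y powr (r - 1) * (C * y powr (1 - r) / (1 - r))"
          using qb [of y] y Suc.prems by (intro mult_left_mono) auto
        also have "\<dots> = C / (1 - r) * (y powr (r - 1) * y powr (1 - r))" by simp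
        also have "y powr (r - 1) * y powr (1 - r) = 1" using y by (simp add: powr_add [symmetric])
        finally show ?thesis by simp
      qed
    qed (use r C0 p0 in auto)
    also have "\<dots> = C * (x / (1 - r))" by simp
    also have "\<dots> \<le> C * (1 / 2)"
      using Suc.prems z0 r C0 by (intro mult_left_mono) (auto simp: r_def field_simps)
    finally show ?case by (simp add: C_def)
  qed
  have "(\<lambda>n. B * (1/2) ^ n) \<longlonglongrightarrow> B * 0"
    by (intro tendsto_intros LIMSEQ_power_zero) auto
  moreover have "norm (p x) \<le> B * (1/2) ^ n" for n
    using B0 [OF x, of n] by (simp add: power_divide)
  ultimately have "norm (p x) \<le> 0"
    by (intro tendsto_lowerbound [of "\<lambda>n. B * (1/2) ^ n"]) (auto intro!: always_eventually)
  thus ?thesis by simp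
qed

section \<open>Agreement of the integral and the power series near 0\<close>

lemma mult_le_one_mono:
  fixes a b c :: real
  assumes "a \<le> 1" "0 \<le> b" "b \<le> c"
  shows "a * b \<le> c"
  using mult_right_mono [OF assms(1,2)] assms(3) by simp

text \<open>Both functions satisfy the same coupled system for the orders \<nu> and 1 - \<nu> and
  both tend to the same Gamma value at 0, so their difference vanishes where the double integration
  contracts. A real interval is enough, because the identity theorem takes over afterwards.\<close>

lemma macdonald_eq_series_near_0:
  assumes \<nu>: "0 < Re \<nu>" "Re \<nu> < 1" and x: "0 < x" "x \<le> (1 - Re \<nu>) / 2"
  shows "macdonald \<nu> (of_real x) = macdonald_series \<nu> (of_real x)"
proof -
  define D where "D = (\<lambda>\<mu> x::real. macdonald \<mu> (of_real x) - macdonald_series \<mu> (of_real x))"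
  have der: "(D \<mu> has_vector_derivative - (of_real x powr (\<mu> - 1) * D (1 - \<mu>) x)) (at x)" if "x > 0" for \<mu> x
  proof -
    have "macdonald (\<mu> - 1) (of_real x) = of_real x powr (\<mu> - 1) * macdonald (1 - \<mu>) (of_real x)"
      using macdonald_reflect [OF that, of "1 - \<mu>"] by simp
    hence "((\<lambda>z. macdonald \<mu> z - macdonald_series \<mu> z) has_field_derivative
            - (of_real x powr (\<mu> - 1) * D (1 - \<mu>) x)) (at (of_real x))"
      using DERIV_diff [OF macdonald_has_field_derivative macdonald_series_has_field_derivative [OF that], of \<mu> \<mu>] that
      by (simp add: D_def algebra_simps)
    moreover have "((of_real :: real \<Rightarrow> complex) has_vector_derivative 1) (at x)"
      by (auto intro!: derivative_eq_intros)
    ultimately have "((\<lambda>z. macdonald \<mu> z - macdonald_series \<mu> z) \<circ> of_real has_vector_derivative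
        1 * - (of_real x powr (\<mu> - 1) * D (1 - \<mu>) x)) (at x)"
      by (intro field_vector_diff_chain_at)
    thus ?thesis by (simp add: D_def o_def)
  qed
  have lim: "(\<lambda>n. D \<mu> (1 / real (Suc n))) \<longlonglongrightarrow> 0" if "0 < Re \<mu>" "Re \<mu> < 1" for \<mu>
    using tendsto_diff [OF macdonald_tendsto_Gamma macdonald_series_tendsto_Gamma, of \<mu> \<mu>] that
    by (simp add: D_def)
  have "\<exists>M. \<forall>x\<in>{0..1::real}. norm (bessel_series \<mu> (of_real x)) \<le> M" for \<mu>
  proof -
    have "continuous_on {0..1::real} (\<lambda>x. bessel_series \<mu> (of_real x))"
      by (intro continuous_at_imp_continuous_on ballI isCont_o2 [OF _ DERIV_isCont [OF bessel_series_has_field_derivative]]) auto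
    hence "bounded ((\<lambda>x. bessel_series \<mu> (of_real x)) ` {0..1::real})"
      by (intro compact_imp_bounded compact_continuous_image) auto
    thus ?thesis by (auto simp: bounded_iff)
  qed
  then obtain M where M: "\<And>\<mu> x. 0 \<le> x \<Longrightarrow> x \<le> 1 \<Longrightarrow> norm (bessel_series \<mu> (of_real x)) \<le> M \<mu>"
    by (metis atLeastAtMost_iff)
  have "D \<nu> x = 0"
  proof (rule coupled_system_zero [OF \<nu> _ _ _ _ order_refl _ x])
    show "(D \<nu> has_vector_derivative - (of_real x powr (\<nu> - 1) * D (1 - \<nu>) x)) (at x)" if "x > 0" for x
      by (rule der [OF that])
    show "(D (1 - \<nu>) has_vector_derivative - (of_real x powr (- \<nu>) * D \<nu> x)) (at x)" if "x > 0" for x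
      using der [OF that, of "1 - \<nu>"] by simp
    show "(\<lambda>n. D \<nu> (1 / real (Suc n))) \<longlonglongrightarrow> 0" "(\<lambda>n. D (1 - \<nu>) (1 / real (Suc n))) \<longlonglongrightarrow> 0"
      using \<nu> by (intro lim; simp)+
    fix y :: real assume y: "0 < y" "y \<le> (1 - Re \<nu>) / 2"
    have y1: "y \<le> 1" using y(2) \<nu>(1) by (simp add: field_simps)
    have p1: "y powr Re \<nu> \<le> 1" using y y1 \<nu> by (auto intro!: powr_le1)
    have "norm (D \<nu> y) \<le> norm (macdonald \<nu> (of_real y)) + norm (macdonald_series \<nu> (of_real y))"
      unfolding D_def by (rule norm_triangle_ineq4)
    also have "norm (macdonald \<nu> (of_real y)) \<le> Gamma (Re \<nu>)"
      using \<nu> y by (intro macdonald_bound)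
    also have "norm (macdonald_series \<nu> (of_real y)) \<le> norm (of_real pi / sin (of_real pi * \<nu>)) * (M (- \<nu>) + 1 * M \<nu>)"
      unfolding macdonald_series_def norm_mult
      using M [of y] y y1 p1 order_trans [OF norm_ge_zero M [of y \<nu>]]
      by (intro mult_left_mono order_trans [OF norm_triangle_ineq4] add_mono)
         (auto simp: norm_mult norm_of_real_powr intro!: mult_le_one_mono)
    finally show "norm (D \<nu> y) \<le> Gamma (Re \<nu>) + norm (of_real pi / sin (of_real pi * \<nu>)) * (M (- \<nu>) + 1 * M \<nu>)"
      by simp
  qed
  thus ?thesis by (simp add: D_def)
qed

section \<open>Laplace representation and continuation to the slit plane\<close>

text \<open>The power y^(\<nu> + 1/2) is, up to a Gamma factor, the integral of s^(\<nu> - 1/2)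
  exp(-s/y) over s. Inserting it reduces order \<nu> to order -1/2 at z + s, where the y-integral is
  elementary.\<close>

lemma macdonald_laplace_aux:
  assumes \<nu>: "0 < Re \<nu>" and z: "z > 0"
  shows "Gamma (\<nu> + 1/2) * macdonald \<nu> (of_real z) =
    (\<integral>s. of_real s powr (\<nu> - 1/2) * of_real (sqrt pi * exp (- 2 * sqrt (z + s)) / sqrt (z + s)) \<partial>half_line)"
proof -
  let ?a = "\<lambda>y. complex_of_real y powr (- (1/2) - 1) * exp (- of_real y - of_real z / of_real y)"
  let ?b = "\<lambda>y s. complex_of_real s powr ((\<nu> + 1/2) - 1) * of_real (exp (- ((1 / y) * s)))"
  let ?f = "\<lambda>y s. ?a y * ?b y s"
  have id: "(\<lambda>x. x) \<in> borel_measurable half_line"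
    by (intro measurable_half_line continuous_intros)
  have [measurable]: "?a \<in> borel_measurable half_line"
    by (rule measurable_half_line [OF macdonald_continuous])
  have [measurable]: "(\<lambda>s. complex_of_real s powr ((\<nu> + 1/2) - 1)) \<in> borel_measurable half_line"
    by (intro measurable_half_line continuous_intros) auto
  have [measurable]: "fst \<in> borel_measurable (half_line \<Otimes>\<^sub>M half_line)"
    by (rule measurable_compose [OF measurable_fst id])
  have [measurable]: "snd \<in> borel_measurable (half_line \<Otimes>\<^sub>M half_line)"
    by (rule measurable_compose [OF measurable_snd id])
  have meas: "case_prod ?f \<in> borel_measurable (half_line \<Otimes>\<^sub>M half_line)"
    by measurable
  have r: "Re (\<nu> + 1/2) > 0" using \<nu> by simp
  have bint: "integrable half_line (?b y)" if "y > 0" for y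
    using half_line_Gamma(1) [OF r, of "1 / y"] that by simp
  have inner: "(\<integral>s. ?f y s \<partial>half_line) = Gamma (\<nu> + 1/2) * (of_real y powr (\<nu> - 1) * exp (- of_real y - of_real z / of_real y))"
    if "y \<in> space half_line" for y
  proof -
    have y: "y > 0" using that by simp
    have "(\<integral>s. ?f y s \<partial>half_line) = ?a y * (\<integral>s. ?b y s \<partial>half_line)"
      by (rule integral_mult_right_zero)
    also have "(\<integral>s. ?b y s \<partial>half_line) = of_real (1 / y) powr (- (\<nu> + 1/2)) * Gamma (\<nu> + 1/2)"
      by (rule half_line_Gamma(2) [OF r]) (use y in auto)
    also have "of_real (1 / y) powr (- (\<nu> + 1/2)) = complex_of_real y powr (\<nu> + 1/2)"
      using y by (simp add: of_real_powr_eq_exp ln_div algebra_simps del: of_real_divide)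
    also have "?a y * (of_real y powr (\<nu> + 1/2) * Gamma (\<nu> + 1/2)) =
      Gamma (\<nu> + 1/2) * ((of_real y powr (- (1/2) - 1) * of_real y powr (\<nu> + 1/2)) * exp (- of_real y - of_real z / of_real y))"
      by (simp only: mult_ac)
    also have "of_real y powr (- (1/2) - 1) * of_real y powr (\<nu> + 1/2) = complex_of_real y powr (\<nu> - 1)"
      by (simp add: powr_add [symmetric])
    finally show ?thesis .
  qed
  have norm_inner: "(\<integral>s. norm (?f y s) \<partial>half_line) = Gamma (Re \<nu> + 1/2) * (y powr (Re \<nu> - 1) * exp (- y - z / y))"
    if "y \<in> space half_line" for y
  proof -
    have y: "y > 0" using that by simp
    have "(\<integral>s. norm (?f y s) \<partial>half_line) =
        (\<integral>s. (y powr (- (1/2) - 1) * exp (- y - z / y)) * (s powr ((Re \<nu> + 1/2) - 1) * exp (- ((1 / y) * s))) \<partial>half_line)"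
      using y by (intro Bochner_Integration.integral_cong refl) (simp add: norm_mult norm_of_real_powr Re_divide_of_real)
    also have "\<dots> = (y powr (- (1/2) - 1) * exp (- y - z / y)) * (\<integral>s. s powr ((Re \<nu> + 1/2) - 1) * exp (- ((1 / y) * s)) \<partial>half_line)"
      by (rule integral_mult_right_zero)
    also have "(\<integral>s. s powr ((Re \<nu> + 1/2) - 1) * exp (- ((1 / y) * s)) \<partial>half_line) = (1 / y) powr (- (Re \<nu> + 1/2)) * Gamma (Re \<nu> + 1/2)"
      by (rule half_line_Gamma_real(2)) (use y \<nu> in auto)
    also have "(1 / y) powr (- (Re \<nu> + 1/2)) = y powr (Re \<nu> + 1/2)"
      using y by (simp add: powr_def ln_div algebra_simps)
    also have "(y powr (- (1/2) - 1) * exp (- y - z / y)) * (y powr (Re \<nu> + 1/2) * Gamma (Re \<nu> + 1/2)) =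
       Gamma (Re \<nu> + 1/2) * ((y powr (- (1/2) - 1) * y powr (Re \<nu> + 1/2)) * exp (- y - z / y))"
      by (simp only: mult_ac)
    also have "y powr (- (1/2) - 1) * y powr (Re \<nu> + 1/2) = y powr (Re \<nu> - 1)"
      by (simp add: powr_add [symmetric])
    finally show ?thesis .
  qed
  have int: "integrable (half_line \<Otimes>\<^sub>M half_line) (case_prod ?f)"
  proof (rule half_line_pair.Fubini_integrable [OF meas])
    have "integrable half_line (\<lambda>y. Gamma (Re \<nu> + 1/2) * (y powr (Re \<nu> - 1) * exp (- y - z / y)))"
      using z by (intro integrable_mult_right macdonald_dominant_integrable) auto
    thus "integrable half_line (\<lambda>y. \<integral>s. norm (case_prod ?f (y, s)) \<partial>half_line)"
      by (simp only: Bochner_Integration.integrable_cong [OF refl norm_inner] split_conv)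
    show "AE y in half_line. integrable half_line (\<lambda>s. case_prod ?f (y, s))"
      using bint by (intro AE_I2) (auto intro!: integrable_mult_right)
  qed
  have outer: "(\<integral>y. ?f y s \<partial>half_line) = of_real s powr (\<nu> - 1/2) * of_real (sqrt pi * exp (- 2 * sqrt (z + s)) / sqrt (z + s))"
    if "s \<in> space half_line" for s
  proof -
    have s: "s > 0" using that by simp
    have "(\<integral>y. ?f y s \<partial>half_line) = (\<integral>y. of_real s powr (\<nu> - 1/2) *
        (of_real y powr (- (1/2) - 1) * exp (- of_real y - of_real (z + s) / of_real y)) \<partial>half_line)"
    proof (intro Bochner_Integration.integral_cong refl)
      fix y assume "y \<in> space half_line"
      have "exp (- complex_of_real y - of_real z / of_real y) * of_real (exp (- ((1 / y) * s))) = exp (- of_real y - of_real (z + s) / of_real y)"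
        by (simp add: exp_of_real [symmetric] exp_add [symmetric] add_divide_distrib algebra_simps)
      thus "?f y s = of_real s powr (\<nu> - 1/2) * (of_real y powr (- (1/2) - 1) * exp (- of_real y - of_real (z + s) / of_real y))"
        by (simp only: mult.assoc mult.left_commute) (simp add: mult_ac)
    qed
    also have "\<dots> = of_real s powr (\<nu> - 1/2) * macdonald (- (1/2)) (of_real (z + s))"
      unfolding macdonald_def by (rule integral_mult_right_zero)
    finally show ?thesis using macdonald_half(2) [of "z + s"] z s by simp
  qed
  have "Gamma (\<nu> + 1/2) * macdonald \<nu> (of_real z) = (\<integral>y. Gamma (\<nu> + 1/2) * (of_real y powr (\<nu> - 1) * exp (- of_real y - of_real z / of_real y)) \<partial>half_line)"
    unfolding macdonald_def by (rule integral_mult_right_zero [symmetric])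
  also have "\<dots> = (\<integral>y. (\<integral>s. ?f y s \<partial>half_line) \<partial>half_line)"
    by (simp only: Bochner_Integration.integral_cong [OF refl inner])
  also have "\<dots> = (\<integral>s. (\<integral>y. ?f y s \<partial>half_line) \<partial>half_line)"
    by (rule half_line_pair.Fubini_integral [OF int, symmetric])
  finally show ?thesis
    by (simp only: Bochner_Integration.integral_cong [OF refl outer])
qed

text \<open>What remains of K after the factor exp(-2 Z) is split off. For Z off the nonpositive
  axis Z + t/4 stays off it as well, so the formula makes sense on the whole slit plane.\<close>

definition laplace_integral :: "complex \<Rightarrow> complex \<Rightarrow> complex" where
  "laplace_integral \<nu> Z = (\<integral>t. of_real t powr (\<nu> - 1/2) * (Z + of_real (t / 4)) powr (\<nu> - 1/2) * of_real (exp (- t)) \<partial>half_line)"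

lemma macdonald_eq_laplace_integral:
  assumes \<nu>: "0 < Re \<nu>" and Z: "Z > 0"
  shows "macdonald \<nu> (of_real (Z\<^sup>2)) = rGamma (\<nu> + 1/2) * of_real (sqrt pi * exp (- 2 * Z)) * laplace_integral \<nu> (of_real Z)"
proof -
  let ?f = "\<lambda>s. complex_of_real s powr (\<nu> - 1/2) * of_real (sqrt pi * exp (- 2 * sqrt (Z\<^sup>2 + s)) / sqrt (Z\<^sup>2 + s))"
  \<comment> \<open>Chosen to complete the square: \<open>Z\<^sup>2 + ?g t\<close> is (Z + t/2)^2,
    so the root disappears and the Jacobian cancels the denominator.\<close>
  let ?g = "\<lambda>t. Z * t + t\<^sup>2 / 4"
  have sq: "sqrt (Z\<^sup>2 + ?g t) = Z + t / 2" if "t > 0" for t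
  proof -
    have "Z\<^sup>2 + ?g t = (Z + t / 2)\<^sup>2" by (simp add: power2_eq_square field_simps)
    thus ?thesis using Z that by simp
  qed
  have pos: "Z\<^sup>2 + s > 0" if "s > 0" for s using that by (intro add_nonneg_pos) auto
  have cont: "continuous_on {0<..} ?f"
    using pos by (intro continuous_intros) (auto simp: less_imp_neq [symmetric])
  have cd: "continuous_on {0<..} (\<lambda>t. Z + t / 2)" by (intro continuous_intros) auto
  have der: "\<forall>t>0. (?g has_field_derivative Z + t / 2) (at t)"
    by (auto intro!: derivative_eq_intros)
  have bij: "bij_betw ?g {0<..} {0<..}"
  proof (rule bij_betwI [where g = "\<lambda>s. 2 * (sqrt (Z\<^sup>2 + s) - Z)"])
    show "?g \<in> {0<..} \<rightarrow> {0<..}" using Z by (auto intro!: add_pos_pos)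
    show "(\<lambda>s. 2 * (sqrt (Z\<^sup>2 + s) - Z)) \<in> {0<..} \<rightarrow> {0<..}"
    proof
      fix s :: real assume "s \<in> {0<..}"
      hence "Z < sqrt (Z\<^sup>2 + s)" by (intro real_less_rsqrt) auto
      thus "2 * (sqrt (Z\<^sup>2 + s) - Z) \<in> {0<..}" by simp
    qed
    show "2 * (sqrt (Z\<^sup>2 + ?g t) - Z) = t" if "t \<in> {0<..}" for t
      using sq [of t] that by simp
    show "?g (2 * (sqrt (Z\<^sup>2 + s) - Z)) = s" if "s \<in> {0<..}" for s
      using pos [of s] that by (simp add: power2_eq_square field_simps)
  qed
  have "Gamma (\<nu> + 1/2) * macdonald \<nu> (of_real (Z\<^sup>2)) = (\<integral>s. ?f s \<partial>half_line)"
    using Z by (intro macdonald_laplace_aux [OF \<nu>]) auto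
  also have "\<dots> = (\<integral>t. \<bar>Z + t / 2\<bar> *\<^sub>R ?f (?g t) \<partial>half_line)"
    by (rule half_line_substitution(2) [OF der bij cont cd])
  also have "\<dots> = (\<integral>t. of_real (sqrt pi * exp (- 2 * Z)) *
      (of_real t powr (\<nu> - 1/2) * (of_real Z + of_real (t / 4)) powr (\<nu> - 1/2) * of_real (exp (- t))) \<partial>half_line)"
  proof (intro Bochner_Integration.integral_cong refl)
    fix t assume "t \<in> space half_line"
    hence t: "t > 0" by simp
    have "complex_of_real (?g t) = of_real t * of_real (Z + t / 4)"
      by (simp add: power2_eq_square field_simps)
    hence 1: "complex_of_real (?g t) powr (\<nu> - 1/2) = of_real t powr (\<nu> - 1/2) * of_real (Z + t / 4) powr (\<nu> - 1/2)"
      using t Z by (simp add: powr_times_real del: of_real_mult of_real_add)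
    have 2: "exp (- 2 * (Z + t / 2)) = exp (- 2 * Z) * exp (- t)"
      by (simp add: exp_add [symmetric] algebra_simps)
    have h0: "Z + t / 2 > 0" using t Z by simp
    have "\<bar>Z + t / 2\<bar> *\<^sub>R ?f (?g t) = of_real (Z + t / 2) * (complex_of_real (?g t) powr (\<nu> - 1/2) *
         of_real (sqrt pi * (exp (- 2 * Z) * exp (- t)) / (Z + t / 2)))"
      using h0 unfolding sq [OF t] 2 by (simp only: scaleR_conv_of_real abs_of_pos)
    also have "\<dots> = complex_of_real (?g t) powr (\<nu> - 1/2) * (of_real (Z + t / 2) * of_real (sqrt pi * (exp (- 2 * Z) * exp (- t)) / (Z + t / 2)))"
      by (simp only: mult_ac)
    also have "complex_of_real (Z + t / 2) * of_real (sqrt pi * (exp (- 2 * Z) * exp (- t)) / (Z + t / 2)) =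
        of_real (sqrt pi * exp (- 2 * Z) * exp (- t))"
      unfolding of_real_mult [symmetric] using h0 by (intro arg_cong [of _ _ of_real]) (simp add: field_simps)
    finally show "\<bar>Z + t / 2\<bar> *\<^sub>R ?f (?g t) = of_real (sqrt pi * exp (- 2 * Z)) *
      (of_real t powr (\<nu> - 1/2) * (of_real Z + of_real (t / 4)) powr (\<nu> - 1/2) * of_real (exp (- t)))"
      unfolding 1 unfolding of_real_mult of_real_add by (simp only: mult_ac)
  qed
  also have "\<dots> = of_real (sqrt pi * exp (- 2 * Z)) * laplace_integral \<nu> (of_real Z)"
    unfolding laplace_integral_def by (rule integral_mult_right_zero)
  finally have *: "Gamma (\<nu> + 1/2) * macdonald \<nu> (of_real (Z\<^sup>2)) = of_real (sqrt pi * exp (- 2 * Z)) * laplace_integral \<nu> (of_real Z)" .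
  have "\<nu> + 1/2 \<notin> \<int>\<^sub>\<le>\<^sub>0" using \<nu> by (auto elim!: nonpos_Ints_cases simp: complex_eq_iff)
  hence "rGamma (\<nu> + 1/2) * Gamma (\<nu> + 1/2) = 1" by (simp add: rGamma_inverse_Gamma Gamma_eq_zero_iff)
  hence "macdonald \<nu> (of_real (Z\<^sup>2)) = rGamma (\<nu> + 1/2) * (Gamma (\<nu> + 1/2) * macdonald \<nu> (of_real (Z\<^sup>2)))"
    by (simp only: mult.assoc [symmetric]) simp
  thus ?thesis unfolding * by (simp only: mult.assoc)
qed

text \<open>Since Re \<nu> < 1/2 the exponent \<nu> - 1/2 has negative real part, and a lower bound
  on the distance to the branch point becomes an upper bound on the power.\<close>

lemma laplace_integrand_bound:
  assumes \<nu>: "0 < Re \<nu>" "Re \<nu> < 1/2" and t: "t > 0" and d: "d > 0" "norm (Z + of_real (t / 4)) \<ge> d"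
  shows "norm (of_real t powr (\<nu> - 1/2) * (Z + of_real (t / 4)) powr (\<nu> - 1/2) * of_real (exp (- t)))
     \<le> d powr (Re \<nu> - 1/2) * exp (pi * \<bar>Im \<nu>\<bar>) * (t powr ((Re \<nu> + 1/2) - 1) * exp (- (1 * t)))"
proof -
  have nz: "Z + of_real (t / 4) \<noteq> 0" using d by auto
  have "norm ((Z + of_real (t / 4)) powr (\<nu> - 1/2)) \<le> norm (Z + of_real (t / 4)) powr (Re \<nu> - 1/2) * exp (pi * \<bar>Im \<nu>\<bar>)"
    using norm_complex_powr_le [OF nz, of "\<nu> - 1/2"] by simp
  also have "\<dots> \<le> d powr (Re \<nu> - 1/2) * exp (pi * \<bar>Im \<nu>\<bar>)"
    using d \<nu> by (intro mult_right_mono powr_mono2') auto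
  finally have "norm ((Z + of_real (t / 4)) powr (\<nu> - 1/2)) \<le> d powr (Re \<nu> - 1/2) * exp (pi * \<bar>Im \<nu>\<bar>)" .
  hence "t powr (Re \<nu> - 1/2) * norm ((Z + of_real (t / 4)) powr (\<nu> - 1/2)) * exp (- t) \<le>
      t powr (Re \<nu> - 1/2) * (d powr (Re \<nu> - 1/2) * exp (pi * \<bar>Im \<nu>\<bar>)) * exp (- t)"
    by (intro mult_right_mono mult_left_mono) auto
  thus ?thesis using t by (simp add: norm_mult norm_of_real_powr mult_ac)
qed

lemma laplace_dominant_integrable:
  assumes "0 < Re \<nu>"
  shows "integrable half_line (\<lambda>t. C * (t powr ((Re \<nu> + 1/2) - 1) * exp (- (1 * t))))"
  using assms by (intro integrable_mult_right half_line_Gamma_real) auto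

lemma laplace_measurable:
  assumes "Z \<notin> \<real>\<^sub>\<le>\<^sub>0"
  shows "(\<lambda>t. complex_of_real t powr (\<nu> - 1/2) * (Z + of_real (t / 4)) powr (\<nu> - 1/2) * of_real (exp (- t))) \<in> borel_measurable half_line"
proof -
  have "Z + complex_of_real t / 4 \<noteq> 0" if "t > 0" for t
  proof
    assume "Z + complex_of_real t / 4 = 0"
    hence "Z = - of_real (t / 4)" by (simp add: eq_neg_iff_add_eq_0)
    thus False using assms that by (simp add: complex_nonpos_Reals_iff)
  qed
  thus ?thesis using assms
    by (intro measurable_half_line continuous_intros) (auto simp: complex_nonpos_Reals_iff)
qed

lemma laplace_integral_holomorphic:
  assumes \<nu>: "0 < Re \<nu>" "Re \<nu> < 1/2"
  shows "laplace_integral \<nu> holomorphic_on - \<real>\<^sub>\<le>\<^sub>0"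
proof -
  have "\<exists>D. (laplace_integral \<nu> has_field_derivative D) (at Z)" if Z: "Z \<in> - \<real>\<^sub>\<le>\<^sub>0" for Z
  proof -
    have "open (- (\<real>\<^sub>\<le>\<^sub>0 :: complex set))" by (simp add: open_Compl)
    then obtain \<epsilon> where \<epsilon>: "\<epsilon> > 0" "ball Z \<epsilon> \<subseteq> - \<real>\<^sub>\<le>\<^sub>0"
      using Z open_contains_ball by blast
    have far: "norm (W + of_real (t / 4)) \<ge> \<epsilon> / 2" if "W \<in> ball Z (\<epsilon> / 2)" "t > 0" for W t
    proof -
      have "- complex_of_real (t / 4) \<in> \<real>\<^sub>\<le>\<^sub>0" using that by (simp add: complex_nonpos_Reals_iff)
      hence "- complex_of_real (t / 4) \<notin> ball Z \<epsilon>" using \<epsilon> by auto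
      hence "\<epsilon> \<le> norm (Z + of_real (t / 4))" by (simp add: dist_norm)
      moreover have "norm (Z + of_real (t / 4)) \<le> norm (W + of_real (t / 4)) + norm (Z - W)"
        using norm_triangle_ineq [of "W + of_real (t / 4)" "Z - W"] by (simp add: algebra_simps)
      ultimately show ?thesis using that by (simp add: dist_norm)
    qed
    have sub: "ball Z (\<epsilon> / 2) \<subseteq> - \<real>\<^sub>\<le>\<^sub>0"
      using \<epsilon> by (intro order_trans [OF subset_ball \<epsilon>(2)]) auto
    show ?thesis
      unfolding laplace_integral_def [abs_def]
    proof (rule exI, rule integral_has_field_derivative [where \<rho> = "\<epsilon> / 2"])
      show "norm (complex_of_real t powr (\<nu> - 1/2) * (W + of_real (t / 4)) powr (\<nu> - 1/2) * of_real (exp (- t)))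
         \<le> (\<epsilon> / 2) powr (Re \<nu> - 1/2) * exp (pi * \<bar>Im \<nu>\<bar>) * (t powr ((Re \<nu> + 1/2) - 1) * exp (- (1 * t)))"
        if "W \<in> ball Z (\<epsilon> / 2)" "t \<in> space half_line" for W t
        using that \<epsilon> by (intro laplace_integrand_bound \<nu> far) auto
      show "integrable half_line (\<lambda>t. (\<epsilon> / 2) powr (Re \<nu> - 1/2) * exp (pi * \<bar>Im \<nu>\<bar>) * (t powr ((Re \<nu> + 1/2) - 1) * exp (- (1 * t))))"
        by (rule laplace_dominant_integrable [OF \<nu>(1)])
      show "(\<lambda>t. complex_of_real t powr (\<nu> - 1/2) * (W + of_real (t / 4)) powr (\<nu> - 1/2) * of_real (exp (- t))) \<in> borel_measurable half_line"
        if "W \<in> ball Z (\<epsilon> / 2)" for W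
        using that sub by (intro laplace_measurable) auto
      show "(\<lambda>W. complex_of_real t powr (\<nu> - 1/2) * (W + of_real (t / 4)) powr (\<nu> - 1/2) * of_real (exp (- t))) holomorphic_on ball Z (\<epsilon> / 2)"
        if "t \<in> space half_line" for t
        using that sub by (intro holomorphic_intros) (auto simp: complex_nonpos_Reals_iff subset_iff)
    qed (use \<epsilon> in auto)
  qed
  thus ?thesis by (subst holomorphic_on_open) (auto simp: open_Compl)
qed

text \<open>For \<open>Re Z > 0\<close> this is \<open>2 Z\<^sup>-\<^sup>\<nu> K\<^sub>\<nu>(2 Z)\<close>; it is holomorphic in the slit plane, so it also
  provides the values of \<open>K\<^sub>\<nu>\<close> on and across the imaginary axis.\<close>
definition kernel_K :: "complex \<Rightarrow> complex \<Rightarrow> complex" where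
  "kernel_K \<nu> Z = of_real pi / sin (of_real pi * \<nu>) *
     (Z powr (- 2 * \<nu>) * bessel_series (- \<nu>) (Z\<^sup>2) - bessel_series \<nu> (Z\<^sup>2))"

lemma kernel_K_holomorphic [holomorphic_intros]:
  assumes "f holomorphic_on S" "\<And>z. z \<in> S \<Longrightarrow> f z \<notin> \<real>\<^sub>\<le>\<^sub>0"
  shows "(\<lambda>z. kernel_K \<nu> (f z)) holomorphic_on S"
  unfolding kernel_K_def using assms by (auto intro!: holomorphic_intros)

text \<open>The identity theorem in the slit plane, applied after multiplication by Z^(2 \<nu>). On
  a real interval near 0 \<open>macdonald\<close> equals both the series and the Laplace
  expression.\<close>

lemma kernel_K_eq_laplace_integral:
  assumes \<nu>: "0 < Re \<nu>" "Re \<nu> < 1/2" and Z: "Z \<notin> \<real>\<^sub>\<le>\<^sub>0"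
  shows "kernel_K \<nu> Z = Z powr (- 2 * \<nu>) * rGamma (\<nu> + 1/2) * of_real (sqrt pi) * exp (- 2 * Z) * laplace_integral \<nu> Z"
proof -
  let ?A = "- (\<real>\<^sub>\<le>\<^sub>0 :: complex set)"
  define h where "h = (\<lambda>Z. of_real pi / sin (of_real pi * \<nu>) * (bessel_series (- \<nu>) (Z\<^sup>2) - Z powr (2 * \<nu>) * bessel_series \<nu> (Z\<^sup>2))
      - rGamma (\<nu> + 1/2) * of_real (sqrt pi) * exp (- 2 * Z) * laplace_integral \<nu> Z)"
  define x0 where "x0 = (1 - Re \<nu>) / 2"
  have x0: "0 < x0" "x0 < 1" using \<nu> by (auto simp: x0_def)
  have A: "open ?A" by (simp add: open_Compl)
  have "complex_of_real ` {..0} = \<real>\<^sub>\<le>\<^sub>0"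
    by (auto simp: nonpos_Reals_def)
  hence conn: "connected ?A"
    using starlike_slotted_complex_plane_left [of 0] starlike_imp_connected by metis
  have hol: "h holomorphic_on ?A"
    unfolding h_def by (intro holomorphic_intros laplace_integral_holomorphic \<nu>) auto
  have zero: "h (of_real x) = 0" if x: "0 < x" "x \<le> x0" for x
  proof -
    have "x\<^sup>2 \<le> x" using x x0 by (simp add: power2_eq_square mult_le_one_mono)
    hence x2: "0 < x\<^sup>2" "x\<^sup>2 \<le> (1 - Re \<nu>) / 2" using x by (auto simp: x0_def)
    have "macdonald \<nu> (of_real (x\<^sup>2)) = macdonald_series \<nu> (of_real (x\<^sup>2))"
      using \<nu> x2 by (intro macdonald_eq_series_near_0) auto
    moreover have "complex_of_real (x\<^sup>2) powr \<nu> = of_real x powr (2 * \<nu>)"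
      using x by (subst (1 2) of_real_powr_eq_exp) (auto simp: ln_realpow mult_ac)
    ultimately show ?thesis
      using macdonald_eq_laplace_integral [OF \<nu>(1) x(1)]
      by (simp add: h_def macdonald_series_def exp_of_real [symmetric])
  qed
  have "h Z = 0"
  proof (rule analytic_continuation [OF hol A conn, of "of_real ` {0<..x0}" "of_real (x0 / 2)"])
    show "complex_of_real ` {0<..x0} \<subseteq> ?A" by auto
    show "complex_of_real (x0 / 2) \<in> ?A" using x0 by (simp del: of_real_divide)
    show "complex_of_real (x0 / 2) islimpt of_real ` {0<..x0}"
    proof (rule islimpt_approachable [THEN iffD2], intro allI impI)
      fix e :: real assume e: "e > 0"
      define y where "y = x0 / 2 + min (e / 2) (x0 / 4)"
      have y: "y \<in> {0<..x0}" "y \<noteq> x0 / 2" "\<bar>y - x0 / 2\<bar> < e" using e x0 by (auto simp: y_def min_def)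
      have "dist (complex_of_real y) (of_real (x0 / 2)) < e"
        using y(3) by (simp only: dist_of_real dist_real_def)
      thus "\<exists>x'\<in>complex_of_real ` {0<..x0}. x' \<noteq> of_real (x0 / 2) \<and> dist x' (of_real (x0 / 2)) < e"
        using y by (intro bexI [of _ "of_real y"]) (auto simp del: of_real_divide)
    qed
  qed (use zero Z in auto)
  moreover have "Z powr (- 2 * \<nu>) * Z powr (2 * \<nu>) = 1" using Z by (auto simp: powr_add [symmetric])
  hence "kernel_K \<nu> Z = Z powr (- 2 * \<nu>) * (of_real pi / sin (of_real pi * \<nu>) *
      (bessel_series (- \<nu>) (Z\<^sup>2) - Z powr (2 * \<nu>) * bessel_series \<nu> (Z\<^sup>2)))"
    by (simp add: kernel_K_def algebra_simps)
  ultimately show ?thesis by (simp add: h_def mult.assoc)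
qed

lemma kernel_K_of_real:
  assumes \<nu>: "0 < Re \<nu>" "Re \<nu> < 1/2" and Z: "Z > 0"
  shows "kernel_K \<nu> (of_real Z) = of_real Z powr (- 2 * \<nu>) * macdonald \<nu> (of_real (Z\<^sup>2))"
  using kernel_K_eq_laplace_integral [OF \<nu>, of "of_real Z"] macdonald_eq_laplace_integral [OF \<nu>(1) Z] Z
  by (simp add: exp_of_real [symmetric] mult_ac)

text \<open>The region reaches beyond the imaginary axis into the sector where the imaginary part
  dominates, because rotated arguments cross that axis. Throughout it Z + t/4 keeps distance |Z|/2
  from 0, which bounds the Laplace integral; past the axis the exponential factor grows.\<close>

lemma kernel_K_bound:
  assumes \<nu>: "0 < Re \<nu>" "Re \<nu> < 1/2"
  obtains C where "C > 0"
    "\<And>Z. Z \<noteq> 0 \<Longrightarrow> Re Z \<ge> 0 \<or> \<bar>Im Z\<bar> \<ge> \<bar>Re Z\<bar> \<Longrightarrow>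
        norm (kernel_K \<nu> Z) \<le> C * norm Z powr (- Re \<nu> - 1/2) * exp (- 2 * Re Z)"
proof -
  define G where "G = Gamma (Re \<nu> + 1/2) * exp (pi * \<bar>Im \<nu>\<bar>) * (1/2) powr (Re \<nu> - 1/2)"
  have "Re \<nu> + 1/2 > 0" using \<nu> by simp
  hence Gpos: "G > 0" by (auto simp: G_def intro!: mult_pos_pos Gamma_real_pos)
  have L: "norm (laplace_integral \<nu> Z) \<le> G * norm Z powr (Re \<nu> - 1/2)"
    if Z: "Z \<noteq> 0" "Re Z \<ge> 0 \<or> \<bar>Im Z\<bar> \<ge> \<bar>Re Z\<bar>" for Z
  proof -
    have far: "norm (Z + of_real (t / 4)) \<ge> norm Z / 2" if t: "t > 0" for t
    proof (cases "Re Z \<ge> 0")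
      case True
      have "(Re Z)\<^sup>2 \<le> (Re (Z + of_real (t / 4)))\<^sup>2"
        using True t by (intro power_mono) auto
      hence "(norm Z)\<^sup>2 \<le> (norm (Z + of_real (t / 4)))\<^sup>2"
        by (simp add: cmod_power2)
      hence "norm Z \<le> norm (Z + of_real (t / 4))" by (rule power2_le_imp_le) auto
      thus ?thesis using norm_ge_zero [of Z] by linarith
    next
      case False
      hence "norm Z \<le> 2 * \<bar>Im Z\<bar>" using Z cmod_le [of Z] by linarith
      moreover have "\<bar>Im Z\<bar> \<le> norm (Z + of_real (t / 4))" using abs_Im_le_cmod [of "Z + of_real (t / 4)"] by simp
      ultimately show ?thesis by linarith
    qed
    have "norm (laplace_integral \<nu> Z) \<le> (\<integral>t. norm (of_real t powr (\<nu> - 1/2) * (Z + of_real (t / 4)) powr (\<nu> - 1/2) * of_real (exp (- t))) \<partial>half_line)"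
      unfolding laplace_integral_def by (rule integral_norm_bound)
    also have "\<dots> \<le> (\<integral>t. (norm Z / 2) powr (Re \<nu> - 1/2) * exp (pi * \<bar>Im \<nu>\<bar>) * (t powr ((Re \<nu> + 1/2) - 1) * exp (- (1 * t))) \<partial>half_line)"
      using Z far
      by (intro integral_mono' laplace_dominant_integrable \<nu> laplace_integrand_bound) auto
    also have "\<dots> = (norm Z / 2) powr (Re \<nu> - 1/2) * exp (pi * \<bar>Im \<nu>\<bar>) * Gamma (Re \<nu> + 1/2)"
      using half_line_Gamma_real(2) [of "Re \<nu> + 1/2" 1] \<nu> by simp
    also have "\<dots> = G * norm Z powr (Re \<nu> - 1/2)"
      using powr_mult [of "norm Z" "1/2" "Re \<nu> - 1/2"] by (simp add: G_def mult_ac)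
    finally show ?thesis .
  qed
  define C where "C = exp (pi * \<bar>Im (- 2 * \<nu>)\<bar>) * norm (rGamma (\<nu> + 1/2) * of_real (sqrt pi)) * G + 1"
  have "norm (kernel_K \<nu> Z) \<le> C * norm Z powr (- Re \<nu> - 1/2) * exp (- 2 * Re Z)"
    if Z: "Z \<noteq> 0" "Re Z \<ge> 0 \<or> \<bar>Im Z\<bar> \<ge> \<bar>Re Z\<bar>" for Z
  proof -
    have slit: "Z \<notin> \<real>\<^sub>\<le>\<^sub>0" using Z by (auto simp: complex_nonpos_Reals_iff complex_eq_iff)
    have "norm (kernel_K \<nu> Z) = norm (Z powr (- 2 * \<nu>)) * norm (rGamma (\<nu> + 1/2) * of_real (sqrt pi)) * exp (- 2 * Re Z) * norm (laplace_integral \<nu> Z)"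
      unfolding kernel_K_eq_laplace_integral [OF \<nu> slit] by (simp add: norm_mult)
    also have "\<dots> \<le> (norm Z powr Re (- 2 * \<nu>) * exp (pi * \<bar>Im (- 2 * \<nu>)\<bar>)) * norm (rGamma (\<nu> + 1/2) * of_real (sqrt pi)) * exp (- 2 * Re Z) * (G * norm Z powr (Re \<nu> - 1/2))"
      using norm_complex_powr_le [OF Z(1), of "- 2 * \<nu>"] L [OF Z] Gpos
      by (intro mult_mono) auto
    also have "\<dots> = (C - 1) * (norm Z powr (- 2 * Re \<nu>) * norm Z powr (Re \<nu> - 1/2)) * exp (- 2 * Re Z)"
      by (simp add: C_def mult_ac)
    also have "norm Z powr (- 2 * Re \<nu>) * norm Z powr (Re \<nu> - 1/2) = norm Z powr (- Re \<nu> - 1/2)"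
      by (simp add: powr_add [symmetric])
    also have "(C - 1) * norm Z powr (- Re \<nu> - 1/2) * exp (- 2 * Re Z) \<le> C * norm Z powr (- Re \<nu> - 1/2) * exp (- 2 * Re Z)"
      by (intro mult_right_mono) auto
    finally show ?thesis .
  qed
  moreover have "C > 0" unfolding C_def using Gpos by (intro add_nonneg_pos mult_nonneg_nonneg) auto
  ultimately show ?thesis using that by blast
qed

subsection \<open>Dirichlet characters and Gauss sums\<close>

lemma dirichlet_char_mod:
  assumes "dirichlet_char q chi"
  shows "chi (n mod q) = chi n"
proof -
  have per: "chi (m + q) = chi m" for m using assms by (auto simp: dirichlet_char_def)
  have "chi (m + k * q) = chi m" for m k
  proof (induction k)
    case (Suc k)
    have "m + Suc k * q = (m + k * q) + q" by simp
    thus ?case by (simp only: per Suc)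
  qed simp
  from this [of "n mod q" "n div q"] show ?thesis by simp
qed

lemma dirichlet_char_cong:
  assumes "dirichlet_char q chi" "[m = n] (mod q)"
  shows "chi m = chi n"
  using dirichlet_char_mod [OF assms(1)] assms(2) by (metis cong_def)

lemma dirichlet_char_mult: "dirichlet_char q chi \<Longrightarrow> chi (m * n) = chi m * chi n"
  by (auto simp: dirichlet_char_def)

lemma dirichlet_char_power: "dirichlet_char q chi \<Longrightarrow> chi (m ^ k) = chi m ^ k"
  by (induction k) (auto simp: dirichlet_char_def)

lemma norm_dirichlet_char:
  assumes chi: "dirichlet_char q chi"
  shows "coprime n q \<Longrightarrow> norm (chi n) = 1" and "norm (chi n) \<le> 1"
proof -
  have q: "q > 0" using chi by (auto simp: dirichlet_char_def)
  show 1: "norm (chi n) = 1" if "coprime n q"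
  proof -
    have "chi n ^ totient q = chi (n ^ totient q)"
      using chi by (simp add: dirichlet_char_power)
    also have "\<dots> = chi 1" by (rule dirichlet_char_cong [OF chi euler_theorem [OF that]])
    also have "\<dots> = 1" using chi by (auto simp: dirichlet_char_def)
    finally have "norm (chi n) ^ totient q = 1" by (metis norm_one norm_power)
    thus ?thesis using q by (intro power_eq_imp_eq_base [of _ "totient q" 1]) auto
  qed
  show "norm (chi n) \<le> 1"
  proof (cases "coprime n q")
    case False
    hence "chi n = 0" using chi by (auto simp: dirichlet_char_def)
    thus ?thesis by simp
  qed (use 1 in auto)
qed

lemma dirichlet_char_cnj:
  assumes "dirichlet_char q chi" "coprime n q"
  shows "cnj (chi n) * chi n = 1"
  using norm_dirichlet_char(1) [OF assms] complex_norm_square [of "chi n"] by (simp add: mult.commute)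

definition root_char :: "nat \<Rightarrow> nat \<Rightarrow> complex" where
  "root_char q n = exp (2 * of_real pi * \<i> * of_nat n / of_nat q)"

lemma root_char_cong:
  assumes "q > 0" "[m = n] (mod q)"
  shows "root_char q m = root_char q n"
  using complex_root_unity_eq [of q m n] assms by (simp add: root_char_def cong_def)

lemma root_char_power: "root_char q n ^ k = root_char q (n * k)"
  by (simp add: root_char_def exp_of_nat_mult [symmetric] field_simps)

lemma sum_residues_shift:
  fixes f :: "nat \<Rightarrow> complex"
  assumes "q > 0" "\<And>m n. [m = n] (mod q) \<Longrightarrow> f m = f n"
  shows "(\<Sum>a=1..q. f a) = (\<Sum>a<q. f a)"
proof -
  have "f q = f 0" by (rule assms(2)) (simp add: cong_def)
  moreover have "{1..q} = insert q {1..<q}" "{..<q} = insert 0 {1..<q}" using assms(1) by auto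
  ultimately show ?thesis by simp
qed

lemma sum_residues_mult:
  fixes f :: "nat \<Rightarrow> complex"
  assumes q: "q > 0" and f: "\<And>m n. [m = n] (mod q) \<Longrightarrow> f m = f n" and c: "coprime c q"
  shows "(\<Sum>a<q. f (c * a)) = (\<Sum>a<q. f a)"
proof -
  have inj: "inj_on (\<lambda>a. c * a mod q) {..<q}"
  proof (rule inj_onI)
    fix a b assume ab: "a \<in> {..<q}" "b \<in> {..<q}" "c * a mod q = c * b mod q"
    hence "[c * a = c * b] (mod q)" by (simp add: cong_def)
    hence "[a = b] (mod q)" using c by (simp add: cong_mult_lcancel_nat)
    thus "a = b" using ab by (simp add: cong_def)
  qed
  have "(\<lambda>a. c * a mod q) ` {..<q} = {..<q}"
    using inj q by (intro endo_inj_surj) auto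
  hence "(\<Sum>a<q. f a) = (\<Sum>a<q. f (c * a mod q))"
    using sum.reindex [OF inj, of f] by (simp add: o_def)
  also have "\<dots> = (\<Sum>a<q. f (c * a))"
    by (intro sum.cong refl f) (simp add: cong_def)
  finally show ?thesis ..
qed

lemma nonprincipal_modulus_gt_1:
  assumes "dirichlet_char q chi" "\<not> principal_char q chi"
  shows "q > 1"
proof (rule ccontr)
  assume "\<not> q > 1"
  hence "q = 1" using assms by (auto simp: dirichlet_char_def)
  hence "chi n = chi 1" for n
    using dirichlet_char_cong [OF assms(1), of n 1] by simp
  thus False using assms by (auto simp: principal_char_def dirichlet_char_def)
qed

text \<open>For h prime to q, multiplication by h permutes the residues. Otherwise q divides d h for
  a proper divisor d, and primitivity supplies two units congruent modulo d with different character
  values; this forces the sum to vanish, as does chi h.\<close>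

theorem primitive_gauss_sum:
  assumes prim: "primitive_char q chi" and q: "q > 1"
  shows "(\<Sum>a=1..q. chi a * root_char q (a * h)) = cnj (chi h) * gauss_sum q chi"
proof -
  have chi: "dirichlet_char q chi" using prim by (auto simp: primitive_char_def)
  have q0: "q > 0" using q by simp
  have per: "chi m * root_char q (m * k) = chi n * root_char q (n * k)" if "[m = n] (mod q)" for m n k
    using that dirichlet_char_cong [OF chi that] root_char_cong [OF q0, of "m * k" "n * k"]
    by (simp add: cong_mult)
  define S where "S = (\<Sum>a<q. chi a * root_char q (a * h))"
  have "(\<Sum>a=1..q. chi a * root_char q (a * h)) = S"
    unfolding S_def by (rule sum_residues_shift [OF q0 per])
  moreover have "S = cnj (chi h) * gauss_sum q chi"
  proof (cases "coprime h q")
    case True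
    have "chi h * S = (\<Sum>a<q. chi (h * a) * root_char q ((h * a) * 1))"
      by (simp add: S_def sum_distrib_left dirichlet_char_mult [OF chi] mult_ac)
    also have "\<dots> = (\<Sum>a<q. chi a * root_char q (a * 1))"
      by (rule sum_residues_mult [OF q0 per True])
    also have "\<dots> = (\<Sum>a=1..q. chi a * root_char q (a * 1))"
      by (rule sum_residues_shift [OF q0 per, symmetric])
    also have "\<dots> = gauss_sum q chi" by (simp add: gauss_sum_def root_char_def)
    finally have "cnj (chi h) * (chi h * S) = cnj (chi h) * gauss_sum q chi" by simp
    thus ?thesis using dirichlet_char_cnj [OF chi True] by (simp add: mult.assoc [symmetric])
  next
    case False
    define g where "g = gcd h q"
    define d where "d = q div g"
    have "g \<noteq> 0" using q0 by (simp add: g_def)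
    moreover have "g \<noteq> 1" using False coprime_iff_gcd_eq_1 [of h q] unfolding g_def by blast
    ultimately have "g > 1" by linarith
    hence g: "g > 1" "g dvd h" "g dvd q" by (auto simp: g_def)
    have d: "d < q" "d dvd q" using g q0 by (auto simp: d_def)
    have "q dvd d * h"
    proof -
      obtain h' where h': "h = g * h'" using g by auto
      have "d * g = q" using g by (simp add: d_def)
      hence "d * h = q * h'" using h' by (simp add: mult.assoc [symmetric])
      thus ?thesis by simp
    qed
    from d prim have "\<not> induced_modulus q chi d" by (auto simp: primitive_char_def)
    then obtain m n where mn: "coprime m q" "coprime n q" "m mod d = n mod d" "chi m \<noteq> chi n"
      using d by (auto simp: induced_modulus_def)
    have "[m * h = n * h] (mod (d * h))"
      using mn by (simp add: cong_def mult_mod_left [symmetric] mod_mult_mult2)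
    hence mh: "[m * h = n * h] (mod q)" using \<open>q dvd d * h\<close> by (rule cong_dvd_modulus_nat)
    \<comment> \<open>Replacing a by c a for a unit c extracts chi c. For c = m and c = n the
      remaining sums coincide, as m h and n h agree modulo q, whence S = chi m S' = chi n
      S'.\<close>
    define S' where "S' = (\<Sum>a<q. chi a * root_char q (a * (m * h)))"
    have twist: "S = chi c * (\<Sum>a<q. chi a * root_char q (a * (c * h)))" if "coprime c q" for c
    proof -
      have "S = (\<Sum>a<q. chi (c * a) * root_char q (c * a * h))"
        unfolding S_def by (rule sum_residues_mult [OF q0 per that, symmetric])
      thus ?thesis by (simp add: sum_distrib_left dirichlet_char_mult [OF chi] mult_ac)
    qed
    have "S = chi m * S'" using twist [OF mn(1)] by (simp add: S'_def)
    moreover have "S = chi n * S'"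
    proof -
      have "root_char q (a * (n * h)) = root_char q (a * (m * h))" for a
        by (rule root_char_cong [OF q0]) (intro cong_mult cong_refl cong_sym [OF mh])
      thus ?thesis using twist [OF mn(2)] by (simp add: S'_def)
    qed
    ultimately have "S = 0" using mn(4) by auto
    moreover have "chi h = 0" using False chi by (auto simp: dirichlet_char_def)
    ultimately show ?thesis by simp
  qed
  ultimately show ?thesis by simp
qed

text \<open>If the Gauss sum were 0, every finite Fourier coefficient of chi would vanish by the
  preceding theorem, and Fourier inversion at 1 would give q chi(1) = 0.\<close>

lemma gauss_sum_nonzero:
  assumes prim: "primitive_char q chi" and q: "q > 1"
  shows "gauss_sum q chi \<noteq> 0"
proof
  assume 0: "gauss_sum q chi = 0"
  have orth: "(\<Sum>h<q. root_char q (k * h)) = (if k = 0 then of_nat q else 0)" if "k < q" for k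
  proof (cases "k = 0")
    case False
    have "root_char q k \<noteq> 1"
      using complex_root_unity_eq_1 [of q k] that False q by (auto simp: root_char_def dest: dvd_imp_le)
    moreover have "root_char q k ^ q = 1"
      unfolding root_char_power unfolding root_char_def using q by (subst complex_root_unity_eq_1) auto
    ultimately show ?thesis using False
      by (simp add: root_char_power [symmetric] sum_gp_strict)
  qed (simp add: root_char_def)
  \<comment> \<open>The natural number q h - h stands for the exponent -h modulo q.\<close>
  have "0 = (\<Sum>h<q. root_char q (q * h - h) * (\<Sum>a=1..q. chi a * root_char q (a * h)))"
    using primitive_gauss_sum [OF prim q] 0 by simp
  also have "\<dots> = (\<Sum>a=1..q. \<Sum>h<q. chi a * (root_char q (q * h - h) * root_char q (a * h)))"
    unfolding sum_distrib_left by (subst sum.swap) (simp only: mult_ac)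
  also have "\<dots> = (\<Sum>a=1..q. chi a * (\<Sum>h<q. root_char q ((a - 1) * h)))"
  proof (intro sum.cong refl, subst sum_distrib_left, intro sum.cong refl)
    fix a h assume a: "a \<in> {1..q}"
    have "root_char q (q * h - h) * root_char q (a * h) = root_char q ((q * h - h) + a * h)"
      by (simp add: root_char_def add_divide_distrib distrib_left exp_add)
    also have "(q * h - h) + a * h = (a - 1) * h + q * h"
      using a q by (auto simp: algebra_simps diff_mult_distrib)
    also have "root_char q \<dots> = root_char q ((a - 1) * h)"
      using q by (intro root_char_cong) (auto simp: cong_def)
    finally show "chi a * (root_char q (q * h - h) * root_char q (a * h)) = chi a * root_char q ((a - 1) * h)" by simp
  qed
  also have "\<dots> = (\<Sum>a=1..q. if a = 1 then chi a * of_nat q else 0)"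
  proof (intro sum.cong refl)
    fix a assume a: "a \<in> {1..q}"
    have "(\<Sum>h<q. root_char q ((a - 1) * h)) = (if a - 1 = 0 then of_nat q else 0)"
      by (rule orth) (use a in auto)
    thus "chi a * (\<Sum>h<q. root_char q ((a - 1) * h)) = (if a = 1 then chi a * of_nat q else 0)"
      using a by (auto simp del: One_nat_def)
  qed
  also have "\<dots> = chi 1 * of_nat q" using q by (simp add: sum.delta)
  also have "chi 1 = 1" using prim by (auto simp: primitive_char_def dirichlet_char_def)
  finally show False using q by simp
qed

lemma sum_primitive_char:
  assumes "primitive_char q chi" "q > 1"
  shows "(\<Sum>a=1..q. chi a) = 0"
proof -
  have "chi 0 = 0" using assms by (auto simp: primitive_char_def dirichlet_char_def)
  thus ?thesis using primitive_gauss_sum [OF assms, of 0] by (simp add: root_char_def)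
qed

lemma even_char_reflect:
  assumes chi: "dirichlet_char q chi" "even_char q chi" and a: "1 \<le> a" "a \<le> q"
  shows "chi (q - a) = chi a"
proof -
  have "(q - 1) * a = q * (a - 1) + (q - a)"
    using a by (cases a) (auto simp: algebra_simps diff_mult_distrib)
  hence "[(q - 1) * a = q - a] (mod q)" by (simp add: cong_def)
  hence "chi ((q - 1) * a) = chi (q - a)" by (rule dirichlet_char_cong [OF chi(1)])
  thus ?thesis using chi by (simp add: dirichlet_char_mult even_char_def)
qed

subsection \<open>Partial fractions\<close>

text \<open>Logarithmic differentiation of the reflection formula turns the cotangent into a
  difference of Digamma values, whose limit formulas share the same logarithm. Hence w + m is paired
  with w - 1 - m, and the term 1/w sits inside m = 0.\<close>

lemma cot_partial_fractions:
  fixes w :: complex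
  assumes w: "w \<notin> \<int>"
  shows "(\<lambda>m. 1 / (w + of_nat m) + 1 / (w - 1 - of_nat m)) sums (of_real pi * cot (of_real pi * w))"
proof -
  have w0: "w \<noteq> 0" "1 - w \<noteq> 0" using w by auto
  have np: "w \<notin> \<int>\<^sub>\<le>\<^sub>0" "1 - w \<notin> \<int>\<^sub>\<le>\<^sub>0"
    using w by (auto dest: nonpos_Ints_Int)
  have sin: "sin (of_real pi * w) \<noteq> 0"
  proof
    assume "sin (of_real pi * w) = 0"
    then obtain n :: int where "of_real pi * w = of_real (of_int n * pi)" by (auto simp: sin_eq_0)
    hence "w = of_int n" by simp
    thus False using w by simp
  qed
  have G: "((\<lambda>z. Gamma z * Gamma (1 - z)) has_field_derivative
      (Gamma w * Digamma w * Gamma (1 - w) + Gamma w * (Gamma (1 - w) * Digamma (1 - w) * (-1)))) (at w)"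
    using np by (auto intro!: derivative_eq_intros simp: mult_ac)
  have S: "((\<lambda>z. of_real pi / sin (of_real pi * z)) has_field_derivative
      (- (of_real pi * (cos (of_real pi * w) * of_real pi)) / (sin (of_real pi * w))\<^sup>2)) (at w)"
    using sin by (auto intro!: derivative_eq_intros simp: power2_eq_square)
  have "Gamma w * Gamma (1 - w) * (Digamma w - Digamma (1 - w)) =
      - (of_real pi * (cos (of_real pi * w) * of_real pi)) / (sin (of_real pi * w))\<^sup>2"
    using DERIV_unique [OF G S [unfolded Gamma_reflection_complex [symmetric]]]
    by (simp add: algebra_simps)
  hence "of_real pi / sin (of_real pi * w) * (Digamma w - Digamma (1 - w)) =
      - (of_real pi * (cos (of_real pi * w) * of_real pi)) / (sin (of_real pi * w))\<^sup>2"
    unfolding Gamma_reflection_complex .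
  also have "\<dots> = of_real pi / sin (of_real pi * w) * (- (of_real pi * cot (of_real pi * w)))"
    by (simp add: cot_def power2_eq_square)
  finally have "Digamma w - Digamma (1 - w) = - (of_real pi * cot (of_real pi * w))"
    using sin by (subst (asm) mult_left_cancel) auto
  hence D: "Digamma (1 - w) - Digamma w = of_real pi * cot (of_real pi * w)"
    by (metis minus_diff_eq minus_minus)
  have "(\<lambda>m. (of_real (ln (real m)) - (\<Sum>n<m. inverse ((1 - w) + of_nat n))) -
         (of_real (ln (real m)) - (\<Sum>n<m. inverse (w + of_nat n)))) \<longlonglongrightarrow> Digamma (1 - w) - Digamma w"
    by (intro tendsto_diff Digamma_LIMSEQ w0)
  also have "(\<lambda>m. (complex_of_real (ln (real m)) - (\<Sum>n<m. inverse ((1 - w) + of_nat n))) -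
         (of_real (ln (real m)) - (\<Sum>n<m. inverse (w + of_nat n)))) =
      (\<lambda>m. \<Sum>n<m. 1 / (w + of_nat n) + 1 / (w - 1 - of_nat n))"
  proof
    fix m
    have "1 / (w - 1 - of_nat n) = - inverse ((1 - w) + of_nat n)" for n
      by (simp add: inverse_eq_divide minus_divide_right algebra_simps)
    thus "(complex_of_real (ln (real m)) - (\<Sum>n<m. inverse ((1 - w) + of_nat n))) -
         (of_real (ln (real m)) - (\<Sum>n<m. inverse (w + of_nat n))) = (\<Sum>n<m. 1 / (w + of_nat n) + 1 / (w - 1 - of_nat n))"
      by (simp add: sum.distrib sum_negf sum_subtractf inverse_eq_divide)
  qed
  finally show ?thesis unfolding D sums_def .
qed

text \<open>In the upper half-plane exp(2 pi i w) has modulus below 1, so the cotangent is 1 plus a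
  geometric series. This expression links partial fractions to the exponentials of the theta-like
  series.\<close>

lemma exp_partial_fractions:
  assumes w: "Im w > 0"
  shows "(\<lambda>m. \<i> * (1 / (w + of_nat m) + 1 / (w - 1 - of_nat m))) sums
           (of_real pi * (1 + 2 * exp (2 * of_real pi * \<i> * w) / (1 - exp (2 * of_real pi * \<i> * w))))"
proof -
  define x where "x = of_real pi * w"
  define E where "E = exp (2 * of_real pi * \<i> * w)"
  have "w \<notin> \<int>" using w by (auto elim!: Ints_cases)
  from sums_mult [OF cot_partial_fractions [OF this], of \<i>]
  have 1: "(\<lambda>m. \<i> * (1 / (w + of_nat m) + 1 / (w - 1 - of_nat m))) sums (of_real pi * (\<i> * cot x))"
    by (simp add: x_def mult_ac)
  have "norm E = exp (- (2 * pi * Im w))" by (simp add: E_def)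
  hence "norm E < 1" using w by simp
  hence E1: "1 - E \<noteq> 0" by auto
  have EE: "E = exp (\<i> * x) * exp (\<i> * x)" by (simp add: E_def x_def exp_add [symmetric] mult_ac)
  have inv: "exp (- (\<i> * x)) = 1 / exp (\<i> * x)" by (simp add: exp_minus divide_inverse)
  have "exp (\<i> * x) - exp (- (\<i> * x)) = (E - 1) / exp (\<i> * x)"
    unfolding inv EE by (simp add: field_simps)
  moreover have "exp (\<i> * x) + exp (- (\<i> * x)) = (E + 1) / exp (\<i> * x)"
    unfolding inv EE by (simp add: field_simps)
  ultimately have cs: "cos x = (E + 1) / exp (\<i> * x) / 2" "sin x = (E - 1) / exp (\<i> * x) / (2 * \<i>)"
    by (simp_all only: cos_exp_eq sin_exp_eq)
  have "\<i> * cot x = - ((E + 1) / (E - 1))"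
    unfolding cot_def cs using E1 by (simp add: field_simps)
  also have "\<dots> = 1 + 2 * E / (1 - E)" using E1 by (simp add: field_simps)
  finally show ?thesis using 1 by (simp add: E_def)
qed

subsection \<open>Double series\<close>

text \<open>The second part bounds all finite partial sums by a product of two single series; in
  this form it supplies the dominating function for integrating the double series term by
  term.\<close>

lemma has_sum_pair_product:
  fixes a b :: "nat \<Rightarrow> complex"
  assumes a: "summable (\<lambda>n. norm (a n))" and b: "summable (\<lambda>n. norm (b n))"
  shows "((\<lambda>(h, k). a h * b k) has_sum (suminf a * suminf b)) UNIV"
    and "finite F \<Longrightarrow> (\<Sum>p\<in>F. norm (case p of (h, k) \<Rightarrow> a h * b k)) \<le> (\<Sum>n. norm (a n)) * (\<Sum>n. norm (b n))"
    and "(\<lambda>p. norm (case p of (h, k) \<Rightarrow> a h * b k)) summable_on UNIV"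
proof -
  show bd: "(\<Sum>p\<in>F. norm (case p of (h, k) \<Rightarrow> a h * b k)) \<le> (\<Sum>n. norm (a n)) * (\<Sum>n. norm (b n))"
    if F: "finite F" for F
  proof -
    have "(\<Sum>p\<in>F. norm (case p of (h, k) \<Rightarrow> a h * b k)) \<le> (\<Sum>p\<in>fst ` F \<times> snd ` F. norm (case p of (h, k) \<Rightarrow> a h * b k))"
      using F by (intro sum_mono2) (auto simp: image_iff, force+)
    also have "\<dots> = (\<Sum>h\<in>fst ` F. norm (a h)) * (\<Sum>k\<in>snd ` F. norm (b k))"
      by (simp add: sum_product sum.cartesian_product norm_mult case_prod_unfold)
    also have "\<dots> \<le> (\<Sum>n. norm (a n)) * (\<Sum>n. norm (b n))"
      using F a b by (intro mult_mono sum_le_suminf suminf_nonneg sum_nonneg) auto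
    finally show ?thesis .
  qed
  show abs: "(\<lambda>p. norm (case p of (h, k) \<Rightarrow> a h * b k)) summable_on UNIV"
    unfolding abs_summable_iff_bdd_above by (rule bdd_aboveI2) (use bd in auto)
  then obtain S where S: "((\<lambda>(h, k). a h * b k) has_sum S) UNIV"
    using abs_summable_summable has_sum_infsum by blast
  have A: "(a has_sum suminf a) UNIV"
    by (rule norm_summable_imp_has_sum [OF a summable_sums [OF summable_norm_cancel [OF a]]])
  have B: "(b has_sum suminf b) UNIV"
    by (rule norm_summable_imp_has_sum [OF b summable_sums [OF summable_norm_cancel [OF b]]])
  have "((\<lambda>h. a h * suminf b) has_sum S) UNIV"
  proof (rule has_sum_SigmaD)
    show "((\<lambda>(h, k). a h * b k) has_sum S) (Sigma UNIV (\<lambda>_. UNIV))" using S by simp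
    show "((\<lambda>k. case (h, k) of (h, k) \<Rightarrow> a h * b k) has_sum a h * suminf b) UNIV" for h
      using has_sum_cmult_right [OF B, of "a h"] by simp
  qed
  moreover have "((\<lambda>h. a h * suminf b) has_sum suminf a * suminf b) UNIV"
    by (rule has_sum_cmult_left [OF A])
  ultimately have "S = suminf a * suminf b" by (rule has_sum_unique)
  thus "((\<lambda>(h, k). a h * b k) has_sum (suminf a * suminf b)) UNIV" using S by simp
qed

text \<open>Unconditional summation allows pairs of positive integers to be grouped by their
  product, which is how divisor sums arise. Indices are shifted by one to range over positive
  integers.\<close>

lemma divisor_sums:
  fixes f :: "nat \<Rightarrow> nat \<Rightarrow> complex"
  assumes "((\<lambda>(h, k). f (Suc h) (Suc k)) has_sum S) UNIV"
  shows "(\<lambda>n. \<Sum>d | d dvd Suc n. f d (Suc n div d)) sums S"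
proof (rule has_sum_imp_sums, rule has_sum_SigmaD)
  show "((\<lambda>(n, d). f d (Suc n div d)) has_sum S) (SIGMA n:UNIV. {d. d dvd Suc n})"
  proof (subst has_sum_reindex_bij_witness [of _ "\<lambda>(h, k). (Suc h * Suc k - 1, Suc h)" "\<lambda>(n, d). (d - 1, Suc n div d - 1)"
        UNIV "\<lambda>(h, k). f (Suc h) (Suc k)" _ S S])
    fix p assume "p \<in> (SIGMA n:UNIV. {d. d dvd Suc n})"
    then obtain n d k where p: "p = (n, d)" "Suc n = d * k" by (auto elim!: dvdE)
    have dk: "d > 0" "k > 0" using p(2) by (auto intro!: Nat.gr0I)
    hence div: "Suc n div d = k" using p(2) by simp
    have e: "Suc (d - 1) = d" "Suc (k - 1) = k" "d * k - 1 = n" using dk p(2) by auto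
    show "(case (case p of (n, d) \<Rightarrow> (d - 1, Suc n div d - 1)) of (h, k) \<Rightarrow> (Suc h * Suc k - 1, Suc h)) = p"
      "(case (case p of (n, d) \<Rightarrow> (d - 1, Suc n div d - 1)) of (h, k) \<Rightarrow> f (Suc h) (Suc k)) = (case p of (n, d) \<Rightarrow> f d (Suc n div d))"
      unfolding p(1) prod.case div e by simp_all
  next
    fix p :: "nat \<times> nat"
    obtain h k where p: "p = (h, k)" by (cases p)
    have *: "Suc (Suc h * Suc k - 1) = Suc h * Suc k" by simp
    show "(case (case p of (h, k) \<Rightarrow> (Suc h * Suc k - 1, Suc h)) of (n, d) \<Rightarrow> (d - 1, Suc n div d - 1)) = p"
      "(case p of (h, k) \<Rightarrow> (Suc h * Suc k - 1, Suc h)) \<in> (SIGMA n:UNIV. {d. d dvd Suc n})"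
      unfolding p prod.case * by (simp_all add: * del: mult_Suc mult_Suc_right)
  qed (use assms in auto)
  show "((\<lambda>d. case (n, d) of (n, d) \<Rightarrow> f d (Suc n div d)) has_sum (\<Sum>d | d dvd Suc n. f d (Suc n div d))) {d. d dvd Suc n}" for n
    by (auto intro!: has_sum_finite)
qed

text \<open>Dominated convergence for an unordered double series: \<open>prod_decode\<close>
  enumerates the pairs. Since g bounds finite sums of norms, the integrals are absolutely summable,
  so the result no longer depends on the enumeration.\<close>

lemma has_sum_integral_dominated:
  fixes f :: "nat \<times> nat \<Rightarrow> 'a \<Rightarrow> complex" and S :: "'a \<Rightarrow> complex"
  assumes meas: "\<And>p. f p \<in> borel_measurable M"
    and g: "integrable M g"
    and bd: "\<And>x F. x \<in> space M \<Longrightarrow> finite F \<Longrightarrow> (\<Sum>p\<in>F. norm (f p x)) \<le> g x"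
    and S: "\<And>x. x \<in> space M \<Longrightarrow> ((\<lambda>p. f p x) has_sum S x) UNIV"
  shows "((\<lambda>p. \<integral>x. f p x \<partial>M) has_sum (\<integral>x. S x \<partial>M)) UNIV" and "integrable M S"
proof -
  have int: "integrable M (f p)" for p
  proof (rule Bochner_Integration.integrable_bound [OF g meas], rule AE_I2)
    fix x assume "x \<in> space M"
    thus "norm (f p x) \<le> norm (g x)" using bd [of x "{p}"] by simp
  qed
  let ?f = "\<lambda>n. f (prod_decode n)"
  have bdn: "(\<Sum>n<N. norm (?f n x)) \<le> g x" if "x \<in> space M" for N x
    using bd [OF that, of "prod_decode ` {..<N}"]
    by (simp add: sum.reindex [OF inj_prod_decode] o_def)
  have "(\<lambda>n. ?f n x) sums S x" if "x \<in> space M" for x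
  proof (rule has_sum_imp_sums)
    have "bij_betw prod_decode UNIV UNIV" by (rule bij_prod_decode)
    from has_sum_reindex_bij_betw [OF this, of "\<lambda>p. f p x"] S [OF that]
    show "((\<lambda>n. ?f n x) has_sum S x) UNIV" by simp
  qed
  hence lim: "(\<lambda>N. \<Sum>n<N. ?f n x) \<longlonglongrightarrow> S x" if "x \<in> space M" for x
    using that by (simp add: sums_def)
  have Sm: "S \<in> borel_measurable M"
    by (rule borel_measurable_LIMSEQ_metric [OF _ lim]) (use meas in auto)
  have dom: "norm (\<Sum>n<N. ?f n x) \<le> g x" if "x \<in> space M" for N x
    using order_trans [OF norm_sum bdn [OF that]] .
  have conv: "(\<lambda>N. \<integral>x. (\<Sum>n<N. ?f n x) \<partial>M) \<longlonglongrightarrow> (\<integral>x. S x \<partial>M)"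
    by (rule integral_dominated_convergence [OF Sm _ g]) (use meas lim dom in auto)
  show "integrable M S"
    by (rule integrable_dominated_convergence [OF Sm _ g, of "\<lambda>N x. \<Sum>n<N. ?f n x"]) (use meas lim dom in auto)
  have sums: "(\<lambda>n. \<integral>x. ?f n x \<partial>M) sums (\<integral>x. S x \<partial>M)"
    using conv int by (simp add: sums_def)
  have "summable (\<lambda>n. norm (\<integral>x. ?f n x \<partial>M))"
  proof (rule bounded_imp_summable)
    fix N
    have "(\<Sum>n\<le>N. norm (\<integral>x. ?f n x \<partial>M)) \<le> (\<Sum>n\<le>N. \<integral>x. norm (?f n x) \<partial>M)"
      by (intro sum_mono integral_norm_bound)
    also have "\<dots> = (\<integral>x. (\<Sum>n\<le>N. norm (?f n x)) \<partial>M)"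
      using int by simp
    also have "\<dots> \<le> (\<integral>x. g x \<partial>M)"
      using int g bdn [of _ "Suc N"] by (intro integral_mono) (auto simp: lessThan_Suc_atMost)
    finally show "(\<Sum>n\<le>N. norm (\<integral>x. ?f n x \<partial>M)) \<le> (\<integral>x. g x \<partial>M)" .
  qed auto
  from norm_summable_imp_has_sum [OF this sums]
  have "((\<lambda>n. \<integral>x. ?f n x \<partial>M) has_sum (\<integral>x. S x \<partial>M)) UNIV" .
  thus "((\<lambda>p. \<integral>x. f p x \<partial>M) has_sum (\<integral>x. S x \<partial>M)) UNIV"
    using has_sum_reindex_bij_betw [OF bij_prod_decode, of "\<lambda>p. \<integral>x. f p x \<partial>M"] by simp
qed

subsection \<open>Partial fractions of the theta-like series\<close>

definition char_theta :: "nat \<Rightarrow> (nat \<Rightarrow> complex) \<Rightarrow> real \<Rightarrow> complex" where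
  "char_theta q chi y = (\<Sum>h. cnj (chi (Suc h)) * of_real (exp (- (2 * pi * real (Suc h) * y / real q))))"

lemma exp_series:
  assumes "c > 0"
  shows "(\<lambda>n. exp (- (c * real (Suc n)))) sums (exp (- c) / (1 - exp (- c)))"
proof -
  have "(\<lambda>n. exp (- c) * exp (- c) ^ n) sums (exp (- c) * (1 / (1 - exp (- c))))"
    using assms by (intro sums_mult geometric_sums) auto
  moreover have "exp (- c) * exp (- c) ^ n = exp (- (c * real (Suc n)))" for n
    by (metis exp_of_nat_mult mult.commute mult_minus_left power_Suc)
  ultimately show ?thesis by simp
qed

lemma summable_inverse_squares_shift:
  assumes "y > 0"
  shows "summable (\<lambda>j. 2 * y / (y\<^sup>2 + (real (Suc j))\<^sup>2))"
proof (rule summable_comparison_test')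
  have "summable (\<lambda>n. inverse (real n ^ 2))" by (rule inverse_power_summable) simp
  hence "summable (\<lambda>n. inverse (real (Suc n) ^ 2))" by (subst summable_Suc_iff)
  thus "summable (\<lambda>n. 2 * y * inverse (real (Suc n) ^ 2))" by (rule summable_mult)
  show "norm (2 * y / (y\<^sup>2 + (real (Suc j))\<^sup>2)) \<le> 2 * y * inverse (real (Suc j) ^ 2)" for j
    using assms by (auto simp: divide_inverse intro!: mult_left_mono le_imp_inverse_le simp del: of_nat_Suc)
qed

text \<open>The previous expansion at w = i x. The value is pi coth(pi x) - 1/x.\<close>

lemma geometric_partial_fractions:
  assumes x: "x > 0"
  shows "(\<lambda>d. 2 * x / (x\<^sup>2 + (real (Suc d))\<^sup>2)) sums (pi * (1 + 2 * (exp (- (2 * pi * x)) / (1 - exp (- (2 * pi * x))))) - 1 / x)"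
proof -
  let ?x = "complex_of_real x"
  let ?E = "exp (- (2 * pi * x))"
  let ?p = "\<lambda>m. 1 / (?x - \<i> * of_nat m) + 1 / (?x + \<i> * of_nat (Suc m))"
  have nz: "?x - \<i> * of_nat m \<noteq> 0" "?x + \<i> * of_nat m \<noteq> 0" for m
    using x by (auto simp: complex_eq_iff)
  have t1: "\<i> * (1 / (\<i> * ?x + of_nat m) + 1 / (\<i> * ?x - 1 - of_nat m)) = ?p m" for m
  proof -
    have 1: "\<i> * ?x + of_nat m = \<i> * (?x - \<i> * of_nat m)" by (simp add: algebra_simps)
    have 2: "\<i> * ?x - 1 - of_nat m = \<i> * (?x + \<i> * of_nat (Suc m))" by (simp add: algebra_simps)
    have "\<i> * (1 / (\<i> * u) + 1 / (\<i> * v)) = 1 / u + 1 / v" for u v :: complex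
      by (cases "u = 0"; cases "v = 0") (auto simp: field_simps)
    thus ?thesis unfolding 1 2 .
  qed
  have "exp (2 * of_real pi * \<i> * (\<i> * ?x)) = of_real ?E"
  proof -
    have "2 * of_real pi * \<i> * (\<i> * ?x) = of_real (- (2 * pi * x))" by (simp add: mult_ac)
    thus ?thesis by (simp only: exp_of_real)
  qed
  hence "?p sums (of_real pi * (1 + 2 * of_real ?E / (1 - of_real ?E)))"
    using exp_partial_fractions [of "\<i> * ?x"] x by (simp only: t1) simp
  hence "(\<lambda>M. \<Sum>m<M. ?p m) \<longlonglongrightarrow> of_real pi * (1 + 2 * of_real ?E / (1 - of_real ?E))"
    by (simp add: sums_def)
  moreover have "(\<lambda>M. 1 / (?x - \<i> * of_nat M)) \<longlonglongrightarrow> 0"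
  proof (rule Lim_null_comparison [OF eventually_at_top_linorderI [of 1]])
    show "norm (1 / (?x - \<i> * of_nat M)) \<le> 1 / real M" if "M \<ge> 1" for M
    proof -
      have "real M \<le> norm (?x - \<i> * of_nat M)"
        using abs_Im_le_cmod [of "?x - \<i> * of_nat M"] by simp
      thus ?thesis using that by (simp add: norm_divide frac_le)
    qed
    show "(\<lambda>M. 1 / real M) \<longlonglongrightarrow> 0" by (rule lim_1_over_n)
  qed
  \<comment> \<open>The cotangent series joins the frequency m to m + 1 of opposite sign. Pairing
    equal frequencies instead costs a boundary term tending to 0 and leaves the single term 1/x
    apart.\<close>
  ultimately have "(\<lambda>M. (\<Sum>m<M. ?p m) + 1 / (?x - \<i> * of_nat M) - 1 / ?x) \<longlonglongrightarrow>
      of_real pi * (1 + 2 * of_real ?E / (1 - of_real ?E)) + 0 - 1 / ?x"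
    by (intro tendsto_intros)
  moreover have "(\<Sum>m<M. ?p m) + 1 / (?x - \<i> * of_nat M) - 1 / ?x = of_real (\<Sum>d<M. 2 * x / (x\<^sup>2 + (real (Suc d))\<^sup>2))" for M
  proof (induction M)
    case (Suc M)
    have "1 / (?x - \<i> * of_nat (Suc M)) + 1 / (?x + \<i> * of_nat (Suc M)) = of_real (2 * x / (x\<^sup>2 + (real (Suc M))\<^sup>2))"
    proof -
      have "(?x - \<i> * of_nat (Suc M)) * (?x + \<i> * of_nat (Suc M)) = of_real (x\<^sup>2 + (real (Suc M))\<^sup>2)"
        by (simp add: algebra_simps power2_eq_square)
      thus ?thesis using nz [of "Suc M"] by (simp add: add_frac_eq mult_ac del: of_nat_Suc)
    qed
    moreover have "(\<Sum>m<Suc M. ?p m) + 1 / (?x - \<i> * of_nat (Suc M)) - 1 / ?x =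
        ((\<Sum>m<M. ?p m) + 1 / (?x - \<i> * of_nat M) - 1 / ?x) +
        (1 / (?x - \<i> * of_nat (Suc M)) + 1 / (?x + \<i> * of_nat (Suc M)))"
      unfolding sum.lessThan_Suc by (simp only: algebra_simps)
    ultimately show ?case unfolding Suc.IH by (simp only: sum.lessThan_Suc of_real_add)
  qed simp
  ultimately have "(\<lambda>M. complex_of_real (\<Sum>d<M. 2 * x / (x\<^sup>2 + (real (Suc d))\<^sup>2))) \<longlonglongrightarrow>
      of_real (pi * (1 + 2 * (?E / (1 - ?E))) - 1 / x)"
    by simp
  thus ?thesis unfolding sums_def by (simp only: tendsto_of_real_iff)
qed

text \<open>Uniform in x: the part of pi coth(pi x) exceeding pi is at most 1/x, which is the amount
  subtracted.\<close>

lemma sum_inverse_squares_shift_le_pi: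
  assumes x: "x > 0"
  shows "(\<Sum>d. 2 * x / (x\<^sup>2 + (real (Suc d))\<^sup>2)) \<le> pi"
proof -
  define c where "c = 2 * pi * x"
  have c: "c > 0" using x by (simp add: c_def)
  have "exp (- c) / (1 - exp (- c)) \<le> 1 / c"
  proof -
    have "c * exp (- c) \<le> 1 - exp (- c)"
      using exp_ge_add_one_self [of c] by (simp add: exp_minus field_simps)
    thus ?thesis using c by (simp add: field_simps)
  qed
  hence "2 * pi * (exp (- c) / (1 - exp (- c))) \<le> 2 * pi * (1 / c)" by (intro mult_left_mono) auto
  also have "\<dots> = 1 / x" using x by (simp add: c_def)
  finally show ?thesis
    using sums_unique [OF geometric_partial_fractions [OF x]] by (simp add: c_def algebra_simps)
qed

locale even_primitive_char =
  fixes q :: nat and chi :: "nat \<Rightarrow> complex"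
  assumes prim: "primitive_char q chi" and q1: "q > 1" and even: "even_char q chi"
begin

lemma chi: "dirichlet_char q chi"
  using prim by (simp add: primitive_char_def)

lemma tau: "gauss_sum q chi \<noteq> 0"
  by (rule gauss_sum_nonzero [OF prim q1])

text \<open>Apply the expansion at (a + i y)/q and average over a with weight chi a. The constant
  terms cancel because chi sums to 0 over a period, Gauss sums turn the exponentials into the
  theta-like series, and evenness makes the two families of fractions conjugate.\<close>

lemma char_partial_fractions:
  assumes y: "y > 0"
  shows "(\<lambda>j. chi (Suc j) * of_real (2 * y / (y\<^sup>2 + (real (Suc j))\<^sup>2))) sums
           (of_real (2 * pi / real q) * gauss_sum q chi * char_theta q chi y)"
proof -
  let ?y = "complex_of_real y"
  define w where "w = (\<lambda>a::nat. (of_nat a + \<i> * ?y) / of_nat q)"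
  define E where "E = (\<lambda>a::nat. root_char q a * of_real (exp (- (2 * pi * y / real q))))"
  have E: "exp (2 * of_real pi * \<i> * w a) = E a" for a
  proof -
    have "2 * of_real pi * \<i> * w a = 2 * of_real pi * \<i> * of_nat a / of_nat q + of_real (- (2 * pi * y / real q))"
      using q1 by (simp add: w_def field_simps)
    thus ?thesis by (simp only: E_def root_char_def exp_add exp_of_real)
  qed
  have nE: "norm (E a) < 1" for a
    using y q1 by (simp add: E_def root_char_def norm_mult)
  have nz: "?y - \<i> * x \<noteq> 0" "?y + \<i> * x \<noteq> 0" if "x \<in> \<real>" for x
    using y that by (auto simp: complex_eq_iff elim!: Reals_cases)
  have block: "(\<lambda>m. chi a * (1 / (?y - \<i> * of_nat (a + q * m)) + 1 / (?y + \<i> * of_nat (q * m + (q - a))))) sums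
      (chi a * (of_real (pi / real q) * (1 + 2 * E a / (1 - E a))))" if a: "a \<le> q" for a
  proof -
    have "Im (w a) > 0" using y q1 by (simp add: w_def)
    from sums_mult [OF exp_partial_fractions [OF this], of "chi a / of_nat q"]
    have "(\<lambda>m. chi a / of_nat q * (\<i> * (1 / (w a + of_nat m) + 1 / (w a - 1 - of_nat m)))) sums
       (chi a * (of_real (pi / real q) * (1 + 2 * E a / (1 - E a))))"
      unfolding E by (simp add: mult_ac)
    also have "(\<lambda>m. chi a / of_nat q * (\<i> * (1 / (w a + of_nat m) + 1 / (w a - 1 - of_nat m)))) =
      (\<lambda>m. chi a * (1 / (?y - \<i> * of_nat (a + q * m)) + 1 / (?y + \<i> * of_nat (q * m + (q - a)))))"
    proof
      fix m
      have 1: "w a + of_nat m = \<i> / of_nat q * (?y - \<i> * of_nat (a + q * m))"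
        using q1 by (simp add: w_def field_simps)
      have "complex_of_nat (q - a) = of_nat q - of_nat a" using a by (simp add: of_nat_diff)
      hence 2: "w a - 1 - of_nat m = \<i> / of_nat q * (?y + \<i> * of_nat (q * m + (q - a)))"
        using q1 by (simp add: w_def field_simps)
      have "chi a / of_nat q * (\<i> * (1 / (\<i> / of_nat q * u) + 1 / (\<i> / of_nat q * v))) = chi a * (1 / u + 1 / v)" for u v :: complex
        using q1 by (cases "u = 0"; cases "v = 0") (auto simp: field_simps)
      thus "chi a / of_nat q * (\<i> * (1 / (w a + of_nat m) + 1 / (w a - 1 - of_nat m))) =
        chi a * (1 / (?y - \<i> * of_nat (a + q * m)) + 1 / (?y + \<i> * of_nat (q * m + (q - a))))"
        unfolding 1 2 .
    qed
    finally show ?thesis .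
  qed
  define c where "c = (\<lambda>j. chi j * of_real (2 * y / (y\<^sup>2 + (real j)\<^sup>2)))"
  have "(\<lambda>m. \<Sum>a=1..q. chi a * (1 / (?y - \<i> * of_nat (a + q * m)) + 1 / (?y + \<i> * of_nat (q * m + (q - a))))) sums
      (\<Sum>a=1..q. chi a * (of_real (pi / real q) * (1 + 2 * E a / (1 - E a))))"
    by (intro sums_sum block) auto
  also have "(\<lambda>m. \<Sum>a=1..q. chi a * (1 / (?y - \<i> * of_nat (a + q * m)) + 1 / (?y + \<i> * of_nat (q * m + (q - a))))) =
     (\<lambda>m. \<Sum>j\<in>{m * q..<m * q + q}. c (Suc j))"
  proof
    fix m
    have chi0: "chi q = 0" "chi 0 = 0" using chi q1 by (auto simp: dirichlet_char_def)
    have ins: "{1..q} = insert q {1..<q}" using q1 by auto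
    have "(\<Sum>a=1..q. chi a * (1 / (?y + \<i> * of_nat (q * m + (q - a))))) = (\<Sum>a=1..<q. chi a * (1 / (?y + \<i> * of_nat (q * m + (q - a)))))"
      unfolding ins by (simp add: chi0 del: of_nat_add of_nat_diff of_nat_mult)
    also have "\<dots> = (\<Sum>a=1..<q. chi a * (1 / (?y + \<i> * of_nat (q * m + a))))"
      by (rule sum.reindex_bij_witness [of _ "\<lambda>a. q - a" "\<lambda>a. q - a"])
         (auto simp: even_char_reflect [OF chi even])
    also have "\<dots> = (\<Sum>a=1..q. chi a * (1 / (?y + \<i> * of_nat (q * m + a))))"
      unfolding ins by (simp add: chi0 del: of_nat_add of_nat_diff of_nat_mult)
    finally have r: "(\<Sum>a=1..q. chi a * (1 / (?y + \<i> * of_nat (q * m + (q - a))))) = (\<Sum>a=1..q. chi a * (1 / (?y + \<i> * of_nat (q * m + a))))" .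
    have "(\<Sum>a=1..q. chi a * (1 / (?y - \<i> * of_nat (a + q * m)) + 1 / (?y + \<i> * of_nat (q * m + (q - a))))) =
       (\<Sum>a=1..q. chi a * (1 / (?y - \<i> * of_nat (q * m + a)) + 1 / (?y + \<i> * of_nat (q * m + a))))"
      unfolding distrib_left sum.distrib r by (simp only: add.commute)
    also have "\<dots> = (\<Sum>a=1..q. c (q * m + a))"
    proof (intro sum.cong refl)
      fix a
      have "chi (q * m + a) = chi a" by (rule dirichlet_char_cong [OF chi]) (simp add: cong_def)
      moreover have "1 / (?y - \<i> * of_nat j) + 1 / (?y + \<i> * of_nat j) = of_real (2 * y / (y\<^sup>2 + (real j)\<^sup>2))" for j
      proof -
        have "(?y - \<i> * of_nat j) * (?y + \<i> * of_nat j) = of_real (y\<^sup>2 + (real j)\<^sup>2)"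
          by (simp add: algebra_simps power2_eq_square)
        thus ?thesis using nz [of "of_nat j"] by (simp add: add_frac_eq mult_ac)
      qed
      ultimately show "chi a * (1 / (?y - \<i> * of_nat (q * m + a)) + 1 / (?y + \<i> * of_nat (q * m + a))) = c (q * m + a)"
        by (simp only: c_def)
    qed
    also have "\<dots> = (\<Sum>j\<in>{m * q..<m * q + q}. c (Suc j))"
      by (rule sum.reindex_bij_witness [of _ "\<lambda>j. Suc j - m * q" "\<lambda>a. m * q + a - 1"]) (auto simp: mult.commute)
    finally show "(\<Sum>a=1..q. chi a * (1 / (?y - \<i> * of_nat (a + q * m)) + 1 / (?y + \<i> * of_nat (q * m + (q - a))))) =
      (\<Sum>j\<in>{m * q..<m * q + q}. c (Suc j))" .
  qed
  finally have 1: "(\<lambda>m. \<Sum>j\<in>{m * q..<m * q + q}. c (Suc j)) sums (\<Sum>a=1..q. chi a * (of_real (pi / real q) * (1 + 2 * E a / (1 - E a))))" .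
  have sc: "summable (\<lambda>j. c (Suc j))"
  proof (rule summable_comparison_test' [OF summable_inverse_squares_shift [OF y]])
    have "0 \<le> 2 * y / (y\<^sup>2 + (real (Suc j))\<^sup>2)" for j using y by (intro divide_nonneg_nonneg) auto
    thus "norm (c (Suc j)) \<le> 2 * y / (y\<^sup>2 + (real (Suc j))\<^sup>2)" for j
      unfolding c_def norm_mult norm_of_real
      by (intro mult_le_one_mono norm_dirichlet_char(2) [OF chi]) (simp_all only: abs_of_nonneg order_refl)
  qed
  \<comment> \<open>The series over j is summable, so grouping it into periods does not change its
    sum.\<close>
  have "(\<lambda>j. c (Suc j)) sums (\<Sum>a=1..q. chi a * (of_real (pi / real q) * (1 + 2 * E a / (1 - E a))))"
    using sums_group [OF summable_sums [OF sc], of q] 1 q1 sums_unique2 summable_sums [OF sc] by fastforce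
  also have "(\<Sum>a=1..q. chi a * (of_real (pi / real q) * (1 + 2 * E a / (1 - E a)))) =
     of_real (pi / real q) * (\<Sum>a=1..q. chi a) + of_real (2 * pi / real q) * (\<Sum>a=1..q. chi a * (E a / (1 - E a)))"
    unfolding sum_distrib_left sum.distrib [symmetric] by (intro sum.cong refl) (simp add: algebra_simps)
  also have "(\<Sum>a=1..q. chi a) = 0" by (rule sum_primitive_char [OF prim q1])
  also have "(\<Sum>a=1..q. chi a * (E a / (1 - E a))) = gauss_sum q chi * char_theta q chi y"
  proof -
    have "(\<lambda>h. \<Sum>a=1..q. chi a * (E a * E a ^ h)) sums (\<Sum>a=1..q. chi a * (E a * (1 / (1 - E a))))"
      by (intro sums_sum sums_mult geometric_sums nE)
    also have "(\<lambda>h. \<Sum>a=1..q. chi a * (E a * E a ^ h)) =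
       (\<lambda>h. gauss_sum q chi * (cnj (chi (Suc h)) * of_real (exp (- (2 * pi * real (Suc h) * y / real q)))))"
    proof
      fix h
      have e: "exp (- (2 * pi * y / real q)) ^ Suc h = exp (- (2 * pi * real (Suc h) * y / real q))"
        unfolding exp_of_nat_mult [symmetric] by (simp add: field_simps)
      have "E a ^ Suc h = root_char q (a * Suc h) * of_real (exp (- (2 * pi * real (Suc h) * y / real q)))" for a
        unfolding E_def power_mult_distrib root_char_power of_real_power [symmetric] e ..
      hence "E a * E a ^ h = root_char q (a * Suc h) * of_real (exp (- (2 * pi * real (Suc h) * y / real q)))" for a
        by (simp only: power_Suc)
      hence "(\<Sum>a=1..q. chi a * (E a * E a ^ h)) = (\<Sum>a=1..q. chi a * root_char q (a * Suc h)) * of_real (exp (- (2 * pi * real (Suc h) * y / real q)))"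
        by (simp only: sum_distrib_right mult.assoc)
      thus "(\<Sum>a=1..q. chi a * (E a * E a ^ h)) = gauss_sum q chi * (cnj (chi (Suc h)) * of_real (exp (- (2 * pi * real (Suc h) * y / real q))))"
        unfolding primitive_gauss_sum [OF prim q1] by (simp only: mult_ac)
    qed
    finally have s: "(\<lambda>h. gauss_sum q chi * (cnj (chi (Suc h)) * of_real (exp (- (2 * pi * real (Suc h) * y / real q))))) sums
        (\<Sum>a=1..q. chi a * (E a * (1 / (1 - E a))))" .
    have "summable (\<lambda>h. cnj (chi (Suc h)) * complex_of_real (exp (- (2 * pi * real (Suc h) * y / real q))))"
      by (rule summable_mult_D [OF sums_summable [OF s] gauss_sum_nonzero [OF prim q1]])
    hence "(\<Sum>h. gauss_sum q chi * (cnj (chi (Suc h)) * of_real (exp (- (2 * pi * real (Suc h) * y / real q))))) = gauss_sum q chi * char_theta q chi y"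
      unfolding char_theta_def by (rule suminf_mult)
    thus ?thesis using sums_unique [OF s] by simp
  qed
  finally show ?thesis by (simp add: c_def mult.assoc)
qed

end

section \<open>Size and Mellin transform of the theta-like series\<close>

lemma abel_summation_bound:
  fixes b :: "nat \<Rightarrow> complex" and f :: "nat \<Rightarrow> real"
  assumes B: "\<And>n. norm (\<Sum>i<n. b i) \<le> B" and dec: "\<And>n. f (Suc n) \<le> f n" and pos: "\<And>n. 0 \<le> f n"
  shows "norm (\<Sum>i<N. b i * of_real (f i)) \<le> B * f 0"
proof -
  define S where "S = (\<lambda>n. \<Sum>i<n. b i)"
  have B0: "B \<ge> 0" using order_trans [OF norm_ge_zero B] .
  have "(\<Sum>i<N. b i * of_real (f i)) = S N * of_real (f N) + (\<Sum>i<N. S (Suc i) * of_real (f i - f (Suc i)))"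
    by (induction N) (auto simp: S_def algebra_simps)
  also have "norm \<dots> \<le> B * f N + (\<Sum>i<N. B * (f i - f (Suc i)))"
  proof (intro order_trans [OF norm_triangle_ineq] add_mono sum_norm_le)
    show "norm (S N * of_real (f N)) \<le> B * f N"
      using B [of N] pos [of N] by (simp add: S_def norm_mult mult_right_mono)
    show "norm (S (Suc i) * of_real (f i - f (Suc i))) \<le> B * (f i - f (Suc i))" for i
      using B [of "Suc i"] dec [of i] unfolding norm_mult norm_of_real S_def
      using B0 by (intro mult_mono) (auto simp del: sum.lessThan_Suc)
  qed
  also have "\<dots> = B * f 0"
    unfolding sum_distrib_left [symmetric] sum_lessThan_telescope' by (simp add: algebra_simps)
  finally show ?thesis .
qed

text \<open>Unlike the general substitution this asks for no continuity, so it applies to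
  \<open>char_theta\<close>, for which only measurability is established.\<close>

lemma half_line_scale:
  fixes F :: "real \<Rightarrow> 'a :: {banach, second_countable_topology}"
  assumes c: "c > 0"
  shows "integrable half_line (\<lambda>y. F (c * y)) \<longleftrightarrow> integrable half_line F"
    and "integral\<^sup>L half_line F = c *\<^sub>R (\<integral>y. F (c * y) \<partial>half_line)"
proof -
  let ?G = "\<lambda>x. indicator {0<..} x *\<^sub>R F x"
  have eq: "indicator {0<..} y *\<^sub>R F (c * y) = ?G (0 + c * y)" for y
    using c by (auto simp: indicator_def zero_less_mult_iff)
  show "integrable half_line (\<lambda>y. F (c * y)) \<longleftrightarrow> integrable half_line F"
  proof -
    have "integrable lborel (\<lambda>y. indicator {0<..} y *\<^sub>R F (c * y)) \<longleftrightarrow> integrable lborel ?G"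
      unfolding eq using c by (intro lborel_integrable_real_affine_iff) auto
    thus ?thesis unfolding half_line_def by (subst (1 2) integrable_restrict_space) auto
  qed
  have "integral\<^sup>L lborel ?G = \<bar>c\<bar> *\<^sub>R (\<integral>y. ?G (0 + c * y) \<partial>lborel)"
    using c by (intro lborel_integral_real_affine) auto
  hence "integral\<^sup>L lborel ?G = c *\<^sub>R (\<integral>y. indicator {0<..} y *\<^sub>R F (c * y) \<partial>lborel)"
    unfolding eq using c by simp
  thus "integral\<^sup>L half_line F = c *\<^sub>R (\<integral>y. F (c * y) \<partial>half_line)"
    unfolding half_line_def by (subst (1 2) integral_restrict_space) auto
qed

text \<open>Two bounds for 1/(exp x - 1). With x = 2 pi/y the first controls large y by y^2; with x
  proportional to y the second keeps exponential decay. Together they dominate the double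
  exponential series.\<close>

lemma exp_geometric_bounds:
  fixes x :: real
  assumes x: "x > 0"
  shows "exp (- x) / (1 - exp (- x)) \<le> 2 / x\<^sup>2"
    and "exp (- x) / (1 - exp (- x)) \<le> 2 * exp (- (x / 2)) / x"
    and "exp (- x) / (1 - exp (- x)) > 0"
proof -
  have e: "exp (- x) / (1 - exp (- x)) = 1 / (exp x - 1)"
    by (simp add: exp_minus field_simps)
  have pos: "exp x - 1 > 0" using x by simp
  show "exp (- x) / (1 - exp (- x)) > 0" unfolding e using pos by simp
  have "x\<^sup>2 / 2 \<le> exp x - 1" using exp_lower_Taylor_quadratic [of x] x by simp
  hence "1 / (exp x - 1) \<le> 1 / (x\<^sup>2 / 2)" using x by (intro divide_left_mono) auto
  thus "exp (- x) / (1 - exp (- x)) \<le> 2 / x\<^sup>2" unfolding e by simp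
  have "x / 2 * exp (x / 2) \<le> (exp (x / 2) - 1) * (exp (x / 2) + 1)"
    using x exp_ge_add_one_self [of "x / 2"] by (intro mult_mono) (auto simp: algebra_simps)
  also have "\<dots> = exp x - 1" by (simp add: algebra_simps flip: exp_add)
  finally have "1 / (exp x - 1) \<le> 1 / (x / 2 * exp (x / 2))" using x by (intro divide_left_mono) auto
  thus "exp (- x) / (1 - exp (- x)) \<le> 2 * exp (- (x / 2)) / x" unfolding e by (simp add: exp_minus field_simps)
qed

lemma macdonald_scaled:
  assumes a: "a > 0" and c: "c > 0"
  shows "(\<integral>y. of_real y powr (\<nu> - 1) * (of_real (exp (- (c * y))) * of_real (exp (- (a / y)))) \<partial>half_line)
           = of_real c powr (- \<nu>) * macdonald \<nu> (of_real (a * c))"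
proof -
  let ?F = "\<lambda>y. complex_of_real y powr (\<nu> - 1) * exp (- of_real y - of_real (a * c) / of_real y)"
  have "macdonald \<nu> (of_real (a * c)) = c *\<^sub>R (\<integral>y. ?F (c * y) \<partial>half_line)"
    unfolding macdonald_def by (rule half_line_scale(2) [OF c])
  also have "(\<integral>y. ?F (c * y) \<partial>half_line) =
     (\<integral>y. of_real c powr (\<nu> - 1) * (of_real y powr (\<nu> - 1) * (of_real (exp (- (c * y))) * of_real (exp (- (a / y))))) \<partial>half_line)"
  proof (intro Bochner_Integration.integral_cong refl)
    fix y assume "y \<in> space half_line"
    hence y: "y > 0" by simp
    have "- complex_of_real (c * y) - of_real (a * c) / of_real (c * y) = of_real (- (c * y)) + of_real (- (a / y))"
      using c by simp
    hence "exp (- complex_of_real (c * y) - of_real (a * c) / of_real (c * y)) = of_real (exp (- (c * y))) * of_real (exp (- (a / y)))"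
      by (simp only: exp_add exp_of_real)
    moreover have "complex_of_real (c * y) powr (\<nu> - 1) = of_real c powr (\<nu> - 1) * of_real y powr (\<nu> - 1)"
      using c y by (simp add: powr_times_real)
    ultimately show "?F (c * y) = of_real c powr (\<nu> - 1) * (of_real y powr (\<nu> - 1) * (of_real (exp (- (c * y))) * of_real (exp (- (a / y)))))"
      by (simp only: mult.assoc)
  qed
  also have "\<dots> = of_real c powr (\<nu> - 1) * (\<integral>y. of_real y powr (\<nu> - 1) * (of_real (exp (- (c * y))) * of_real (exp (- (a / y)))) \<partial>half_line)"
    by (rule integral_mult_right_zero)
  finally have "of_real c powr (- \<nu>) * macdonald \<nu> (of_real (a * c)) = (of_real c powr (- \<nu>) * (of_real c * of_real c powr (\<nu> - 1))) *
     (\<integral>y. of_real y powr (\<nu> - 1) * (of_real (exp (- (c * y))) * of_real (exp (- (a / y)))) \<partial>half_line)"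
    by (simp only: scaleR_conv_of_real mult.assoc)
  also have "of_real c powr (- \<nu>) * (complex_of_real c * of_real c powr (\<nu> - 1)) = 1"
    using c by (simp add: powr_diff powr_minus)
  finally show ?thesis by simp
qed

lemma sum_lessThan_add:
  fixes f :: "nat \<Rightarrow> 'a :: comm_monoid_add"
  shows "(\<Sum>i<m + n. f i) = (\<Sum>i<m. f i) + (\<Sum>j<n. f (m + j))"
  by (induction n) (auto simp: add.assoc)

context even_primitive_char
begin

lemma char_partial_sums_bound: "norm (\<Sum>i<n. chi (Suc i)) \<le> real q"
proof -
  have per: "chi (Suc (q * k + j)) = chi (Suc j)" for k j
  proof (rule dirichlet_char_cong [OF chi])
    have "Suc (q * k + j) = Suc j + q * k" by simp
    thus "[Suc (q * k + j) = Suc j] (mod q)" unfolding cong_def by (simp only: mod_mult_self2)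
  qed
  have "(\<Sum>j<q. chi (Suc j)) = (\<Sum>a=1..q. chi a)"
    by (rule sum.reindex_bij_witness [of _ "\<lambda>a. a - 1" Suc]) auto
  hence period: "(\<Sum>j<q. chi (Suc j)) = 0" using sum_primitive_char [OF prim q1] by simp
  have full: "(\<Sum>i<q * k. chi (Suc i)) = 0" for k
  proof (induction k)
    case (Suc k)
    have "(\<Sum>i<q * Suc k. chi (Suc i)) = (\<Sum>i<q * k + q. chi (Suc i))" by (simp add: add.commute)
    thus ?case unfolding sum_lessThan_add per Suc.IH period by simp
  qed simp
  have "(\<Sum>i<n. chi (Suc i)) = (\<Sum>i<q * (n div q) + n mod q. chi (Suc i))" by simp
  also have "\<dots> = (\<Sum>j<n mod q. chi (Suc j))" unfolding sum_lessThan_add per full by simp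
  also have "norm \<dots> \<le> (\<Sum>j<n mod q. 1)" by (intro sum_norm_le norm_dirichlet_char(2) [OF chi])
  also have "\<dots> \<le> real q" using q1 by (simp add: less_imp_le)
  finally show ?thesis .
qed

text \<open>For y \<ge> 1 a geometric series suffices. Near 0 absolute values in the exponential
  series would give only 1/y; there the partial fractions, bounded by pi, show that the cancellation
  in the character keeps the function bounded.\<close>

lemma char_theta_bound:
  obtains C where "C > 0" "\<And>y. y > 0 \<Longrightarrow> norm (char_theta q chi y) \<le> C * exp (- (2 * pi * y / real q))"
proof -
  define c where "c = 2 * pi / real q"
  have c: "c > 0" using q1 by (simp add: c_def)
  define K where "K = pi / (c * norm (gauss_sum q chi))"
  have K: "K > 0" using c tau by (simp add: K_def)
  define C where "C = 1 / (1 - exp (- c)) + K * exp c"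
  have C: "C > 0" using c K by (auto simp: C_def intro!: add_pos_pos)
  have "norm (char_theta q chi y) \<le> C * exp (- (2 * pi * y / real q))" if y: "y > 0" for y
  proof (cases "y \<ge> 1")
    case True
    have cy: "c \<le> c * y" "c * y > 0" using True c by auto
    note s = exp_series [OF cy(2)]
    have "norm (char_theta q chi y) \<le> (\<Sum>h. exp (- (c * y * real (Suc h))))"
      unfolding char_theta_def
    proof (rule norm_suminf_le [OF _ sums_summable [OF s]])
      fix h
      have "2 * pi * real (Suc h) * y / real q = c * y * real (Suc h)" by (simp add: c_def)
      thus "norm (cnj (chi (Suc h)) * of_real (exp (- (2 * pi * real (Suc h) * y / real q)))) \<le> exp (- (c * y * real (Suc h)))"
        unfolding norm_mult by (intro mult_le_one_mono) (auto simp: norm_dirichlet_char(2) [OF chi])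
    qed
    also have "\<dots> = exp (- (c * y)) / (1 - exp (- (c * y)))" using sums_unique [OF s] by simp
    also have "\<dots> \<le> exp (- (c * y)) / (1 - exp (- c))"
      using cy c by (intro divide_left_mono mult_pos_pos) auto
    also have "\<dots> \<le> C * exp (- (c * y))"
      using K by (simp add: C_def algebra_simps)
    finally show ?thesis by (simp add: c_def)
  next
    case False
    have "norm (of_real c * gauss_sum q chi * char_theta q chi y) \<le> pi"
    proof -
      have "of_real c * gauss_sum q chi * char_theta q chi y = (\<Sum>j. chi (Suc j) * of_real (2 * y / (y\<^sup>2 + (real (Suc j))\<^sup>2)))"
        using sums_unique [OF char_partial_fractions [OF y]] by (simp add: c_def)
      also have "norm \<dots> \<le> (\<Sum>j. 2 * y / (y\<^sup>2 + (real (Suc j))\<^sup>2))"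
      proof (rule norm_suminf_le [OF _ summable_inverse_squares_shift [OF y]])
        fix j
        have "0 \<le> 2 * y / (y\<^sup>2 + (real (Suc j))\<^sup>2)" using y by (intro divide_nonneg_nonneg) auto
        thus "norm (chi (Suc j) * of_real (2 * y / (y\<^sup>2 + (real (Suc j))\<^sup>2))) \<le> 2 * y / (y\<^sup>2 + (real (Suc j))\<^sup>2)"
          unfolding norm_mult norm_of_real
          by (intro mult_le_one_mono norm_dirichlet_char(2) [OF chi]) (simp_all only: abs_of_nonneg order_refl)
      qed
      also have "\<dots> \<le> pi" by (rule sum_inverse_squares_shift_le_pi [OF y])
      finally show ?thesis .
    qed
    hence "norm (char_theta q chi y) \<le> K"
      using c tau by (simp add: K_def norm_mult field_simps)
    also have "K \<le> K * (exp c * exp (- (c * y)))"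
    proof -
      have "c * y \<le> c" using False c by (simp add: mult_left_le)
      hence "1 \<le> exp c * exp (- (c * y))" by (simp flip: exp_add)
      thus ?thesis using K by simp
    qed
    also have "\<dots> \<le> C * exp (- (c * y))"
      using c by (simp add: C_def distrib_right mult.assoc)
    finally show ?thesis by (simp add: c_def)
  qed
  thus ?thesis using that C by blast
qed

lemma char_theta_measurable: "char_theta q chi \<in> borel_measurable half_line"
  unfolding char_theta_def [abs_def]
  by (intro borel_measurable_suminf measurable_half_line continuous_intros) (use q1 in auto)

lemma char_theta_mellin_integrable:
  assumes s: "Re s > 0"
  shows "integrable half_line (\<lambda>u. of_real u powr (s - 1) * char_theta q chi u)"
proof -
  obtain C where C: "C > 0" "\<And>y. y > 0 \<Longrightarrow> norm (char_theta q chi y) \<le> C * exp (- (2 * pi * y / real q))"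
    by (rule char_theta_bound) blast
  have "integrable half_line (\<lambda>u. C * (u powr (Re s - 1) * exp (- (2 * pi / real q * u))))"
    using s q1 by (intro integrable_mult_right half_line_Gamma_real) auto
  thus ?thesis
  proof (rule Bochner_Integration.integrable_bound)
    have [measurable]: "(\<lambda>u. complex_of_real u powr (s - 1)) \<in> borel_measurable half_line"
      by (intro measurable_half_line continuous_intros) auto
    note char_theta_measurable [measurable]
    show "(\<lambda>u. of_real u powr (s - 1) * char_theta q chi u) \<in> borel_measurable half_line" by measurable
    show "AE u in half_line. norm (of_real u powr (s - 1) * char_theta q chi u) \<le> norm (C * (u powr (Re s - 1) * exp (- (2 * pi / real q * u))))"
    proof (rule AE_I2)
      fix u assume "u \<in> space half_line"
      hence u: "u > 0" by simp
      have "norm (of_real u powr (s - 1) * char_theta q chi u) \<le> u powr (Re s - 1) * (C * exp (- (2 * pi * u / real q)))"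
        using C(2) [OF u] u by (simp add: norm_mult norm_of_real_powr mult_left_mono)
      thus "norm (of_real u powr (s - 1) * char_theta q chi u) \<le> norm (C * (u powr (Re s - 1) * exp (- (2 * pi / real q * u))))"
        using C(1) by (simp add: abs_mult mult_ac)
    qed
  qed
qed

text \<open>The Dirichlet series of \<open>L(1 - \<nu>, \<chi>)\<close> converges only conditionally, so the interchange rests on
  Abel summation: the partial sums of the partial fraction expansion are dominated by \<open>q u / (1 + u\<^sup>2)\<close>.\<close>
lemma char_theta_mellin:
  assumes \<nu>: "0 < Re \<nu>" "Re \<nu> < 1"
  shows "(\<integral>u. of_real u powr (\<nu> - 1) * char_theta q chi u \<partial>half_line) =
     of_nat q / gauss_sum q chi * dirichlet_L chi (1 - \<nu>) / (2 * cos (of_real pi * \<nu> / 2))"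
proof -
  define cs where "cs = cos (of_real pi * \<nu> / 2)"
  define sN where "sN = (\<lambda>N u. \<Sum>j<N. chi (Suc j) * (of_real u powr (\<nu> - 1) * of_real (u / (u\<^sup>2 + (real (Suc j))\<^sup>2))))"
  define I where "I = (\<integral>u. of_real u powr (\<nu> - 1) * char_theta q chi u \<partial>half_line)"
  have sin: "sin (of_real pi * (\<nu> + 1) / 2) = cs"
  proof -
    have "of_real pi * (\<nu> + 1) / 2 = of_real pi * \<nu> / 2 + of_real (pi / 2)" by (simp add: field_simps)
    moreover have "sin (complex_of_real (pi / 2)) = 1" "cos (complex_of_real (pi / 2)) = 0"
      by (simp_all only: sin_of_real cos_of_real sin_pi_half cos_pi_half of_real_1 of_real_0)
    ultimately show ?thesis by (simp only: sin_add cs_def) simp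
  qed
  have "sin (of_real pi * ((\<nu> + 1) / 2)) \<noteq> 0" using \<nu> by (intro sin_pi_nonzero) auto
  hence cs: "cs \<noteq> 0" using sin by simp
  have term_eq: "complex_of_real u powr (\<nu> - 1) * of_real (u / (u\<^sup>2 + J\<^sup>2)) =
      of_real (1 / J\<^sup>2) * (of_real u powr ((\<nu> + 1) - 1) / of_real (1 + (1 / J * u)\<^sup>2))" if u: "u > 0" and J: "J > 0" for u J
  proof -
    have "complex_of_real u powr ((\<nu> + 1) - 1) = of_real u powr (\<nu> - 1) * of_real u"
      using u by (simp add: powr_diff)
    moreover have "u / (u\<^sup>2 + J\<^sup>2) = 1 / J\<^sup>2 * (u / (1 + (1 / J * u)\<^sup>2))"
      using u J by (simp add: power_divide field_simps)
    ultimately show ?thesis by (simp only: of_real_mult of_real_divide) (simp add: mult_ac)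
  qed
  have \<nu>2: "0 < Re (\<nu> + 1)" "Re (\<nu> + 1) < 2" using \<nu> by auto
  have ti: "integrable half_line (\<lambda>u. of_real u powr (\<nu> - 1) * of_real (u / (u\<^sup>2 + J\<^sup>2)) :: complex)" 
    and tv: "(\<integral>u. of_real u powr (\<nu> - 1) * of_real (u / (u\<^sup>2 + J\<^sup>2)) \<partial>half_line) = of_real pi / (2 * cs) * (1 / of_real J powr (1 - \<nu>))"
    if J: "J > 0" for J :: real
  proof -
    have J1: "1 / J > 0" using J by simp
    have eq: "complex_of_real u powr (\<nu> - 1) * of_real (u / (u\<^sup>2 + J\<^sup>2)) =
      of_real (1 / J\<^sup>2) * (of_real u powr ((\<nu> + 1) - 1) / of_real (1 + (1 / J * u)\<^sup>2))" if "u \<in> space half_line" for u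
      using term_eq [OF _ J] that by simp
    have "integrable half_line (\<lambda>u. of_real (1 / J\<^sup>2) * (of_real u powr ((\<nu> + 1) - 1) / of_real (1 + (1 / J * u)\<^sup>2)) :: complex)"
      by (rule integrable_mult_right [OF half_line_mellin_square(1) [OF \<nu>2 J1]])
    thus "integrable half_line (\<lambda>u. of_real u powr (\<nu> - 1) * of_real (u / (u\<^sup>2 + J\<^sup>2)) :: complex)"
      by (simp only: Bochner_Integration.integrable_cong [OF refl eq])
    have "(\<integral>u. complex_of_real u powr (\<nu> - 1) * of_real (u / (u\<^sup>2 + J\<^sup>2)) \<partial>half_line) =
        of_real (1 / J\<^sup>2) * (of_real (1 / J) powr (- (\<nu> + 1)) * (of_real pi / (2 * cs)))"
      by (subst Bochner_Integration.integral_cong [OF refl eq])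
         (simp_all only: integral_mult_right_zero half_line_mellin_square(2) [OF \<nu>2 J1] sin)
    also have "complex_of_real (1 / J) powr (- (\<nu> + 1)) = of_real (J\<^sup>2) * (1 / of_real J powr (1 - \<nu>))"
    proof -
      have "of_real (J\<^sup>2) * (1 / of_real J powr (1 - \<nu>)) = exp (2 * of_real (ln J)) * exp (- ((1 - \<nu>) * complex_of_real (ln J)))"
        using J by (simp add: of_real_powr_eq_exp exp_minus divide_inverse exp_double exp_of_real)
      also have "\<dots> = exp ((\<nu> + 1) * of_real (ln J))" by (simp add: algebra_simps flip: exp_add)
      also have "\<dots> = complex_of_real (1 / J) powr (- (\<nu> + 1))"
        using J by (subst of_real_powr_eq_exp) (auto simp: ln_div algebra_simps)
      finally show ?thesis ..
    qed
    also have "of_real (1 / J\<^sup>2) * (of_real (J\<^sup>2) * (1 / of_real J powr (1 - \<nu>)) * (of_real pi / (2 * cs))) =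
       of_real pi / (2 * cs) * (1 / of_real J powr (1 - \<nu>))" using J by simp
    finally show "(\<integral>u. of_real u powr (\<nu> - 1) * of_real (u / (u\<^sup>2 + J\<^sup>2)) \<partial>half_line) = of_real pi / (2 * cs) * (1 / of_real J powr (1 - \<nu>))" .
  qed
  have "(\<lambda>N. \<integral>u. sN N u \<partial>half_line) \<longlonglongrightarrow> (\<integral>u. of_real (pi / real q) * gauss_sum q chi * (of_real u powr (\<nu> - 1) * char_theta q chi u) \<partial>half_line)"
  proof (rule integral_dominated_convergence [where w = "\<lambda>u. real q * norm (complex_of_real u powr (\<nu> - 1) * of_real (u / (u\<^sup>2 + 1\<^sup>2)))"])
    show "(\<lambda>u. of_real (pi / real q) * gauss_sum q chi * (of_real u powr (\<nu> - 1) * char_theta q chi u)) \<in> borel_measurable half_line"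
      using char_theta_mellin_integrable [OF \<nu>(1)] by (intro borel_measurable_times borel_measurable_const borel_measurable_integrable)
    show "sN N \<in> borel_measurable half_line" for N
      unfolding sN_def by (intro borel_measurable_sum borel_measurable_times borel_measurable_const borel_measurable_integrable ti) auto
    show "integrable half_line (\<lambda>u. real q * norm (complex_of_real u powr (\<nu> - 1) * of_real (u / (u\<^sup>2 + 1\<^sup>2))))"
      by (intro integrable_mult_right integrable_norm ti) auto
    show "AE u in half_line. (\<lambda>N. sN N u) \<longlonglongrightarrow> of_real (pi / real q) * gauss_sum q chi * (of_real u powr (\<nu> - 1) * char_theta q chi u)"
    proof (rule AE_I2)
      fix u assume "u \<in> space half_line"
      hence u: "u > 0" by simp
      from sums_mult [OF char_partial_fractions [OF u], of "of_real u powr (\<nu> - 1) / 2"]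
      have "(\<lambda>j. of_real u powr (\<nu> - 1) / 2 * (chi (Suc j) * of_real (2 * u / (u\<^sup>2 + (real (Suc j))\<^sup>2)))) sums
        (of_real (pi / real q) * gauss_sum q chi * (of_real u powr (\<nu> - 1) * char_theta q chi u))"
        by (simp add: mult_ac)
      moreover have "of_real u powr (\<nu> - 1) / 2 * (chi (Suc j) * of_real (2 * u / (u\<^sup>2 + (real (Suc j))\<^sup>2))) =
         chi (Suc j) * (of_real u powr (\<nu> - 1) * of_real (u / (u\<^sup>2 + (real (Suc j))\<^sup>2)))" for j
        by simp
      ultimately show "(\<lambda>N. sN N u) \<longlonglongrightarrow> of_real (pi / real q) * gauss_sum q chi * (of_real u powr (\<nu> - 1) * char_theta q chi u)"
        by (simp only: sums_def sN_def)
    qed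
    show "AE u in half_line. norm (sN N u) \<le> real q * norm (complex_of_real u powr (\<nu> - 1) * of_real (u / (u\<^sup>2 + 1\<^sup>2)))" for N
    proof (rule AE_I2)
      fix u assume "u \<in> space half_line"
      hence u: "u > 0" by simp
      have "norm (\<Sum>j<N. chi (Suc j) * of_real (u / (u\<^sup>2 + (real (Suc j))\<^sup>2))) \<le> real q * (u / (u\<^sup>2 + (real (Suc 0))\<^sup>2))"
      proof (rule abel_summation_bound [OF char_partial_sums_bound])
        show "u / (u\<^sup>2 + (real (Suc (Suc n)))\<^sup>2) \<le> u / (u\<^sup>2 + (real (Suc n))\<^sup>2)" for n
          using u by (intro divide_left_mono mult_pos_pos add_pos_pos add_left_mono power_mono) auto
      qed (use u in auto)
      moreover have "sN N u = of_real u powr (\<nu> - 1) * (\<Sum>j<N. chi (Suc j) * of_real (u / (u\<^sup>2 + (real (Suc j))\<^sup>2)))"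
        unfolding sN_def sum_distrib_left by (simp only: mult_ac)
      ultimately have "norm (sN N u) \<le> norm (of_real u powr (\<nu> - 1)) * (real q * (u / (u\<^sup>2 + (real (Suc 0))\<^sup>2)))"
        by (simp only: norm_mult mult_left_mono norm_ge_zero)
      moreover have "norm (complex_of_real (u / (u\<^sup>2 + 1\<^sup>2))) = u / (u\<^sup>2 + (real (Suc 0))\<^sup>2)"
        using u unfolding norm_of_real by simp
      ultimately show "norm (sN N u) \<le> real q * norm (complex_of_real u powr (\<nu> - 1) * of_real (u / (u\<^sup>2 + 1\<^sup>2)))"
        by (simp only: norm_mult mult_ac)
    qed
  qed
  also have "(\<integral>u. of_real (pi / real q) * gauss_sum q chi * (of_real u powr (\<nu> - 1) * char_theta q chi u) \<partial>half_line) = of_real (pi / real q) * gauss_sum q chi * I"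
    unfolding I_def by (rule integral_mult_right_zero)
  also have "(\<lambda>N. \<integral>u. sN N u \<partial>half_line) = (\<lambda>N. of_real pi / (2 * cs) * (\<Sum>n=1..N. chi n / of_nat n powr (1 - \<nu>)))"
  proof
    fix N
    have "(\<integral>u. sN N u \<partial>half_line) = (\<Sum>j<N. chi (Suc j) * (\<integral>u. of_real u powr (\<nu> - 1) * of_real (u / (u\<^sup>2 + (real (Suc j))\<^sup>2)) \<partial>half_line))"
      unfolding sN_def
      by (subst Bochner_Integration.integral_sum) (auto intro!: integrable_mult_right ti sum.cong simp del: of_nat_Suc of_real_divide)
    also have "\<dots> = (\<Sum>j<N. chi (Suc j) * (of_real pi / (2 * cs) * (1 / of_nat (Suc j) powr (1 - \<nu>))))"
      by (intro sum.cong refl) (simp only: tv of_nat_0_less_iff zero_less_Suc of_real_of_nat_eq)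
    also have "\<dots> = of_real pi / (2 * cs) * (\<Sum>j<N. chi (Suc j) / of_nat (Suc j) powr (1 - \<nu>))"
      unfolding sum_distrib_left by (intro sum.cong refl) simp
    also have "(\<Sum>j<N. chi (Suc j) / of_nat (Suc j) powr (1 - \<nu>)) = (\<Sum>n=1..N. chi n / of_nat n powr (1 - \<nu>))"
      by (rule sum.reindex_bij_witness [of _ "\<lambda>a. a - 1" Suc]) auto
    finally show "(\<integral>u. sN N u \<partial>half_line) = of_real pi / (2 * cs) * (\<Sum>n=1..N. chi n / of_nat n powr (1 - \<nu>))" .
  qed
  finally have "(\<lambda>N. (2 * cs) / of_real pi * (of_real pi / (2 * cs) * (\<Sum>n=1..N. chi n / of_nat n powr (1 - \<nu>)))) \<longlonglongrightarrow>
      (2 * cs) / of_real pi * (of_real (pi / real q) * gauss_sum q chi * I)"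
    by (rule tendsto_mult_left)
  hence "(\<lambda>N. \<Sum>n=1..N. chi n / of_nat n powr (1 - \<nu>)) \<longlonglongrightarrow> 2 * cs * gauss_sum q chi * I / of_nat q"
    using cs by (simp add: mult_ac)
  hence "dirichlet_L chi (1 - \<nu>) = 2 * cs * gauss_sum q chi * I / of_nat q"
    unfolding dirichlet_L_def by (rule limI)
  thus ?thesis unfolding I_def [symmetric] cs_def [symmetric] using cs tau q1 by simp
qed

end

subsection \<open>The Koshliakov-type identity\<close>

lemma sin_half_pi_nonzero:
  assumes "0 < Re \<nu>" "Re \<nu> < 2"
  shows "sin (of_real pi * \<nu> / 2) \<noteq> 0"
  using sin_pi_nonzero [of "\<nu> / 2"] assms by simp

locale koshliakov_setup = even_primitive_char +
  fixes \<nu> :: complex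
  assumes \<nu>: "0 < Re \<nu>" "Re \<nu> < 1/2"
begin

text \<open>Here \<zeta> is the square of the variable w of the later identity. The last factor is
  1/(exp(2 pi/y) - 1), written as the sum of its geometric series.\<close>

definition kosh_integral :: "real \<Rightarrow> complex" where
  "kosh_integral \<zeta> = (\<integral>y. of_real y powr (\<nu> - 1) *
     (char_theta q chi (\<zeta> * y) * of_real (exp (- (2 * pi / y)) / (1 - exp (- (2 * pi / y))))) \<partial>half_line)"

text \<open>A pair of exponentials with indices h, k integrates to a Macdonald function whose
  argument depends only on n = h k. The remaining factor k^\<nu> = n^\<nu> h^(-\<nu>) turns the sum
  over factorisations into the divisor function.\<close>

lemma kosh_integral_series:
  assumes \<zeta>: "\<zeta> > 0"
  shows "(\<lambda>n. of_real (2 * pi) powr \<nu> * of_nat (Suc n) powr \<nu> * sigma_char (- \<nu>) (\<lambda>m. cnj (chi m)) (Suc n) *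
             kernel_K \<nu> (of_real (2 * pi * sqrt (real (Suc n) / real q) * sqrt \<zeta>))) sums kosh_integral \<zeta>"
proof -
  define c where "c = 2 * pi * \<zeta> / real q"
  have c: "c > 0" using \<zeta> q1 by (simp add: c_def)
  define a where "a = (\<lambda>y h. cnj (chi (Suc h)) * complex_of_real (exp (- (c * real (Suc h) * y))))"
  define b where "b = (\<lambda>y k. complex_of_real (exp (- (2 * pi * real (Suc k) / y))))"
  define f where "f = (\<lambda>p y. complex_of_real y powr (\<nu> - 1) * (case p of (h, k) \<Rightarrow> a y h * b y k))"
  have na: "norm (a y h) \<le> exp (- (c * y * real (Suc h)))" for y h
    unfolding a_def norm_mult
    by (intro mult_le_one_mono) (auto simp: norm_dirichlet_char(2) [OF chi] mult_ac simp del: of_nat_Suc)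
  have nb: "norm (b y k) = exp (- (2 * pi / y * real (Suc k)))" for y k
    by (simp add: b_def del: of_nat_Suc)
  have sa: "summable (\<lambda>h. norm (a y h))" "(\<Sum>h. norm (a y h)) \<le> exp (- (c * y)) / (1 - exp (- (c * y)))" if y: "y > 0" for y
  proof -
    have s: "(\<lambda>h. exp (- (c * y * real (Suc h)))) sums (exp (- (c * y)) / (1 - exp (- (c * y))))"
      using c y by (intro exp_series) auto
    show 1: "summable (\<lambda>h. norm (a y h))"
      by (rule summable_comparison_test' [OF sums_summable [OF s]]) (use na in auto)
    show "(\<Sum>h. norm (a y h)) \<le> exp (- (c * y)) / (1 - exp (- (c * y)))"
      using suminf_le [OF na 1 sums_summable [OF s]] sums_unique [OF s] by simp
  qed
  have sb: "(\<lambda>k. norm (b y k)) sums (exp (- (2 * pi / y)) / (1 - exp (- (2 * pi / y))))" if y: "y > 0" for y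
    unfolding nb using y by (intro exp_series) auto
  have suma: "suminf (a y) = char_theta q chi (\<zeta> * y)" for y
    unfolding char_theta_def a_def by (intro suminf_cong) (simp add: c_def mult_ac del: of_nat_Suc)
  have sumb: "suminf (b y) = of_real (exp (- (2 * pi / y)) / (1 - exp (- (2 * pi / y))))" if y: "y > 0" for y
  proof -
    have "b y = (\<lambda>k. of_real (norm (b y k)))" by (simp add: b_def fun_eq_iff)
    moreover have "(\<lambda>k. complex_of_real (norm (b y k))) sums of_real (exp (- (2 * pi / y)) / (1 - exp (- (2 * pi / y))))"
      by (rule sums_of_real [OF sb [OF y]])
    ultimately show ?thesis using sums_unique by metis
  qed
  define g where "g = (\<lambda>y. (2 / c) * (2 / (2 * pi)\<^sup>2) * (y powr ((Re \<nu> + 1) - 1) * exp (- (c / 2 * y))))"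
  have int_g: "integrable half_line g"
    unfolding g_def using c \<nu> by (intro integrable_mult_right half_line_Gamma_real) auto
  have cont: "continuous_on {0<..} (f p)" for p
    unfolding f_def a_def b_def by (cases p) (auto intro!: continuous_intros)
  have bound: "(\<Sum>p\<in>F. norm (f p y)) \<le> g y" if y: "y \<in> space half_line" and F: "finite F" for y F
  proof -
    have y: "y > 0" using y by simp
    have cy: "c * y > 0" using c y by simp
    have "(\<Sum>p\<in>F. norm (f p y)) = y powr (Re \<nu> - 1) * (\<Sum>p\<in>F. norm (case p of (h, k) \<Rightarrow> a y h * b y k))"
      unfolding f_def norm_mult sum_distrib_left using y by (simp add: norm_of_real_powr)
    also have "\<dots> \<le> y powr (Re \<nu> - 1) * ((\<Sum>h. norm (a y h)) * (\<Sum>k. norm (b y k)))"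
      by (intro mult_left_mono has_sum_pair_product(2) sa(1) [OF y] sums_summable [OF sb [OF y]] F) auto
    also have "\<dots> \<le> y powr (Re \<nu> - 1) * ((2 * exp (- (c * y / 2)) / (c * y)) * (2 / (2 * pi / y)\<^sup>2))"
    proof (intro mult_left_mono mult_mono)
      show "(\<Sum>h. norm (a y h)) \<le> 2 * exp (- (c * y / 2)) / (c * y)"
        using sa(2) [OF y] exp_geometric_bounds(2) [OF cy] by linarith
      show "(\<Sum>k. norm (b y k)) \<le> 2 / (2 * pi / y)\<^sup>2"
        using sums_unique [OF sb [OF y]] exp_geometric_bounds(1) [of "2 * pi / y"] y by simp
      show "0 \<le> (\<Sum>k. norm (b y k))" by (intro suminf_nonneg sums_summable [OF sb [OF y]]) auto
    qed (use cy in auto)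
    also have "\<dots> = (2 / c) * (2 / (2 * pi)\<^sup>2) * (y powr (Re \<nu> - 1) * y * exp (- (c / 2 * y)))"
      using c y by (simp add: power_divide power2_eq_square field_simps)
    also have "y powr (Re \<nu> - 1) * y = y powr ((Re \<nu> + 1) - 1)"
      using y by (simp add: powr_diff)
    finally show ?thesis by (simp add: g_def)
  qed
  have hs: "((\<lambda>p. f p y) has_sum (of_real y powr (\<nu> - 1) *
     (char_theta q chi (\<zeta> * y) * of_real (exp (- (2 * pi / y)) / (1 - exp (- (2 * pi / y))))))) UNIV"
    if y: "y \<in> space half_line" for y
  proof -
    have y: "y > 0" using y by simp
    have "((\<lambda>p. case p of (h, k) \<Rightarrow> a y h * b y k) has_sum (suminf (a y) * suminf (b y))) UNIV"
      by (rule has_sum_pair_product(1) [OF sa(1) [OF y] sums_summable [OF sb [OF y]]])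
    thus ?thesis unfolding suma sumb [OF y] f_def by (rule has_sum_cmult_right)
  qed
  have "((\<lambda>p. \<integral>y. f p y \<partial>half_line) has_sum kosh_integral \<zeta>) UNIV"
    unfolding kosh_integral_def
    by (rule has_sum_integral_dominated(1) [OF measurable_half_line [OF cont] int_g bound hs])
  also have "(\<lambda>p. \<integral>y. f p y \<partial>half_line) = (\<lambda>(h, k). cnj (chi (Suc h)) * of_real (2 * pi * real (Suc k)) powr \<nu> *
       kernel_K \<nu> (of_real (2 * pi * sqrt (real (Suc h * Suc k) / real q) * sqrt \<zeta>)))"
  proof (rule ext, clarify)
    fix h k
    define A where "A = 2 * pi * real (Suc k)"
    define B where "B = c * real (Suc h)"
    have AB: "A > 0" "B > 0" using c by (auto simp: A_def B_def)
    have "(\<integral>y. f (h, k) y \<partial>half_line) = (\<integral>y. cnj (chi (Suc h)) * (of_real y powr (\<nu> - 1) * (of_real (exp (- (B * y))) * of_real (exp (- (A / y))))) \<partial>half_line)"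
      unfolding f_def a_def b_def A_def B_def prod.case by (intro Bochner_Integration.integral_cong refl) (simp only: mult_ac)
    also have "\<dots> = cnj (chi (Suc h)) * (of_real B powr (- \<nu>) * macdonald \<nu> (of_real (A * B)))"
      unfolding integral_mult_right_zero macdonald_scaled [OF AB] ..
    also have "of_real B powr (- \<nu>) * macdonald \<nu> (of_real (A * B)) = of_real A powr \<nu> * kernel_K \<nu> (of_real (sqrt (A * B)))"
    proof -
      have "kernel_K \<nu> (of_real (sqrt (A * B))) = of_real (sqrt (A * B)) powr (- 2 * \<nu>) * macdonald \<nu> (of_real ((sqrt (A * B))\<^sup>2))"
        using AB by (intro kernel_K_of_real \<nu>) auto
      moreover have "(sqrt (A * B))\<^sup>2 = A * B" using AB by simp
      moreover have "of_real A powr \<nu> * complex_of_real (sqrt (A * B)) powr (- 2 * \<nu>) = of_real B powr (- \<nu>)"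
      proof -
        have l: "ln (sqrt (A * B)) = (ln A + ln B) / 2" using AB by (simp add: ln_sqrt ln_mult)
        have "of_real A powr \<nu> * complex_of_real (sqrt (A * B)) powr (- 2 * \<nu>) = exp (\<nu> * of_real (ln A) + - 2 * \<nu> * of_real ((ln A + ln B) / 2))"
          using AB by (simp only: of_real_powr_eq_exp real_sqrt_gt_zero mult_pos_pos l exp_add)
        also have "\<nu> * of_real (ln A) + - 2 * \<nu> * of_real ((ln A + ln B) / 2) = - \<nu> * complex_of_real (ln B)"
          by (simp add: field_simps)
        finally show ?thesis using AB by (simp only: of_real_powr_eq_exp)
      qed
      ultimately show ?thesis by (simp only: mult.assoc [symmetric])
    qed
    also have "sqrt (A * B) = 2 * pi * sqrt (real (Suc h * Suc k) / real q) * sqrt \<zeta>"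
    proof -
      have "A * B = (2 * pi)\<^sup>2 * (real (Suc h * Suc k) / real q) * \<zeta>"
        by (simp add: A_def B_def c_def power2_eq_square mult_ac del: of_nat_Suc mult_Suc mult_Suc_right)
      thus ?thesis by (simp only: real_sqrt_mult real_sqrt_abs) simp
    qed
    finally show "(\<integral>y. f (h, k) y \<partial>half_line) = cnj (chi (Suc h)) * of_real (2 * pi * real (Suc k)) powr \<nu> *
       kernel_K \<nu> (of_real (2 * pi * sqrt (real (Suc h * Suc k) / real q) * sqrt \<zeta>))"
      by (simp only: A_def mult.assoc)
  qed
  finally have "(\<lambda>n. \<Sum>d | d dvd Suc n. cnj (chi d) * of_real (2 * pi * real (Suc n div d)) powr \<nu> *
       kernel_K \<nu> (of_real (2 * pi * sqrt (real (d * (Suc n div d)) / real q) * sqrt \<zeta>))) sums kosh_integral \<zeta>"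
    by (rule divisor_sums)
  also have "(\<lambda>n. \<Sum>d | d dvd Suc n. cnj (chi d) * of_real (2 * pi * real (Suc n div d)) powr \<nu> *
       kernel_K \<nu> (of_real (2 * pi * sqrt (real (d * (Suc n div d)) / real q) * sqrt \<zeta>))) =
     (\<lambda>n. of_real (2 * pi) powr \<nu> * of_nat (Suc n) powr \<nu> * sigma_char (- \<nu>) (\<lambda>m. cnj (chi m)) (Suc n) *
             kernel_K \<nu> (of_real (2 * pi * sqrt (real (Suc n) / real q) * sqrt \<zeta>)))"
  proof
    fix n
    have "cnj (chi d) * of_real (2 * pi * real (Suc n div d)) powr \<nu> *
       kernel_K \<nu> (of_real (2 * pi * sqrt (real (d * (Suc n div d)) / real q) * sqrt \<zeta>)) =
       (of_real (2 * pi) powr \<nu> * of_nat (Suc n) powr \<nu>) * (of_nat d powr (- \<nu>) * cnj (chi d)) *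
             kernel_K \<nu> (of_real (2 * pi * sqrt (real (Suc n) / real q) * sqrt \<zeta>))" if "d dvd Suc n" for d
    proof -
      have d: "d > 0" using that by (auto intro!: Nat.gr0I)
      have dn: "d * (Suc n div d) = Suc n" using that by simp
      hence k: "Suc n div d > 0" by (metis nat.distinct(1) gr0I mult_0_right)
      have "real (Suc n) = real d * real (Suc n div d)" by (metis dn of_nat_mult)
      hence "ln (real (Suc n)) = ln (real d) + ln (real (Suc n div d))"
        using d k by (simp add: ln_mult del: of_nat_Suc)
      hence "complex_of_real (2 * pi * real (Suc n div d)) powr \<nu> = of_real (2 * pi) powr \<nu> * of_real (real (Suc n)) powr \<nu> * of_real (real d) powr (- \<nu>)"
        using d k by (subst (1 2 3 4) of_real_powr_eq_exp) (auto simp: ln_mult algebra_simps simp del: of_nat_Suc simp flip: exp_add)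
      thus ?thesis unfolding dn of_real_of_nat_eq by (simp only: mult_ac)
    qed
    thus "(\<Sum>d | d dvd Suc n. cnj (chi d) * of_real (2 * pi * real (Suc n div d)) powr \<nu> *
       kernel_K \<nu> (of_real (2 * pi * sqrt (real (d * (Suc n div d)) / real q) * sqrt \<zeta>))) =
      of_real (2 * pi) powr \<nu> * of_nat (Suc n) powr \<nu> * sigma_char (- \<nu>) (\<lambda>m. cnj (chi m)) (Suc n) *
             kernel_K \<nu> (of_real (2 * pi * sqrt (real (Suc n) / real q) * sqrt \<zeta>))"
      unfolding sigma_char_def sum_distrib_left sum_distrib_right by (intro sum.cong) auto
  qed
  finally show ?thesis .
qed

text \<open>The Mellin transform of the theta-like series at \<nu> + 1, divided by 2 pi. No closed
  form is sought: its contributions to the two halves are opposite.\<close>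

definition kosh_const :: complex where
  "kosh_const = (\<integral>u. of_real u powr ((\<nu> + 1) - 1) * char_theta q chi u \<partial>half_line) / of_real (2 * pi)"

text \<open>The same integral with partial fractions for both factors: every pair of fractions
  becomes a difference of two Mellin integrals of the type \<open>half_line_mellin_square\<close>.
  Non-integrality of \<zeta> keeps the denominators \<zeta>^2 - n^2 away from 0.\<close>

lemma kosh_integral_explicit:
  assumes \<zeta>: "\<zeta> > 0" "\<zeta> \<notin> \<int>"
  defines "th \<equiv> of_real pi * \<nu> / 2"
  shows "(\<lambda>n. of_nat q / gauss_sum q chi * of_real \<zeta> / (2 * of_real pi * sin th) *
            (sigma_bar_char (- \<nu>) chi (Suc n) * (1 - of_nat (Suc n) powr \<nu> * of_real \<zeta> powr (- \<nu>)) / (of_real (\<zeta>\<^sup>2) - of_nat (Suc n) ^ 2)))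
         sums (kosh_integral \<zeta> - kosh_const * of_real \<zeta> powr (- \<nu> - 1)
            + of_nat q / gauss_sum q chi * dirichlet_L chi (1 - \<nu>) / (4 * cos th) * of_real \<zeta> powr (- \<nu>))"
proof -
  let ?t = "\<lambda>y. char_theta q chi (\<zeta> * y)"
  let ?G = "\<lambda>x::real. exp (- (2 * pi * x)) / (1 - exp (- (2 * pi * x)))"
  have sinth: "sin th \<noteq> 0" unfolding th_def using \<nu> by (intro sin_half_pi_nonzero) auto
  define S2 where "S2 = (\<Sum>n. inverse (real (Suc n) ^ 2))"
  have "summable (\<lambda>n. inverse (real n ^ 2))" by (rule inverse_power_summable) simp
  hence s2: "summable (\<lambda>n. inverse (real (Suc n) ^ 2))" by (subst summable_Suc_iff)
  have S2: "S2 \<ge> 0" unfolding S2_def by (intro suminf_nonneg s2) auto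
  have small: "(\<Sum>d. 2 * x / (x\<^sup>2 + (real (Suc d))\<^sup>2)) \<le> 2 * x * S2" if x: "x > 0" for x
  proof -
    have "2 * x * S2 = (\<Sum>d. 2 * x * inverse (real (Suc d) ^ 2))" unfolding S2_def by (rule suminf_mult [OF s2, symmetric])
    moreover have "(\<Sum>d. 2 * x / (x\<^sup>2 + (real (Suc d))\<^sup>2)) \<le> (\<Sum>d. 2 * x * inverse (real (Suc d) ^ 2))"
      using x by (intro suminf_le summable_inverse_squares_shift summable_mult s2)
                 (auto simp: divide_inverse intro!: mult_left_mono le_imp_inverse_le simp del: of_nat_Suc)
    ultimately show ?thesis by simp
  qed
  define K where "K = of_nat q / (2 * of_real pi * gauss_sum q chi)"
  define a where "a = (\<lambda>y d. complex_of_real (1 / (2 * pi) * (2 * (1 / y) / ((1 / y)\<^sup>2 + (real (Suc d))\<^sup>2))))"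
  define b where "b = (\<lambda>y j. K * (chi (Suc j) * complex_of_real (2 * (\<zeta> * y) / ((\<zeta> * y)\<^sup>2 + (real (Suc j))\<^sup>2))))"
  define f where "f = (\<lambda>p y. complex_of_real y powr (\<nu> - 1) * (case p of (d, j) \<Rightarrow> a y d * b y j))"
  have pos: "0 \<le> 2 * x / (x\<^sup>2 + (real (Suc d))\<^sup>2)" if "x > 0" for x d
    using that by (intro divide_nonneg_nonneg) auto
  have na: "norm (a y d) = 1 / (2 * pi) * (2 * (1 / y) / ((1 / y)\<^sup>2 + (real (Suc d))\<^sup>2))" if y: "y > 0" for y d
    using pos [of "1 / y" d] y unfolding a_def norm_of_real by (intro abs_of_nonneg mult_nonneg_nonneg) auto
  have nb: "norm (b y j) \<le> norm K * (2 * (\<zeta> * y) / ((\<zeta> * y)\<^sup>2 + (real (Suc j))\<^sup>2))" if y: "y > 0" for y j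
    unfolding b_def norm_mult norm_of_real using pos [of "\<zeta> * y" j] y \<zeta>
    by (intro mult_left_mono mult_le_one_mono norm_dirichlet_char(2) [OF chi]) (simp_all only: abs_of_nonneg order_refl, auto)
  have sa: "summable (\<lambda>d. norm (a y d))" "(\<Sum>d. norm (a y d)) = 1 / (2 * pi) * (\<Sum>d. 2 * (1 / y) / ((1 / y)\<^sup>2 + (real (Suc d))\<^sup>2))" if y: "y > 0" for y
  proof -
    have s: "summable (\<lambda>d. 2 * (1 / y) / ((1 / y)\<^sup>2 + (real (Suc d))\<^sup>2))" using y by (intro summable_inverse_squares_shift) auto
    show "summable (\<lambda>d. norm (a y d))" unfolding na [OF y] by (rule summable_mult [OF s])
    show "(\<Sum>d. norm (a y d)) = 1 / (2 * pi) * (\<Sum>d. 2 * (1 / y) / ((1 / y)\<^sup>2 + (real (Suc d))\<^sup>2))"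
      unfolding na [OF y] by (rule suminf_mult [OF s])
  qed
  have sb: "summable (\<lambda>j. norm (b y j))" "(\<Sum>j. norm (b y j)) \<le> norm K * (\<Sum>j. 2 * (\<zeta> * y) / ((\<zeta> * y)\<^sup>2 + (real (Suc j))\<^sup>2))" if y: "y > 0" for y
  proof -
    have s: "summable (\<lambda>j. 2 * (\<zeta> * y) / ((\<zeta> * y)\<^sup>2 + (real (Suc j))\<^sup>2))" using y \<zeta> by (intro summable_inverse_squares_shift) auto
    show 1: "summable (\<lambda>j. norm (b y j))"
      by (rule summable_comparison_test' [OF summable_mult [OF s, of "norm K"]]) (use nb [OF y] in simp)
    show "(\<Sum>j. norm (b y j)) \<le> norm K * (\<Sum>j. 2 * (\<zeta> * y) / ((\<zeta> * y)\<^sup>2 + (real (Suc j))\<^sup>2))"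
      using suminf_le [OF nb [OF y] 1 summable_mult [OF s]] suminf_mult [OF s, of "norm K"] by simp
  qed
  \<comment> \<open>Partial fractions produce 1/2 - y/(2 pi) in addition to 1/(exp(2 pi/y) - 1).
    Integrated against the theta-like series, these corrections become the L-value term and the term
    with \<open>kosh_const\<close>.\<close>
  have suma: "suminf (a y) = of_real (?G (1 / y) + 1/2 - y / (2 * pi))" if y: "y > 0" for y
  proof -
    have "(\<lambda>d. 1 / (2 * pi) * (2 * (1 / y) / ((1 / y)\<^sup>2 + (real (Suc d))\<^sup>2))) sums (1 / (2 * pi) * (pi * (1 + 2 * ?G (1 / y)) - 1 / (1 / y)))"
      using y by (intro sums_mult geometric_partial_fractions) auto
    hence "(\<lambda>d. a y d) sums of_real (1 / (2 * pi) * (pi * (1 + 2 * ?G (1 / y)) - 1 / (1 / y)))"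
      unfolding a_def by (rule sums_of_real)
    moreover have "1 / (2 * pi) * (pi * (1 + 2 * G) - 1 / (1 / y)) = G + 1/2 - y / (2 * pi)" for G :: real
      using y by (simp add: field_simps)
    ultimately show ?thesis using sums_unique by metis
  qed
  have sumb: "suminf (b y) = ?t y" if y: "y > 0" for y
  proof -
    have "(\<lambda>j. b y j) sums (K * (of_real (2 * pi / real q) * gauss_sum q chi * ?t y))"
      unfolding b_def using y \<zeta> by (intro sums_mult char_partial_fractions) auto
    moreover have "K * (of_real (2 * pi / real q) * gauss_sum q chi * ?t y) = ?t y"
      using tau q1 by (simp add: K_def)
    ultimately show ?thesis using sums_unique by metis
  qed
  define C where "C = 1 / (2 * pi) * (norm K * (4 * pi * S2 * (\<zeta> + 1)))"
  have C: "C \<ge> 0" using S2 \<zeta> by (auto simp: C_def)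
  define g where "g = (\<lambda>y. C * norm (complex_of_real y powr ((\<nu> + 1) - 1) / of_real (1 + (1 * y)\<^sup>2)))"
  have int_g: "integrable half_line g"
    unfolding g_def using \<nu> by (intro integrable_mult_right integrable_norm half_line_mellin_square) auto
  have cont: "continuous_on {0<..} (f p)" for p
  proof (cases p)
    case (Pair d j)
    have "(1 / y)\<^sup>2 + (real (Suc d))\<^sup>2 \<noteq> 0" "(\<zeta> * y)\<^sup>2 + (real (Suc j))\<^sup>2 \<noteq> 0" for y
      using zero_le_power2 [of "1 / y"] zero_le_power2 [of "\<zeta> * y"] by (simp_all add: add_nonneg_eq_0_iff)
    thus ?thesis unfolding f_def a_def b_def Pair prod.case by (intro continuous_intros) auto
  qed
  have bound: "(\<Sum>p\<in>F. norm (f p y)) \<le> g y" if y: "y \<in> space half_line" and F: "finite F" for y F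
  proof -
    have y: "y > 0" using y by simp
    define A where "A = (\<Sum>d. 2 * (1 / y) / ((1 / y)\<^sup>2 + (real (Suc d))\<^sup>2))"
    define B where "B = (\<Sum>j. 2 * (\<zeta> * y) / ((\<zeta> * y)\<^sup>2 + (real (Suc j))\<^sup>2))"
    have yy: "1 / y > 0" "\<zeta> * y > 0" using y \<zeta> by auto
    have A: "0 \<le> A" "A \<le> pi" "A \<le> 2 * (1 / y) * S2"
      unfolding A_def
      by (rule suminf_nonneg [OF summable_inverse_squares_shift [OF yy(1)] pos [OF yy(1)]]
            sum_inverse_squares_shift_le_pi [OF yy(1)] small [OF yy(1)])+
    have B: "0 \<le> B" "B \<le> pi" "B \<le> 2 * (\<zeta> * y) * S2"
      unfolding B_def
      by (rule suminf_nonneg [OF summable_inverse_squares_shift [OF yy(2)] pos [OF yy(2)]]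
            sum_inverse_squares_shift_le_pi [OF yy(2)] small [OF yy(2)])+
    \<comment> \<open>Each factor has a uniform bound pi and a bound linear in its argument. The
      linear one is used for B when y \<le> 1 and for A, whose argument is 1/y, otherwise; both
      cases fit under y/(1 + y^2), whose Mellin integral converges.\<close>
    have AB: "A * B \<le> 4 * pi * S2 * (\<zeta> + 1) * (y / (1 + y\<^sup>2))"
    proof (cases "y \<le> 1")
      case True
      have "y * y \<le> 1" using True y by (simp add: mult_le_one)
      hence y2: "y \<le> 2 * (y / (1 + y\<^sup>2))" using y by (simp add: field_simps power2_eq_square add_pos_pos)
      have "A * B \<le> pi * (2 * (\<zeta> * y) * S2)" using A B by (intro mult_mono) auto
      also have "\<dots> = (2 * pi * S2 * \<zeta>) * y" by simp
      also have "\<dots> \<le> (2 * pi * S2 * (\<zeta> + 1)) * (2 * (y / (1 + y\<^sup>2)))"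
        using y2 y S2 \<zeta> by (intro mult_mono) auto
      finally show ?thesis by (simp add: mult_ac)
    next
      case False
      have "1 / y \<le> 2 * (y / (1 + y\<^sup>2))"
      proof -
        have "1 \<le> y * y" using False mult_mono [of 1 y 1 y] by simp
        thus ?thesis using y by (simp add: field_simps power2_eq_square add_pos_pos)
      qed
      hence y2: "(2 * pi * S2 * 1) * (1 / y) \<le> (2 * pi * S2 * (\<zeta> + 1)) * (2 * (y / (1 + y\<^sup>2)))"
        using y S2 \<zeta> by (intro mult_mono) auto
      have "A * B \<le> (2 * (1 / y) * S2) * pi" using A B by (intro mult_mono) auto
      also have "\<dots> = (2 * pi * S2 * 1) * (1 / y)" by simp
      finally show ?thesis using y2 by (simp add: mult_ac)
    qed
    have "(\<Sum>p\<in>F. norm (f p y)) = y powr (Re \<nu> - 1) * (\<Sum>p\<in>F. norm (case p of (h, k) \<Rightarrow> a y h * b y k))"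
      unfolding f_def norm_mult sum_distrib_left using y by (simp add: norm_of_real_powr)
    also have "\<dots> \<le> y powr (Re \<nu> - 1) * ((\<Sum>d. norm (a y d)) * (\<Sum>j. norm (b y j)))"
      by (intro mult_left_mono has_sum_pair_product(2) sa(1) [OF y] sb(1) [OF y] F) auto
    also have "\<dots> \<le> y powr (Re \<nu> - 1) * ((1 / (2 * pi) * A) * (norm K * B))"
      unfolding sa(2) [OF y] A_def [symmetric] using sb(2) [OF y] A
      by (intro mult_left_mono) (auto simp: B_def simp del: of_nat_Suc)
    also have "\<dots> = y powr (Re \<nu> - 1) * (1 / (2 * pi) * norm K) * (A * B)" by simp
    also have "\<dots> \<le> y powr (Re \<nu> - 1) * (1 / (2 * pi) * norm K) * (4 * pi * S2 * (\<zeta> + 1) * (y / (1 + y\<^sup>2)))"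
      by (intro mult_left_mono AB) auto
    also have "\<dots> = C * (y powr (Re \<nu> - 1) * y / (1 + y\<^sup>2))" by (simp add: C_def mult_ac)
    also have "y powr (Re \<nu> - 1) * y = y powr Re \<nu>" using y by (simp add: powr_diff)
    also have "C * (y powr Re \<nu> / (1 + y\<^sup>2)) = g y"
    proof -
      have "norm (complex_of_real (1 + (1 * y)\<^sup>2)) = 1 + y\<^sup>2" unfolding norm_of_real by simp
      thus ?thesis using y by (simp only: g_def norm_divide) (simp add: norm_of_real_powr)
    qed
    finally show ?thesis .
  qed
  have hs: "((\<lambda>p. f p y) has_sum (of_real y powr (\<nu> - 1) * (of_real (?G (1 / y) + 1/2 - y / (2 * pi)) * ?t y))) UNIV"
    if y: "y \<in> space half_line" for y
  proof -
    have y: "y > 0" using y by simp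
    have "((\<lambda>p. case p of (h, k) \<Rightarrow> a y h * b y k) has_sum (suminf (a y) * suminf (b y))) UNIV"
      by (rule has_sum_pair_product(1) [OF sa(1) [OF y] sb(1) [OF y]])
    thus ?thesis unfolding suma [OF y] sumb [OF y] f_def by (rule has_sum_cmult_right)
  qed
  have sum_f: "((\<lambda>p. \<integral>y. f p y \<partial>half_line) has_sum (\<integral>y. of_real y powr (\<nu> - 1) * (of_real (?G (1 / y) + 1/2 - y / (2 * pi)) * ?t y) \<partial>half_line)) UNIV"
    and int_f: "integrable half_line (\<lambda>y. of_real y powr (\<nu> - 1) * (of_real (?G (1 / y) + 1/2 - y / (2 * pi)) * ?t y))"
    using has_sum_integral_dominated [OF measurable_half_line [OF cont] int_g bound hs] by blast+
  have scale: "integrable half_line (\<lambda>y. of_real y powr (s - 1) * ?t y)"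
      "(\<integral>y. of_real y powr (s - 1) * ?t y \<partial>half_line) = of_real \<zeta> powr (- s) * (\<integral>u. of_real u powr (s - 1) * char_theta q chi u \<partial>half_line)"
    if s: "Re s > 0" for s
  proof -
    let ?F = "\<lambda>u. complex_of_real u powr (s - 1) * char_theta q chi u"
    have eq: "?F (\<zeta> * y) = of_real \<zeta> powr (s - 1) * (of_real y powr (s - 1) * ?t y)" if "y \<in> space half_line" for y
      using that \<zeta> by (simp add: powr_times_real)
    have "integrable half_line (\<lambda>y. ?F (\<zeta> * y))"
      using half_line_scale(1) [OF \<zeta>(1), of ?F] char_theta_mellin_integrable [OF s] by simp
    hence "integrable half_line (\<lambda>y. of_real \<zeta> powr (s - 1) * (of_real y powr (s - 1) * ?t y))"
      by (simp only: Bochner_Integration.integrable_cong [OF refl eq])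
    thus "integrable half_line (\<lambda>y. of_real y powr (s - 1) * ?t y)"
      by (rule integrable_mult_cancel) (use \<zeta> in simp)
    have "(\<integral>u. ?F u \<partial>half_line) = \<zeta> *\<^sub>R (\<integral>y. ?F (\<zeta> * y) \<partial>half_line)" by (rule half_line_scale(2) [OF \<zeta>(1)])
    also have "(\<integral>y. ?F (\<zeta> * y) \<partial>half_line) = of_real \<zeta> powr (s - 1) * (\<integral>y. of_real y powr (s - 1) * ?t y \<partial>half_line)"
      by (subst Bochner_Integration.integral_cong [OF refl eq]) (simp_all only: integral_mult_right_zero)
    finally have "of_real \<zeta> powr (- s) * (\<integral>u. ?F u \<partial>half_line) = (of_real \<zeta> powr (- s) * (of_real \<zeta> * of_real \<zeta> powr (s - 1))) * (\<integral>y. of_real y powr (s - 1) * ?t y \<partial>half_line)"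
      by (simp only: scaleR_conv_of_real mult.assoc)
    also have "of_real \<zeta> powr (- s) * (complex_of_real \<zeta> * of_real \<zeta> powr (s - 1)) = 1"
      using \<zeta> by (simp add: powr_diff powr_minus)
    finally show "(\<integral>y. of_real y powr (s - 1) * ?t y \<partial>half_line) = of_real \<zeta> powr (- s) * (\<integral>u. ?F u \<partial>half_line)" by simp
  qed
  have r1: "Re \<nu> > 0" "Re (\<nu> + 1) > 0" using \<nu> by auto
  have kosh: "kosh_integral \<zeta> = (\<integral>y. of_real y powr (\<nu> - 1) * (of_real (?G (1 / y) + 1/2 - y / (2 * pi)) * ?t y) \<partial>half_line)
      + of_real (1 / (2 * pi)) * (\<integral>y. of_real y powr ((\<nu> + 1) - 1) * ?t y \<partial>half_line) - 1/2 * (\<integral>y. of_real y powr (\<nu> - 1) * ?t y \<partial>half_line)"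
  proof -
    have "kosh_integral \<zeta> = (\<integral>y. of_real y powr (\<nu> - 1) * (of_real (?G (1 / y) + 1/2 - y / (2 * pi)) * ?t y)
      + of_real (1 / (2 * pi)) * (of_real y powr ((\<nu> + 1) - 1) * ?t y) - 1/2 * (of_real y powr (\<nu> - 1) * ?t y) \<partial>half_line)"
      unfolding kosh_integral_def
    proof (intro Bochner_Integration.integral_cong refl)
      fix y assume "y \<in> space half_line"
      hence y: "y > 0" by simp
      define G where "G = ?G (1 / y)"
      have p: "complex_of_real y powr ((\<nu> + 1) - 1) = of_real y powr (\<nu> - 1) * of_real y" using y by (simp add: powr_diff)
      have "P * (T * of_real G) = P * (of_real (G + 1/2 - y / (2 * pi)) * T) + of_real (1 / (2 * pi)) * (P * of_real y * T) - 1/2 * (P * T)" for P T :: complex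
        by (simp add: algebra_simps)
      thus "of_real y powr (\<nu> - 1) * (?t y * of_real (exp (- (2 * pi / y)) / (1 - exp (- (2 * pi / y))))) =
        of_real y powr (\<nu> - 1) * (of_real (?G (1 / y) + 1/2 - y / (2 * pi)) * ?t y)
      + of_real (1 / (2 * pi)) * (of_real y powr ((\<nu> + 1) - 1) * ?t y) - 1/2 * (of_real y powr (\<nu> - 1) * ?t y)"
        unfolding p G_def by (simp only: times_divide_eq_right mult_1_right)
    qed
    also have "\<dots> = (\<integral>y. of_real y powr (\<nu> - 1) * (of_real (?G (1 / y) + 1/2 - y / (2 * pi)) * ?t y) \<partial>half_line)
      + (\<integral>y. of_real (1 / (2 * pi)) * (of_real y powr ((\<nu> + 1) - 1) * ?t y) \<partial>half_line) - (\<integral>y. 1/2 * (of_real y powr (\<nu> - 1) * ?t y) \<partial>half_line)"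
    proof -
      note i2 = integrable_mult_right [OF scale(1) [OF r1(2)], of "of_real (1 / (2 * pi))"]
      note i3 = integrable_mult_right [OF scale(1) [OF r1(1)], of "1/2"]
      show ?thesis
        unfolding Bochner_Integration.integral_diff [OF Bochner_Integration.integrable_add [OF int_f i2] i3]
          Bochner_Integration.integral_add [OF int_f i2] ..
    qed
    finally show ?thesis by (simp only: integral_mult_right_zero)
  qed
  have val: "(\<integral>y. f p y \<partial>half_line) = (case p of (d, j) \<Rightarrow> of_nat q / gauss_sum q chi * of_real \<zeta> / (2 * of_real pi * sin th) *
      (of_nat (Suc d) powr (- \<nu>) * chi (Suc j) * (1 - of_nat (Suc d * Suc j) powr \<nu> * of_real \<zeta> powr (- \<nu>)) / (of_real (\<zeta>\<^sup>2) - of_nat (Suc d * Suc j) ^ 2)))" for p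
  proof (cases p)
    case (Pair d j)
    define D where "D = real (Suc d)"
    define J where "J = real (Suc j)"
    have DJ: "D > 0" "J > 0" by (auto simp: D_def J_def)
    have nz: "\<zeta>\<^sup>2 - (D * J)\<^sup>2 \<noteq> 0"
    proof
      assume "\<zeta>\<^sup>2 - (D * J)\<^sup>2 = 0"
      hence "\<zeta> = D * J" using \<zeta> DJ by (simp add: power2_eq_iff_nonneg)
      hence "\<zeta> = of_nat (Suc d * Suc j)" by (simp only: D_def J_def of_nat_mult)
      thus False using \<zeta>(2) by (metis Ints_of_nat)
    qed
    \<comment> \<open>As a function of y^2 the product of the two fractions has poles at -1/D^2 and
      -(J/\<zeta>)^2. They are distinct by \<open>nz\<close>, so the product splits into a
      difference of two simple fractions.\<close>
    have eq: "f p y = (K * chi (Suc j) * of_real (2 * \<zeta> / pi / (\<zeta>\<^sup>2 - (D * J)\<^sup>2))) *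
        (of_real y powr (\<nu> - 1) / of_real (1 + (D * y)\<^sup>2) - of_real y powr (\<nu> - 1) / of_real (1 + (\<zeta> / J * y)\<^sup>2))"
      if "y \<in> space half_line" for y
    proof -
      have y: "y > 0" using that by simp
      have 1: "1 + (D * y)\<^sup>2 \<noteq> 0" "1 + (\<zeta> / J * y)\<^sup>2 \<noteq> 0" "(\<zeta> * y)\<^sup>2 + J\<^sup>2 \<noteq> 0"
        using DJ zero_le_power2 [of "D * y"] zero_le_power2 [of "\<zeta> / J * y"] zero_le_power2 [of "\<zeta> * y"] by (auto simp: add_nonneg_eq_0_iff)
      have e1: "2 * (1 / y) / ((1 / y)\<^sup>2 + D\<^sup>2) = 2 * y / (1 + (D * y)\<^sup>2)"
        using y 1 DJ by (simp add: field_simps power2_eq_square add_nonneg_eq_0_iff)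
      have e2: "1 / (1 + (\<zeta> / J * y)\<^sup>2) = J\<^sup>2 / ((\<zeta> * y)\<^sup>2 + J\<^sup>2)"
        using DJ 1 by (simp add: field_simps power2_eq_square)
      have e3: "1 / (1 + (D * y)\<^sup>2) - J\<^sup>2 / ((\<zeta> * y)\<^sup>2 + J\<^sup>2) = (\<zeta>\<^sup>2 - (D * J)\<^sup>2) * y\<^sup>2 / ((1 + (D * y)\<^sup>2) * ((\<zeta> * y)\<^sup>2 + J\<^sup>2))"
        using 1 by (simp add: diff_frac_eq power2_eq_square algebra_simps)
      have r: "1 / (2 * pi) * (2 * (1 / y) / ((1 / y)\<^sup>2 + D\<^sup>2)) * (2 * (\<zeta> * y) / ((\<zeta> * y)\<^sup>2 + J\<^sup>2)) =
         2 * \<zeta> / pi / (\<zeta>\<^sup>2 - (D * J)\<^sup>2) * (1 / (1 + (D * y)\<^sup>2) - 1 / (1 + (\<zeta> / J * y)\<^sup>2))"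
      proof -
        have "1 / (2 * pi) * (2 * y / U) * (2 * (\<zeta> * y) / V) = 2 * \<zeta> / pi / X * (X * y\<^sup>2 / (U * V))" if "X \<noteq> 0" for U V X :: real
          using that by (simp add: power2_eq_square mult_ac)
        thus ?thesis unfolding e1 e2 e3 using nz by blast
      qed
      have "f p y = K * chi (Suc j) * of_real y powr (\<nu> - 1) * of_real (1 / (2 * pi) * (2 * (1 / y) / ((1 / y)\<^sup>2 + D\<^sup>2)) * (2 * (\<zeta> * y) / ((\<zeta> * y)\<^sup>2 + J\<^sup>2)))"
        unfolding f_def Pair prod.case a_def b_def D_def [symmetric] J_def [symmetric] of_real_mult by (simp only: mult_ac)
      also have "\<dots> = (K * chi (Suc j) * of_real (2 * \<zeta> / pi / (\<zeta>\<^sup>2 - (D * J)\<^sup>2))) * (of_real y powr (\<nu> - 1) * of_real (1 / (1 + (D * y)\<^sup>2) - 1 / (1 + (\<zeta> / J * y)\<^sup>2)))"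
        unfolding r of_real_mult by (simp only: mult_ac)
      also have "of_real y powr (\<nu> - 1) * complex_of_real (1 / (1 + (D * y)\<^sup>2) - 1 / (1 + (\<zeta> / J * y)\<^sup>2)) =
        of_real y powr (\<nu> - 1) / of_real (1 + (D * y)\<^sup>2) - of_real y powr (\<nu> - 1) / of_real (1 + (\<zeta> / J * y)\<^sup>2)"
        by (simp only: of_real_diff of_real_divide of_real_1 right_diff_distrib times_divide_eq_right mult_1_right)
      finally show ?thesis .
    qed
    have \<nu>2: "0 < Re \<nu>" "Re \<nu> < 2" using \<nu> by auto
    have zj: "\<zeta> / J > 0" using \<zeta> DJ by simp
    have "(\<integral>y. f p y \<partial>half_line) = (K * chi (Suc j) * of_real (2 * \<zeta> / pi / (\<zeta>\<^sup>2 - (D * J)\<^sup>2))) *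
        (of_real D powr (- \<nu>) * (of_real pi / (2 * sin (of_real pi * \<nu> / 2))) - of_real (\<zeta> / J) powr (- \<nu>) * (of_real pi / (2 * sin (of_real pi * \<nu> / 2))))"
      by (subst Bochner_Integration.integral_cong [OF refl eq], assumption, subst integral_mult_right_zero)
         (simp only: Bochner_Integration.integral_diff [OF half_line_mellin_square(1) [OF \<nu>2 DJ(1)] half_line_mellin_square(1) [OF \<nu>2 zj]]
           half_line_mellin_square(2) [OF \<nu>2 DJ(1)] half_line_mellin_square(2) [OF \<nu>2 zj])
    also have "\<dots> = (K * chi (Suc j) * of_real (2 * \<zeta> / pi / (\<zeta>\<^sup>2 - (D * J)\<^sup>2))) * (of_real pi / (2 * sin th)) * (of_real D powr (- \<nu>) - of_real (\<zeta> / J) powr (- \<nu>))"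
      unfolding th_def [symmetric] by (simp only: left_diff_distrib [symmetric] mult.commute mult.left_commute mult.assoc)
    also have "of_real (\<zeta> / J) powr (- \<nu>) = of_real D powr (- \<nu>) * (complex_of_real (D * J) powr \<nu> * of_real \<zeta> powr (- \<nu>))"
      using \<zeta> DJ by (subst (1 2 3 4) of_real_powr_eq_exp) (auto simp: ln_mult ln_div algebra_simps simp flip: exp_add)
    also have "(K * chi (Suc j) * of_real (2 * \<zeta> / pi / (\<zeta>\<^sup>2 - (D * J)\<^sup>2))) * (of_real pi / (2 * sin th)) *
        (of_real D powr (- \<nu>) - of_real D powr (- \<nu>) * (complex_of_real (D * J) powr \<nu> * of_real \<zeta> powr (- \<nu>))) =
      of_nat q / gauss_sum q chi * of_real \<zeta> / (2 * of_real pi * sin th) *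
      (of_real D powr (- \<nu>) * chi (Suc j) * (1 - complex_of_real (D * J) powr \<nu> * of_real \<zeta> powr (- \<nu>)) / of_real (\<zeta>\<^sup>2 - (D * J)\<^sup>2))"
      using nz sinth tau unfolding K_def by (simp add: divide_simps del: of_real_diff of_real_power of_real_mult) (simp add: algebra_simps)
    also have "complex_of_real (\<zeta>\<^sup>2 - (D * J)\<^sup>2) = of_real (\<zeta>\<^sup>2) - of_real (D * J) ^ 2" by simp
    also have "complex_of_real (D * J) = of_nat (Suc d * Suc j)" by (simp only: D_def J_def of_nat_mult of_real_mult of_real_of_nat_eq)
    also have "complex_of_real D = of_nat (Suc d)" by (simp only: D_def of_real_of_nat_eq)
    finally show ?thesis unfolding Pair prod.case .
  qed
  have "((\<lambda>p. case p of (d, j) \<Rightarrow> of_nat q / gauss_sum q chi * of_real \<zeta> / (2 * of_real pi * sin th) *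
      (of_nat (Suc d) powr (- \<nu>) * chi (Suc j) * (1 - of_nat (Suc d * Suc j) powr \<nu> * of_real \<zeta> powr (- \<nu>)) / (of_real (\<zeta>\<^sup>2) - of_nat (Suc d * Suc j) ^ 2)))
      has_sum (\<integral>y. of_real y powr (\<nu> - 1) * (of_real (?G (1 / y) + 1/2 - y / (2 * pi)) * ?t y) \<partial>half_line)) UNIV"
    using sum_f unfolding val .
  hence "(\<lambda>n. \<Sum>d | d dvd Suc n. of_nat q / gauss_sum q chi * of_real \<zeta> / (2 * of_real pi * sin th) *
      (of_nat d powr (- \<nu>) * chi (Suc n div d) * (1 - of_nat (d * (Suc n div d)) powr \<nu> * of_real \<zeta> powr (- \<nu>)) / (of_real (\<zeta>\<^sup>2) - of_nat (d * (Suc n div d)) ^ 2)))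
      sums (\<integral>y. of_real y powr (\<nu> - 1) * (of_real (?G (1 / y) + 1/2 - y / (2 * pi)) * ?t y) \<partial>half_line)"
    by (rule divisor_sums)
  also have "(\<lambda>n. \<Sum>d | d dvd Suc n. of_nat q / gauss_sum q chi * of_real \<zeta> / (2 * of_real pi * sin th) *
      (of_nat d powr (- \<nu>) * chi (Suc n div d) * (1 - of_nat (d * (Suc n div d)) powr \<nu> * of_real \<zeta> powr (- \<nu>)) / (of_real (\<zeta>\<^sup>2) - of_nat (d * (Suc n div d)) ^ 2))) =
    (\<lambda>n. of_nat q / gauss_sum q chi * of_real \<zeta> / (2 * of_real pi * sin th) *
            (sigma_bar_char (- \<nu>) chi (Suc n) * (1 - of_nat (Suc n) powr \<nu> * of_real \<zeta> powr (- \<nu>)) / (of_real (\<zeta>\<^sup>2) - of_nat (Suc n) ^ 2)))"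
    unfolding sigma_bar_char_def sum_distrib_left sum_distrib_right sum_divide_distrib
    by (intro ext sum.cong refl) auto
  also have "(\<integral>y. of_real y powr (\<nu> - 1) * (of_real (?G (1 / y) + 1/2 - y / (2 * pi)) * ?t y) \<partial>half_line) =
     kosh_integral \<zeta> - kosh_const * of_real \<zeta> powr (- \<nu> - 1)
            + of_nat q / gauss_sum q chi * dirichlet_L chi (1 - \<nu>) / (4 * cos th) * of_real \<zeta> powr (- \<nu>)"
  proof -
    have m1: "(\<integral>u. of_real u powr (\<nu> - 1) * char_theta q chi u \<partial>half_line) = of_nat q / gauss_sum q chi * dirichlet_L chi (1 - \<nu>) / (2 * cos th)"
      unfolding th_def using \<nu> by (intro char_theta_mellin) auto
    have m2: "(\<integral>u. of_real u powr ((\<nu> + 1) - 1) * char_theta q chi u \<partial>half_line) = of_real (2 * pi) * kosh_const"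
      by (simp add: kosh_const_def)
    have m3: "- (\<nu> + 1) = - \<nu> - 1" by simp
    show ?thesis
      unfolding kosh scale(2) [OF r1(1)] scale(2) [OF r1(2)] m1 m2 m3 by (simp add: field_simps)
  qed
  finally show ?thesis .
qed

end

subsection \<open>Holomorphic continuation of the identity\<close>

text \<open>Only squares with nonzero coefficient are excluded from the domain. Setting finitely
  many coefficients to 0 therefore yields a function holomorphic across those points, which is how
  the poles inside the interval are separated later.\<close>

lemma pole_series_holomorphic:
  fixes c :: "nat \<Rightarrow> complex"
  assumes c: "summable (\<lambda>n. norm (c n) / real (Suc n) ^ 2)"
  shows "(\<lambda>x. \<Sum>n. c n / (x - of_nat (Suc n) ^ 2)) holomorphic_on - {of_nat (Suc n) ^ 2 | n. c n \<noteq> 0}"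
    and "x \<notin> {of_nat (Suc n) ^ 2 | n. c n \<noteq> 0} \<Longrightarrow> summable (\<lambda>n. norm (c n / (x - of_nat (Suc n) ^ 2)))"
proof -
  let ?P = "{of_nat (Suc n) ^ 2 | n. c n \<noteq> 0} :: complex set"
  have "?P = of_nat ` ((\<lambda>n. Suc n ^ 2) ` {n. c n \<noteq> 0})" by (simp add: setcompr_eq_image image_image)
  hence op: "open (- ?P)" by (simp add: closed_of_nat_image open_Compl)
  have bd: "\<forall>\<^sub>F n in sequentially. \<forall>z\<in>cball x d. norm (c n / (z - of_nat (Suc n) ^ 2)) \<le> 2 * (norm (c n) / real (Suc n) ^ 2)" for x :: complex and d
  proof -
    have "filterlim (\<lambda>n. real (Suc n) ^ 2) at_top sequentially"
      by (intro filterlim_pow_at_top filterlim_compose [OF filterlim_real_sequentially] filterlim_Suc) auto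
    hence "\<forall>\<^sub>F n in sequentially. real (Suc n) ^ 2 \<ge> 2 * (norm x + \<bar>d\<bar>)"
      by (auto simp: filterlim_at_top)
    thus ?thesis
    proof eventually_elim
      case (elim n)
      show ?case
      proof
        fix z assume "z \<in> cball x d"
        hence "norm z \<le> norm x + \<bar>d\<bar>"
          using norm_triangle_ineq [of x "z - x"] by (simp add: dist_norm norm_minus_commute)
        moreover have "real (Suc n) ^ 2 \<le> norm z + norm (z - of_nat (Suc n) ^ 2)"
          using norm_triangle_ineq4 [of z "z - of_nat (Suc n) ^ 2"] by (simp add: norm_power del: of_nat_Suc)
        ultimately have "real (Suc n) ^ 2 / 2 \<le> norm (z - of_nat (Suc n) ^ 2)" using elim by simp
        hence "norm (c n) / norm (z - of_nat (Suc n) ^ 2) \<le> norm (c n) / (real (Suc n) ^ 2 / 2)"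
          by (intro divide_left_mono mult_pos_pos) (auto intro: less_le_trans [of 0 "real (Suc n) ^ 2 / 2"])
        thus "norm (c n / (z - of_nat (Suc n) ^ 2)) \<le> 2 * (norm (c n) / real (Suc n) ^ 2)"
          by (simp add: norm_divide mult.commute del: of_nat_Suc)
      qed
    qed
  qed
  show "(\<lambda>x. \<Sum>n. c n / (x - of_nat (Suc n) ^ 2)) holomorphic_on - ?P"
  proof (rule holomorphic_uniform_sequence [OF op])
    show "(\<lambda>x. \<Sum>n<N. c n / (x - of_nat (Suc n) ^ 2)) holomorphic_on - ?P" for N
    proof (intro holomorphic_on_sum)
      fix n
      show "(\<lambda>x. c n / (x - of_nat (Suc n) ^ 2)) holomorphic_on - ?P"
      proof (cases "c n = 0")
        case False
        thus ?thesis by (intro holomorphic_intros) auto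
      qed simp
    qed
    fix x assume "x \<in> - ?P"
    then obtain d where d: "d > 0" "cball x d \<subseteq> - ?P" using op open_contains_cball by blast
    moreover have "uniform_limit (cball x d) (\<lambda>N x. \<Sum>n<N. c n / (x - of_nat (Suc n) ^ 2)) (\<lambda>x. \<Sum>n. c n / (x - of_nat (Suc n) ^ 2)) sequentially"
      by (rule Weierstrass_m_test_ev [OF bd summable_mult [OF c]])
    ultimately show "\<exists>d>0. cball x d \<subseteq> - ?P \<and> uniform_limit (cball x d) (\<lambda>N x. \<Sum>n<N. c n / (x - of_nat (Suc n) ^ 2)) (\<lambda>x. \<Sum>n. c n / (x - of_nat (Suc n) ^ 2)) sequentially"
      by blast
  qed
  show "summable (\<lambda>n. norm (c n / (x - of_nat (Suc n) ^ 2)))"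
  proof (rule summable_comparison_test_ev [OF _ summable_mult [OF c, of 2]])
    show "\<forall>\<^sub>F n in sequentially. norm (norm (c n / (x - of_nat (Suc n) ^ 2))) \<le> 2 * (norm (c n) / real (Suc n) ^ 2)"
      using bd [of x 0] by eventually_elim simp
  qed
qed

lemma summable_power_exp_sqrt:
  assumes "\<delta> > 0"
  shows "summable (\<lambda>n. real (Suc n) ^ k * exp (- (\<delta> * sqrt (real (Suc n)))))"
proof (rule summable_comparison_test')
  \<comment> \<open>The power N of the square root is the power k + 2 of Suc n: k to cancel the
    polynomial factor, 2 for convergence.\<close>
  define N where "N = 2 * (k + 2)"
  have "summable (\<lambda>n. inverse (real n ^ 2))" by (rule inverse_power_summable) simp
  hence "summable (\<lambda>n. inverse (real (Suc n) ^ 2))" by (subst summable_Suc_iff)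
  thus "summable (\<lambda>n. fact N / \<delta> ^ N * inverse (real (Suc n) ^ 2))" by (rule summable_mult)
  show "norm (real (Suc n) ^ k * exp (- (\<delta> * sqrt (real (Suc n))))) \<le> fact N / \<delta> ^ N * inverse (real (Suc n) ^ 2)" for n
  proof -
    have "exp (- (\<delta> * sqrt (real (Suc n)))) \<le> fact N / (\<delta> * sqrt (real (Suc n))) ^ N"
      using assms by (intro exp_neg_le_power) auto
    also have "(\<delta> * sqrt (real (Suc n))) ^ N = \<delta> ^ N * (real (Suc n) ^ k * real (Suc n) ^ 2)"
      unfolding power_mult_distrib N_def power_mult by (simp add: power_add [symmetric] del: of_nat_Suc)
    finally have "real (Suc n) ^ k * exp (- (\<delta> * sqrt (real (Suc n)))) \<le> real (Suc n) ^ k * (fact N / (\<delta> ^ N * (real (Suc n) ^ k * real (Suc n) ^ 2)))"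
      by (intro mult_left_mono) auto
    also have "\<dots> = fact N / \<delta> ^ N * inverse (real (Suc n) ^ 2)"
      by (simp add: field_simps del: of_nat_Suc)
    finally show ?thesis by (simp del: of_nat_Suc)
  qed
qed

context koshliakov_setup
begin

text \<open>All sequences here are indexed from 0: entry n belongs to the integer n + 1.\<close>

definition div_coeff :: "nat \<Rightarrow> complex" where
  "div_coeff n = sigma_bar_char (- \<nu>) chi (Suc n)"

definition dual_coeff :: "nat \<Rightarrow> complex" where
  "dual_coeff n = of_real (2 * pi) powr \<nu> * of_nat (Suc n) powr \<nu> * sigma_char (- \<nu>) (\<lambda>m. cnj (chi m)) (Suc n)"

text \<open>Half the frequency of the Bessel argument in the theorem, because
  \<open>kernel_K\<close> at Z contains K at 2 Z.\<close>

definition dual_freq :: "nat \<Rightarrow> real" where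
  "dual_freq n = 2 * pi * sqrt (real (Suc n) / real q)"

lemma dual_freq_pos: "dual_freq n > 0"
  using q1 by (simp add: dual_freq_def)

text \<open>The coefficients are bounded by the number of divisors, whose Dirichlet series with
  exponent Re \<nu> - 2 < -1 is the square of a convergent series, by
  \<open>divisor_sums\<close>.\<close>

lemma norm_div_coeff_summable:
  "summable (\<lambda>n. norm (div_coeff n * of_nat (Suc n) powr \<nu>) / real (Suc n) ^ 2)"
  "summable (\<lambda>n. norm (div_coeff n) / real (Suc n) ^ 2)"
proof -
  define r where "r = Re \<nu> - 2"
  have sr: "summable (\<lambda>h. norm (complex_of_real (real (Suc h) powr r)))"
  proof -
    have "summable (\<lambda>h. real h powr r)" using \<nu> by (subst summable_real_powr_iff) (auto simp: r_def)
    hence "summable (\<lambda>h. real (Suc h) powr r)" by (subst summable_Suc_iff)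
    thus ?thesis by simp
  qed
  define F where "F = (\<lambda>d k. complex_of_real (real d powr r) * complex_of_real (real k powr r))"
  have "((\<lambda>(h, k). F (Suc h) (Suc k)) has_sum (suminf (\<lambda>h. complex_of_real (real (Suc h) powr r)) * suminf (\<lambda>h. complex_of_real (real (Suc h) powr r)))) UNIV"
    unfolding F_def by (rule has_sum_pair_product(1) [OF sr sr])
  hence "summable (\<lambda>n. \<Sum>d | d dvd Suc n. F d (Suc n div d))"
    using divisor_sums sums_summable by blast
  also have "(\<lambda>n. \<Sum>d | d dvd Suc n. F d (Suc n div d)) = (\<lambda>n. complex_of_real (\<Sum>d | d dvd Suc n. real (Suc n) powr r))"
  proof
    fix n
    have "F d (Suc n div d) = of_real (real (Suc n) powr r)" if "d dvd Suc n" for d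
    proof -
      have "real (Suc n) = real d * real (Suc n div d)" using that by (metis dvd_mult_div_cancel of_nat_mult)
      thus ?thesis unfolding F_def of_real_mult [symmetric] by (simp only: powr_mult)
    qed
    thus "(\<Sum>d | d dvd Suc n. F d (Suc n div d)) = complex_of_real (\<Sum>d | d dvd Suc n. real (Suc n) powr r)"
      unfolding of_real_sum by (intro sum.cong) auto
  qed
  finally have s: "summable (\<lambda>n. \<Sum>d | d dvd Suc n. real (Suc n) powr r)"
    by (simp only: summable_of_real_iff)
  have nd: "norm (div_coeff n) \<le> (\<Sum>d | d dvd Suc n. 1)" for n
    unfolding div_coeff_def sigma_bar_char_def
  proof (rule sum_norm_le)
    fix d assume "d \<in> {d. d dvd Suc n}"
    hence "d > 0" by (auto intro!: Nat.gr0I)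
    hence "norm (complex_of_nat d powr (- \<nu>)) \<le> 1"
      using norm_of_real_powr [of "real d" "- \<nu>"] \<nu> by (simp add: powr_le_one_le ge_one_powr_ge_zero powr_minus inverse_le_1_iff)
    thus "norm (complex_of_nat d powr (- \<nu>) * chi (Suc n div d)) \<le> 1"
      using norm_dirichlet_char(2) [OF chi, of "Suc n div d"] by (simp add: norm_mult mult_le_one)
  qed
  have np: "norm (complex_of_nat (Suc n) powr \<nu>) = real (Suc n) powr Re \<nu>" for n
    using norm_of_real_powr [of "real (Suc n)" \<nu>] by (simp del: of_nat_Suc)
  show 1: "summable (\<lambda>n. norm (div_coeff n * of_nat (Suc n) powr \<nu>) / real (Suc n) ^ 2)"
  proof (rule summable_comparison_test' [OF s])
    fix n
    have "norm (div_coeff n * of_nat (Suc n) powr \<nu>) / real (Suc n) ^ 2 = norm (div_coeff n) * real (Suc n) powr r"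
      unfolding norm_mult np r_def by (simp add: powr_diff powr_numeral del: of_nat_Suc)
    also have "\<dots> \<le> (\<Sum>d | d dvd Suc n. 1) * real (Suc n) powr r" by (intro mult_right_mono nd) auto
    finally show "norm (norm (div_coeff n * of_nat (Suc n) powr \<nu>) / real (Suc n) ^ 2) \<le> (\<Sum>d | d dvd Suc n. real (Suc n) powr r)"
      by (simp del: of_nat_Suc)
  qed
  show "summable (\<lambda>n. norm (div_coeff n) / real (Suc n) ^ 2)"
  proof (rule summable_comparison_test' [OF 1])
    fix n
    have "norm (div_coeff n) * 1 \<le> norm (div_coeff n) * real (Suc n) powr Re \<nu>"
      using \<nu> by (intro mult_left_mono ge_one_powr_ge_zero) auto
    thus "norm (norm (div_coeff n) / real (Suc n) ^ 2) \<le> norm (div_coeff n * of_nat (Suc n) powr \<nu>) / real (Suc n) ^ 2"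
      unfolding norm_mult np by (simp add: divide_right_mono del: of_nat_Suc)
  qed
qed

lemma norm_sigma_char_le: "norm (sigma_char (- \<nu>) (\<lambda>m. cnj (chi m)) (Suc n)) \<le> real (card {d. d dvd Suc n})"
proof -
  have "norm (sigma_char (- \<nu>) (\<lambda>m. cnj (chi m)) (Suc n)) \<le> (\<Sum>d | d dvd Suc n. 1)"
    unfolding sigma_char_def
  proof (rule sum_norm_le)
    fix d assume "d \<in> {d. d dvd Suc n}"
    hence "d > 0" by (auto intro!: Nat.gr0I)
    hence "norm (complex_of_nat d powr (- \<nu>)) \<le> 1"
      using norm_of_real_powr [of "real d" "- \<nu>"] \<nu> by (simp add: ge_one_powr_ge_zero powr_minus inverse_le_1_iff)
    thus "norm (complex_of_nat d powr (- \<nu>) * cnj (chi d)) \<le> 1"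
      using norm_dirichlet_char(2) [OF chi, of d] by (simp add: norm_mult mult_le_one)
  qed
  thus ?thesis by simp
qed

text \<open>The power \<open>Re \<nu> / 2 - 1/4\<close> of \<open>n + 1\<close> is the size of the terms before integration; it is what the
  hypothesis \<open>Re \<nu> < 1/2\<close> has to control.\<close>
lemma dual_term_bound:
  obtains C where "C > 0"
    "\<And>n w. w \<noteq> 0 \<Longrightarrow> Re w \<ge> 0 \<or> \<bar>Im w\<bar> \<ge> \<bar>Re w\<bar> \<Longrightarrow>
        norm (dual_coeff n * kernel_K \<nu> (of_real (dual_freq n) * w)) \<le>
          C * real (card {d. d dvd Suc n}) * real (Suc n) powr (Re \<nu> / 2 - 1/4) * norm w powr (- Re \<nu> - 1/2) * exp (- 2 * dual_freq n * Re w)"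
proof -
  obtain C where C: "C > 0" "\<And>Z. Z \<noteq> 0 \<Longrightarrow> Re Z \<ge> 0 \<or> \<bar>Im Z\<bar> \<ge> \<bar>Re Z\<bar> \<Longrightarrow>
        norm (kernel_K \<nu> Z) \<le> C * norm Z powr (- Re \<nu> - 1/2) * exp (- 2 * Re Z)"
    by (rule kernel_K_bound [OF \<nu>]) blast
  define s where "s = - Re \<nu> - 1/2"
  define b where "b = 2 * pi / sqrt (real q)"
  have b: "b > 0" using q1 by (simp add: b_def)
  define C' where "C' = (2 * pi) powr Re \<nu> * C * b powr s"
  have C': "C' > 0" using C b by (simp add: C'_def)
  have "norm (dual_coeff n * kernel_K \<nu> (of_real (dual_freq n) * w)) \<le>
          C' * real (card {d. d dvd Suc n}) * real (Suc n) powr (Re \<nu> / 2 - 1/4) * norm w powr s * exp (- 2 * dual_freq n * Re w)"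
    if w: "w \<noteq> 0" "Re w \<ge> 0 \<or> \<bar>Im w\<bar> \<ge> \<bar>Re w\<bar>" for n w
  proof -
    define \<rho> where "\<rho> = dual_freq n"
    have \<rho>: "\<rho> > 0" by (simp add: \<rho>_def dual_freq_pos)
    have "Re (of_real \<rho> * w) \<ge> 0 \<or> \<bar>Im (of_real \<rho> * w)\<bar> \<ge> \<bar>Re (of_real \<rho> * w)\<bar>"
      using w(2) \<rho> by (auto simp: abs_mult)
    hence "norm (kernel_K \<nu> (of_real \<rho> * w)) \<le> C * norm (of_real \<rho> * w) powr s * exp (- 2 * Re (of_real \<rho> * w))"
      unfolding s_def using w(1) \<rho> by (intro C(2)) auto
    also have "norm (of_real \<rho> * w) powr s = \<rho> powr s * norm w powr s"
      using \<rho> by (simp add: norm_mult powr_mult)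
    also have "\<rho> powr s = b powr s * real (Suc n) powr (s / 2)"
    proof -
      have "\<rho> = b * real (Suc n) powr (1/2)"
        by (simp add: \<rho>_def dual_freq_def b_def real_sqrt_divide powr_half_sqrt del: of_nat_Suc)
      thus ?thesis using b by (simp add: powr_mult powr_powr del: of_nat_Suc)
    qed
    finally have k: "norm (kernel_K \<nu> (of_real \<rho> * w)) \<le> C * (b powr s * real (Suc n) powr (s / 2) * norm w powr s) * exp (- 2 * \<rho> * Re w)"
      by (simp add: mult_ac)
    have "norm (dual_coeff n) \<le> (2 * pi) powr Re \<nu> * real (Suc n) powr Re \<nu> * real (card {d. d dvd Suc n})"
    proof -
      have "norm (dual_coeff n) = (2 * pi) powr Re \<nu> * real (Suc n) powr Re \<nu> * norm (sigma_char (- \<nu>) (\<lambda>m. cnj (chi m)) (Suc n))"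
        using norm_of_real_powr [of "2 * pi" \<nu>] norm_of_real_powr [of "real (Suc n)" \<nu>]
        unfolding dual_coeff_def norm_mult by (simp del: of_nat_Suc of_real_mult)
      thus ?thesis using norm_sigma_char_le [of n] by (simp add: mult_left_mono del: of_nat_Suc)
    qed
    from mult_mono [OF this k]
    have "norm (dual_coeff n * kernel_K \<nu> (of_real \<rho> * w)) \<le>
       ((2 * pi) powr Re \<nu> * real (Suc n) powr Re \<nu> * real (card {d. d dvd Suc n})) *
       (C * (b powr s * real (Suc n) powr (s / 2) * norm w powr s) * exp (- 2 * \<rho> * Re w))"
      unfolding norm_mult by (simp del: of_nat_Suc)
    also have "\<dots> = C' * real (card {d. d dvd Suc n}) * (real (Suc n) powr Re \<nu> * real (Suc n) powr (s / 2)) * norm w powr s * exp (- 2 * \<rho> * Re w)"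
      by (simp only: C'_def mult_ac)
    also have "real (Suc n) powr Re \<nu> * real (Suc n) powr (s / 2) = real (Suc n) powr (Re \<nu> / 2 - 1/4)"
      by (simp add: powr_add [symmetric] s_def field_simps del: of_nat_Suc)
    finally show ?thesis by (simp add: \<rho>_def)
  qed
  thus ?thesis using that C' by (simp add: s_def)
qed

text \<open>Away from the imaginary axis the exponential of sqrt n outweighs even the crude bound n
  for the number of divisors of n, so the Weierstrass test applies.\<close>

lemma dual_series_uniform:
  assumes \<delta>: "\<delta> > 0" and A: "\<And>w. w \<in> A \<Longrightarrow> Re w \<ge> \<delta>"
  obtains M where "summable M" "\<And>n w. w \<in> A \<Longrightarrow> norm (dual_coeff n * kernel_K \<nu> (of_real (dual_freq n) * w)) \<le> M n"
proof -
  obtain C where C: "C > 0" "\<And>n w. w \<noteq> 0 \<Longrightarrow> Re w \<ge> 0 \<or> \<bar>Im w\<bar> \<ge> \<bar>Re w\<bar> \<Longrightarrow>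
        norm (dual_coeff n * kernel_K \<nu> (of_real (dual_freq n) * w)) \<le>
          C * real (card {d. d dvd Suc n}) * real (Suc n) powr (Re \<nu> / 2 - 1/4) * norm w powr (- Re \<nu> - 1/2) * exp (- 2 * dual_freq n * Re w)"
    by (rule dual_term_bound) blast
  define b where "b = 2 * (2 * pi / sqrt (real q)) * \<delta>"
  have b: "b > 0" using q1 \<delta> by (simp add: b_def)
  define M where "M = (\<lambda>n. C * \<delta> powr (- Re \<nu> - 1/2) * (real (Suc n) ^ 1 * exp (- (b * sqrt (real (Suc n))))))"
  have sM: "summable M" unfolding M_def by (intro summable_mult summable_power_exp_sqrt b)
  moreover have "norm (dual_coeff n * kernel_K \<nu> (of_real (dual_freq n) * w)) \<le> M n" if w: "w \<in> A" for n w
  proof -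
    have Rw: "Re w \<ge> \<delta>" "norm w \<ge> \<delta>" using A [OF w] complex_Re_le_cmod [of w] by auto
    hence w0: "w \<noteq> 0" "Re w \<ge> 0" using \<delta> by auto
    have "card {d. d dvd Suc n} \<le> card {1..Suc n}" by (intro card_mono) (auto dest: dvd_imp_le intro!: Suc_leI Nat.gr0I)
    hence d: "real (card {d. d dvd Suc n}) \<le> real (Suc n) ^ 1" by (simp del: of_nat_Suc)
    have p: "real (Suc n) powr (Re \<nu> / 2 - 1/4) \<le> 1"
      using powr_mono [of "Re \<nu> / 2 - 1/4" 0 "real (Suc n)"] \<nu> by simp
    have e: "exp (- 2 * dual_freq n * Re w) \<le> exp (- (b * sqrt (real (Suc n))))"
    proof -
      have "b * sqrt (real (Suc n)) = 2 * dual_freq n * \<delta>"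
        by (simp add: b_def dual_freq_def real_sqrt_divide del: of_nat_Suc)
      also have "\<dots> \<le> 2 * dual_freq n * Re w" using Rw dual_freq_pos [of n] by (intro mult_left_mono) auto
      finally show ?thesis by simp
    qed
    have n: "norm w powr (- Re \<nu> - 1/2) \<le> \<delta> powr (- Re \<nu> - 1/2)"
      using \<delta> Rw \<nu> by (intro powr_mono2') auto
    have "norm (dual_coeff n * kernel_K \<nu> (of_real (dual_freq n) * w)) \<le>
       C * real (card {d. d dvd Suc n}) * real (Suc n) powr (Re \<nu> / 2 - 1/4) * norm w powr (- Re \<nu> - 1/2) * exp (- 2 * dual_freq n * Re w)"
      using C(2) [OF w0(1)] w0 by blast
    also have "\<dots> \<le> C * real (Suc n) ^ 1 * 1 * \<delta> powr (- Re \<nu> - 1/2) * exp (- (b * sqrt (real (Suc n))))"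
      using C(1) d p e n by (intro mult_mono mult_nonneg_nonneg) auto
    finally show ?thesis by (simp add: M_def mult_ac)
  qed
  ultimately show ?thesis by (rule that)
qed

definition pole_sum :: "(nat \<Rightarrow> complex) \<Rightarrow> complex \<Rightarrow> complex" where
  "pole_sum c x = (\<Sum>n. c n / (x - of_nat (Suc n) ^ 2))"

text \<open>\<open>kosh_integral_explicit\<close> solved for the integral and rewritten with \<zeta>
  = w^2; the poles at \<zeta>^2 = N^2 then sit at w^4 = N^2.\<close>

definition kosh_sum :: "complex \<Rightarrow> complex" where
  "kosh_sum w = kosh_const * w powr (- 2 * \<nu> - 2)
     - of_nat q / gauss_sum q chi * dirichlet_L chi (1 - \<nu>) / (4 * cos (of_real pi * \<nu> / 2)) * w powr (- 2 * \<nu>)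
     + of_nat q / gauss_sum q chi * w\<^sup>2 / (2 * of_real pi * sin (of_real pi * \<nu> / 2)) *
       (pole_sum div_coeff (w ^ 4) - w powr (- 2 * \<nu>) * pole_sum (\<lambda>n. div_coeff n * of_nat (Suc n) powr \<nu>) (w ^ 4))"

lemma dual_series_summable:
  assumes "Re w > 0"
  shows "summable (\<lambda>n. dual_coeff n * kernel_K \<nu> (of_real (dual_freq n) * w))"
proof -
  obtain M where M: "summable M" "\<And>n z. z \<in> {w} \<Longrightarrow> norm (dual_coeff n * kernel_K \<nu> (of_real (dual_freq n) * z)) \<le> M n"
    using dual_series_uniform [of "Re w" "{w}"] assms by auto
  thus ?thesis by (intro summable_comparison_test' [OF M(1)]) auto
qed

text \<open>Analytic continuation from the real interval (0, 1), which contains no pole. The right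
  half-plane without the countable closed set of poles is still connected.\<close>

lemma koshliakov:
  assumes w: "Re w > 0" "\<And>n. w \<noteq> of_real (sqrt (real (Suc n)))"
  shows "(\<lambda>n. dual_coeff n * kernel_K \<nu> (of_real (dual_freq n) * w)) sums kosh_sum w"
proof -
  define P where "P = (\<lambda>n. complex_of_real (sqrt (real (Suc n)))) ` UNIV"
  let ?H = "{w. Re w > 0}"
  have opH: "open ?H" by (simp add: open_halfspace_Re_gt)
  \<comment> \<open>In the open right half-plane w^2 cannot be a negative real, so w^4 = N^2 leaves
    only w = sqrt N.\<close>
  have P4: "w ^ 4 \<noteq> of_nat (Suc n) ^ 2" if "w \<in> ?H - P" for w n
  proof
    assume "w ^ 4 = of_nat (Suc n) ^ 2"
    hence "(w\<^sup>2)\<^sup>2 = (of_nat (Suc n))\<^sup>2" by (simp add: power_mult [symmetric])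
    hence "w\<^sup>2 = of_nat (Suc n) \<or> w\<^sup>2 = - of_nat (Suc n)" by (simp only: power2_eq_iff)
    thus False
    proof
      assume "w\<^sup>2 = of_nat (Suc n)"
      also have "\<dots> = (complex_of_real (sqrt (real (Suc n))))\<^sup>2"
        by (simp add: of_real_power [symmetric] del: of_nat_Suc of_real_power)
      finally have "w = of_real (sqrt (real (Suc n))) \<or> w = - of_real (sqrt (real (Suc n)))" by (simp add: power2_eq_iff)
      thus False using that by (auto simp: P_def)
    next
      assume "w\<^sup>2 = - of_nat (Suc n)"
      hence "Im (w\<^sup>2) = 0" "Re (w\<^sup>2) < 0" by simp_all
      thus False using that by (simp add: power2_eq_square)
    qed
  qed
  have closedP: "closed P"
  proof -
    \<comment> \<open>Closedness is read off a preimage of a closed set of integers under the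
      continuous squaring map.\<close>
    have "P = {w. Re w \<ge> 0} \<inter> (\<lambda>w. w\<^sup>2) -` (of_nat ` {1..})"
    proof (intro Set.set_eqI iffI)
      fix w assume "w \<in> P"
      then obtain n where n: "w = of_real (sqrt (real (Suc n)))" by (auto simp: P_def)
      have "w\<^sup>2 = of_nat (Suc n)" unfolding n of_real_power [symmetric] by (simp del: of_nat_Suc of_real_power)
      thus "w \<in> {w. Re w \<ge> 0} \<inter> (\<lambda>w. w\<^sup>2) -` (of_nat ` {1..})" unfolding n by (auto simp del: of_nat_Suc)
    next
      fix w :: complex assume "w \<in> {w. Re w \<ge> 0} \<inter> (\<lambda>w. w\<^sup>2) -` (of_nat ` {1..})"
      then obtain m where m: "m \<ge> 1" "w\<^sup>2 = of_nat m" "Re w \<ge> 0" by auto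
      then obtain n where n: "m = Suc n" by (cases m) auto
      have "w\<^sup>2 = (complex_of_real (sqrt (real (Suc n))))\<^sup>2"
        unfolding m(2) n of_real_power [symmetric] by (simp del: of_nat_Suc of_real_power)
      hence "w = of_real (sqrt (real (Suc n))) \<or> w = - of_real (sqrt (real (Suc n)))" by (simp add: power2_eq_iff)
      hence "w = of_real (sqrt (real (Suc n)))" using m(3) by auto
      thus "w \<in> P" by (auto simp: P_def)
    qed
    moreover have "closed ((\<lambda>w::complex. w\<^sup>2) -` (of_nat ` {1..}))"
      by (intro continuous_closed_vimage closed_of_nat_image) (auto intro!: continuous_intros)
    ultimately show ?thesis by (simp add: closed_Int closed_halfspace_Re_ge)
  qed
  define \<Psi> where "\<Psi> = (\<lambda>w. \<Sum>n. dual_coeff n * kernel_K \<nu> (of_real (dual_freq n) * w))"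
  have holPsi: "\<Psi> holomorphic_on ?H"
  proof (rule holomorphic_uniform_sequence [OF opH])
    show "(\<lambda>w. \<Sum>n<N. dual_coeff n * kernel_K \<nu> (of_real (dual_freq n) * w)) holomorphic_on ?H" for N
    proof (intro holomorphic_intros)
      fix n w assume "w \<in> ?H"
      hence "Re (of_real (dual_freq n) * w) > 0" using dual_freq_pos [of n] by simp
      thus "of_real (dual_freq n) * w \<notin> \<real>\<^sub>\<le>\<^sub>0" by (auto simp: complex_nonpos_Reals_iff)
    qed
    fix w assume w: "w \<in> ?H"
    define d where "d = Re w / 2"
    have d: "d > 0" using w by (simp add: d_def)
    have Re: "Re z \<ge> d" if "z \<in> cball w d" for z
      using that abs_Re_le_cmod [of "w - z"] by (auto simp: dist_norm d_def)
    obtain M where M: "summable M" "\<And>n z. z \<in> cball w d \<Longrightarrow> norm (dual_coeff n * kernel_K \<nu> (of_real (dual_freq n) * z)) \<le> M n"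
      using dual_series_uniform [OF d Re] by metis
    have "uniform_limit (cball w d) (\<lambda>N w. \<Sum>n<N. dual_coeff n * kernel_K \<nu> (of_real (dual_freq n) * w)) \<Psi> sequentially"
      unfolding \<Psi>_def by (rule Weierstrass_m_test [OF M(2) M(1)])
    moreover have "cball w d \<subseteq> ?H" using Re d by force
    ultimately show "\<exists>d>0. cball w d \<subseteq> ?H \<and> uniform_limit (cball w d) (\<lambda>N w. \<Sum>n<N. dual_coeff n * kernel_K \<nu> (of_real (dual_freq n) * w)) \<Psi> sequentially"
      using d by blast
  qed
  have holX: "kosh_sum holomorphic_on ?H - P"
  proof -
    have pole: "(\<lambda>w. pole_sum c (w ^ 4)) holomorphic_on ?H - P" if "summable (\<lambda>n. norm (c n) / real (Suc n) ^ 2)" for c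
    proof -
      have "(pole_sum c \<circ> (\<lambda>w. w ^ 4)) holomorphic_on ?H - P"
        unfolding pole_sum_def [abs_def]
        by (rule holomorphic_on_compose_gen [OF _ pole_series_holomorphic(1) [OF that]])
           (use P4 in \<open>auto intro!: holomorphic_intros\<close>)
      thus ?thesis by (simp add: o_def)
    qed
    have ne: "w \<notin> \<real>\<^sub>\<le>\<^sub>0" if "w \<in> ?H - P" for w using that by (auto simp: complex_nonpos_Reals_iff)
    show ?thesis
      unfolding kosh_sum_def
      by (intro holomorphic_intros pole norm_div_coeff_summable ne)
         (use sin_half_pi_nonzero [of \<nu>] \<nu> in auto)
  qed
  have agree: "\<Psi> (of_real x) = kosh_sum (of_real x)" if x: "0 < x" "x < 1" for x
  proof -
    define \<zeta> where "\<zeta> = x\<^sup>2"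
    have z: "0 < \<zeta>" "\<zeta> < 1" using x by (auto simp: \<zeta>_def power_less_one_iff)
    have zi: "\<zeta> \<notin> \<int>" using z by (auto elim!: Ints_cases)
    have sq: "sqrt \<zeta> = x" using x by (simp add: \<zeta>_def)
    define k where "k = of_nat q / gauss_sum q chi * of_real \<zeta> / (2 * of_real pi * sin (of_real pi * \<nu> / 2))"
    have e1: "(\<lambda>n. k * (div_coeff n * (1 - of_nat (Suc n) powr \<nu> * of_real \<zeta> powr (- \<nu>)) / (of_real (\<zeta>\<^sup>2) - of_nat (Suc n) ^ 2)))
         sums (kosh_integral \<zeta> - kosh_const * of_real \<zeta> powr (- \<nu> - 1)
            + of_nat q / gauss_sum q chi * dirichlet_L chi (1 - \<nu>) / (4 * cos (of_real pi * \<nu> / 2)) * of_real \<zeta> powr (- \<nu>))"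
      unfolding k_def div_coeff_def by (rule kosh_integral_explicit [OF z(1) zi])
    have e2: "(\<lambda>n. dual_coeff n * kernel_K \<nu> (of_real (dual_freq n) * of_real x)) sums kosh_integral \<zeta>"
      using kosh_integral_series [OF z(1)] unfolding dual_coeff_def dual_freq_def sq by simp
    have pw: "complex_of_real \<zeta> powr (- \<nu>) = of_real x powr (- 2 * \<nu>)" "complex_of_real \<zeta> powr (- \<nu> - 1) = of_real x powr (- 2 * \<nu> - 2)"
      unfolding \<zeta>_def using x by (simp_all add: of_real_powr_eq_exp ln_realpow algebra_simps del: of_real_power)
    have x4: "complex_of_real (\<zeta>\<^sup>2) = of_real x ^ 4" by (simp add: \<zeta>_def power_mult [symmetric])
    have np: "complex_of_real x ^ 4 \<notin> {of_nat (Suc n) ^ 2 | n. c n \<noteq> 0}" for c :: "nat \<Rightarrow> complex"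
    proof -
      have "complex_of_real x \<in> ?H - P"
      proof -
        have "x \<noteq> sqrt (real (Suc n))" for n using x by (metis less_irrefl less_le_trans real_sqrt_ge_one of_nat_1 of_nat_le_iff Suc_le_eq One_nat_def zero_less_Suc)
        thus ?thesis using x by (auto simp: P_def simp del: of_nat_Suc)
      qed
      thus ?thesis using P4 by blast
    qed
    have s0: "(\<lambda>n. div_coeff n / (of_real x ^ 4 - of_nat (Suc n) ^ 2)) sums pole_sum div_coeff (of_real x ^ 4)"
      unfolding pole_sum_def
      by (rule summable_sums [OF summable_norm_cancel [OF pole_series_holomorphic(2) [OF norm_div_coeff_summable(2) np]]])
    have s1: "(\<lambda>n. div_coeff n * of_nat (Suc n) powr \<nu> / (of_real x ^ 4 - of_nat (Suc n) ^ 2)) sums pole_sum (\<lambda>n. div_coeff n * of_nat (Suc n) powr \<nu>) (of_real x ^ 4)"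
      unfolding pole_sum_def
      by (rule summable_sums [OF summable_norm_cancel [OF pole_series_holomorphic(2) [OF norm_div_coeff_summable(1) np]]])
    have su: "(\<lambda>n. k * (div_coeff n / (of_real x ^ 4 - of_nat (Suc n) ^ 2) - of_real x powr (- 2 * \<nu>) * (div_coeff n * of_nat (Suc n) powr \<nu> / (of_real x ^ 4 - of_nat (Suc n) ^ 2)))) sums
       (k * (pole_sum div_coeff (of_real x ^ 4) - of_real x powr (- 2 * \<nu>) * pole_sum (\<lambda>n. div_coeff n * of_nat (Suc n) powr \<nu>) (of_real x ^ 4)))"
      by (intro sums_mult sums_diff s0 s1)
    have eqn: "(\<lambda>n. k * (div_coeff n * (1 - of_nat (Suc n) powr \<nu> * of_real \<zeta> powr (- \<nu>)) / (of_real (\<zeta>\<^sup>2) - of_nat (Suc n) ^ 2))) =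
      (\<lambda>n. k * (div_coeff n / (of_real x ^ 4 - of_nat (Suc n) ^ 2) - of_real x powr (- 2 * \<nu>) * (div_coeff n * of_nat (Suc n) powr \<nu> / (of_real x ^ 4 - of_nat (Suc n) ^ 2))))"
      unfolding x4 pw by (intro ext arg_cong [of _ _ "(*) k"]) (simp add: diff_divide_distrib algebra_simps del: of_nat_Suc)
    have "k * (pole_sum div_coeff (of_real x ^ 4) - of_real x powr (- 2 * \<nu>) * pole_sum (\<lambda>n. div_coeff n * of_nat (Suc n) powr \<nu>) (of_real x ^ 4)) =
       kosh_integral \<zeta> - kosh_const * of_real \<zeta> powr (- \<nu> - 1)
            + of_nat q / gauss_sum q chi * dirichlet_L chi (1 - \<nu>) / (4 * cos (of_real pi * \<nu> / 2)) * of_real \<zeta> powr (- \<nu>)"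
      by (rule sums_unique2 [OF su e1 [unfolded eqn]])
    moreover have "\<Psi> (of_real x) = kosh_integral \<zeta>" unfolding \<Psi>_def using sums_unique [OF e2] by simp
    moreover have "complex_of_real \<zeta> = (of_real x)\<^sup>2" by (simp add: \<zeta>_def)
    ultimately show ?thesis unfolding kosh_sum_def k_def pw by (simp add: algebra_simps)
  qed
  have "\<Psi> w - kosh_sum w = 0"
  proof (rule analytic_continuation [of "\<lambda>w. \<Psi> w - kosh_sum w" "?H - P" "of_real ` {0<..<1}" "1/2"])
    show "(\<lambda>w. \<Psi> w - kosh_sum w) holomorphic_on ?H - P"
      by (intro holomorphic_on_diff holX holomorphic_on_subset [OF holPsi]) auto
    show "open (?H - P)" by (intro open_Diff opH closedP)
    show "connected (?H - P)"
    proof (rule connected_convex_diff_countable)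
      show "convex ?H" by (rule convex_halfspace_Re_gt)
      show "countable P" by (simp add: P_def)
      show "\<not> collinear ?H"
      proof
        assume "collinear ?H"
        hence "collinear {1, 2, 1 + \<i>}" by (rule collinear_subset) auto
        thus False by (subst (asm) collinear_3_expand) (auto simp: complex_eq_iff)
      qed
    qed
    have lt: "sqrt (real (Suc n)) \<ge> 1" for n by simp
    have sub: "complex_of_real x \<in> ?H - P" if "0 < x" "x < 1" for x
      using that lt by (auto simp: P_def simp del: of_nat_Suc)
    show "complex_of_real ` {0<..<1} \<subseteq> ?H - P" using sub by auto
    show "1/2 \<in> ?H - P" using sub [of "1/2"] by simp
    show "(1/2 :: complex) islimpt of_real ` {0<..<1}"
    proof (rule islimpt_approachable [THEN iffD2], intro allI impI)
      fix e :: real assume e: "e > 0"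
      define y where "y = 1/2 + min (e / 2) (1/4)"
      have y: "y \<in> {0<..<1}" "y \<noteq> 1/2" "\<bar>y - 1/2\<bar> < e" using e by (auto simp: y_def min_def)
      have "dist (complex_of_real y) (of_real (1/2)) < e"
        using y(3) by (simp only: dist_of_real dist_real_def)
      moreover have "complex_of_real y \<noteq> of_real (1/2)" using y(2) unfolding of_real_eq_iff .
      ultimately show "\<exists>x'\<in>complex_of_real ` {0<..<1}. x' \<noteq> 1/2 \<and> dist x' (1/2) < e"
        using y(1) by (intro bexI [of _ "of_real y"]) auto
    qed
    show "\<Psi> z - kosh_sum z = 0" if "z \<in> of_real ` {0<..<1}" for z
      using that agree by auto
    show "w \<in> ?H - P" using w by (auto simp: P_def)
  qed
  hence "\<Psi> w = kosh_sum w" by simp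
  thus ?thesis using summable_sums [OF dual_series_summable [OF w(1)]] by (simp add: \<Psi>_def)
qed

end

subsection \<open>Divisor sums over blocks between consecutive squares\<close>

text \<open>Of two complementary divisors of a number below (T + 1)^2 at least one is at most
  T.\<close>

lemma card_divisors_le:
  assumes m: "m > 0" "m < (Suc T)\<^sup>2"
  shows "card {d. d dvd m} \<le> 2 * card {d. d dvd m \<and> d \<le> T}"
proof -
  let ?A = "{d. d dvd m \<and> d \<le> T}"
  have sub: "{d. d dvd m} \<subseteq> ?A \<union> (\<lambda>d. m div d) ` ?A"
  proof
    fix d assume "d \<in> {d. d dvd m}"
    then obtain k where k: "m = d * k" by auto
    show "d \<in> ?A \<union> (\<lambda>d. m div d) ` ?A"
    proof (cases "d \<le> T")
      case False
      have "k \<le> T"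
      proof (rule ccontr)
        assume "\<not> k \<le> T"
        hence "Suc T * Suc T \<le> d * k" using False by (intro mult_le_mono) auto
        thus False using m k by (simp add: power2_eq_square)
      qed
      moreover have "m div k = d" "k dvd m" using k m by auto
      ultimately show ?thesis by (intro UnI2 image_eqI [of _ _ k]) auto
    qed (use k in auto)
  qed
  have fin: "finite ?A" by (rule finite_subset [of _ "{..T}"]) auto
  have "card {d. d dvd m} \<le> card (?A \<union> (\<lambda>d. m div d) ` ?A)"
    using fin by (intro card_mono sub) auto
  also have "\<dots> \<le> card ?A + card ((\<lambda>d. m div d) ` ?A)" by (rule card_Un_le)
  also have "\<dots> \<le> card ?A + card ?A" using fin by (intro add_left_mono card_image_le)
  finally show ?thesis by simp
qed

lemma card_multiples_le:
  assumes d: "d > 0"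
  shows "real (card {m \<in> {a..<a + L}. d dvd m}) \<le> real L / real d + 2"
proof -
  have inj: "inj_on (\<lambda>m. m div d) {m \<in> {a..<a + L}. d dvd m}"
    by (rule inj_onI) (auto elim!: dvdE simp: d)
  have "card {m \<in> {a..<a + L}. d dvd m} = card ((\<lambda>m. m div d) ` {m \<in> {a..<a + L}. d dvd m})"
    by (rule card_image [OF inj, symmetric])
  also have "\<dots> \<le> card {a div d..(a + L) div d}"
    by (intro card_mono) (auto intro!: div_le_mono)
  also have "\<dots> = Suc ((a + L) div d) - a div d" by simp
  finally have "real (card {m \<in> {a..<a + L}. d dvd m}) \<le> real (Suc ((a + L) div d) - a div d)" by linarith
  also have "\<dots> = real ((a + L) div d) + 1 - real (a div d)"
  proof -
    have "a div d \<le> (a + L) div d" by (intro div_le_mono) auto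
    thus ?thesis by (simp add: of_nat_diff Suc_diff_le)
  qed
  also have "\<dots> \<le> real (a + L) / real d + 1 - (real a / real d - 1)"
  proof -
    have eq: "real k = real d * real (k div d) + real (k mod d)" for k
      by (metis mult_div_mod_eq of_nat_add of_nat_mult)
    have "real ((a + L) div d) \<le> real (a + L) / real d"
      using eq [of "a + L"] d by (simp add: field_simps)
    moreover have "real a / real d - 1 \<le> real (a div d)"
    proof -
      have "real (a mod d) \<le> real d" using d by (simp add: less_imp_le)
      thus ?thesis using eq [of a] d by (simp add: field_simps)
    qed
    ultimately show ?thesis by linarith
  qed
  also have "\<dots> = real L / real d + 2" by (simp add: add_divide_distrib)
  finally show ?thesis .
qed

text \<open>The hyperbola method in a short interval: the 2 T + 1 integers of the block are counted
  by their divisors up to T. The main part is a harmonic sum, and the rounding errors amount to at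
  most 2 for each divisor; in all T log T.\<close>

lemma sum_card_divisors_block:
  assumes T: "T > 0"
  shows "(\<Sum>m=T\<^sup>2..<(Suc T)\<^sup>2. real (card {d. d dvd m})) \<le> 2 * ((2 * real T + 1) * (ln (real T) + 1) + 2 * real T)"
proof -
  let ?B = "{T\<^sup>2..<(Suc T)\<^sup>2}"
  have sq: "(Suc T)\<^sup>2 = T\<^sup>2 + (2 * T + 1)" by (simp add: power2_eq_square)
  have pos: "m > 0" if "m \<in> ?B" for m using that T by (auto intro: less_le_trans [of 0 "T\<^sup>2"])
  have "(\<Sum>m\<in>?B. real (card {d. d dvd m})) \<le> (\<Sum>m\<in>?B. 2 * real (card {d. d dvd m \<and> d \<le> T}))"
  proof (rule sum_mono)
    fix m assume "m \<in> ?B"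
    hence "card {d. d dvd m} \<le> 2 * card {d. d dvd m \<and> d \<le> T}" using pos by (intro card_divisors_le) auto
    thus "real (card {d. d dvd m}) \<le> 2 * real (card {d. d dvd m \<and> d \<le> T})" by linarith
  qed
  also have "\<dots> = 2 * (\<Sum>m\<in>?B. real (card {d. d dvd m \<and> d \<le> T}))" by (simp add: sum_distrib_left)
  also have "(\<Sum>m\<in>?B. real (card {d. d dvd m \<and> d \<le> T})) = (\<Sum>m\<in>?B. \<Sum>d=1..T. if d dvd m then 1 else 0)"
  proof (rule sum.cong [OF refl])
    fix m assume "m \<in> ?B"
    hence "{d. d dvd m \<and> d \<le> T} = {d \<in> {1..T}. d dvd m}" using pos by (auto intro!: Suc_leI Nat.gr0I)
    thus "real (card {d. d dvd m \<and> d \<le> T}) = (\<Sum>d=1..T. if d dvd m then 1 else 0)"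
      by (simp add: sum.If_cases Int_def)
  qed
  also have "\<dots> = (\<Sum>d=1..T. \<Sum>m\<in>?B. if d dvd m then 1 else 0)" by (rule sum.swap)
  also have "\<dots> = (\<Sum>d=1..T. real (card {m \<in> ?B. d dvd m}))"
    by (intro sum.cong refl) (simp add: sum.If_cases Int_def)
  also have "\<dots> \<le> (\<Sum>d=1..T. real (2 * T + 1) / real d + 2)"
    unfolding sq by (intro sum_mono card_multiples_le) auto
  also have "\<dots> = real (2 * T + 1) * harm T + 2 * real T"
    by (simp add: sum.distrib harm_def sum_distrib_left divide_inverse)
  also have "\<dots> \<le> (2 * real T + 1) * (ln (real T) + 1) + 2 * real T"
  proof -
    obtain k where k: "T = Suc k" using T by (cases T) auto
    have "harm (Suc k) - ln (real (Suc k)) \<le> harm (Suc 0) - ln (real (Suc 0))"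
      using decseqD [OF decseq_harm_diff_ln, of 0 k] by simp
    hence "harm T \<le> ln (real T) + 1" by (simp add: k harm_Suc harm_expand)
    hence "real (2 * T + 1) * harm T \<le> real (2 * T + 1) * (ln (real T) + 1)" by (intro mult_left_mono) auto
    thus ?thesis by (simp add: add.commute)
  qed
  finally show ?thesis by simp
qed

text \<open>On block T the power of m is at most T^(r - 3/2), and the divisor sum is of order T log
  T. The product tends to 0 because a = 1/2 - r is positive.\<close>

lemma divisor_blocks_tendsto_0:
  assumes r: "r < 1/2"
  shows "(\<lambda>T. \<Sum>m=T\<^sup>2..<(Suc T)\<^sup>2. C * (real (card {d. d dvd m}) * real m powr (r / 2 - 3/4))) \<longlonglongrightarrow> 0"
proof -
  define a where "a = 1/2 - r"
  have a: "a > 0" using r by (simp add: a_def)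
  have lim: "(\<lambda>T. \<bar>C\<bar> * (2 * ((2 * real T + 1) * (ln (real T) + 1) + 2 * real T) * real T powr (- 1 - a))) \<longlonglongrightarrow> 0"
    using a by real_asymp
  show ?thesis
  proof (rule Lim_null_comparison [OF _ lim])
    show "\<forall>\<^sub>F T in sequentially. norm (\<Sum>m=T\<^sup>2..<(Suc T)\<^sup>2. C * (real (card {d. d dvd m}) * real m powr (r / 2 - 3/4)))
        \<le> \<bar>C\<bar> * (2 * ((2 * real T + 1) * (ln (real T) + 1) + 2 * real T) * real T powr (- 1 - a))"
      using eventually_gt_at_top [of 0]
    proof eventually_elim
      case (elim T)
      have pw: "real m powr (r / 2 - 3/4) \<le> real T powr (- 1 - a)" if "m \<in> {T\<^sup>2..<(Suc T)\<^sup>2}" for m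
      proof -
        have "real m powr (r / 2 - 3/4) \<le> (real T ^ 2) powr (r / 2 - 3/4)"
          using that elim r by (intro powr_mono2') (auto simp flip: of_nat_power)
        also have "real T ^ 2 = real T powr 2" using elim by simp
        also have "(real T powr 2) powr (r / 2 - 3/4) = real T powr (- 1 - a)"
          unfolding powr_powr by (simp add: a_def algebra_simps)
        finally show ?thesis .
      qed
      have "norm (\<Sum>m=T\<^sup>2..<(Suc T)\<^sup>2. C * (real (card {d. d dvd m}) * real m powr (r / 2 - 3/4)))
         \<le> (\<Sum>m=T\<^sup>2..<(Suc T)\<^sup>2. \<bar>C\<bar> * (real (card {d. d dvd m}) * real T powr (- 1 - a)))"
      proof (rule sum_norm_le)
        fix m assume "m \<in> {T\<^sup>2..<(Suc T)\<^sup>2}"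
        from pw [OF this] show "norm (C * (real (card {d. d dvd m}) * real m powr (r / 2 - 3/4))) \<le> \<bar>C\<bar> * (real (card {d. d dvd m}) * real T powr (- 1 - a))"
          by (simp add: abs_mult mult_left_mono)
      qed
      also have "\<dots> = \<bar>C\<bar> * ((\<Sum>m=T\<^sup>2..<(Suc T)\<^sup>2. real (card {d. d dvd m})) * real T powr (- 1 - a))"
        by (simp only: sum_distrib_left sum_distrib_right mult_ac)
      also have "\<dots> \<le> \<bar>C\<bar> * (2 * ((2 * real T + 1) * (ln (real T) + 1) + 2 * real T) * real T powr (- 1 - a))"
        by (intro mult_left_mono mult_right_mono sum_card_divisors_block elim) auto
      finally show ?case .
    qed
  qed
qed

subsection \<open>Rotation of the kernel by a right angle\<close>

text \<open>Arguments in the right half-plane lie strictly between -pi/2 and pi/2, so a quarter turn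
  either way does not cross the cut of the principal logarithm.\<close>

lemma rotated_powr:
  assumes e: "e = \<i> \<or> e = - \<i>" and w: "Re w > 0"
  shows "(e * w) powr s = exp (s * e * of_real (pi / 2)) * w powr s"
proof -
  have w0: "w \<noteq> 0" using w by auto
  have im: "\<bar>Im (Ln w)\<bar> < pi / 2" using w Re_Ln_pos_lt_imp [of w] by (simp add: Re_Ln_pos_lt [OF w0])
  have "Ln (e * w) = e * of_real (pi / 2) + Ln w"
    using e
  proof
    assume i: "e = \<i>"
    have "\<not> (Re w < 0 \<and> 0 \<le> Im w)" using w by simp
    thus ?thesis using Ln_times_ii [OF w0] w by (simp add: i)
  next
    assume i: "e = - \<i>"
    have "Ln (- \<i> * w) = Ln (- \<i>) + Ln w"
      using w0 im by (intro Ln_times_simple) auto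
    thus ?thesis by (simp add: i)
  qed
  thus ?thesis using w0 e by (auto simp: powr_def algebra_simps exp_add)
qed

lemma rotated_exp:
  assumes e: "e = \<i> \<or> e = - \<i>"
  shows "exp (e * z) = cos z + e * sin z"
  using e by (auto simp: exp_Euler exp_minus_Euler)

lemma bessel_J_eq_series:
  "bessel_J \<nu> x = of_real (x / 2) powr \<nu> * bessel_series \<nu> (- (of_real (x / 2))\<^sup>2)"
proof -
  have "(-1) ^ m * rGamma (of_nat m + \<nu> + 1) / fact m * of_real ((x / 2) ^ (2 * m)) =
      rGamma (of_nat m + \<nu> + 1) / fact m * (- (complex_of_real (x / 2))\<^sup>2) ^ m" for m
    unfolding power_minus [of "(complex_of_real (x / 2))\<^sup>2" m] by (simp add: power_mult)
  thus ?thesis unfolding bessel_J_def bessel_series_def by (simp only:)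
qed

lemma bessel_I_eq_series:
  "bessel_I \<nu> x = of_real (x / 2) powr \<nu> * bessel_series \<nu> ((of_real (x / 2))\<^sup>2)"
  unfolding bessel_I_def bessel_series_def by (simp add: power_mult)

text \<open>Everything is expressed by the four series for J and I of orders \<nu> and -\<nu>. The
  rotated kernels produce the J part. The K part has weight 2 cos th = exp(i th) + exp(-i th) and is
  shared accordingly, so that each rotation gets its own unrotated companion.\<close>

lemma voronoi_kernel_eq:
  assumes \<nu>: "0 < Re \<nu>" "Re \<nu> < 1" and x: "x > 0"
  defines "Z \<equiv> complex_of_real (x / 2)" and "th \<equiv> of_real pi * \<nu> / 2"
  shows "2 * of_real pi * Z powr (- \<nu>) * ((2 / of_real pi * bessel_K \<nu> x - bessel_Y \<nu> x) * cos th - bessel_J \<nu> x * sin th) =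
     exp (\<i> * th) * (kernel_K \<nu> (\<i> * Z) + kernel_K \<nu> Z) + exp (- \<i> * th) * (kernel_K \<nu> (- \<i> * Z) + kernel_K \<nu> Z)"
proof -
  define sn where "sn = sin (of_real pi * \<nu>)"
  have sn: "sn \<noteq> 0" unfolding sn_def by (rule sin_pi_nonzero [OF \<nu>])
  have ReZ: "Re Z > 0" using x by (simp add: Z_def)
  define A where "A = Z powr (- \<nu>)"
  define B where "B = Z powr \<nu>"
  have AB: "A * B = 1" using ReZ by (auto simp: A_def B_def powr_add [symmetric])
  have A2: "Z powr (- 2 * \<nu>) = A * A" by (simp add: A_def powr_add [symmetric])
  define Em where "Em = bessel_series (- \<nu>) (- Z\<^sup>2)"
  define E where "E = bessel_series \<nu> (- Z\<^sup>2)"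
  define Fm where "Fm = bessel_series (- \<nu>) (Z\<^sup>2)"
  define F where "F = bessel_series \<nu> (Z\<^sup>2)"
  have J: "bessel_J \<nu> x = B * E" "bessel_J (- \<nu>) x = A * Em"
    by (simp_all add: bessel_J_eq_series A_def B_def E_def Em_def Z_def)
  have I: "bessel_I \<nu> x = B * F" "bessel_I (- \<nu>) x = A * Fm"
    by (simp_all add: bessel_I_eq_series A_def B_def F_def Fm_def Z_def)
  define c where "c = cos th"
  define s where "s = sin th"
  have dbl: "cos (\<nu> * of_real pi) = c * c - s * s" "sin (\<nu> * of_real pi) = 2 * s * c"
    using cos_add [of th th] sin_add [of th th] by (simp_all add: th_def c_def s_def mult_ac)
  have snd: "sn = 2 * s * c" using dbl(2) by (simp add: sn_def mult.commute)
  have one: "c * c + s * s = 1" using sin_cos_squared_add3 [of th] by (simp add: c_def s_def)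
  have Y: "bessel_Y \<nu> x = (B * E * (c * c - s * s) - A * Em) / sn"
    unfolding bessel_Y_def J dbl(1) sn_def by (simp add: mult.commute)
  have K: "2 / of_real pi * bessel_K \<nu> x = (A * Fm - B * F) / sn"
  proof -
    have "2 / of_real pi * (of_real pi / 2 * u / v) = u / v" for u v :: complex by simp
    thus ?thesis unfolding bessel_K_def I sn_def by (simp only: mult.commute [of \<nu>] of_real_divide of_real_numeral)
  qed
  have "(2 / of_real pi * bessel_K \<nu> x - bessel_Y \<nu> x) * c - bessel_J \<nu> x * s =
     (((A * Fm - B * F) - (B * E * (c * c - s * s) - A * Em)) * c - B * E * s * sn) / sn"
    unfolding K Y J using sn by (simp add: field_simps)
  also have "((A * Fm - B * F) - (B * E * (c * c - s * s) - A * Em)) * c - B * E * s * sn =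
     c * ((A * Fm - B * F) + A * Em - B * E * (c * c + s * s))"
    unfolding snd by (simp add: algebra_simps)
  finally have L: "(2 / of_real pi * bessel_K \<nu> x - bessel_Y \<nu> x) * c - bessel_J \<nu> x * s =
     c * (A * Fm - B * F + A * Em - B * E) / sn" unfolding one by simp
  have rot: "exp (e * th) * kernel_K \<nu> (e * Z) = of_real pi / sn * (exp (- (e * th)) * (A * A) * Em - exp (e * th) * E)"
    if e: "e = \<i> \<or> e = - \<i>" for e
  proof -
    have sq: "(e * Z)\<^sup>2 = - Z\<^sup>2" using e by (auto simp: power_mult_distrib)
    have p: "(e * Z) powr (- 2 * \<nu>) = exp (- 2 * (e * th)) * (A * A)"
      using rotated_powr [OF e ReZ, of "- 2 * \<nu>"] A2 by (simp add: th_def mult_ac)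
    have u: "exp (- (e * th)) = exp (e * th) * exp (- 2 * (e * th))" by (simp flip: exp_add)
    have "u * (k * (v * (A * A) * Em - E)) = k * (u * v * (A * A) * Em - u * E)" for u v k
      by (simp add: algebra_simps)
    thus ?thesis
      unfolding kernel_K_def sq p u Em_def [symmetric] E_def [symmetric] sn_def [symmetric] .
  qed
  have K0: "kernel_K \<nu> Z = of_real pi / sn * (A * A * Fm - F)"
    unfolding kernel_K_def A2 Fm_def F_def sn_def ..
  have ei: "exp (\<i> * th) = c + \<i> * s" "exp (- \<i> * th) = c - \<i> * s"
     "exp (- (\<i> * th)) = c - \<i> * s" "exp (- (- \<i> * th)) = c + \<i> * s"
    using rotated_exp [of \<i> th] rotated_exp [of "- \<i>" th] by (simp_all add: c_def s_def)
  have "exp (\<i> * th) * (kernel_K \<nu> (\<i> * Z) + kernel_K \<nu> Z) + exp (- \<i> * th) * (kernel_K \<nu> (- \<i> * Z) + kernel_K \<nu> Z) =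
     exp (\<i> * th) * kernel_K \<nu> (\<i> * Z) + exp (- \<i> * th) * kernel_K \<nu> (- \<i> * Z) + (exp (\<i> * th) + exp (- \<i> * th)) * kernel_K \<nu> Z"
    by (simp only: distrib_left distrib_right add_ac)
  also have "\<dots> = of_real pi / sn * (2 * c) * (A * A * Em - E + (A * A * Fm - F))"
  proof -
    define k where "k = of_real pi / sn"
    show ?thesis
      unfolding rot [OF disjI1 [OF refl]] rot [OF disjI2 [OF refl]] K0
      unfolding ei k_def [symmetric] by (simp add: algebra_simps)
  qed
  also have "A * A * Em - E + (A * A * Fm - F) = A * (A * Fm - B * F + A * Em - B * E)"
  proof -
    have "A * (A * Fm - B * F + A * Em - B * E) = A * A * Fm - (A * B) * F + A * A * Em - (A * B) * E"
      by (simp add: algebra_simps)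
    thus ?thesis unfolding AB by simp
  qed
  finally show ?thesis unfolding L [unfolded c_def s_def, folded c_def] A_def [symmetric]
    unfolding c_def [symmetric] s_def [symmetric] L by (simp add: mult_ac)
qed

subsection \<open>One side of the Voronoi formula\<close>

text \<open>The strip lives in the plane of \<open>w = \<surd>t\<close>: \<open>sa = \<surd>\<alpha>\<close>, \<open>sb = \<surd>\<beta>\<close>, \<open>g w = 2 w f(w\<^sup>2)\<close>, and \<open>J\<close> collects the
  \<open>n\<close> with \<open>\<alpha> < n + 1 < \<beta>\<close>.\<close>
locale voronoi_setup = koshliakov_setup +
  fixes sa sb eps :: real and g :: "complex \<Rightarrow> complex" and J :: "nat set"
  assumes sab: "sa < sb" and eps: "0 < eps" "2 * eps \<le> sa"
    and g: "g holomorphic_on {w. sa - eps < Re w \<and> Re w < sb + eps \<and> \<bar>Im w\<bar> < eps}"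
    and J: "finite J" "\<And>n. n \<in> J \<Longrightarrow> sa + eps \<le> sqrt (real (Suc n)) \<and> sqrt (real (Suc n)) \<le> sb - eps"
    and poles: "\<And>n w. sa - eps < Re w \<Longrightarrow> Re w < sb + eps \<Longrightarrow> \<bar>Im w\<bar> < eps \<Longrightarrow> n \<notin> J \<Longrightarrow> w ^ 4 \<noteq> of_nat (Suc n) ^ 2"
begin

definition "strip = {w. sa - eps < Re w \<and> Re w < sb + eps \<and> \<bar>Im w\<bar> < eps}"

definition "th = of_real pi * \<nu> / 2"

definition "Q = of_nat q powr (1 - \<nu> / 2) / gauss_sum q chi"

definition "pcoeff n = div_coeff n * of_nat (Suc n) powr \<nu>"

text \<open>The unrotated companion is added here so that the \<open>div_coeff\<close> pole series
  of \<open>kosh_sum\<close> cancels: its factor w^2 changes sign under the rotation while w^4 does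
  not.\<close>

definition side_term :: "complex \<Rightarrow> nat \<Rightarrow> complex \<Rightarrow> complex" where
  "side_term e n w = of_nat q powr (- \<nu> / 2) * exp (e * th) *
     (dual_coeff n * kernel_K \<nu> (of_real (dual_freq n) * (e * w)) + dual_coeff n * kernel_K \<nu> (of_real (dual_freq n) * w))"

text \<open>Odd in e, in contrast to \<open>k2\<close>, which is the same for both rotations and
  yields the L-value term.\<close>

definition "k1 e = of_nat q powr (- \<nu> / 2) * kosh_const * (exp (e * th) - exp (- (e * th)))"

definition "k2 = - (Q * dirichlet_L chi (1 - \<nu>) / 2)"

definition side_sum :: "complex \<Rightarrow> complex \<Rightarrow> complex" where
  "side_sum e w = k1 e * w powr (- 2 * \<nu> - 2) + k2 * w powr (- 2 * \<nu>)
     - e * (Q / of_real pi) * w\<^sup>2 * w powr (- 2 * \<nu>) * pole_sum pcoeff (w ^ 4)"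

definition pole :: "nat \<Rightarrow> complex" where
  "pole n = of_real (sqrt (real (Suc n)))"

text \<open>The denominator is (w^4 - (n + 1)^2)/(w - pole n). Thus phi n w/(w - pole n) is the n-th
  term of the pole series with all its factors except e, and the value at the pole is the
  residue.\<close>

definition phi :: "nat \<Rightarrow> complex \<Rightarrow> complex" where
  "phi n w = g w * (- (Q / of_real pi)) * w\<^sup>2 * w powr (- 2 * \<nu>) * pcoeff n / ((w + pole n) * (w\<^sup>2 + of_nat (Suc n)))"

text \<open>What remains of the pole series once the simple poles with index in J are subtracted;
  the case distinction fills the removable singularities. The factor e stays outside, so one
  function serves both rotations.\<close>

definition regular_part :: "complex \<Rightarrow> complex" where
  "regular_part w = g w * (- (Q / of_real pi)) * w\<^sup>2 * w powr (- 2 * \<nu>) * pole_sum (\<lambda>n. if n \<in> J then 0 else pcoeff n) (w ^ 4)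
     + (\<Sum>n\<in>J. if w = pole n then deriv (phi n) (pole n) else (phi n w - phi n (pole n)) / (w - pole n))"

lemma open_strip: "open strip" and convex_strip: "convex strip"
proof -
  have "strip = box (Complex (sa - eps) (- eps)) (Complex (sb + eps) eps)"
    by (auto simp: strip_def in_box_complex_iff abs_less_iff)
  thus "open strip" "convex strip" by (simp_all add: open_box convex_box)
qed

lemma strip_Re: "w \<in> strip \<Longrightarrow> \<bar>Im w\<bar> < Re w" "w \<in> strip \<Longrightarrow> Re w > 0"
  using eps by (auto simp: strip_def)

lemma strip_slit: "w \<in> strip \<Longrightarrow> w \<notin> \<real>\<^sub>\<le>\<^sub>0"
  using strip_Re(2) [of w] by (auto simp: complex_nonpos_Reals_iff)

lemma pole_square: "(pole n)\<^sup>2 = of_nat (Suc n)"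
  unfolding pole_def of_real_power [symmetric] by (simp del: of_nat_Suc of_real_power)

lemma pcoeff_summable: "summable (\<lambda>n. norm (pcoeff n) / real (Suc n) ^ 2)"
  unfolding pcoeff_def by (rule norm_div_coeff_summable(1))

text \<open>The factor exp(e th) symmetrises the two copies: the coefficients 1 and exp(-2 e th)
  become exp(e th) and exp(-e th). Their sum 2 cos th and difference 2 e sin th cancel the cosine
  and sine in the denominators of \<open>kosh_sum\<close>.\<close>

lemma side_term_sums:
  assumes e: "e = \<i> \<or> e = - \<i>" and w: "\<bar>Im w\<bar> < Re w" "Re (e * w) > 0"
  shows "(\<lambda>n. side_term e n w) sums side_sum e w"
proof -
  have Re: "Re w > 0" using w by linarith
  have im: "Im w \<noteq> 0" using e w(2) by auto
  define c where "c = cos th"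
  define s where "s = sin th"
  define E where "E = exp (e * th)"
  have cs: "c \<noteq> 0" "s \<noteq> 0"
  proof -
    show "s \<noteq> 0" unfolding s_def th_def using \<nu> by (intro sin_half_pi_nonzero) auto
    have "sin (of_real pi * \<nu>) \<noteq> 0" using \<nu> by (intro sin_pi_nonzero) auto
    moreover have "sin (of_real pi * \<nu>) = 2 * s * c"
      using sin_add [of th th] by (simp add: th_def c_def s_def mult_ac)
    ultimately show "c \<noteq> 0" by auto
  qed
  have E: "E = c + e * s" "exp (- (e * th)) = c - e * s"
    using rotated_exp [OF e, of th] rotated_exp [of "- e" th] e by (auto simp: E_def c_def s_def)
  have ee: "e * e = - 1" using e by auto
  have inv: "E * exp (- 2 * (e * th)) = exp (- (e * th))" by (simp add: E_def flip: exp_add)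
  have "(\<lambda>n. dual_coeff n * kernel_K \<nu> (of_real (dual_freq n) * (e * w))) sums kosh_sum (e * w)"
  proof (rule koshliakov [OF w(2)])
    show "e * w \<noteq> of_real (sqrt (real (Suc n)))" for n
    proof
      assume "e * w = of_real (sqrt (real (Suc n)))"
      hence "Im (e * w) = 0" by simp
      thus False using e Re by auto
    qed
  qed
  moreover have "(\<lambda>n. dual_coeff n * kernel_K \<nu> (of_real (dual_freq n) * w)) sums kosh_sum w"
    by (rule koshliakov [OF Re]) (use im in auto)
  ultimately have "(\<lambda>n. side_term e n w) sums (of_nat q powr (- \<nu> / 2) * E * (kosh_sum (e * w) + kosh_sum w))"
    unfolding side_term_def E_def by (intro sums_mult sums_add)
  also have "of_nat q powr (- \<nu> / 2) * E * (kosh_sum (e * w) + kosh_sum w) = side_sum e w"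
  proof -
    define qp where "qp = complex_of_nat q powr (- \<nu> / 2)"
    define qt where "qt = of_nat q / gauss_sum q chi"
    define Lc where "Lc = dirichlet_L chi (1 - \<nu>)"
    define kc where "kc = kosh_const"
    define p2 where "p2 = w powr (- 2 * \<nu>)"
    define p4 where "p4 = w powr (- 2 * \<nu> - 2)"
    define h0 where "h0 = pole_sum div_coeff (w ^ 4)"
    define h1 where "h1 = pole_sum pcoeff (w ^ 4)"
    define E2 where "E2 = exp (- 2 * (e * th))"
    have Qq: "Q = qp * qt"
    proof -
      have "complex_of_nat q powr (1 - \<nu> / 2) = of_nat q powr (- \<nu> / 2 + 1)" by simp
      also have "\<dots> = qp * of_nat q" unfolding qp_def powr_add using q1 by simp
      finally show ?thesis by (simp add: Q_def qt_def)
    qed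
    have r2: "(e * w) powr (- 2 * \<nu>) = E2 * p2"
      unfolding rotated_powr [OF e Re] E2_def p2_def th_def by (simp add: mult_ac)
    have r4: "(e * w) powr (- 2 * \<nu> - 2) = - (E2 * p4)"
    proof -
      have "(- 2 * \<nu> - 2) * e * of_real (pi / 2) = - 2 * (e * th) + - (e * of_real pi)"
        by (simp add: th_def field_simps)
      moreover have "exp (- (e * of_real pi)) = - 1" using e by (auto simp: exp_minus)
      ultimately show ?thesis
        unfolding rotated_powr [OF e Re] E2_def p4_def by (simp only: exp_add) simp
    qed
    have w2: "(e * w)\<^sup>2 = - w\<^sup>2" "(e * w) ^ 4 = w ^ 4"
      using e by (auto simp: power_mult_distrib power4_eq_xxxx)
    have k: "kosh_sum (e * w) = kc * - (E2 * p4) - qt * Lc / (4 * c) * (E2 * p2) + qt * - w\<^sup>2 / (2 * of_real pi * s) * (h0 - E2 * p2 * h1)"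
      "kosh_sum w = kc * p4 - qt * Lc / (4 * c) * p2 + qt * w\<^sup>2 / (2 * of_real pi * s) * (h0 - p2 * h1)"
      unfolding kosh_sum_def r2 r4 w2 p2_def [symmetric] p4_def [symmetric] pcoeff_def [symmetric]
        h0_def [symmetric] h1_def [symmetric] th_def [symmetric] c_def [symmetric] s_def [symmetric] kc_def [symmetric] qt_def [symmetric] Lc_def [symmetric]
      by (simp_all only: minus_mult_right)
    have EE2: "E * E2 = c - e * s" using inv E(2) by (simp add: E2_def)
    have "qp * E * (kosh_sum (e * w) + kosh_sum w) =
       qp * kc * (E - E * E2) * p4 - qp * qt * Lc / (4 * c) * (E * E2 + E) * p2 + qp * qt * w\<^sup>2 / (2 * of_real pi * s) * (p2 * h1) * (E * E2 - E)"
      unfolding k by (simp add: algebra_simps diff_divide_distrib add_divide_distrib)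
    also have "\<dots> = qp * kc * (E - (c - e * s)) * p4 - qp * qt * Lc / (4 * c) * (2 * c) * p2 + qp * qt * w\<^sup>2 / (2 * of_real pi * s) * (p2 * h1) * (- (2 * e * s))"
      unfolding EE2 by (simp add: E(1))
    also have "qp * qt * Lc / (4 * c) * (2 * c) = qp * qt * Lc / 2" using cs by simp
    also have "qp * qt * w\<^sup>2 / (2 * of_real pi * s) * (p2 * h1) * (- (2 * e * s)) = - (e * (qp * qt / of_real pi) * w\<^sup>2 * p2 * h1)"
      using cs by simp
    also have "qp * kc * (E - (c - e * s)) * p4 - qp * qt * Lc / 2 * p2 + - (e * (qp * qt / of_real pi) * w\<^sup>2 * p2 * h1) = side_sum e w"
      unfolding side_sum_def k1_def k2_def Qq E(2) [symmetric] E_def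
        p2_def [symmetric] p4_def [symmetric] h1_def [symmetric] kc_def [symmetric] Lc_def [symmetric] qp_def [symmetric]
      by simp
    finally show ?thesis unfolding qp_def .
  qed
  finally show ?thesis .
qed

lemma phi_holomorphic: "phi n holomorphic_on strip"
proof -
  have "w + pole n \<noteq> 0" if "w \<in> strip" for w
  proof -
    have "Re (w + pole n) > 0" using strip_Re(2) [OF that] by (simp add: pole_def add_pos_nonneg)
    thus ?thesis by (metis less_irrefl zero_complex.sel(1))
  qed
  moreover have "w\<^sup>2 + of_nat (Suc n) \<noteq> 0" if "w \<in> strip" for w
  proof
    assume "w\<^sup>2 + of_nat (Suc n) = 0"
    hence "Re (w\<^sup>2) < 0" by (simp add: add_eq_0_iff2)
    moreover have "\<bar>Im w\<bar>\<^sup>2 \<le> (Re w)\<^sup>2" using strip_Re [OF that] by (intro power_mono) auto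
    ultimately show False by (simp add: power2_eq_square)
  qed
  ultimately show ?thesis
    unfolding phi_def using strip_slit g [folded strip_def] by (intro holomorphic_intros) auto
qed

lemma regular_part_holomorphic: "regular_part holomorphic_on strip"
proof -
  let ?c = "\<lambda>n. if n \<in> J then 0 else pcoeff n"
  have s: "summable (\<lambda>n. norm (?c n) / real (Suc n) ^ 2)"
    by (rule summable_comparison_test' [OF pcoeff_summable]) (auto simp del: of_nat_Suc)
  have "(pole_sum ?c \<circ> (\<lambda>w. w ^ 4)) holomorphic_on strip"
    unfolding pole_sum_def [abs_def]
    by (rule holomorphic_on_compose_gen [OF _ pole_series_holomorphic(1) [OF s]])
       (use poles in \<open>auto intro!: holomorphic_intros simp: strip_def\<close>)
  hence 1: "(\<lambda>w. pole_sum ?c (w ^ 4)) holomorphic_on strip" by (simp add: o_def)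
  show ?thesis
    unfolding regular_part_def
    by (intro holomorphic_on_add holomorphic_on_mult holomorphic_on_sum 1 pole_lemma_open phi_holomorphic open_strip
          g [folded strip_def] holomorphic_on_const holomorphic_on_power holomorphic_on_ident holomorphic_on_powr)
       (use strip_slit in \<open>auto intro!: holomorphic_intros\<close>)
qed

lemma side_sum_decomposition:
  assumes w: "w \<in> strip" "\<And>n. n \<in> J \<Longrightarrow> w \<noteq> pole n"
  shows "g w * side_sum e w = k1 e * (g w * w powr (- 2 * \<nu> - 2)) + k2 * (g w * w powr (- 2 * \<nu>)) + e * regular_part w
           + (\<Sum>n\<in>J. e * phi n (pole n) / (w - pole n))"
proof -
  let ?c = "\<lambda>n. if n \<in> J then 0 else pcoeff n"
  let ?d = "\<lambda>n. w ^ 4 - of_nat (Suc n) ^ 2"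
  have s: "summable (\<lambda>n. norm (?c n) / real (Suc n) ^ 2)"
    by (rule summable_comparison_test' [OF pcoeff_summable]) (auto simp del: of_nat_Suc)
  have np: "w ^ 4 \<notin> {of_nat (Suc n) ^ 2 | n. ?c n \<noteq> 0}" using w(1) poles by (auto simp: strip_def)
  have "(\<lambda>n. ?c n / ?d n) sums pole_sum ?c (w ^ 4)"
    unfolding pole_sum_def by (rule summable_sums [OF summable_norm_cancel [OF pole_series_holomorphic(2) [OF s np]]])
  moreover have "(\<lambda>n. if n \<in> J then pcoeff n / ?d n else 0) sums (\<Sum>n\<in>J. pcoeff n / ?d n)"
    by (rule sums_If_finite_set [OF J(1)])
  ultimately have "(\<lambda>n. ?c n / ?d n + (if n \<in> J then pcoeff n / ?d n else 0)) sums (pole_sum ?c (w ^ 4) + (\<Sum>n\<in>J. pcoeff n / ?d n))"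
    by (rule sums_add)
  moreover have "(\<lambda>n. ?c n / ?d n + (if n \<in> J then pcoeff n / ?d n else 0)) = (\<lambda>n. pcoeff n / ?d n)" by auto
  ultimately have "(\<lambda>n. pcoeff n / ?d n) sums (pole_sum ?c (w ^ 4) + (\<Sum>n\<in>J. pcoeff n / ?d n))" by simp
  hence split: "pole_sum pcoeff (w ^ 4) = pole_sum ?c (w ^ 4) + (\<Sum>n\<in>J. pcoeff n / ?d n)"
    unfolding pole_sum_def by (simp only: sums_iff)
  define P where "P = g w * (- (Q / of_real pi)) * w\<^sup>2 * w powr (- 2 * \<nu>)"
  have poleterm: "P * (pcoeff n / ?d n) = phi n (pole n) / (w - pole n) + (if w = pole n then deriv (phi n) (pole n) else (phi n w - phi n (pole n)) / (w - pole n))"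
    if "n \<in> J" for n
  proof -
    have nz: "w - pole n \<noteq> 0" using w(2) [OF that] by simp
    have "?d n = (w - pole n) * ((w + pole n) * (w\<^sup>2 + of_nat (Suc n)))"
    proof -
      have "(w - pole n) * ((w + pole n) * (w\<^sup>2 + of_nat (Suc n))) = (w\<^sup>2 - (pole n)\<^sup>2) * (w\<^sup>2 + of_nat (Suc n))"
        by (simp add: power2_eq_square algebra_simps)
      also have "\<dots> = ?d n" unfolding pole_square by (simp add: power2_eq_square power4_eq_xxxx algebra_simps)
      finally show ?thesis ..
    qed
    hence "P * (pcoeff n / ?d n) = phi n w / (w - pole n)"
      by (simp add: phi_def P_def mult_ac)
    also have "\<dots> = phi n (pole n) / (w - pole n) + (phi n w - phi n (pole n)) / (w - pole n)"
      by (simp add: diff_divide_distrib)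
    finally show ?thesis using nz by simp
  qed
  have "g w * side_sum e w = k1 e * (g w * w powr (- 2 * \<nu> - 2)) + k2 * (g w * w powr (- 2 * \<nu>)) + e * (P * pole_sum pcoeff (w ^ 4))"
    by (simp add: side_sum_def P_def algebra_simps)
  also have "P * pole_sum pcoeff (w ^ 4) = P * pole_sum ?c (w ^ 4) + (\<Sum>n\<in>J. P * (pcoeff n / ?d n))"
    unfolding split distrib_left sum_distrib_left ..
  also have "(\<Sum>n\<in>J. P * (pcoeff n / ?d n)) = (\<Sum>n\<in>J. phi n (pole n) / (w - pole n)) +
      (\<Sum>n\<in>J. if w = pole n then deriv (phi n) (pole n) else (phi n w - phi n (pole n)) / (w - pole n))"
    unfolding sum.distrib [symmetric] by (intro sum.cong refl poleterm)
  also have "P * pole_sum ?c (w ^ 4) + ((\<Sum>n\<in>J. phi n (pole n) / (w - pole n)) +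
      (\<Sum>n\<in>J. if w = pole n then deriv (phi n) (pole n) else (phi n w - phi n (pole n)) / (w - pole n))) =
     regular_part w + (\<Sum>n\<in>J. phi n (pole n) / (w - pole n))"
    by (simp add: regular_part_def P_def)
  finally show ?thesis by (simp add: distrib_left sum_distrib_left add.assoc)
qed

lemma side_term_holomorphic:
  assumes e: "e = \<i> \<or> e = - \<i>"
  shows "side_term e n holomorphic_on strip"
proof -
  have \<rho>: "dual_freq n > 0" by (rule dual_freq_pos)
  have "of_real (dual_freq n) * w \<notin> \<real>\<^sub>\<le>\<^sub>0" "of_real (dual_freq n) * (e * w) \<notin> \<real>\<^sub>\<le>\<^sub>0" if "w \<in> strip" for w
    using strip_Re(2) [OF that] \<rho> e by (auto simp: complex_nonpos_Reals_iff mult_le_0_iff)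
  thus ?thesis unfolding side_term_def [abs_def] by (intro holomorphic_intros) auto
qed

text \<open>A compact part of the strip, on which g is bounded, with room for every shifted path
  used below.\<close>

definition "core_strip = {w. sa - eps / 2 \<le> Re w \<and> Re w \<le> sb + eps / 2 \<and> \<bar>Im w\<bar> \<le> eps / 2}"

lemma core_subset: "core_strip \<subseteq> strip"
  using eps by (auto simp: core_strip_def strip_def)

lemma g_bounded: obtains M where "M > 0" "\<And>w. w \<in> core_strip \<Longrightarrow> norm (g w) \<le> M"
proof -
  have "core_strip = cbox (Complex (sa - eps / 2) (- (eps / 2))) (Complex (sb + eps / 2) (eps / 2))"
    by (auto simp: core_strip_def in_cbox_complex_iff abs_le_iff)
  hence "compact core_strip" by simp
  moreover have "continuous_on core_strip g"
    using g [folded strip_def] core_subset by (meson holomorphic_on_imp_continuous_on holomorphic_on_subset)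
  ultimately have "bounded (g ` core_strip)" by (intro compact_imp_bounded compact_continuous_image)
  thus ?thesis using that by (auto simp: bounded_pos)
qed

text \<open>Re (e w) may be negative, but |Im (e w)| = Re w then dominates it, so the extended
  region of \<open>dual_term_bound\<close> is available. The unrotated copy obeys the same bound
  because Re w \<ge> Re (e w).\<close>

lemma side_term_bound:
  assumes e: "e = \<i> \<or> e = - \<i>"
  obtains B where "B > 0"
    "\<And>n w. w \<in> core_strip \<Longrightarrow> norm (g w * side_term e n w) \<le>
       B * (real (card {d. d dvd Suc n}) * real (Suc n) powr (Re \<nu> / 2 - 1/4)) * exp (- 2 * dual_freq n * Re (e * w))"
proof -
  obtain C where C: "C > 0" "\<And>n w. w \<noteq> 0 \<Longrightarrow> Re w \<ge> 0 \<or> \<bar>Im w\<bar> \<ge> \<bar>Re w\<bar> \<Longrightarrow>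
        norm (dual_coeff n * kernel_K \<nu> (of_real (dual_freq n) * w)) \<le>
          C * real (card {d. d dvd Suc n}) * real (Suc n) powr (Re \<nu> / 2 - 1/4) * norm w powr (- Re \<nu> - 1/2) * exp (- 2 * dual_freq n * Re w)"
    by (rule dual_term_bound) blast
  obtain M where M: "M > 0" "\<And>w. w \<in> core_strip \<Longrightarrow> norm (g w) \<le> M" by (rule g_bounded) blast
  define m where "m = (sa / 2) powr (- Re \<nu> - 1/2)"
  define A where "A = norm (of_nat q powr (- \<nu> / 2) * exp (e * th))"
  have A0: "A > 0" using q1 by (simp add: A_def norm_mult)
  have m0: "m > 0" using eps by (simp add: m_def)
  define B where "B = M * (A * (2 * (C * m)))"
  have B0: "B > 0" using M A0 C m0 by (simp add: B_def)
  have "norm (g w * side_term e n w) \<le> B * (real (card {d. d dvd Suc n}) * real (Suc n) powr (Re \<nu> / 2 - 1/4)) * exp (- 2 * dual_freq n * Re (e * w))"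
    if w: "w \<in> core_strip" for n w
  proof -
    define D where "D = real (card {d. d dvd Suc n}) * real (Suc n) powr (Re \<nu> / 2 - 1/4)"
    define X where "X = exp (- 2 * dual_freq n * Re (e * w))"
    have D0: "D \<ge> 0" by (simp add: D_def)
    have wd: "w \<in> strip" using w core_subset by blast
    have rw: "Re (e * w) \<le> Re w" "\<bar>Im (e * w)\<bar> \<ge> \<bar>Re (e * w)\<bar>" "norm (e * w) = norm w"
      using strip_Re [OF wd] e by (auto simp: norm_mult)
    have nw: "norm w \<ge> sa / 2" "w \<noteq> 0" using w eps complex_Re_le_cmod [of w] strip_Re(2) [OF wd] by (auto simp: core_strip_def)
    have nm: "norm w powr (- Re \<nu> - 1/2) \<le> m" unfolding m_def using nw eps \<nu> by (intro powr_mono2') auto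
    have b: "norm (dual_coeff n * kernel_K \<nu> (of_real (dual_freq n) * v)) \<le> C * m * D * X"
      if v: "norm v = norm w" "Re v \<ge> Re (e * w)" "Re v \<ge> 0 \<or> \<bar>Im v\<bar> \<ge> \<bar>Re v\<bar>" for v
    proof -
      have "v \<noteq> 0" using v(1) nw(2) by auto
      hence "norm (dual_coeff n * kernel_K \<nu> (of_real (dual_freq n) * v)) \<le>
          C * real (card {d. d dvd Suc n}) * real (Suc n) powr (Re \<nu> / 2 - 1/4) * norm v powr (- Re \<nu> - 1/2) * exp (- 2 * dual_freq n * Re v)"
        by (intro C(2) v(3))
      also have "\<dots> = C * D * norm w powr (- Re \<nu> - 1/2) * exp (- 2 * dual_freq n * Re v)"
        unfolding v(1) D_def by (simp only: mult_ac)
      also have "\<dots> \<le> C * D * m * X"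
      proof (intro mult_mono mult_nonneg_nonneg nm)
        have "2 * dual_freq n * Re (e * w) \<le> 2 * dual_freq n * Re v"
          using v(2) dual_freq_pos [of n] by (intro mult_left_mono) auto
        thus "exp (- 2 * dual_freq n * Re v) \<le> X" by (simp add: X_def)
      qed (use C D0 m0 in auto)
      finally show ?thesis by (simp only: mult_ac)
    qed
    have "norm (g w * side_term e n w) = norm (g w) * (A * norm (dual_coeff n * kernel_K \<nu> (of_real (dual_freq n) * (e * w)) + dual_coeff n * kernel_K \<nu> (of_real (dual_freq n) * w)))"
      unfolding side_term_def A_def by (simp only: norm_mult)
    also have "\<dots> \<le> M * (A * (C * m * D * X + C * m * D * X))"
      using M(2) [OF w] M(1) A0 b [of "e * w"] b [of w] rw strip_Re(2) [OF wd]
      by (intro mult_mono order_trans [OF norm_triangle_ineq] add_mono mult_nonneg_nonneg) auto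
    also have "\<dots> = B * D * X" by (simp add: B_def)
    finally show ?thesis by (simp add: D_def X_def)
  qed
  thus ?thesis using that B0 by blast
qed

text \<open>The ends of the interval are displaced to s - e z. Since e (s - e z) = e s + z, the real
  part of z is Re (e w): for Re z > 0 the series converges on the displaced segment, and z = 0 is
  the axis. Differences of primitives at the two ends depend holomorphically on z, as the Tauberian
  theorem requires.\<close>

theorem one_sided_voronoi:
  assumes e: "e = \<i> \<or> e = - \<i>"
    and G: "\<And>n w. w \<in> strip \<Longrightarrow> (G n has_field_derivative g w * side_term e n w) (at w)"
    and Ha: "\<And>w. w \<in> strip \<Longrightarrow> (Ha has_field_derivative g w * w powr (- 2 * \<nu> - 2)) (at w)"
    and Hb: "\<And>w. w \<in> strip \<Longrightarrow> (Hb has_field_derivative g w * w powr (- 2 * \<nu>)) (at w)"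
    and Hc: "\<And>w. w \<in> strip \<Longrightarrow> (Hc has_field_derivative regular_part w) (at w)"
  shows "(\<lambda>n. G n (of_real sb) - G n (of_real sa)) sums
     ((\<Sum>n\<in>J. e * phi n (pole n) * (of_real (ln (sb - sqrt (real (Suc n)))) - of_real (ln (sqrt (real (Suc n)) - sa)) + e * of_real pi))
      + k1 e * (Ha (of_real sb) - Ha (of_real sa)) + k2 * (Hb (of_real sb) - Hb (of_real sa)) + e * (Hc (of_real sb) - Hc (of_real sa)))"
proof -
  have ee: "e * e = - 1" and ne: "norm e = 1" and e0: "e \<noteq> 0" using e by auto
  have Re_e: "Re (e * (of_real s - e * z)) = Re z" "e * (of_real s - e * z) = e * of_real s + z" for s z
    using e by (auto simp: algebra_simps)
  have in_strip: "of_real s - e * z \<in> strip" if "s \<in> {sa..sb}" "norm z < eps" for s z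
  proof -
    have "\<bar>Re (e * z)\<bar> < eps" "\<bar>Im (e * z)\<bar> < eps"
      using that(2) abs_Re_le_cmod [of "e * z"] abs_Im_le_cmod [of "e * z"] ne by (simp_all add: norm_mult)
    thus ?thesis using that(1) by (auto simp: strip_def)
  qed
  have in_core: "of_real s - e * z \<in> core_strip" if "s \<in> {sa..sb}" "norm z \<le> eps / 2" for s z
  proof -
    have "\<bar>Re (e * z)\<bar> \<le> eps / 2" "\<bar>Im (e * z)\<bar> \<le> eps / 2"
      using that(2) abs_Re_le_cmod [of "e * z"] abs_Im_le_cmod [of "e * z"] ne by (simp_all add: norm_mult)
    moreover have "Re (of_real s - e * z) = s - Re (e * z)" "Im (of_real s - e * z) = - Im (e * z)"
      by (simp_all only: minus_complex.sel Re_complex_of_real Im_complex_of_real diff_0)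
    ultimately show ?thesis using that(1) unfolding core_strip_def mem_Collect_eq by (simp only: atLeastAtMost_iff) linarith
  qed
  have sab': "sa \<in> {sa..sb}" "sb \<in> {sa..sb}" using sab by auto
  obtain B where B: "B > 0" "\<And>n w. w \<in> core_strip \<Longrightarrow> norm (g w * side_term e n w) \<le>
       B * (real (card {d. d dvd Suc n}) * real (Suc n) powr (Re \<nu> / 2 - 1/4)) * exp (- 2 * dual_freq n * Re (e * w))"
    by (rule side_term_bound [OF e]) blast
  \<comment> \<open>The factor e inside the logarithm directs its cut from each pole into the side
    Re (e w) < 0, so the primitive is valid along every segment with Re (e w) > 0.\<close>
  define Pr where "Pr = (\<lambda>w. (\<Sum>n\<in>J. e * phi n (pole n) * Ln (e * (w - pole n))) + k1 e * Ha w + k2 * Hb w + e * Hc w)"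
  have Pr: "(Pr has_field_derivative g w * side_sum e w) (at w)"
    if w: "w \<in> strip" "\<And>n. n \<in> J \<Longrightarrow> e * (w - pole n) \<notin> \<real>\<^sub>\<le>\<^sub>0" for w
  proof -
    have "w \<noteq> pole n" if "n \<in> J" for n using w(2) [OF that] by auto
    hence eq: "g w * side_sum e w = (\<Sum>n\<in>J. e * phi n (pole n) / (w - pole n)) + k1 e * (g w * w powr (- 2 * \<nu> - 2)) + k2 * (g w * w powr (- 2 * \<nu>)) + e * regular_part w"
      using side_sum_decomposition [OF w(1), of e] by simp
    have L: "((\<lambda>w. Ln (e * (w - pole n))) has_field_derivative 1 / (w - pole n)) (at w)" if "n \<in> J" for n
    proof -
      have "((\<lambda>w. Ln (e * (w - pole n))) has_field_derivative inverse (e * (w - pole n)) * e) (at w)"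
        by (rule DERIV_chain2 [where f = Ln and g = "\<lambda>w. e * (w - pole n)" and x = w, OF has_field_derivative_Ln [OF w(2) [OF that]]]) (auto intro!: derivative_eq_intros)
      moreover have "inverse (e * (w - pole n)) * e = 1 / (w - pole n)" using e0 by (simp add: divide_simps)
      ultimately show ?thesis by (simp only:)
    qed
    have "((\<lambda>w. \<Sum>n\<in>J. e * phi n (pole n) * Ln (e * (w - pole n))) has_field_derivative (\<Sum>n\<in>J. e * phi n (pole n) * (1 / (w - pole n)))) (at w)"
      by (intro DERIV_sum DERIV_cmult L)
    hence "(Pr has_field_derivative (\<Sum>n\<in>J. e * phi n (pole n) * (1 / (w - pole n))) + k1 e * (g w * w powr (- 2 * \<nu> - 2)) + k2 * (g w * w powr (- 2 * \<nu>)) + e * regular_part w) (at w)"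
      unfolding Pr_def by (intro DERIV_add DERIV_cmult Ha Hb Hc w(1))
    thus ?thesis unfolding eq by simp
  qed
  \<comment> \<open>The leading 0 moves the term of the integer n + 1 to index n + 1, so the decay
    rate at index m is c sqrt m, as the Tauberian theorem expects.\<close>
  define u where "u = (\<lambda>m z. case m of 0 \<Rightarrow> 0 | Suc n \<Rightarrow> G n (of_real sb - e * z) - G n (of_real sa - e * z))"
  define F where "F = (\<lambda>z. Pr (of_real sb - e * z) - Pr (of_real sa - e * z))"
  define c where "c = 2 * (2 * pi / sqrt (real q))"
  have c: "c > 0" using q1 by (simp add: c_def)
  have cfreq: "2 * dual_freq n = c * sqrt (real (Suc n))" for n
    by (simp add: dual_freq_def c_def real_sqrt_divide del: of_nat_Suc)
  define \<delta> where "\<delta> = eps / 8"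
  have \<delta>: "\<delta> > 0" using eps by (simp add: \<delta>_def)
  define C where "C = 2 * B / c * ((sb - sa) / (2 * \<delta>) + 1)"
  define en where "en = (\<lambda>m. C * (real (card {d. d dvd m}) * real m powr (Re \<nu> / 2 - 3/4)))"
  have "(\<lambda>m. u m 0) sums F 0"
  proof (rule fatou_riesz_sqrt [where R = \<delta> and c = c and U = "ball 0 eps" and e = en])
    show "cball 0 \<delta> \<subseteq> ball 0 eps" using eps by (auto simp: \<delta>_def)
    have Ghol: "(\<lambda>z. G n (of_real s - e * z)) holomorphic_on ball 0 eps" if "s \<in> {sa..sb}" for n s
    proof -
      have "G n holomorphic_on strip" using G open_strip by (auto simp: holomorphic_on_open)
      hence "(G n \<circ> (\<lambda>z. of_real s - e * z)) holomorphic_on ball 0 eps"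
        by (rule holomorphic_on_compose_gen [rotated]) (use in_strip [OF that] in \<open>auto intro!: holomorphic_intros\<close>)
      thus ?thesis by (simp add: o_def)
    qed
    show "u m holomorphic_on ball 0 eps" for m
      unfolding u_def using sab' by (cases m) (auto intro!: holomorphic_intros Ghol)
    show "F holomorphic_on ball 0 eps"
    proof -
      \<comment> \<open>Both ends keep distance eps from the poles. As e is imaginary, this shows up
        in the imaginary part, which a z of norm below eps cannot cancel.\<close>
      have avoid: "e * (of_real s - e * z - pole n) \<notin> \<real>\<^sub>\<le>\<^sub>0" if s: "s \<in> {sa, sb}" and z: "norm z < eps" and n: "n \<in> J" for s z n
      proof -
        have "\<bar>s - sqrt (real (Suc n))\<bar> \<ge> eps" using s J(2) [OF n] eps by auto
        moreover have "\<bar>Im z\<bar> < eps" using z abs_Im_le_cmod [of z] by linarith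
        moreover have "e * (of_real s - e * z - pole n) = e * of_real (s - sqrt (real (Suc n))) + z"
          unfolding pole_def using e by (auto simp: algebra_simps)
        ultimately have "Im (e * (of_real s - e * z - pole n)) \<noteq> 0" using e by auto
        thus ?thesis by (auto simp: complex_nonpos_Reals_iff)
      qed
      have "\<exists>D. ((\<lambda>z. Pr (of_real s - e * z)) has_field_derivative D) (at z)" if s: "s \<in> {sa, sb}" and z: "z \<in> ball 0 eps" for s z
      proof -
        have "(Pr has_field_derivative g (of_real s - e * z) * side_sum e (of_real s - e * z)) (at (of_real s - e * z))"
          using s z sab by (intro Pr in_strip avoid) auto
        moreover have "((\<lambda>z. of_real s - e * z) has_field_derivative - e) (at z)" by (auto intro!: derivative_eq_intros)
        ultimately show ?thesis by (intro exI, rule DERIV_chain2)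
      qed
      hence "(\<lambda>z. Pr (of_real s - e * z)) holomorphic_on ball 0 eps" if "s \<in> {sa, sb}" for s
        using that by (subst holomorphic_on_open) auto
      thus ?thesis unfolding F_def by (intro holomorphic_on_diff) auto
    qed
    show "(\<lambda>T. \<Sum>m=T\<^sup>2..<(Suc T)\<^sup>2. en m) \<longlonglongrightarrow> 0"
      unfolding en_def by (rule divisor_blocks_tendsto_0 [OF \<nu>(2)])
    show "norm (u m z) \<le> en m * exp (- c * sqrt (real m) * Re z)" if z: "z \<in> cball 0 \<delta>" for m z
    proof (cases m)
      case 0
      thus ?thesis by (simp add: u_def en_def)
    next
      case (Suc n)
      define \<rho> where "\<rho> = 2 * dual_freq n"
      have \<rho>: "\<rho> > 0" using dual_freq_pos [of n] by (simp add: \<rho>_def)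
      define b where "b = B * (real (card {d. d dvd Suc n}) * real (Suc n) powr (Re \<nu> / 2 - 1/4))"
      have b0: "b \<ge> 0" using B(1) by (simp add: b_def)
      define x where "x = Re z"
      have nz: "norm z \<le> \<delta>" using z by simp
      have gb: "norm (g w * side_term e n w) \<le> b * exp (- (\<rho> * Re (e * w)))" if "w \<in> core_strip" for w
        using B(2) [OF that, of n] by (simp add: b_def \<rho>_def)
      have small: "norm (z + of_real t) \<le> eps / 2" if "0 \<le> t" "t \<le> \<delta>" for t
        using norm_triangle_ineq [of z "of_real t"] nz that by (simp add: \<delta>_def)
      \<comment> \<open>Having a primitive, the difference between the ends may be computed over a
        three-sided detour displaced by \<delta>. On its long side the extra factor exp(-\<rho>
        \<delta>) is at most 1/(\<rho> \<delta>).\<close>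
      have vert: "norm (G n (of_real sb - e * (z + of_real \<delta>)) - G n (of_real sa - e * (z + of_real \<delta>))) \<le> b * exp (- (\<rho> * (x + \<delta>))) * (sb - sa)"
      proof -
        let ?z = "z + of_real \<delta>"
        let ?L = "closed_segment (of_real sa - e * ?z) (of_real sb - e * ?z)"
        have L: "\<exists>s\<in>{sa..sb}. w = of_real s - e * ?z" if "w \<in> ?L" for w
        proof -
          from that obtain t where t: "0 \<le> t" "t \<le> 1" "w = (1 - t) *\<^sub>R (of_real sa - e * ?z) + t *\<^sub>R (of_real sb - e * ?z)"
            by (auto simp: closed_segment_def)
          have "w = of_real ((1 - t) * sa + t * sb) - e * ?z"
            unfolding t(3) by (simp add: scaleR_conv_of_real algebra_simps)
          moreover have "(1 - t) * sa + t * sb \<in> {sa..sb}"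
          proof -
            have "(1 - t) * sa + t * sb = sa + t * (sb - sa)" "(1 - t) * sa + t * sb = sb - (1 - t) * (sb - sa)" by (simp_all add: algebra_simps)
            thus ?thesis using t sab by (metis atLeastAtMost_iff diff_ge_0_iff_ge diff_le_eq le_add_same_cancel1 less_imp_le mult_nonneg_nonneg le_add_same_cancel1)
          qed
          ultimately show ?thesis by blast
        qed
        have "norm (G n (of_real sb - e * ?z) - G n (of_real sa - e * ?z)) \<le> (b * exp (- (\<rho> * (x + \<delta>)))) * norm ((of_real sb - e * ?z) - (of_real sa - e * ?z))"
        proof (rule field_differentiable_bound [where S = ?L and f' = "\<lambda>w. g w * side_term e n w"])
          fix w assume "w \<in> ?L"
          then obtain s where s: "s \<in> {sa..sb}" "w = of_real s - e * ?z" using L by blast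
          have wc: "w \<in> core_strip" unfolding s(2) using s(1) small [of \<delta>] \<delta> by (intro in_core) auto
          show "(G n has_field_derivative g w * side_term e n w) (at w within ?L)"
            using G [of w n] wc core_subset by (auto intro: has_field_derivative_at_within)
          have "Re (e * w) = x + \<delta>" unfolding s(2) Re_e(1) by (simp add: x_def)
          thus "norm (g w * side_term e n w) \<le> b * exp (- (\<rho> * (x + \<delta>)))" using gb [OF wc] by simp
        qed auto
        also have "norm ((of_real sb - e * ?z) - (of_real sa - e * ?z)) = sb - sa"
          using sab by (simp flip: of_real_diff)
        finally show ?thesis .
      qed
      \<comment> \<open>On the two short sides the exponential bound integrates to 1/\<rho>. All
        three sides thus gain 1/\<rho>, of order n^(-1/2), which lowers the exponent -1/4 of the
        terms to -3/4.\<close>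
      have horiz: "norm (G n (of_real s - e * (z + of_real \<delta>)) - G n (of_real s - e * z)) \<le> b * exp (- (\<rho> * x)) / \<rho>" if s: "s \<in> {sa..sb}" for s
      proof -
        define \<gamma> where "\<gamma> = (\<lambda>t. complex_of_real s - e * (z + of_real t))"
        define \<phi> where "\<phi> = (\<lambda>t. - (b / \<rho> * exp (- (\<rho> * (x + t)))))"
        have gc: "\<gamma> t \<in> core_strip" if "0 \<le> t" "t \<le> \<delta>" for t
          unfolding \<gamma>_def using s small that by (intro in_core) auto
        have d\<gamma>: "((\<lambda>t. G n (\<gamma> t)) has_vector_derivative (- e) * (g (\<gamma> t) * side_term e n (\<gamma> t))) (at t)" if "0 \<le> t" "t \<le> \<delta>" for t
        proof -
          have "(\<gamma> has_vector_derivative - e) (at t)"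
            unfolding \<gamma>_def by (auto intro!: derivative_eq_intros)
          moreover have "(G n has_field_derivative g (\<gamma> t) * side_term e n (\<gamma> t)) (at (\<gamma> t))"
            using G gc [OF that] core_subset by blast
          ultimately have "(G n \<circ> \<gamma> has_vector_derivative (- e) * (g (\<gamma> t) * side_term e n (\<gamma> t))) (at t)"
            by (rule field_vector_diff_chain_at)
          thus ?thesis by (simp add: o_def)
        qed
        have d\<phi>: "(\<phi> has_vector_derivative b * exp (- (\<rho> * (x + t)))) (at t)" for t
          unfolding \<phi>_def has_real_derivative_iff_has_vector_derivative [symmetric]
          using \<rho> by (auto intro!: derivative_eq_intros)
        have "norm (G n (\<gamma> \<delta>) - G n (\<gamma> 0)) \<le> \<phi> \<delta> - \<phi> 0"
        proof (rule differentiable_bound_general [OF \<delta>])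
          show "continuous_on {0..\<delta>} (\<lambda>t. G n (\<gamma> t))"
            by (intro continuous_at_imp_continuous_on ballI, rule has_vector_derivative_continuous, rule d\<gamma>) auto
          show "continuous_on {0..\<delta>} \<phi>"
            by (intro continuous_at_imp_continuous_on ballI, rule has_vector_derivative_continuous, rule d\<phi>)
          show "norm ((- e) * (g (\<gamma> t) * side_term e n (\<gamma> t))) \<le> b * exp (- (\<rho> * (x + t)))" if "0 < t" "t < \<delta>" for t
          proof -
            have "Re (e * \<gamma> t) = x + t" unfolding \<gamma>_def Re_e(1) by (simp add: x_def)
            thus ?thesis using gb [OF gc, of t] that ne by (simp add: norm_mult)
          qed
        qed (use d\<gamma> d\<phi> in auto)
        also have "\<phi> \<delta> - \<phi> 0 \<le> - \<phi> 0" using b0 \<rho> by (simp add: \<phi>_def)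
        also have "- \<phi> 0 = b * exp (- (\<rho> * x)) / \<rho>" by (simp add: \<phi>_def)
        finally show ?thesis by (simp add: \<gamma>_def)
      qed
      have expd: "exp (- (\<rho> * \<delta>)) \<le> 1 / (\<rho> * \<delta>)"
        using exp_neg_le_power [of "\<rho> * \<delta>" 1] \<rho> \<delta> by simp
      have "u m z = (G n (of_real sb - e * (z + of_real \<delta>)) - G n (of_real sa - e * (z + of_real \<delta>)))
          - (G n (of_real sb - e * (z + of_real \<delta>)) - G n (of_real sb - e * z))
          + (G n (of_real sa - e * (z + of_real \<delta>)) - G n (of_real sa - e * z))"
        by (simp add: u_def Suc)
      also have "norm \<dots> \<le> b * exp (- (\<rho> * (x + \<delta>))) * (sb - sa) + b * exp (- (\<rho> * x)) / \<rho> + b * exp (- (\<rho> * x)) / \<rho>"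
        by (intro order_trans [OF norm_triangle_ineq] order_trans [OF norm_triangle_ineq4] add_mono vert horiz sab')
      also have "b * exp (- (\<rho> * (x + \<delta>))) * (sb - sa) \<le> b * (exp (- (\<rho> * x)) * (1 / (\<rho> * \<delta>))) * (sb - sa)"
      proof -
        have "exp (- (\<rho> * (x + \<delta>))) = exp (- (\<rho> * x)) * exp (- (\<rho> * \<delta>))" by (simp add: algebra_simps flip: exp_add)
        moreover have "exp (- (\<rho> * x)) * exp (- (\<rho> * \<delta>)) \<le> exp (- (\<rho> * x)) * (1 / (\<rho> * \<delta>))"
          by (intro mult_left_mono expd) auto
        ultimately show ?thesis using b0 sab by (intro mult_right_mono mult_left_mono) linarith+
      qed
      also have "b * (exp (- (\<rho> * x)) * (1 / (\<rho> * \<delta>))) * (sb - sa) + b * exp (- (\<rho> * x)) / \<rho> + b * exp (- (\<rho> * x)) / \<rho> =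
          2 * b / \<rho> * ((sb - sa) / (2 * \<delta>) + 1) * exp (- (\<rho> * x))"
        using \<rho> \<delta> by (simp add: field_simps)
      also have "2 * b / \<rho> * ((sb - sa) / (2 * \<delta>) + 1) = en m"
      proof -
        have "\<rho> = c * real (Suc n) powr (1/2)" by (simp add: \<rho>_def cfreq powr_half_sqrt del: of_nat_Suc)
        hence "2 * b / \<rho> = 2 * B / c * (real (card {d. d dvd Suc n}) * (real (Suc n) powr (Re \<nu> / 2 - 1/4) / real (Suc n) powr (1/2)))"
          by (simp add: b_def)
        also have "real (Suc n) powr (Re \<nu> / 2 - 1/4) / real (Suc n) powr (1/2) = real (Suc n) powr (Re \<nu> / 2 - 3/4)"
          by (simp add: powr_diff [symmetric] del: of_nat_Suc)
        finally show ?thesis by (simp add: en_def C_def Suc mult_ac del: of_nat_Suc)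
      qed
      also have "\<rho> * x = c * sqrt (real m) * Re z" by (simp only: \<rho>_def cfreq Suc x_def)
      finally show ?thesis by simp
    qed
    \<comment> \<open>For Re z > 0 the series converges uniformly along the displaced segment, so it
      is integrated term by term, and its sum is integrated through \<open>Pr\<close>.\<close>
    show "(\<lambda>m. u m z) sums F z" if z: "z \<in> cball 0 \<delta>" and Rz: "Re z > 0" for z
    proof -
      have nz: "norm z \<le> eps / 2" "norm z < eps" using z eps by (auto simp: \<delta>_def)
      define p where "p = (\<lambda>s::real. of_real s - e * z)"
      have pc: "p s \<in> core_strip" "p s \<in> strip" if "s \<in> {sa..sb}" for s
        using in_core [OF that nz(1)] core_subset by (auto simp: p_def)
      have Rep: "Re (e * p s) = Re z" for s unfolding p_def Re_e(1) ..
      obtain M where M: "M > 0" "\<And>w. w \<in> core_strip \<Longrightarrow> norm (g w) \<le> M" by (rule g_bounded) blast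
      obtain M1 where M1: "summable M1" "\<And>n w. w \<in> (\<lambda>s. e * p s) ` {sa..sb} \<Longrightarrow> norm (dual_coeff n * kernel_K \<nu> (of_real (dual_freq n) * w)) \<le> M1 n"
        by (rule dual_series_uniform [OF Rz, of "(\<lambda>s. e * p s) ` {sa..sb}"]) (use Rep in auto)
      have "sa / 2 > 0" using eps by simp
      obtain M2 where M2: "summable M2" "\<And>n w. w \<in> p ` {sa..sb} \<Longrightarrow> norm (dual_coeff n * kernel_K \<nu> (of_real (dual_freq n) * w)) \<le> M2 n"
      proof (rule dual_series_uniform [OF \<open>sa / 2 > 0\<close>, of "p ` {sa..sb}"])
        show "Re w \<ge> sa / 2" if w: "w \<in> p ` {sa..sb}" for w
        proof -
          have "w \<in> core_strip" using w pc by auto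
          thus ?thesis using eps by (simp add: core_strip_def)
        qed
      qed blast
      define A where "A = norm (of_nat q powr (- \<nu> / 2) * exp (e * th))"
      have unif: "uniform_limit {sa..sb} (\<lambda>N s. \<Sum>n<N. g (p s) * side_term e n (p s)) (\<lambda>s. \<Sum>n. g (p s) * side_term e n (p s)) sequentially"
      proof (rule Weierstrass_m_test [where M = "\<lambda>n. M * (A * (M1 n + M2 n))"])
        show "summable (\<lambda>n. M * (A * (M1 n + M2 n)))" by (intro summable_mult summable_add M1 M2)
        show "norm (g (p s) * side_term e n (p s)) \<le> M * (A * (M1 n + M2 n))" if "s \<in> {sa..sb}" for n s
        proof -
          have "norm (g (p s) * side_term e n (p s)) = norm (g (p s)) * (A * norm (dual_coeff n * kernel_K \<nu> (of_real (dual_freq n) * (e * p s)) + dual_coeff n * kernel_K \<nu> (of_real (dual_freq n) * p s)))"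
            unfolding side_term_def A_def by (simp only: norm_mult)
          also have "\<dots> \<le> M * (A * (M1 n + M2 n))"
          proof (intro mult_mono order_trans [OF norm_triangle_ineq] add_mono)
            show "norm (g (p s)) \<le> M" using M(2) pc that by blast
            show "norm (dual_coeff n * kernel_K \<nu> (of_real (dual_freq n) * (e * p s))) \<le> M1 n" using that by (intro M1) auto
            show "norm (dual_coeff n * kernel_K \<nu> (of_real (dual_freq n) * p s)) \<le> M2 n" using that by (intro M2) auto
          qed (use M(1) in \<open>auto simp: A_def\<close>)
          finally show ?thesis .
        qed
      qed
      have lim: "(\<Sum>n. g (p s) * side_term e n (p s)) = g (p s) * side_sum e (p s)" if "s \<in> {sa..sb}" for s
      proof -
        have "(\<lambda>n. side_term e n (p s)) sums side_sum e (p s)"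
          using strip_Re(1) [OF pc(2) [OF that]] Rep [of s] Rz by (intro side_term_sums [OF e]) auto
        from sums_mult [OF this, of "g (p s)"] show ?thesis by (simp add: sums_iff)
      qed
      have dp: "(p has_vector_derivative 1) (at s within A)" for s A
        unfolding p_def by (auto intro!: derivative_eq_intros)
      have ftc: "((\<lambda>s. h (p s)) has_integral (Hh (p sb) - Hh (p sa))) {sa..sb}"
        if der: "\<And>s. s \<in> {sa..sb} \<Longrightarrow> (Hh has_field_derivative h (p s)) (at (p s))" for h Hh :: "complex \<Rightarrow> complex"
      proof (rule fundamental_theorem_of_calculus)
        show "((\<lambda>s. Hh (p s)) has_vector_derivative h (p s)) (at s within {sa..sb})" if "s \<in> {sa..sb}" for s
        proof -
          have "(Hh \<circ> p has_vector_derivative 1 * h (p s)) (at s)"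
            by (rule field_vector_diff_chain_at [OF dp der [OF that]])
          thus ?thesis by (auto simp: o_def intro: has_vector_derivative_at_within)
        qed
      qed (use sab in auto)
      have Gint: "((\<lambda>s. g (p s) * side_term e n (p s)) has_integral (G n (p sb) - G n (p sa))) {sa..sb}" for n
        by (rule ftc [of "G n" "\<lambda>w. g w * side_term e n w"]) (use G pc in blast)
      have Fint: "((\<lambda>s. g (p s) * side_sum e (p s)) has_integral F z) {sa..sb}"
      proof -
        have "((\<lambda>s. g (p s) * side_sum e (p s)) has_integral (Pr (p sb) - Pr (p sa))) {sa..sb}"
        proof (rule ftc [of Pr "\<lambda>w. g w * side_sum e w"])
          fix s assume s: "s \<in> {sa..sb}"
          have "e * (p s - pole n) \<notin> \<real>\<^sub>\<le>\<^sub>0" for n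
          proof -
            have "Re (e * pole n) = 0" using e by (auto simp: pole_def)
            hence "Re (e * (p s - pole n)) = Re z" using Rep [of s] by (simp add: right_diff_distrib)
            thus ?thesis using Rz by (auto simp: complex_nonpos_Reals_iff)
          qed
          thus "(Pr has_field_derivative g (p s) * side_sum e (p s)) (at (p s))" using pc [OF s] by (intro Pr) auto
        qed
        thus ?thesis by (simp add: F_def p_def)
      qed
      have cont: "continuous_on {sa..sb} (\<lambda>s. \<Sum>n<N. g (p s) * side_term e n (p s))" for N
      proof (intro continuous_on_sum)
        fix n
        have "continuous_on strip (\<lambda>w. g w * side_term e n w)"
          by (intro holomorphic_on_imp_continuous_on holomorphic_on_mult g [folded strip_def] side_term_holomorphic [OF e])
        moreover have "continuous_on {sa..sb} p" unfolding p_def by (intro continuous_intros)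
        ultimately show "continuous_on {sa..sb} (\<lambda>s. g (p s) * side_term e n (p s))"
          by (rule continuous_on_compose2) (use pc in auto)
      qed
      obtain I K where IK: "\<And>N. ((\<lambda>s. \<Sum>n<N. g (p s) * side_term e n (p s)) has_integral I N) {sa..sb}"
        "((\<lambda>s. \<Sum>n. g (p s) * side_term e n (p s)) has_integral K) {sa..sb}" "I \<longlonglongrightarrow> K"
        by (rule uniform_limit_integral [OF unif cont]) auto
      have "I = (\<lambda>N. \<Sum>n<N. G n (p sb) - G n (p sa))"
      proof (rule ext)
        show "I N = (\<Sum>n<N. G n (p sb) - G n (p sa))" for N
          by (rule has_integral_unique [OF IK(1)]) (intro has_integral_sum Gint, auto)
      qed
      moreover have "K = F z"
      proof (rule has_integral_unique [OF IK(2)])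
        show "((\<lambda>s. \<Sum>n. g (p s) * side_term e n (p s)) has_integral F z) {sa..sb}"
          by (rule has_integral_eq [OF _ Fint]) (simp add: lim)
      qed
      ultimately have "(\<lambda>n. G n (p sb) - G n (p sa)) sums F z" using IK(3) unfolding sums_def by (simp only:)
      hence "(\<lambda>n. u (Suc n) z) sums F z" by (simp add: u_def p_def)
      thus ?thesis by (subst (asm) sums_Suc_iff) (simp add: u_def)
    qed
  qed (use \<delta> c in auto)
  hence "(\<lambda>n. u (Suc n) 0) sums (F 0 - u 0 0)" by (subst sums_Suc_iff) simp
  moreover have "u 0 0 = 0" by (simp add: u_def)
  ultimately have main: "(\<lambda>n. G n (of_real sb) - G n (of_real sa)) sums F 0" by (simp add: u_def)
  \<comment> \<open>On the axis e (w - pole n) is a positive multiple of e at the right end and of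
    -e at the left end, so the logarithms differ by e pi besides their real parts: half a turn
    around the pole.\<close>
  have Lb: "Ln (e * (of_real sb - pole n)) = of_real (ln (sb - sqrt (real (Suc n)))) + e * of_real (pi / 2)" if "n \<in> J" for n
  proof -
    have pos: "sb - sqrt (real (Suc n)) > 0" using J(2) [OF that] eps by auto
    have "e * (of_real sb - pole n) = e * of_real (sb - sqrt (real (Suc n)))" by (simp add: pole_def)
    also have "Ln \<dots> = Ln (of_real (sb - sqrt (real (Suc n)))) + Ln e"
      using Ln_times_of_real [OF pos e0] by (simp only: mult.commute add.commute Ln_of_real [OF pos])
    finally show ?thesis using e Ln_of_real [OF pos] by auto
  qed
  have La: "Ln (e * (of_real sa - pole n)) = of_real (ln (sqrt (real (Suc n)) - sa)) - e * of_real (pi / 2)" if "n \<in> J" for n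
  proof -
    have pos: "sqrt (real (Suc n)) - sa > 0" using J(2) [OF that] eps by auto
    have "e * (of_real sa - pole n) = (- e) * of_real (sqrt (real (Suc n)) - sa)" by (simp add: pole_def algebra_simps)
    also have "Ln \<dots> = Ln (of_real (sqrt (real (Suc n)) - sa)) + Ln (- e)"
      using Ln_times_of_real [OF pos, of "- e"] e0 by (simp only: mult.commute add.commute Ln_of_real [OF pos]) simp
    finally show ?thesis using e Ln_of_real [OF pos] by auto
  qed
  have "F 0 = (\<Sum>n\<in>J. e * phi n (pole n) * (Ln (e * (of_real sb - pole n)) - Ln (e * (of_real sa - pole n))))
      + k1 e * (Ha (of_real sb) - Ha (of_real sa)) + k2 * (Hb (of_real sb) - Hb (of_real sa)) + e * (Hc (of_real sb) - Hc (of_real sa))"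
    by (simp add: F_def Pr_def right_diff_distrib sum_subtractf algebra_simps)
  also have "(\<Sum>n\<in>J. e * phi n (pole n) * (Ln (e * (of_real sb - pole n)) - Ln (e * (of_real sa - pole n)))) =
     (\<Sum>n\<in>J. e * phi n (pole n) * (of_real (ln (sb - sqrt (real (Suc n)))) - of_real (ln (sqrt (real (Suc n)) - sa)) + e * of_real pi))"
    by (intro sum.cong refl) (simp add: La Lb)
  finally show ?thesis using main by simp
qed

lemma strip_real: "s \<in> {sa..sb} \<Longrightarrow> of_real s \<in> strip"
  using eps by (auto simp: strip_def)

lemma strip_primitive:
  assumes "h holomorphic_on strip"
  obtains H where "\<And>w. w \<in> strip \<Longrightarrow> (H has_field_derivative h w) (at w)"
    "((\<lambda>s. h (of_real s)) has_integral (H (of_real sb) - H (of_real sa))) {sa..sb}"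
proof -
  obtain H where H': "\<And>w. w \<in> strip \<Longrightarrow> (H has_field_derivative h w) (at w within strip)"
    using holomorphic_convex_primitive' [OF convex_strip open_strip assms] by blast
  have H: "(H has_field_derivative h w) (at w)" if "w \<in> strip" for w
    using H' [OF that] unfolding at_within_open [OF that open_strip] .
  have "((\<lambda>s. h (of_real s)) has_integral (H (of_real sb) - H (of_real sa))) {sa..sb}"
  proof (rule fundamental_theorem_of_calculus)
    fix s assume "s \<in> {sa..sb}"
    hence "(H has_field_derivative h (of_real s)) (at (of_real s))" by (intro H strip_real)
    moreover have "(of_real has_vector_derivative (1 :: complex)) (at s)"
      by (auto intro!: derivative_eq_intros)
    ultimately have "(H \<circ> of_real has_vector_derivative 1 * h (of_real s)) (at s)"
      by (intro field_vector_diff_chain_at)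
    thus "((\<lambda>s. H (of_real s)) has_vector_derivative h (of_real s)) (at s within {sa..sb})"
      by (simp add: o_def has_vector_derivative_at_within)
  qed (use sab in simp)
  with H that show ?thesis by blast
qed

text \<open>Real logarithms, \<open>k1\<close> and the regular part enter with opposite signs. The
  half turns enter through e times e pi = -pi, which has the same sign on both sides, and so does
  \<open>k2\<close>.\<close>

theorem two_sided_voronoi:
  "(\<lambda>n. integral {sa..sb} (\<lambda>s. g (of_real s) * (side_term \<i> n (of_real s) + side_term (- \<i>) n (of_real s)))) sums
     ((\<Sum>n\<in>J. - (2 * of_real pi * phi n (pole n))) + 2 * k2 * integral {sa..sb} (\<lambda>s. g (of_real s) * of_real s powr (- 2 * \<nu>)))"
proof -
  have gh: "g holomorphic_on strip" using g by (simp add: strip_def)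
  have pw: "(\<lambda>w. g w * w powr a) holomorphic_on strip" for a
    using gh strip_slit by (intro holomorphic_intros) auto
  obtain Ha where Ha: "\<And>w. w \<in> strip \<Longrightarrow> (Ha has_field_derivative g w * w powr (- 2 * \<nu> - 2)) (at w)"
    using strip_primitive [OF pw] by blast
  obtain Hb where Hb: "\<And>w. w \<in> strip \<Longrightarrow> (Hb has_field_derivative g w * w powr (- 2 * \<nu>)) (at w)"
      "((\<lambda>s. g (of_real s) * of_real s powr (- 2 * \<nu>)) has_integral (Hb (of_real sb) - Hb (of_real sa))) {sa..sb}"
    using strip_primitive [OF pw] by blast
  obtain Hc where Hc: "\<And>w. w \<in> strip \<Longrightarrow> (Hc has_field_derivative regular_part w) (at w)"
    using strip_primitive [OF regular_part_holomorphic] by blast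
  have "\<exists>G. (\<forall>w\<in>strip. (G has_field_derivative g w * side_term e n w) (at w)) \<and>
      ((\<lambda>s. g (of_real s) * side_term e n (of_real s)) has_integral (G (of_real sb) - G (of_real sa))) {sa..sb}"
    if "e = \<i> \<or> e = - \<i>" for e n
    by (rule strip_primitive [OF holomorphic_on_mult [OF gh side_term_holomorphic [OF that, of n]]]) blast
  hence "\<exists>G. \<forall>n. (\<forall>w\<in>strip. (G n has_field_derivative g w * side_term e n w) (at w)) \<and>
      ((\<lambda>s. g (of_real s) * side_term e n (of_real s)) has_integral (G n (of_real sb) - G n (of_real sa))) {sa..sb}"
    if "e = \<i> \<or> e = - \<i>" for e
    using that by (intro choice) blast
  from this [of \<i>] this [of "- \<i>"] obtain G G' where
    G: "\<And>n w. w \<in> strip \<Longrightarrow> (G n has_field_derivative g w * side_term \<i> n w) (at w)"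
      "\<And>n. ((\<lambda>s. g (of_real s) * side_term \<i> n (of_real s)) has_integral (G n (of_real sb) - G n (of_real sa))) {sa..sb}" and
    G': "\<And>n w. w \<in> strip \<Longrightarrow> (G' n has_field_derivative g w * side_term (- \<i>) n w) (at w)"
      "\<And>n. ((\<lambda>s. g (of_real s) * side_term (- \<i>) n (of_real s)) has_integral (G' n (of_real sb) - G' n (of_real sa))) {sa..sb}"
    by blast
  have int: "integral {sa..sb} (\<lambda>s. g (of_real s) * (side_term \<i> n (of_real s) + side_term (- \<i>) n (of_real s))) =
      (G n (of_real sb) - G n (of_real sa)) + (G' n (of_real sb) - G' n (of_real sa))" for n
    unfolding distrib_left by (rule integral_unique [OF has_integral_add [OF G(2) G'(2)]])
  define D where "D = (\<lambda>n. complex_of_real (ln (sb - sqrt (real (Suc n)))) - of_real (ln (sqrt (real (Suc n)) - sa)))"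
  have comb: "(x + a * u + b * v + \<i> * z) + (y + c * u + b * v + - \<i> * z) = (x + y) + (a + c) * u + 2 * b * v"
    for a b c u v x y z :: complex by (simp add: algebra_simps)
  have k1: "k1 \<i> + k1 (- \<i>) = 0" by (simp add: k1_def algebra_simps)
  have "(\<lambda>n. (G n (of_real sb) - G n (of_real sa)) + (G' n (of_real sb) - G' n (of_real sa))) sums
      (((\<Sum>n\<in>J. \<i> * phi n (pole n) * (D n + \<i> * of_real pi)) + k1 \<i> * (Ha (of_real sb) - Ha (of_real sa)) + k2 * (Hb (of_real sb) - Hb (of_real sa)) + \<i> * (Hc (of_real sb) - Hc (of_real sa)))
     + ((\<Sum>n\<in>J. - \<i> * phi n (pole n) * (D n + - \<i> * of_real pi)) + k1 (- \<i>) * (Ha (of_real sb) - Ha (of_real sa)) + k2 * (Hb (of_real sb) - Hb (of_real sa)) + - \<i> * (Hc (of_real sb) - Hc (of_real sa))))"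
    unfolding D_def
    by (rule sums_add [OF one_sided_voronoi [OF _ G(1) Ha Hb(1) Hc] one_sided_voronoi [OF _ G'(1) Ha Hb(1) Hc]]) auto
  also have "((\<Sum>n\<in>J. \<i> * phi n (pole n) * (D n + \<i> * of_real pi)) + k1 \<i> * (Ha (of_real sb) - Ha (of_real sa)) + k2 * (Hb (of_real sb) - Hb (of_real sa)) + \<i> * (Hc (of_real sb) - Hc (of_real sa)))
     + ((\<Sum>n\<in>J. - \<i> * phi n (pole n) * (D n + - \<i> * of_real pi)) + k1 (- \<i>) * (Ha (of_real sb) - Ha (of_real sa)) + k2 * (Hb (of_real sb) - Hb (of_real sa)) + - \<i> * (Hc (of_real sb) - Hc (of_real sa))) =
     ((\<Sum>n\<in>J. \<i> * phi n (pole n) * (D n + \<i> * of_real pi)) + (\<Sum>n\<in>J. - \<i> * phi n (pole n) * (D n + - \<i> * of_real pi)))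
       + (k1 \<i> + k1 (- \<i>)) * (Ha (of_real sb) - Ha (of_real sa)) + 2 * k2 * (Hb (of_real sb) - Hb (of_real sa))"
    by (simp only: comb)
  also have "(\<Sum>n\<in>J. \<i> * phi n (pole n) * (D n + \<i> * of_real pi)) + (\<Sum>n\<in>J. - \<i> * phi n (pole n) * (D n + - \<i> * of_real pi)) =
      (\<Sum>n\<in>J. - (2 * of_real pi * phi n (pole n)))"
    unfolding sum.distrib [symmetric] by (intro sum.cong refl) (simp add: algebra_simps)
  finally show ?thesis unfolding k1 int integral_unique [OF Hb(2)] by simp
qed

text \<open>With Z = x/2 the factor Z^(-\<nu>) absorbs (2 pi)^\<nu>, the power of q and half of
  n^\<nu>, and leaves n^(\<nu>/2) t^(-\<nu>/2).\<close>

lemma side_term_kernel: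
  fixes t :: real and n :: nat
  assumes t: "t > 0"
  defines "x \<equiv> 4 * pi * sqrt (real (Suc n) * t / real q)"
  shows "side_term \<i> n (of_real (sqrt t)) + side_term (- \<i>) n (of_real (sqrt t)) =
    2 * pi * sigma_char (-\<nu>) (\<lambda>m. cnj (chi m)) (Suc n) * of_nat (Suc n) powr (\<nu> / 2) * (of_real t powr (-\<nu> / 2) *
              ((2 / pi * bessel_K \<nu> x - bessel_Y \<nu> x) * cos (pi * \<nu> / 2) - bessel_J \<nu> x * sin (pi * \<nu> / 2)))"
proof -
  define N where "N = real (Suc n)"
  define Z where "Z = complex_of_real (x / 2)"
  define \<kappa> where "\<kappa> = (2 / of_real pi * bessel_K \<nu> x - bessel_Y \<nu> x) * cos th - bessel_J \<nu> x * sin th"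
  define \<sigma> where "\<sigma> = sigma_char (-\<nu>) (\<lambda>m. cnj (chi m)) (Suc n)"
  have N: "N > 0" and q0: "real q > 0" using q1 by (simp_all add: N_def)
  have x: "x > 0" using t q0 by (simp add: x_def)
  have Zf: "of_real (dual_freq n) * of_real (sqrt t) = Z"
    by (simp add: Z_def x_def dual_freq_def real_sqrt_mult real_sqrt_divide del: of_nat_Suc)
  have ker: "2 * of_real pi * Z powr (- \<nu>) * \<kappa> =
      exp (\<i> * th) * (kernel_K \<nu> (\<i> * Z) + kernel_K \<nu> Z) + exp (- \<i> * th) * (kernel_K \<nu> (- \<i> * Z) + kernel_K \<nu> Z)"
    unfolding \<kappa>_def Z_def th_def using \<nu> x by (intro voronoi_kernel_eq) auto
  have "side_term \<i> n (of_real (sqrt t)) + side_term (- \<i>) n (of_real (sqrt t)) =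
      of_nat q powr (- \<nu> / 2) * dual_coeff n *
      (exp (\<i> * th) * (kernel_K \<nu> (\<i> * Z) + kernel_K \<nu> Z) + exp (- \<i> * th) * (kernel_K \<nu> (- \<i> * Z) + kernel_K \<nu> Z))"
    unfolding side_term_def mult.left_commute [of "of_real (dual_freq n)" "\<i>"] mult.left_commute [of "of_real (dual_freq n)" "- \<i>"] Zf
    by (simp only: distrib_left mult_ac)
  also have "\<dots> = of_nat q powr (- \<nu> / 2) * dual_coeff n * Z powr (- \<nu>) * (2 * of_real pi * \<kappa>)"
    unfolding ker [symmetric] by (simp only: mult_ac)
  also have "of_nat q powr (- \<nu> / 2) * dual_coeff n * Z powr (- \<nu>) = \<sigma> * of_nat (Suc n) powr (\<nu> / 2) * of_real t powr (- \<nu> / 2)"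
  proof -
    have Zv: "Z = of_real (2 * pi * sqrt N * sqrt t / sqrt (real q))"
      by (simp add: Z_def x_def N_def real_sqrt_mult real_sqrt_divide)
    have half: "ln (sqrt y) = ln y / 2" if "y > 0" for y :: real using that by (simp add: ln_sqrt)
    have lnZ: "ln (2 * pi * sqrt N * sqrt t / sqrt (real q)) = ln (2 * pi) + ln N / 2 + ln t / 2 - ln (real q) / 2"
      using N t q0 by (simp add: ln_mult ln_div half)
    have pr: "complex_of_real y powr a = exp (a * of_real (ln y))" if "y > 0" for y a
      using that by (simp add: powr_def Ln_of_real)
    have cN: "of_nat (Suc n) = complex_of_real N" and cq: "of_nat q = complex_of_real (real q)" by (simp_all add: N_def)
    have "of_nat q powr (- \<nu> / 2) * dual_coeff n * Z powr (- \<nu>) = \<sigma> *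
       (of_real (real q) powr (- \<nu> / 2) * (of_real (2 * pi) powr \<nu> * of_real N powr \<nu>) * Z powr (- \<nu>))"
      unfolding dual_coeff_def \<sigma>_def cN cq by (simp only: mult_ac)
    also have "of_real (real q) powr (- \<nu> / 2) * (of_real (2 * pi) powr \<nu> * of_real N powr \<nu>) * Z powr (- \<nu>) =
        of_real N powr (\<nu> / 2) * of_real t powr (- \<nu> / 2)"
    proof -
      have pos: "2 * pi * sqrt N * sqrt t / sqrt (real q) > 0" "2 * pi > 0" using N t q0 by simp_all
      show ?thesis
        unfolding Zv pr [OF q0] pr [OF N] pr [OF t] pr [OF pos(2)] pr [OF pos(1)] lnZ exp_add [symmetric]
        by (rule arg_cong [where f = exp]) (simp add: algebra_simps add_divide_distrib diff_divide_distrib)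
    qed
    finally show ?thesis unfolding cN by (simp only: mult_ac)
  qed
  finally show ?thesis unfolding \<kappa>_def \<sigma>_def th_def by (simp add: mult_ac)
qed

text \<open>At w = sqrt N the factors w^(-2 \<nu>) and N^\<nu> cancel. For g w = 2 w f(w^2) the last
  quotient is f(N).\<close>

lemma phi_at_pole: "- (2 * of_real pi * phi n (pole n)) = Q * (div_coeff n * (g (pole n) / (2 * pole n)))"
proof -
  define N where "N = real (Suc n)"
  have N: "N > 0" by (simp add: N_def)
  have p0: "pole n \<noteq> 0" using N by (simp add: pole_def N_def)
  have pp: "pole n powr (- 2 * \<nu>) * of_nat (Suc n) powr \<nu> = 1"
  proof -
    have "pole n powr (- 2 * \<nu>) = exp (- \<nu> * of_real (ln N))"
      unfolding pole_def N_def [symmetric] using N by (simp add: powr_def Ln_of_real ln_sqrt)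
    moreover have "of_nat (Suc n) powr \<nu> = exp (\<nu> * of_real (ln N))"
    proof -
      have "of_nat (Suc n) = complex_of_real N" by (simp add: N_def)
      thus ?thesis using N by (simp only: powr_def Ln_of_real) simp
    qed
    ultimately show ?thesis by (simp flip: exp_add)
  qed
  have "phi n (pole n) = g (pole n) * (- (Q / of_real pi)) * (pole n)\<^sup>2 * (pole n powr (- 2 * \<nu>) * of_nat (Suc n) powr \<nu>) * div_coeff n / ((pole n + pole n) * ((pole n)\<^sup>2 + (pole n)\<^sup>2))"
    unfolding phi_def pcoeff_def pole_square by (simp only: mult_ac)
  also have "\<dots> = g (pole n) * (- (Q / of_real pi)) * div_coeff n / (4 * pole n)"
    unfolding pp using p0 by (simp add: power2_eq_square field_simps)
  finally show ?thesis using p0 by (simp add: field_simps)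
qed

end

section \<open>Return from w to t = w^2 and assembly\<close>

lemma sqrt_substitution:
  fixes f T :: "complex \<Rightarrow> complex"
  assumes "0 < \<alpha>" "\<alpha> < \<beta>" "continuous_on (of_real ` {\<alpha>..\<beta>}) f" "continuous_on (of_real ` {sqrt \<alpha>..sqrt \<beta>}) T"
  shows "integral {sqrt \<alpha>..sqrt \<beta>} (\<lambda>s. 2 * of_real s * f ((of_real s)\<^sup>2) * T (of_real s)) =
    integral {\<alpha>..\<beta>} (\<lambda>t. f (of_real t) * T (of_real (sqrt t)))"
proof -
  have sq: "s\<^sup>2 \<in> {\<alpha>..\<beta>}" if "s \<in> {sqrt \<alpha>..sqrt \<beta>}" for s
  proof -
    have "sqrt \<alpha> \<ge> 0" using assms(1) by simp
    hence "(sqrt \<alpha>)\<^sup>2 \<le> s\<^sup>2" "s\<^sup>2 \<le> (sqrt \<beta>)\<^sup>2" using that unfolding atLeastAtMost_iff by (intro power_mono; linarith)+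
    thus ?thesis using assms(1,2) by simp
  qed
  have "((\<lambda>s. (2 * s) *\<^sub>R (f (of_real (s\<^sup>2)) * T (of_real (sqrt (s\<^sup>2))))) has_integral
      (integral {(sqrt \<alpha>)\<^sup>2..(sqrt \<beta>)\<^sup>2} (\<lambda>t. f (of_real t) * T (of_real (sqrt t))))) {sqrt \<alpha>..sqrt \<beta>}"
  proof (rule has_integral_substitution [where c = \<alpha> and d = \<beta>])
    show "(\<lambda>s. s\<^sup>2) ` {sqrt \<alpha>..sqrt \<beta>} \<subseteq> {\<alpha>..\<beta>}" using sq by auto
    show "continuous_on {\<alpha>..\<beta>} (\<lambda>t. f (of_real t) * T (of_real (sqrt t)))"
      by (intro continuous_on_mult continuous_on_compose2 [OF assms(3)] continuous_on_compose2 [OF assms(4)] continuous_intros) auto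
  qed (use assms(1,2) in \<open>auto intro!: derivative_eq_intros\<close>)
  hence "((\<lambda>s. 2 * of_real s * f ((of_real s)\<^sup>2) * T (of_real s)) has_integral
      (integral {\<alpha>..\<beta>} (\<lambda>t. f (of_real t) * T (of_real (sqrt t))))) {sqrt \<alpha>..sqrt \<beta>}"
  proof (rule has_integral_eq_rhs [OF has_integral_eq, rotated])
    fix s assume "s \<in> {sqrt \<alpha>..sqrt \<beta>}"
    moreover have "sqrt \<alpha> \<ge> 0" using assms(1) by simp
    ultimately have "s \<ge> 0" unfolding atLeastAtMost_iff by linarith
    hence "sqrt (s\<^sup>2) = s" by simp
    thus "(2 * s) *\<^sub>R (f (of_real (s\<^sup>2)) * T (of_real (sqrt (s\<^sup>2)))) = 2 * of_real s * f ((of_real s)\<^sup>2) * T (of_real s)"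
      by (simp only:) (simp add: scaleR_conv_of_real)
  qed (use assms(1,2) in simp)
  thus ?thesis by (rule integral_unique)
qed

text \<open>Compactness of the real segment inside an open set. The fourth powers to be avoided form
  a closed set, being integers, and the segment misses them because neither endpoint of the original
  interval is an integer.\<close>

lemma voronoi_neighbourhood:
  fixes \<alpha> \<beta> :: real and S :: "complex set"
  assumes "0 < \<alpha>" "\<alpha> < \<beta>" "\<alpha> \<notin> \<int>" "\<beta> \<notin> \<int>" "open S" "complex_of_real ` {\<alpha>..\<beta>} \<subseteq> S"
  defines "J \<equiv> {n. \<alpha> < real (Suc n) \<and> real (Suc n) < \<beta>}"
  obtains eps where "0 < eps" "2 * eps \<le> sqrt \<alpha>"
    "\<And>n. n \<in> J \<Longrightarrow> sqrt \<alpha> + eps \<le> sqrt (real (Suc n)) \<and> sqrt (real (Suc n)) \<le> sqrt \<beta> - eps"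
    "\<And>w. sqrt \<alpha> - eps < Re w \<Longrightarrow> Re w < sqrt \<beta> + eps \<Longrightarrow> \<bar>Im w\<bar> < eps \<Longrightarrow>
       w\<^sup>2 \<in> S \<and> (\<forall>n. n \<notin> J \<longrightarrow> w ^ 4 \<noteq> of_nat (Suc n) ^ 2)"
proof -
  have finJ: "finite J"
  proof (rule finite_subset)
    show "J \<subseteq> {..nat \<lceil>\<beta>\<rceil>}" unfolding J_def by (auto, linarith)
  qed auto
  define C where "C = {complex_of_nat (Suc n) ^ 2 | n. n \<notin> J}"
  have "closed C"
  proof (rule closed_subset_Ints)
    show "C \<subseteq> \<int>" unfolding C_def by (auto simp del: of_nat_Suc)
  qed
  define B where "B = (\<lambda>w. w\<^sup>2) -` S \<inter> (\<lambda>w. w ^ 4) -` (- C)"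
  have "open B" unfolding B_def using \<open>closed C\<close> assms(5)
    by (intro open_Int open_vimage) (auto intro!: continuous_intros)
  moreover have "compact (complex_of_real ` {sqrt \<alpha>..sqrt \<beta>})"
    by (intro compact_continuous_image continuous_intros) auto
  moreover have "complex_of_real ` {sqrt \<alpha>..sqrt \<beta>} \<subseteq> B"
  proof safe
    fix s assume s: "s \<in> {sqrt \<alpha>..sqrt \<beta>}"
    have "sqrt \<alpha> \<ge> 0" using assms(1) by simp
    hence "(sqrt \<alpha>)\<^sup>2 \<le> s\<^sup>2" "s\<^sup>2 \<le> (sqrt \<beta>)\<^sup>2" using s unfolding atLeastAtMost_iff by (intro power_mono; linarith)+
    hence s2: "s\<^sup>2 \<in> {\<alpha>..\<beta>}" using assms(1,2) by simp
    have "(complex_of_real s) ^ 4 \<noteq> of_nat (Suc n) ^ 2" if n: "n \<notin> J" for n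
    proof
      assume "(complex_of_real s) ^ 4 = of_nat (Suc n) ^ 2"
      hence "complex_of_real (s ^ 4) = of_real (real (Suc n) ^ 2)" by simp
      hence "(s\<^sup>2)\<^sup>2 = (real (Suc n))\<^sup>2" by (simp only: of_real_eq_iff) (simp flip: power_mult)
      hence eq: "s\<^sup>2 = real (Suc n)" by (subst (asm) power2_eq_iff_nonneg) auto
      have "real (Suc n) \<noteq> \<alpha>" "real (Suc n) \<noteq> \<beta>" using assms(3,4) by (auto simp del: of_nat_Suc)
      hence "n \<in> J" using s2 unfolding eq J_def by (auto simp del: of_nat_Suc)
      thus False using n by simp
    qed
    moreover have "(complex_of_real s)\<^sup>2 \<in> S"
      using assms(6) s2 by (auto simp flip: of_real_power)
    ultimately show "complex_of_real s \<in> B" unfolding B_def C_def by blast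
  qed
  ultimately obtain \<delta> where \<delta>: "\<delta> > 0" "(\<Union>x\<in>complex_of_real ` {sqrt \<alpha>..sqrt \<beta>}. ball x \<delta>) \<subseteq> B"
    using compact_subset_open_imp_ball_epsilon_subset by metis
  \<comment> \<open>The element 1 keeps the minimum defined when no integer lies between \<alpha>
    and \<beta>.\<close>
  define gap where "gap = Min (insert 1 ((\<lambda>n. min (sqrt (real (Suc n)) - sqrt \<alpha>) (sqrt \<beta> - sqrt (real (Suc n)))) ` J))"
  have gap: "gap > 0" unfolding gap_def using finJ by (subst Min_gr_iff) (auto simp: J_def)
  have gapJ: "gap \<le> min (sqrt (real (Suc n)) - sqrt \<alpha>) (sqrt \<beta> - sqrt (real (Suc n)))" if "n \<in> J" for n
    unfolding gap_def using finJ that by (intro Min_le) auto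
  define eps where "eps = min (\<delta> / 2) (min (sqrt \<alpha> / 2) gap)"
  show ?thesis
  proof (rule that [of eps])
    show "0 < eps" using \<delta> gap assms(1) by (simp add: eps_def)
    show "2 * eps \<le> sqrt \<alpha>" by (simp add: eps_def min_def)
    show "sqrt \<alpha> + eps \<le> sqrt (real (Suc n)) \<and> sqrt (real (Suc n)) \<le> sqrt \<beta> - eps" if "n \<in> J" for n
    proof -
      have "eps \<le> gap" by (simp add: eps_def)
      thus ?thesis using gapJ [OF that] by linarith
    qed
    fix w assume w: "sqrt \<alpha> - eps < Re w" "Re w < sqrt \<beta> + eps" "\<bar>Im w\<bar> < eps"
    \<comment> \<open>The projection of Re w to the interval. Real and imaginary distances are both
      below eps, so w lies within 2 eps \<le> \<delta> of it.\<close>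
    define s where "s = max (sqrt \<alpha>) (min (sqrt \<beta>) (Re w))"
    have ab: "sqrt \<alpha> < sqrt \<beta>" using assms by simp
    have "s \<in> {sqrt \<alpha>..sqrt \<beta>}" using ab by (auto simp: s_def)
    moreover have "w \<in> ball (of_real s) \<delta>"
    proof -
      have "\<bar>Re w - s\<bar> < eps" using w ab by (auto simp: s_def max_def min_def)
      hence "norm (w - of_real s) < 2 * eps" using cmod_le [of "w - of_real s"] w(3) by simp
      also have "\<dots> \<le> \<delta>" by (simp add: eps_def min_def)
      finally show ?thesis by (simp add: dist_norm norm_minus_commute)
    qed
    ultimately have "w \<in> B" using \<delta>(2) by blast
    thus "w\<^sup>2 \<in> S \<and> (\<forall>n. n \<notin> J \<longrightarrow> w ^ 4 \<noteq> of_nat (Suc n) ^ 2)" unfolding B_def C_def by blast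
  qed
qed

text \<open>The formula is solved for the infinite series, so that \<open>sums\<close> asserts
  convergence in the natural order along with the value. Analyticity inside a contour around the
  interval enters as holomorphy on an open set containing the segment.\<close>

theorem theorem4p1:
  fixes \<alpha> \<beta> :: real and f :: "complex \<Rightarrow> complex" and S :: "complex set"
    and q :: nat and chi :: "nat \<Rightarrow> complex" and \<nu> :: complex
  assumes "0 < \<alpha>" "\<alpha> < \<beta>" "\<alpha> \<notin> \<int>" "\<beta> \<notin> \<int>"
    and "open S" "complex_of_real ` {\<alpha>..\<beta>} \<subseteq> S" "f holomorphic_on S"
    and "primitive_char q chi" "\<not> principal_char q chi" "even_char q chi"
    and "0 < Re \<nu>" "Re \<nu> < 1 / 2"
  shows "(\<lambda>k. let n = Suc k; x = (\<lambda>t. 4 * pi * sqrt (real n * t / real q)) in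
            2 * pi * sigma_char (-\<nu>) (\<lambda>m. cnj (chi m)) n * of_nat n powr (\<nu> / 2) *
            integral {\<alpha>..\<beta>} (\<lambda>t. f (of_real t) * of_real t powr (-\<nu> / 2) *
              ((2 / pi * bessel_K \<nu> (x t) - bessel_Y \<nu> (x t)) * cos (pi * \<nu> / 2)
               - bessel_J \<nu> (x t) * sin (pi * \<nu> / 2))))
         sums
         (of_nat q powr (1 - \<nu> / 2) / gauss_sum q chi *
            (\<Sum>j \<in> {j::nat. \<alpha> < real j \<and> real j < \<beta>}. sigma_bar_char (-\<nu>) chi j * f (of_nat j))
          - of_nat q powr (1 - \<nu> / 2) / gauss_sum q chi * dirichlet_L chi (1 - \<nu>) *
            integral {\<alpha>..\<beta>} (\<lambda>t. f (of_real t) / of_real t powr \<nu>))"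
proof -
  define J where "J = {n. \<alpha> < real (Suc n) \<and> real (Suc n) < \<beta>}"
  obtain eps where eps: "0 < eps" "2 * eps \<le> sqrt \<alpha>"
    "\<And>n. n \<in> J \<Longrightarrow> sqrt \<alpha> + eps \<le> sqrt (real (Suc n)) \<and> sqrt (real (Suc n)) \<le> sqrt \<beta> - eps"
    "\<And>w. sqrt \<alpha> - eps < Re w \<Longrightarrow> Re w < sqrt \<beta> + eps \<Longrightarrow> \<bar>Im w\<bar> < eps \<Longrightarrow>
       w\<^sup>2 \<in> S \<and> (\<forall>n. n \<notin> J \<longrightarrow> w ^ 4 \<noteq> of_nat (Suc n) ^ 2)"
    unfolding J_def by (rule voronoi_neighbourhood [OF assms(1-6)]) (rule that, unfold J_def)
  have finJ: "finite J"
  proof (rule finite_subset)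
    show "J \<subseteq> {..nat \<lceil>\<beta>\<rceil>}" unfolding J_def by (auto, linarith)
  qed auto
  have q1: "q > 1" using assms(8,9) by (intro nonprincipal_modulus_gt_1) (auto simp: primitive_char_def)
  define g where "g = (\<lambda>w. 2 * w * f (w\<^sup>2))"
  have g: "g holomorphic_on {w. sqrt \<alpha> - eps < Re w \<and> Re w < sqrt \<beta> + eps \<and> \<bar>Im w\<bar> < eps}"
  proof -
    have "(f \<circ> (\<lambda>w. w\<^sup>2)) holomorphic_on {w. sqrt \<alpha> - eps < Re w \<and> Re w < sqrt \<beta> + eps \<and> \<bar>Im w\<bar> < eps}"
      by (rule holomorphic_on_compose_gen [OF _ assms(7)]) (use eps(4) in \<open>auto intro!: holomorphic_intros\<close>)
    thus ?thesis unfolding g_def by (intro holomorphic_intros) (simp_all add: o_def)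
  qed
  interpret voronoi_setup q chi \<nu> "sqrt \<alpha>" "sqrt \<beta>" eps g J
    using assms eps q1 finJ g by unfold_locales auto
  have fc: "continuous_on (of_real ` {\<alpha>..\<beta>}) f"
    using assms(6,7) by (meson continuous_on_subset holomorphic_on_imp_continuous_on)
  have sub: "complex_of_real ` {sqrt \<alpha>..sqrt \<beta>} \<subseteq> strip" using strip_real by blast
  define Th where "Th = (\<lambda>n w. side_term \<i> n w + side_term (- \<i>) n w)"
  have Tc: "continuous_on (of_real ` {sqrt \<alpha>..sqrt \<beta>}) (Th n)" for n
    unfolding Th_def using sub
    by (intro continuous_on_add holomorphic_on_imp_continuous_on holomorphic_on_subset [OF side_term_holomorphic]) auto
  have pc: "continuous_on (of_real ` {sqrt \<alpha>..sqrt \<beta>}) (\<lambda>w. w powr (- 2 * \<nu>))"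
  proof -
    have "(\<lambda>w. w powr (- 2 * \<nu>)) holomorphic_on strip" using strip_slit by (intro holomorphic_intros) auto
    thus ?thesis using sub by (meson continuous_on_subset holomorphic_on_imp_continuous_on)
  qed
  have term_eq: "integral {sqrt \<alpha>..sqrt \<beta>} (\<lambda>s. g (of_real s) * (side_term \<i> k (of_real s) + side_term (- \<i>) k (of_real s))) =
      (let n = Suc k; x = (\<lambda>t. 4 * pi * sqrt (real n * t / real q)) in
            2 * pi * sigma_char (-\<nu>) (\<lambda>m. cnj (chi m)) n * of_nat n powr (\<nu> / 2) *
            integral {\<alpha>..\<beta>} (\<lambda>t. f (of_real t) * of_real t powr (-\<nu> / 2) *
              ((2 / pi * bessel_K \<nu> (x t) - bessel_Y \<nu> (x t)) * cos (pi * \<nu> / 2)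
               - bessel_J \<nu> (x t) * sin (pi * \<nu> / 2))))" for k
  proof -
    have "integral {sqrt \<alpha>..sqrt \<beta>} (\<lambda>s. g (of_real s) * (side_term \<i> k (of_real s) + side_term (- \<i>) k (of_real s))) =
       integral {\<alpha>..\<beta>} (\<lambda>t. f (of_real t) * Th k (of_real (sqrt t)))"
      using sqrt_substitution [OF assms(1,2) fc Tc [of k]] by (simp add: g_def Th_def)
    also have "\<dots> = integral {\<alpha>..\<beta>} (\<lambda>t. (2 * pi * sigma_char (-\<nu>) (\<lambda>m. cnj (chi m)) (Suc k) * of_nat (Suc k) powr (\<nu> / 2)) *
        (f (of_real t) * of_real t powr (-\<nu> / 2) *
              ((2 / pi * bessel_K \<nu> (4 * pi * sqrt (real (Suc k) * t / real q)) - bessel_Y \<nu> (4 * pi * sqrt (real (Suc k) * t / real q))) * cos (pi * \<nu> / 2)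
               - bessel_J \<nu> (4 * pi * sqrt (real (Suc k) * t / real q)) * sin (pi * \<nu> / 2))))"
    proof (rule integral_cong)
      fix t assume "t \<in> {\<alpha>..\<beta>}"
      hence "t > 0" using assms(1) by auto
      from side_term_kernel [OF this, of k] show "f (of_real t) * Th k (of_real (sqrt t)) = (2 * pi * sigma_char (-\<nu>) (\<lambda>m. cnj (chi m)) (Suc k) * of_nat (Suc k) powr (\<nu> / 2)) *
        (f (of_real t) * of_real t powr (-\<nu> / 2) *
              ((2 / pi * bessel_K \<nu> (4 * pi * sqrt (real (Suc k) * t / real q)) - bessel_Y \<nu> (4 * pi * sqrt (real (Suc k) * t / real q))) * cos (pi * \<nu> / 2)
               - bessel_J \<nu> (4 * pi * sqrt (real (Suc k) * t / real q)) * sin (pi * \<nu> / 2)))"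
        unfolding Th_def by (simp only: mult_ac)
    qed
    also have "\<dots> = (2 * pi * sigma_char (-\<nu>) (\<lambda>m. cnj (chi m)) (Suc k) * of_nat (Suc k) powr (\<nu> / 2)) *
       integral {\<alpha>..\<beta>} (\<lambda>t. f (of_real t) * of_real t powr (-\<nu> / 2) *
              ((2 / pi * bessel_K \<nu> (4 * pi * sqrt (real (Suc k) * t / real q)) - bessel_Y \<nu> (4 * pi * sqrt (real (Suc k) * t / real q))) * cos (pi * \<nu> / 2)
               - bessel_J \<nu> (4 * pi * sqrt (real (Suc k) * t / real q)) * sin (pi * \<nu> / 2)))"
      by (rule integral_mult_right)
    finally show ?thesis unfolding Let_def .
  qed
  have main_int: "integral {sqrt \<alpha>..sqrt \<beta>} (\<lambda>s. g (of_real s) * of_real s powr (- 2 * \<nu>)) = integral {\<alpha>..\<beta>} (\<lambda>t. f (of_real t) / of_real t powr \<nu>)"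
  proof -
    have "integral {sqrt \<alpha>..sqrt \<beta>} (\<lambda>s. g (of_real s) * of_real s powr (- 2 * \<nu>)) =
       integral {\<alpha>..\<beta>} (\<lambda>t. f (of_real t) * of_real (sqrt t) powr (- 2 * \<nu>))"
      using sqrt_substitution [OF assms(1,2) fc pc] by (simp add: g_def)
    also have "\<dots> = integral {\<alpha>..\<beta>} (\<lambda>t. f (of_real t) / of_real t powr \<nu>)"
    proof (rule integral_cong)
      fix t assume "t \<in> {\<alpha>..\<beta>}"
      hence t: "t > 0" using assms(1) by auto
      have "complex_of_real (sqrt t) powr (- 2 * \<nu>) = 1 / of_real t powr \<nu>"
        using t by (simp add: powr_def Ln_of_real ln_sqrt exp_minus field_simps)
      thus "f (of_real t) * of_real (sqrt t) powr (- 2 * \<nu>) = f (of_real t) / of_real t powr \<nu>" by simp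
    qed
    finally show ?thesis .
  qed
  have finite_sum: "(\<Sum>n\<in>J. - (2 * of_real pi * phi n (pole n))) =
      Q * (\<Sum>j \<in> {j::nat. \<alpha> < real j \<and> real j < \<beta>}. sigma_bar_char (-\<nu>) chi j * f (of_nat j))"
  proof -
    have "(\<Sum>j \<in> {j::nat. \<alpha> < real j \<and> real j < \<beta>}. sigma_bar_char (-\<nu>) chi j * f (of_nat j)) =
        (\<Sum>n\<in>J. sigma_bar_char (-\<nu>) chi (Suc n) * f (of_nat (Suc n)))"
    proof (rule sum.reindex_bij_witness [where i = Suc and j = "\<lambda>j. j - 1"])
      fix j assume "j \<in> {j::nat. \<alpha> < real j \<and> real j < \<beta>}"
      hence j: "\<alpha> < real j" "real j < \<beta>" by auto
      hence "j > 0" using assms(1) by (cases j) auto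
      thus "Suc (j - 1) = j" "j - 1 \<in> J" "sigma_bar_char (-\<nu>) chi (Suc (j - 1)) * f (of_nat (Suc (j - 1))) = sigma_bar_char (-\<nu>) chi j * f (of_nat j)"
        using j by (simp_all add: J_def)
    qed (auto simp: J_def)
    moreover have "- (2 * of_real pi * phi n (pole n)) = Q * (sigma_bar_char (-\<nu>) chi (Suc n) * f (of_nat (Suc n)))" for n
    proof -
      have "pole n \<noteq> 0" using pole_square [of n] by (metis of_nat_eq_0_iff nat.distinct(2) zero_power2)
      hence "g (pole n) / (2 * pole n) = f (of_nat (Suc n))" unfolding g_def pole_square by simp
      thus ?thesis unfolding phi_at_pole div_coeff_def by simp
    qed
    ultimately show ?thesis by (simp add: sum_distrib_left)
  qed
  have "2 * k2 = - (Q * dirichlet_L chi (1 - \<nu>))" by (simp add: k2_def)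
  with two_sided_voronoi show ?thesis
    unfolding term_eq main_int finite_sum Q_def by simp
qed

end
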